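(* Let $\Gamma$ be a compact connected abelian group with an expansive automorphism $\alpha$ such that $(\Gamma,\alpha)$ is cyclic, with stable group $\Omega^+$, unstable group $\Omega^-$ and homoclinic group $\Omega=\Omega^+\cap\Omega^-$, where $\Omega^\pm$ carry their strong topologies and $\Omega$ the discrete topology. Then $$0\to\Omega\xrightarrow{\ \omega\mapsto(-\omega,\omega)\ }\Omega^-\times\Omega^+\xrightarrow{\ (u,v)\mapsto u+v\ }\Gamma\to0$$ is a self-dual exact sequence of locally compact abelian groups.
   Context: $\Gamma$ is a $\mathbb Z[x,x^{-1}]$-module with $x$ acting by $\alpha$; cyclic means the Pontryagin dual of $\Gamma$ is a cyclic $\mathbb Z[x,x^{-1}]$-module, whose annihilator is generated by the associated polynomial $f$ (primitive, $f(0)\ne0$, positive leading coefficient), which is hyperbolic by expansiveness. $\Omega^+=\{g:\alpha^ng\to0\ (n\to\infty)\}$, $\Omega^-=\{g:\alpha^ng\to0\ (n\to-\infty)\}$. A formal Laurent series $\sum c_nx^n$ is almost convergent if $\limsup_{n\to\infty}|c_n|^{1/n}\le1$ and $\limsup_{n\to\infty}|c_{-n}|^{1/n}\le1$; $\mathbb Z_{ac}(x)$ is the set of such series with integer coefficients, $\mathbb Z_{ac}[x)$ (resp. $\mathbb Z_{ac}(x]$) those with only finitely many nonzero coefficients at negative (resp. positive) powers. Algebraically $\Gamma\cong\mathbb Z_{ac}(x)/f\mathbb Z_{ac}(x)$ with $x$ acting by multiplication, and under this identification $\Omega^+$ is the image of $\mathbb Z_{ac}[x)$, isomorphic to $\mathbb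 Z_{ac}[x)/f\mathbb Z_{ac}[x)$, and $\Omega^-$ the image of $\mathbb Z_{ac}(x]$, isomorphic to $\mathbb Z_{ac}(x]/f\mathbb Z_{ac}(x]$. Strong topology on $\Omega^+$: let $B_k(N)=\{\sum a_ix^i:a_i\in\mathbb Z,|a_i|\le N,\ a_i=0\text{ for }i<-k\}$ (compact in the product topology) and $B_\infty(N)=\bigcup_kB_k(N)$, with $N$ large enough that $B_\infty(N)$ maps onto $\Omega^+$; a set $U\subset\Omega^+$ is closed iff its preimage in $B_\infty(N)$ meets each $B_k(N)$ in a closed subset. The strong topology on $\Omega^-$ is defined symmetrically using $\mathbb Z_{ac}(x]$ and sets with $a_i=0$ for $i>k$. $\Gamma$ carries its compact topology. Self-dual means the Pontryagin dual sequence is isomorphic to the given one. *)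

theory Defs
  imports "HOL-Analysis.Analysis" "HOL-Computational_Algebra.Polynomial"
begin

type_synonym 'a tgroup = "'a topology \<times> ('a \<Rightarrow> 'a \<Rightarrow> 'a) \<times> 'a"

definition tg_top :: "'a tgroup \<Rightarrow> 'a topology" where "tg_top G = fst G"
definition tg_op :: "'a tgroup \<Rightarrow> 'a \<Rightarrow> 'a \<Rightarrow> 'a" where "tg_op G = fst (snd G)"
definition tg_unit :: "'a tgroup \<Rightarrow> 'a" where "tg_unit G = snd (snd G)"
definition tg_carrier :: "'a tgroup \<Rightarrow> 'a set" where "tg_carrier G = topspace (tg_top G)"

definition abelian_tgroup :: "'a tgroup \<Rightarrow> bool" where
  "abelian_tgroup G \<longleftrightarrow>
     (let S = tg_carrier G; m = tg_op G; e = tg_unit G in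
        e \<in> S \<and> (\<forall>x\<in>S. \<forall>y\<in>S. m x y \<in> S)
      \<and> (\<forall>x\<in>S. \<forall>y\<in>S. \<forall>z\<in>S. m (m x y) z = m x (m y z))
      \<and> (\<forall>x\<in>S. \<forall>y\<in>S. m x y = m y x)
      \<and> (\<forall>x\<in>S. m e x = x)
      \<and> continuous_map (prod_topology (tg_top G) (tg_top G)) (tg_top G) (\<lambda>(x,y). m x y)
      \<and> (\<exists>i. continuous_map (tg_top G) (tg_top G) i \<and> (\<forall>x\<in>S. m x (i x) = e)))"

definition LCA :: "'a tgroup \<Rightarrow> bool" where
  "LCA G \<longleftrightarrow> abelian_tgroup G \<and> Hausdorff_space (tg_top G) \<and> locally_compact_space (tg_top G)"

definition tg_hom :: "'a tgroup \<Rightarrow> 'b tgroup \<Rightarrow> ('a \<Rightarrow> 'b) \<Rightarrow> bool" where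
  "tg_hom G H f \<longleftrightarrow> continuous_map (tg_top G) (tg_top H) f
     \<and> (\<forall>x\<in>tg_carrier G. \<forall>y\<in>tg_carrier G. f (tg_op G x y) = tg_op H (f x) (f y))"

definition tg_iso :: "'a tgroup \<Rightarrow> 'b tgroup \<Rightarrow> ('a \<Rightarrow> 'b) \<Rightarrow> bool" where
  "tg_iso G H f \<longleftrightarrow> tg_hom G H f \<and> homeomorphic_map (tg_top G) (tg_top H) f"

definition short_exact ::
  "'a tgroup \<Rightarrow> 'b tgroup \<Rightarrow> 'c tgroup \<Rightarrow> ('a \<Rightarrow> 'b) \<Rightarrow> ('b \<Rightarrow> 'c) \<Rightarrow> bool" where
  "short_exact A B C i p \<longleftrightarrow>
     tg_hom A B i \<and> tg_hom B C p
   \<and> inj_on i (tg_carrier A)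
   \<and> p ` tg_carrier B = tg_carrier C
   \<and> i ` tg_carrier A = {y \<in> tg_carrier B. p y = tg_unit C}
   \<and> homeomorphic_map (tg_top A) (subtopology (tg_top B) (i ` tg_carrier A)) i
   \<and> closedin (tg_top B) (i ` tg_carrier A)
   \<and> open_map (tg_top B) (tg_top C) p"

definition circle_top :: "complex topology" where
  "circle_top = subtopology euclidean (sphere 0 1)"

definition characters :: "'a tgroup \<Rightarrow> ('a \<Rightarrow> complex) set" where
  "characters G = {ch. continuous_map (tg_top G) circle_top ch \<and> ch \<in> extensional (tg_carrier G)
     \<and> (\<forall>x\<in>tg_carrier G. \<forall>y\<in>tg_carrier G. ch (tg_op G x y) = ch x * ch y)}"

definition compact_open_top :: "'a tgroup \<Rightarrow> ('a \<Rightarrow> complex) topology" where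
  "compact_open_top G = topology_generated_by
     (insert (characters G)
        {{ch \<in> characters G. ch ` K \<subseteq> U} | K U. compactin (tg_top G) K \<and> openin circle_top U})"

definition pdual :: "'a tgroup \<Rightarrow> ('a \<Rightarrow> complex) tgroup" where
  "pdual G = (compact_open_top G,
              (\<lambda>ch \<psi>. restrict (\<lambda>x. ch x * \<psi> x) (tg_carrier G)),
              restrict (\<lambda>_. 1) (tg_carrier G))"

definition dual_map :: "'a tgroup \<Rightarrow> ('a \<Rightarrow> 'b) \<Rightarrow> ('b \<Rightarrow> complex) \<Rightarrow> ('a \<Rightarrow> complex)" where
  "dual_map G f = (\<lambda>ch. restrict (ch \<circ> f) (tg_carrier G))"

definition self_dual_seq ::
  "'a tgroup \<Rightarrow> 'b tgroup \<Rightarrow> 'c tgroup \<Rightarrow> ('a \<Rightarrow> 'b) \<Rightarrow> ('b \<Rightarrow> 'c) \<Rightarrow> bool" where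
  "self_dual_seq A B C i p \<longleftrightarrow>
     (\<exists>\<phi>A \<phi>B \<phi>C.
        tg_iso A (pdual C) \<phi>A \<and> tg_iso B (pdual B) \<phi>B \<and> tg_iso C (pdual A) \<phi>C
      \<and> (\<forall>a\<in>tg_carrier A. \<phi>B (i a) = dual_map B p (\<phi>A a))
      \<and> (\<forall>b\<in>tg_carrier B. \<phi>C (p b) = dual_map A i (\<phi>B b)))"

definition apow :: "('g \<Rightarrow> 'g) \<Rightarrow> int \<Rightarrow> 'g \<Rightarrow> 'g" where
  "apow \<alpha> n = (if 0 \<le> n then \<alpha> ^^ nat n else inv \<alpha> ^^ nat (- n))"

definition add_tgroup :: "'g::ab_group_add topology \<Rightarrow> 'g tgroup" where
  "add_tgroup T = (T, (+), 0)"

definition expansive :: "'g::ab_group_add topology \<Rightarrow> ('g \<Rightarrow> 'g) \<Rightarrow> bool" where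
  "expansive T \<alpha> \<longleftrightarrow> (\<exists>U. openin T U \<and> 0 \<in> U \<and>
      (\<forall>g\<in>topspace T. (\<forall>n::int. apow \<alpha> n g \<in> U) \<longrightarrow> g = 0))"

text \<open>Laurent polynomials over Z: finitely supported maps int => int.
  The Laurent polynomial c acts on a character chi (x acting by chi |-> chi o alpha).\<close>
definition laurent_act :: "('g \<Rightarrow> 'g) \<Rightarrow> (int \<Rightarrow> int) \<Rightarrow> ('g \<Rightarrow> complex) \<Rightarrow> 'g \<Rightarrow> complex" where
  "laurent_act \<alpha> c ch = (\<lambda>g. \<Prod>n\<in>{n. c n \<noteq> 0}. ch (apow \<alpha> n g) powi c n)"

definition laurent_polys :: "(int \<Rightarrow> int) set" where
  "laurent_polys = {c. finite {n. c n \<noteq> 0}}"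

definition is_cyclic_generator :: "'g::ab_group_add topology \<Rightarrow> ('g \<Rightarrow> 'g) \<Rightarrow> ('g \<Rightarrow> complex) \<Rightarrow> bool" where
  "is_cyclic_generator T \<alpha> ch0 \<longleftrightarrow> ch0 \<in> characters (add_tgroup T) \<and>
     (\<forall>ch\<in>characters (add_tgroup T). \<exists>c\<in>laurent_polys.
        \<forall>g\<in>topspace T. ch g = laurent_act \<alpha> c ch0 g)"

definition cyclic :: "'g::ab_group_add topology \<Rightarrow> ('g \<Rightarrow> 'g) \<Rightarrow> bool" where
  "cyclic T \<alpha> \<longleftrightarrow> (\<exists>ch0. is_cyclic_generator T \<alpha> ch0)"

definition cyc_gen :: "'g::ab_group_add topology \<Rightarrow> ('g \<Rightarrow> 'g) \<Rightarrow> 'g \<Rightarrow> complex" where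
  "cyc_gen T \<alpha> = (SOME ch0. is_cyclic_generator T \<alpha> ch0)"

definition laurent_conv :: "(int \<Rightarrow> int) \<Rightarrow> (int \<Rightarrow> int) \<Rightarrow> int \<Rightarrow> int" where
  "laurent_conv a b = (\<lambda>n. \<Sum>k\<in>{k. a k \<noteq> 0}. a k * b (n - k))"

definition laurent_of_poly :: "int poly \<Rightarrow> int \<Rightarrow> int" where
  "laurent_of_poly f = (\<lambda>n. if 0 \<le> n then coeff f (nat n) else 0)"

definition assoc_poly :: "'g::ab_group_add topology \<Rightarrow> ('g \<Rightarrow> 'g) \<Rightarrow> ('g \<Rightarrow> complex) \<Rightarrow> int poly" where
  "assoc_poly T \<alpha> ch0 = (THE f. content f = 1 \<and> coeff f 0 \<noteq> 0 \<and> lead_coeff f > 0 \<and>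
      {c\<in>laurent_polys. \<forall>g\<in>topspace T. laurent_act \<alpha> c ch0 g = 1}
        = {laurent_conv (laurent_of_poly f) q | q. q \<in> laurent_polys})"

text \<open>The fundamental bounded solution w of  sum_i f_i w(i+m) = delta_{m,0}
  (Laurent expansion of 1/f; exists and is unique since f is hyperbolic).\<close>
definition fund_sol :: "int poly \<Rightarrow> int \<Rightarrow> real" where
  "fund_sol f = (THE w. bounded (range w) \<and>
     (\<forall>m. (\<Sum>i\<le>degree f. of_int (coeff f i) * w (int i + m)) = (if m = 0 then 1 else 0)))"

definition coord :: "int poly \<Rightarrow> (int \<Rightarrow> int) \<Rightarrow> int \<Rightarrow> real" where
  "coord f a n = (\<Sum>\<^sub>\<infinity>k. of_int (a k) * fund_sol f (k + n))"

text \<open>theta(a) is the point g with chi0(alpha^n g) = exp(2 pi i coord_n(a)) for all n;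
  theta : Z_ac(x) -> Gamma is x-equivariant with kernel f Z_ac(x).\<close>
definition ident :: "'g::ab_group_add topology \<Rightarrow> ('g \<Rightarrow> 'g) \<Rightarrow> (int \<Rightarrow> int) \<Rightarrow> 'g" where
  "ident T \<alpha> a = (let ch0 = cyc_gen T \<alpha>; f = assoc_poly T \<alpha> ch0 in
     THE g. g \<in> topspace T \<and> (\<forall>n. ch0 (apow \<alpha> n g) = cis (2 * pi * coord f a n)))"

definition stable_grp :: "'g::ab_group_add topology \<Rightarrow> ('g \<Rightarrow> 'g) \<Rightarrow> 'g set" where
  "stable_grp T \<alpha> = {g\<in>topspace T. limitin T (\<lambda>n. (\<alpha> ^^ n) g) 0 sequentially}"

definition unstable_grp :: "'g::ab_group_add topology \<Rightarrow> ('g \<Rightarrow> 'g) \<Rightarrow> 'g set" where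
  "unstable_grp T \<alpha> = {g\<in>topspace T. limitin T (\<lambda>n. (inv \<alpha> ^^ n) g) 0 sequentially}"

definition homoclinic_grp :: "'g::ab_group_add topology \<Rightarrow> ('g \<Rightarrow> 'g) \<Rightarrow> 'g set" where
  "homoclinic_grp T \<alpha> = stable_grp T \<alpha> \<inter> unstable_grp T \<alpha>"

definition seq_top :: "(int \<Rightarrow> int) topology" where
  "seq_top = product_topology (\<lambda>_. discrete_topology UNIV) UNIV"

definition Bplus :: "nat \<Rightarrow> nat \<Rightarrow> (int \<Rightarrow> int) set" where
  "Bplus N k = {a. \<forall>i. \<bar>a i\<bar> \<le> int N \<and> (i < - int k \<longrightarrow> a i = 0)}"

definition Bminus :: "nat \<Rightarrow> nat \<Rightarrow> (int \<Rightarrow> int) set" where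
  "Bminus N k = {a. \<forall>i. \<bar>a i\<bar> \<le> int N \<and> (i > int k \<longrightarrow> a i = 0)}"

definition strong_top :: "((int \<Rightarrow> int) \<Rightarrow> 'g) \<Rightarrow> (nat \<Rightarrow> (int \<Rightarrow> int) set) \<Rightarrow> 'g set \<Rightarrow> 'g topology" where
  "strong_top \<theta> B S = topology_generated_by
     {U. U \<subseteq> S \<and> (\<forall>k. openin (subtopology seq_top (B k)) {a \<in> B k. \<theta> a \<in> U})}"

definition Nplus :: "'g::ab_group_add topology \<Rightarrow> ('g \<Rightarrow> 'g) \<Rightarrow> nat" where
  "Nplus T \<alpha> = (LEAST N. ident T \<alpha> ` (\<Union>k. Bplus N k) = stable_grp T \<alpha>)"

definition Nminus :: "'g::ab_group_add topology \<Rightarrow> ('g \<Rightarrow> 'g) \<Rightarrow> nat" where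
  "Nminus T \<alpha> = (LEAST N. ident T \<alpha> ` (\<Union>k. Bminus N k) = unstable_grp T \<alpha>)"

definition strong_top_plus :: "'g::ab_group_add topology \<Rightarrow> ('g \<Rightarrow> 'g) \<Rightarrow> 'g topology" where
  "strong_top_plus T \<alpha> = strong_top (ident T \<alpha>) (Bplus (Nplus T \<alpha>)) (stable_grp T \<alpha>)"

definition strong_top_minus :: "'g::ab_group_add topology \<Rightarrow> ('g \<Rightarrow> 'g) \<Rightarrow> 'g topology" where
  "strong_top_minus T \<alpha> = strong_top (ident T \<alpha>) (Bminus (Nminus T \<alpha>)) (unstable_grp T \<alpha>)"

definition pair_tgroup :: "('g::ab_group_add) topology \<Rightarrow> 'g topology \<Rightarrow> ('g \<times> 'g) tgroup" where
  "pair_tgroup S1 S2 = (prod_topology S1 S2, (\<lambda>(a,b) (c,d). (a + c, b + d)), (0, 0))"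

end

(* The characters of Gamma along the orbit of the cyclic generator embed Gamma in the infinite torus.
   By Peter-Weyl (obtained here from an invariant mean and a variational argument) the image is the
   kernel of a single Laurent polynomial f, primitive by connectedness and hyperbolic by
   expansiveness. Its bounded fundamental solution w represents every point of Gamma by a bounded
   integer digit sequence, with right-sided digits for Omega^+ and left-sided ones for Omega^-; two
   representations of a point are compared by cutting out a block between two equal windows. In these
   terms the strong topologies are the metrics that weight the coordinates geometrically on one side.
   Splitting the digits at 0 gives exactness, and the symmetric form
   (a, b) |-> sum a_i b_j w(i + j) mod Z identifies Omega^+ and Omega^- with their own duals and Omega
   with the dual of Gamma. *)
theory Submission
  imports Defs "HOL-Computational_Algebra.Polynomial_Factorial" "HOL-Computational_Algebra.Fundamental_Theorem_Algebra"
begin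

section \<open>Invariant means\<close>

text \<open>The strong topologies are final topologies for the sets B(N), where N is the least bound
  whose digits reach every point. Only this property of N is known, whereas the estimates produce
  digits bounded by other constants, such as half the l1-norm of f rounded up, or twice that. The
  cutting argument removes the discrepancy: a point with digits of any bound M starting at -k has
  digits bounded by N starting at -k - m, with m depending on M and N alone, so the topology is the
  same for every admissible N. The form descends to points because digits that represent 0 have
  integral lifts, so that one summation leaves a series of integers. It needs a convergent double
  series; hence Omega^+ is paired with itself, but Gamma only with Omega, whose points have finite
  digits. A homomorphism on finite digits is given by its values at unit digits, and its triviality
  on the translates of f says exactly that these values are the coordinates of a point of Gamma. The
  dual of Omega and, by density, that of Omega^+ both come from this remark.\<close>

definition bdd_fun :: "('g \<Rightarrow> 'a::real_normed_vector) \<Rightarrow> bool" where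
  "bdd_fun f \<longleftrightarrow> (\<exists>B. \<forall>x. norm (f x) \<le> B)"

lemma bdd_funI: "(\<And>x. norm (f x) \<le> B) \<Longrightarrow> bdd_fun f"
  by (auto simp: bdd_fun_def)

lemma bdd_fun_add [intro]: "bdd_fun f \<Longrightarrow> bdd_fun g \<Longrightarrow> bdd_fun (\<lambda>x. f x + g x)"
  unfolding bdd_fun_def by (meson add_mono norm_triangle_le)

lemma bdd_fun_mult [intro]:
  fixes f g :: "'g \<Rightarrow> 'a::real_normed_algebra"
  assumes "bdd_fun f" "bdd_fun g" shows "bdd_fun (\<lambda>x. f x * g x)"
proof -
  obtain B C where B: "\<And>x. norm (f x) \<le> B" and C: "\<And>x. norm (g x) \<le> C"
    using assms by (auto simp: bdd_fun_def)
  have "norm (f x * g x) \<le> B * C" for x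
    by (meson B C mult_mono norm_ge_zero norm_mult_ineq order_trans)
  then show ?thesis by (rule bdd_funI)
qed

lemma bdd_fun_const [intro, simp]: "bdd_fun (\<lambda>_. c)"
  by (rule bdd_funI[of _ "norm c"]) simp

lemma bdd_fun_comp: "bdd_fun f \<Longrightarrow> bdd_fun (\<lambda>x. f (h x))"
  by (auto simp: bdd_fun_def)

lemma bdd_fun_diff [intro]:
  assumes "bdd_fun f" "bdd_fun g" shows "bdd_fun (\<lambda>x. f x - g x)"
proof -
  have "bdd_fun (\<lambda>x. - g x)"
    using assms(2) by (simp add: bdd_fun_def)
  from bdd_fun_add[OF assms(1) this] show ?thesis by simp
qed

lemma bdd_fun_sum [intro]: "(\<And>i. i \<in> I \<Longrightarrow> bdd_fun (f i)) \<Longrightarrow> bdd_fun (\<lambda>x. \<Sum>i\<in>I. f i x)"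
  by (induction I rule: infinite_finite_induct) auto

lemma bdd_fun_Re [intro]: "bdd_fun f \<Longrightarrow> bdd_fun (\<lambda>x. Re (f x))"
  unfolding bdd_fun_def real_norm_def using abs_Re_le_cmod order_trans by blast

lemma bdd_fun_Im [intro]: "bdd_fun f \<Longrightarrow> bdd_fun (\<lambda>x. Im (f x))"
  unfolding bdd_fun_def real_norm_def using abs_Im_le_cmod order_trans by blast

lemma bdd_fun_cnj [intro]: "bdd_fun f \<Longrightarrow> bdd_fun (\<lambda>x. cnj (f x))"
  by (simp add: bdd_fun_def)

lemma bdd_fun_norm_sq [intro]:
  assumes "bdd_fun f" shows "bdd_fun (\<lambda>x. (norm (f x))\<^sup>2)"
proof -
  have "bdd_fun (\<lambda>x. norm (f x))" using assms by (simp add: bdd_fun_def)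
  then show ?thesis unfolding power2_eq_square by (intro bdd_fun_mult)
qed

text \<open>The value 0 on unbounded functions makes the bound
  \<open>\<bar>L f\<bar> \<le> sup_abs f\<close> meaningful for every function: a mean must vanish
  on unbounded ones, so that all means lie in one product of compact intervals.\<close>

definition sup_abs :: "('g \<Rightarrow> real) \<Rightarrow> real" where
  "sup_abs f = (if bdd_fun f then SUP x. \<bar>f x\<bar> else 0)"

lemma sup_abs_upper: "bdd_fun f \<Longrightarrow> \<bar>f x\<bar> \<le> sup_abs f"
  unfolding sup_abs_def bdd_fun_def
  by (auto intro!: cSUP_upper bdd_aboveI2)

lemma sup_abs_least: "(\<And>x. \<bar>f x\<bar> \<le> B) \<Longrightarrow> sup_abs f \<le> B"
  unfolding sup_abs_def bdd_fun_def
  by (auto intro!: cSUP_least)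

lemma sup_abs_nonneg: "0 \<le> sup_abs f"
proof (cases "bdd_fun f")
  case True
  then show ?thesis using sup_abs_upper[of f undefined] by linarith
qed (simp add: sup_abs_def)

definition linear_mean :: "(('g \<Rightarrow> real) \<Rightarrow> real) \<Rightarrow> bool" where
  "linear_mean L \<longleftrightarrow> (\<forall>f g. bdd_fun f \<longrightarrow> bdd_fun g \<longrightarrow> L (\<lambda>x. f x + g x) = L f + L g)
    \<and> (\<forall>c f. bdd_fun f \<longrightarrow> L (\<lambda>x. c * f x) = c * L f)
    \<and> (\<forall>f. \<bar>L f\<bar> \<le> sup_abs f) \<and> L (\<lambda>_. 1) = 1"

text \<open>The rate is the one produced by averaging over \<open>n + 1\<close> consecutive
  translates. Invariance is the limit over all finite \<open>A\<close> and all
  \<open>n\<close>.\<close>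

definition almost_inv :: "'g::ab_group_add set \<Rightarrow> nat \<Rightarrow> (('g \<Rightarrow> real) \<Rightarrow> real) \<Rightarrow> bool" where
  "almost_inv A n L \<longleftrightarrow> (\<forall>a\<in>A. \<forall>f. bdd_fun f \<longrightarrow>
     \<bar>L (\<lambda>x. f (x + a)) - L f\<bar> \<le> 2 * sup_abs f / real (Suc n))"

text \<open>Translations commute. Averaging a mean that is almost invariant under \<open>A\<close>
  over the translates by the multiples 0 to \<open>n\<close> of \<open>a\<close> therefore keeps the
  old bounds and adds one for \<open>a\<close>, whose defect telescopes to two boundary
  terms.\<close>

lemma almost_inv_mean_exists:
  assumes "finite A"
  shows "\<exists>L :: ('g::ab_group_add \<Rightarrow> real) \<Rightarrow> real. linear_mean L \<and> almost_inv A n L"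
  using assms
proof (induction A)
  case empty
  \<comment> \<open>With no translations to respect, evaluation at 0 is already a mean.\<close>
  have "linear_mean (\<lambda>f :: 'g \<Rightarrow> real. if bdd_fun f then f 0 else 0)"
    by (auto simp: linear_mean_def sup_abs_upper sup_abs_nonneg bdd_fun_add bdd_fun_mult)
  then show ?case by (auto simp: almost_inv_def)
next
  case (insert a A)
  then obtain L :: "('g \<Rightarrow> real) \<Rightarrow> real" where L: "linear_mean L" "almost_inv A n L" by auto
  define nn where "nn = real (Suc n)"
  have nn: "nn > 0" by (simp add: nn_def)
  define add_n where "add_n = (\<lambda>k x. ((\<lambda>y::'g. y + a) ^^ k) x)"
  have add_Suc: "add_n (Suc k) x = add_n k (x + a)" for k x
    by (simp add: add_n_def funpow_Suc_right del: funpow.simps)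
  have add_0: "add_n 0 x = x" for x by (simp add: add_n_def)
  have add_b: "add_n k (x + b) = add_n k x + b" for k x b
    by (induction k) (auto simp: add_n_def algebra_simps)
  define av where "av = (\<lambda>(f::'g\<Rightarrow>real) x. (1/nn) * (\<Sum>k<Suc n. f (add_n k x)))"
  have av_bdd: "bdd_fun (av f)" if "bdd_fun f" for f
    unfolding av_def by (intro bdd_fun_mult bdd_fun_sum bdd_fun_const bdd_fun_comp[OF that])
  have av_le: "sup_abs (av f) \<le> sup_abs f" if "bdd_fun f" for f
  proof (rule sup_abs_least)
    fix x
    have "\<bar>\<Sum>k<Suc n. f (add_n k x)\<bar> \<le> (\<Sum>k<Suc n. \<bar>f (add_n k x)\<bar>)" by (rule sum_abs)
    also have "\<dots> \<le> (\<Sum>k<Suc n. sup_abs f)" by (intro sum_mono sup_abs_upper that)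
    also have "\<dots> = nn * sup_abs f" by (simp add: nn_def)
    finally show "\<bar>av f x\<bar> \<le> sup_abs f" using nn by (simp add: av_def abs_mult field_simps)
  qed
  define L' where "L' = (\<lambda>f. if bdd_fun f then L (av f) else 0)"
  have Ladd: "L (\<lambda>x. f x + g x) = L f + L g" if "bdd_fun f" "bdd_fun g" for f g
    using L that by (simp add: linear_mean_def)
  have Lmult: "L (\<lambda>x. c * f x) = c * L f" if "bdd_fun f" for f c
    using L that by (simp add: linear_mean_def)
  have Lle: "\<bar>L f\<bar> \<le> sup_abs f" for f using L by (simp add: linear_mean_def)
  have L1: "L (\<lambda>x. 1) = 1" using L by (simp add: linear_mean_def)
  have "linear_mean L'"
    unfolding linear_mean_def
  proof (intro conjI allI impI)
    fix f g :: "'g \<Rightarrow> real" assume fg: "bdd_fun f" "bdd_fun g"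
    have "av (\<lambda>x. f x + g x) = (\<lambda>x. av f x + av g x)"
      by (auto simp: av_def fun_eq_iff sum.distrib add_divide_distrib simp del: sum.lessThan_Suc)
    then show "L' (\<lambda>x. f x + g x) = L' f + L' g"
      using fg by (simp add: L'_def bdd_fun_add Ladd av_bdd)
  next
    fix c and f :: "'g \<Rightarrow> real" assume f: "bdd_fun f"
    have "av (\<lambda>x. c * f x) = (\<lambda>x. c * av f x)"
      by (simp add: av_def fun_eq_iff distrib_left flip: sum_distrib_left)
    then show "L' (\<lambda>x. c * f x) = c * L' f"
      using f bdd_fun_mult[OF bdd_fun_const f, of c] by (simp add: L'_def Lmult av_bdd)
  next
    fix f :: "'g \<Rightarrow> real"
    show "\<bar>L' f\<bar> \<le> sup_abs f"
      using Lle[of "av f"] av_le[of f] sup_abs_nonneg[of f] by (auto simp: L'_def)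
  next
    have "av (\<lambda>x. 1) = (\<lambda>x. 1)" using nn by (simp add: av_def nn_def fun_eq_iff)
    then show "L' (\<lambda>_. 1) = 1" using L1 by (simp add: L'_def)
  qed
  moreover have "almost_inv (insert a A) n L'"
    unfolding almost_inv_def
  proof (intro ballI allI impI)
    fix b and f :: "'g \<Rightarrow> real" assume b: "b \<in> insert a A" and f: "bdd_fun f"
    have homoclinic_pairing: "bdd_fun (\<lambda>x. f (x + b))" using f by (rule bdd_fun_comp)
    show "\<bar>L' (\<lambda>x. f (x + b)) - L' f\<bar> \<le> 2 * sup_abs f / real (Suc n)"
    proof (cases "b \<in> A")
      case True
      have "av (\<lambda>x. f (x + b)) = (\<lambda>x. av f (x + b))" by (simp add: av_def add_b)
      moreover have "\<bar>L (\<lambda>x. av f (x + b)) - L (av f)\<bar> \<le> 2 * sup_abs (av f) / real (Suc n)"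
        using L(2) True av_bdd[OF f] by (auto simp: almost_inv_def)
      moreover have "2 * sup_abs (av f) / real (Suc n) \<le> 2 * sup_abs f / real (Suc n)"
        using av_le[OF f] by (intro divide_right_mono) auto
      ultimately show ?thesis using f homoclinic_pairing by (simp add: L'_def)
    next
      case False
      then have ba: "b = a" using b by simp
      define D where "D = (\<lambda>x. (1/nn) * (f (add_n (Suc n) x) - f x))"
      have tele: "(\<Sum>k<m. f (add_n k (x + a))) = (\<Sum>k<m. f (add_n k x)) + f (add_n m x) - f x" for m x
        by (induction m) (auto simp: add_Suc add_0)
      have "av (\<lambda>x. f (x + b)) x = av f (x + a)" for x
        by (simp add: av_def ba add_b)
      then have "av (\<lambda>x. f (x + b)) x = av f x + D x" for x
        by (simp only: av_def D_def tele) (simp only: algebra_simps)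
      then have eq: "av (\<lambda>x. f (x + b)) = (\<lambda>x. av f x + D x)" by auto
      have Db: "bdd_fun D" unfolding D_def by (intro bdd_fun_mult bdd_fun_diff bdd_fun_const bdd_fun_comp[OF f] f)
      have "sup_abs D \<le> 2 * sup_abs f / real (Suc n)"
      proof (rule sup_abs_least)
        fix x
        have "\<bar>f (add_n (Suc n) x) - f x\<bar> \<le> 2 * sup_abs f"
          using sup_abs_upper[OF f, of "add_n (Suc n) x"] sup_abs_upper[OF f, of x] by linarith
        then have "\<bar>f (add_n (Suc n) x) - f x\<bar> / nn \<le> 2 * sup_abs f / nn"
          using nn by (intro divide_right_mono) auto
        then show "\<bar>D x\<bar> \<le> 2 * sup_abs f / real (Suc n)"
          using nn by (simp add: D_def abs_mult nn_def)
      qed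
      then have "\<bar>L D\<bar> \<le> 2 * sup_abs f / real (Suc n)" using Lle[of D] by linarith
      moreover have "L' (\<lambda>x. f (x + b)) - L' f = L D"
        using f homoclinic_pairing by (simp add: L'_def eq Ladd av_bdd Db)
      ultimately show ?thesis by simp
    qed
  qed
  ultimately show ?case by blast
qed

lemma closed_linear_mean: "closed {L. linear_mean L}"
proof -
  have "{L. linear_mean L} = (\<Inter>f\<in>{f. bdd_fun f}. \<Inter>g\<in>{f. bdd_fun f}. {L. L (\<lambda>x. f x + g x) = L f + L g})
    \<inter> (\<Inter>c. \<Inter>f\<in>{f. bdd_fun f}. {L. L (\<lambda>x. c * f x) = c * L f})
    \<inter> (\<Inter>f. {L. \<bar>L f\<bar> \<le> sup_abs f}) \<inter> {L. L (\<lambda>_. 1) = 1}"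
    by (auto simp: linear_mean_def)
  also have "closed \<dots>"
    by (intro closed_Int closed_INT ballI closed_Collect_eq closed_Collect_le continuous_intros continuous_on_product_coordinates)
  finally show ?thesis .
qed

lemma closed_almost_inv: "closed {L. almost_inv A n L}"
proof -
  have "{L. almost_inv A n L} = (\<Inter>a\<in>A. \<Inter>f\<in>{f. bdd_fun f}. 
      {L. \<bar>L (\<lambda>x. f (x + a)) - L f\<bar> \<le> 2 * sup_abs f / real (Suc n)})"
    by (auto simp: almost_inv_def)
  also have "closed \<dots>"
    by (intro closed_Int closed_INT ballI closed_Collect_eq closed_Collect_le continuous_intros continuous_on_product_coordinates)
  finally show ?thesis .
qed

lemma compact_Pi_UNIV:
  fixes S :: "'i \<Rightarrow> 'b::topological_space set"
  assumes "\<And>i. compact (S i)" shows "compact (PiE UNIV S)"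
  using compactin_PiE[of "\<lambda>_. euclidean" UNIV S] assms by (simp add: euclidean_product_topology)

definition invariant_mean :: "(('g::ab_group_add \<Rightarrow> real) \<Rightarrow> real) \<Rightarrow> bool" where
  "invariant_mean L \<longleftrightarrow> linear_mean L \<and> (\<forall>a f. bdd_fun f \<longrightarrow> L (\<lambda>x. f (x + a)) = L f)"

text \<open>The almost invariant means for finite sets of translations form closed subsets of a
  compact product with the finite intersection property. A common point has a defect below
  \<open>2 * sup_abs f / (n + 1)\<close> for every \<open>n\<close>.\<close>

theorem invariant_mean_exists: "\<exists>L :: ('g::ab_group_add \<Rightarrow> real) \<Rightarrow> real. invariant_mean L"
proof -
  let ?K = "PiE UNIV (\<lambda>f::'g\<Rightarrow>real. {- sup_abs f..sup_abs f})"
  let ?I = "{(A, n::nat). finite (A::'g set)}"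
  define C where "C = (\<lambda>(A, n). {L :: ('g \<Rightarrow> real) \<Rightarrow> real. linear_mean L} \<inter> {L. almost_inv A n L})"
  have "?K \<inter> (\<Inter>i\<in>?I. C i) \<noteq> {}"
  proof (rule compact_imp_fip_image)
    show "compact ?K" by (rule compact_Pi_UNIV) auto
    show "closed (C i)" for i
      by (cases i) (simp add: C_def closed_Int closed_linear_mean closed_almost_inv)
    fix I' assume I': "finite I'" "I' \<subseteq> ?I"
    \<comment> \<open>Finitely many conditions follow from a single one: the union of the sets of
      translations with the largest precision.\<close>
    define A where "A = (\<Union>i\<in>I'. fst i)"
    define n where "n = Max (insert 0 (snd ` I'))"
    have "finite A" using I' by (auto simp: A_def)
    then obtain L :: "('g \<Rightarrow> real) \<Rightarrow> real" where L: "linear_mean L" "almost_inv A n L"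
      using almost_inv_mean_exists by blast
    have "L \<in> ?K" using L(1) unfolding linear_mean_def PiE_UNIV_domain Pi_def
      by (auto simp: abs_le_iff) (metis minus_le_iff)
    moreover have "L \<in> C i" if "i \<in> I'" for i
    proof -
      obtain B m where i: "i = (B, m)" by (cases i)
      have "B \<subseteq> A" using that i by (force simp: A_def)
      moreover have "m \<le> n" unfolding n_def using that i I' by (intro Max_ge) force+
      then have "2 * sup_abs f / real (Suc n) \<le> 2 * sup_abs f / real (Suc m)" for f :: "'g \<Rightarrow> real"
        by (intro divide_left_mono) (auto simp: sup_abs_nonneg)
      ultimately have "almost_inv B m L"
        using L(2) unfolding almost_inv_def by (meson order_trans subsetD)
      then show ?thesis using L(1) by (simp add: C_def i)
    qed
    ultimately show "?K \<inter> (\<Inter>i\<in>I'. C i) \<noteq> {}" by blast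
  qed
  then obtain L where L: "\<And>A n. finite A \<Longrightarrow> L \<in> C (A, n)" by auto
  have "L (\<lambda>x. f (x + a)) = L f" if f: "bdd_fun f" for a f
  proof -
    have le: "\<bar>L (\<lambda>x. f (x + a)) - L f\<bar> \<le> 2 * sup_abs f / real (Suc n)" for n
      using L[of "{a}" n] f by (auto simp: C_def almost_inv_def)
    have "(\<lambda>n. 2 * sup_abs f / real (Suc n)) \<longlonglongrightarrow> 0"
      by (rule LIMSEQ_Suc) (rule lim_const_over_n)
    then have "\<bar>L (\<lambda>x. f (x + a)) - L f\<bar> \<le> 0"
      using LIMSEQ_le_const le by blast
    then show ?thesis by simp
  qed
  then show ?thesis using L[of "{}" 0] by (auto simp: invariant_mean_def C_def)
qed

section \<open>Calculus of an invariant mean\<close>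

locale mean =
  fixes L :: "('g::ab_group_add \<Rightarrow> real) \<Rightarrow> real"
  assumes inv_mean: "invariant_mean L"
begin

lemma L_add: "bdd_fun f \<Longrightarrow> bdd_fun g \<Longrightarrow> L (\<lambda>x. f x + g x) = L f + L g"
  and L_cmult: "bdd_fun f \<Longrightarrow> L (\<lambda>x. c * f x) = c * L f"
  and L_sup: "\<bar>L f\<bar> \<le> sup_abs f"
  and L_one: "L (\<lambda>_. 1) = 1"
  and L_shift: "bdd_fun f \<Longrightarrow> L (\<lambda>x. f (x + a)) = L f"
  using inv_mean by (auto simp: invariant_mean_def linear_mean_def)

lemma L_const [simp]: "L (\<lambda>_. c) = c"
  using L_cmult[of "\<lambda>_. 1" c] L_one by simp

lemma L_diff:
  assumes "bdd_fun f" "bdd_fun g" shows "L (\<lambda>x. f x - g x) = L f - L g"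
  using L_add[OF assms(1), of "\<lambda>x. (-1) * g x"] L_cmult[OF assms(2), of "-1"]
    bdd_fun_mult[OF bdd_fun_const assms(2), of "-1"] by simp

text \<open>Positivity comes out of the norm bound and \<open>L 1 = 1\<close>: with \<open>B\<close>
  the supremum of \<open>f\<close>, the function \<open>B / 2 - f\<close> has modulus at most
  \<open>B / 2\<close>, hence \<open>B / 2 - L f \<le> B / 2\<close>.\<close>

lemma L_nonneg:
  assumes f: "bdd_fun f" and nn: "\<And>x. 0 \<le> f x" shows "0 \<le> L f"
proof -
  define B where "B = sup_abs f"
  have "\<bar>B / 2 - f x\<bar> \<le> B / 2" for x
    using nn[of x] sup_abs_upper[OF f, of x] by (simp add: B_def abs_if)
  then have "sup_abs (\<lambda>x. B / 2 - f x) \<le> B / 2" by (rule sup_abs_least)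
  then have "\<bar>L (\<lambda>x. B / 2 - f x)\<bar> \<le> B / 2" using L_sup order_trans by blast
  moreover have "L (\<lambda>x. B / 2 - f x) = B / 2 - L f" using L_diff[of "\<lambda>_. B / 2" f] f by simp
  ultimately show ?thesis by linarith
qed

lemma L_mono:
  assumes "bdd_fun f" "bdd_fun g" "\<And>x. f x \<le> g x" shows "L f \<le> L g"
  using L_nonneg[of "\<lambda>x. g x - f x"] assms L_diff[of g f] by auto

lemma L_le: "bdd_fun f \<Longrightarrow> (\<And>x. f x \<le> c) \<Longrightarrow> L f \<le> c"
  using L_mono[of f "\<lambda>_. c"] by auto

lemma L_sum: "finite I \<Longrightarrow> (\<And>i. i \<in> I \<Longrightarrow> bdd_fun (f i)) \<Longrightarrow> L (\<lambda>x. \<Sum>i\<in>I. f i x) = (\<Sum>i\<in>I. L (f i))"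
  by (induction I rule: finite_induct) (auto simp: L_add bdd_fun_sum)

definition cmean :: "('g \<Rightarrow> complex) \<Rightarrow> complex" where
  "cmean f = Complex (L (\<lambda>x. Re (f x))) (L (\<lambda>x. Im (f x)))"

lemma cmean_const [simp]: "cmean (\<lambda>_. c) = c"
  by (simp add: cmean_def)

lemma cmean_add: "bdd_fun f \<Longrightarrow> bdd_fun g \<Longrightarrow> cmean (\<lambda>x. f x + g x) = cmean f + cmean g"
  by (simp add: cmean_def complex_eq_iff L_add bdd_fun_Re bdd_fun_Im)

lemma cmean_diff: "bdd_fun f \<Longrightarrow> bdd_fun g \<Longrightarrow> cmean (\<lambda>x. f x - g x) = cmean f - cmean g"
  by (simp add: cmean_def complex_eq_iff L_diff bdd_fun_Re bdd_fun_Im)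

lemma cmean_cmult:
  assumes f: "bdd_fun f" shows "cmean (\<lambda>x. c * f x) = c * cmean f"
proof -
  have b: "bdd_fun (\<lambda>x. r * Re (f x))" "bdd_fun (\<lambda>x. r * Im (f x))" for r
    using f by (auto intro!: bdd_fun_mult)
  have b': "bdd_fun (\<lambda>x. Re (f x))" "bdd_fun (\<lambda>x. Im (f x))" using f by auto
  show ?thesis using b b' by (simp add: cmean_def complex_eq_iff L_diff L_add L_cmult)
qed

lemma cmean_shift: "bdd_fun f \<Longrightarrow> cmean (\<lambda>x. f (x + a)) = cmean f"
  using L_shift[of "\<lambda>x. Re (f x)" a] L_shift[of "\<lambda>x. Im (f x)" a]
  by (simp add: cmean_def bdd_fun_Re bdd_fun_Im)

lemma cmean_cnj:
  assumes "bdd_fun f" shows "cmean (\<lambda>x. cnj (f x)) = cnj (cmean f)"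
proof -
  have "bdd_fun (\<lambda>x. Im (f x))" using assms by auto
  from L_cmult[OF this, of "-1"] show ?thesis by (simp add: cmean_def complex_eq_iff)
qed

lemma cmean_of_real: "cmean (\<lambda>x. of_real (f x)) = of_real (L f)"
  by (simp add: cmean_def complex_eq_iff)

text \<open>A rotation moves the mean onto the nonnegative real axis; what remains is monotonicity
  for a real part.\<close>

lemma norm_cmean_le:
  assumes f: "bdd_fun f" shows "cmod (cmean f) \<le> L (\<lambda>x. cmod (f x))"
proof -
  define z where "z = cmean f"
  define u where "u = (if z = 0 then 1 else cnj z / of_real (cmod z))"
  have u: "cmod u = 1" by (auto simp: u_def norm_divide)
  have uz: "u * z = of_real (cmod z)"
    by (auto simp: u_def complex_norm_square power2_eq_square field_simps simp flip: complex_norm_square)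
  have bn: "bdd_fun (\<lambda>x. cmod (f x))" using f by (simp add: bdd_fun_def)
  have "cmean (\<lambda>x. u * f x) = of_real (cmod z)" by (simp add: cmean_cmult f uz z_def[symmetric])
  then have "cmod z = L (\<lambda>x. Re (u * f x))" by (simp add: cmean_def complex_eq_iff)
  also have "\<dots> \<le> L (\<lambda>x. cmod (f x))"
  proof (rule L_mono)
    show "bdd_fun (\<lambda>x. Re (u * f x))" using f by (intro bdd_fun_Re bdd_fun_mult bdd_fun_const)
    show "Re (u * f x) \<le> cmod (f x)" for x
      using complex_Re_le_cmod[of "u * f x"] by (simp add: norm_mult u)
  qed (rule bn)
  finally show ?thesis by (simp add: z_def)
qed

lemma norm_cmean_le_const:
  assumes "\<And>x. cmod (f x) \<le> B" shows "cmod (cmean f) \<le> B"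
proof -
  have f: "bdd_fun f" using assms by (rule bdd_funI)
  then have "bdd_fun (\<lambda>x. cmod (f x))" by (simp add: bdd_fun_def)
  then show ?thesis using norm_cmean_le[OF f] L_le[of "\<lambda>x. cmod (f x)" B] assms by force
qed

section \<open>Energy, self-correlation and smoothing\<close>

definition energy :: "('g \<Rightarrow> complex) \<Rightarrow> real" where
  "energy v = L (\<lambda>x. (cmod (v x))\<^sup>2)"

text \<open>A self-correlation plays the role of a positive definite function.\<close>
definition autocorr :: "('g \<Rightarrow> complex) \<Rightarrow> 'g \<Rightarrow> complex" where
  "autocorr v x = cmean (\<lambda>z. v (x + z) * cnj (v z))"

lemma autocorr_0: "autocorr v 0 = of_real (energy v)"
  unfolding autocorr_def energy_def cmean_of_real[symmetric]
  by (simp only: complex_norm_square add_0)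

lemma energy_nonneg: "bdd_fun v \<Longrightarrow> 0 \<le> energy v"
  unfolding energy_def by (rule L_nonneg) auto

lemma bdd_shift: "bdd_fun v \<Longrightarrow> bdd_fun (\<lambda>z. v (x + z))"
  by (rule bdd_fun_comp)

lemma norm_autocorr_le:
  assumes v: "bdd_fun v" shows "cmod (autocorr v x) \<le> energy v"
proof -
  have b: "bdd_fun (\<lambda>z. v (x + z) * cnj (v z))"
    by (intro bdd_fun_mult bdd_fun_cnj bdd_shift[OF v] v)
  have bv: "bdd_fun (\<lambda>z. (cmod (v z))\<^sup>2)" "bdd_fun (\<lambda>z. (cmod (v (z + x)))\<^sup>2)"
    using v by (auto intro: bdd_fun_norm_sq bdd_fun_comp[OF v])
  have "cmod (autocorr v x) \<le> L (\<lambda>z. cmod (v (x + z) * cnj (v z)))"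
    unfolding autocorr_def by (rule norm_cmean_le[OF b])
  also have "\<dots> \<le> L (\<lambda>z. (1/2) * ((cmod (v z))\<^sup>2 + (cmod (v (z + x)))\<^sup>2))"
  proof (rule L_mono)
    show "bdd_fun (\<lambda>z. cmod (v (x + z) * cnj (v z)))" using b by (simp add: bdd_fun_def)
    show "bdd_fun (\<lambda>z. (1/2) * ((cmod (v z))\<^sup>2 + (cmod (v (z + x)))\<^sup>2))"
      using bv by (intro bdd_fun_mult bdd_fun_const bdd_fun_add)
    show "cmod (v (x + z) * cnj (v z)) \<le> (1/2) * ((cmod (v z))\<^sup>2 + (cmod (v (z + x)))\<^sup>2)" for z
      using sum_squares_bound[of "cmod (v z)" "cmod (v (z + x))"]
      unfolding norm_mult complex_mod_cnj add.commute[of x z] by (simp add: ac_simps)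
  qed
  also have "\<dots> = energy v"
    using L_shift[OF bv(1), of x] bv
    by (subst L_cmult[OF bdd_fun_add[OF bv]], subst L_add[OF bv]) (simp add: energy_def)
  finally show ?thesis .
qed

lemma bdd_autocorr: "bdd_fun v \<Longrightarrow> bdd_fun (autocorr v)"
  using norm_autocorr_le by (rule bdd_funI)

lemma autocorr_uminus:
  assumes v: "bdd_fun v" shows "autocorr v (- x) = cnj (autocorr v x)"
proof -
  have b: "bdd_fun (\<lambda>z. v (- x + z) * cnj (v z))" and b2: "bdd_fun (\<lambda>z. v (x + z) * cnj (v z))"
    by (intro bdd_fun_mult bdd_fun_cnj bdd_shift[OF v] v)+
  show ?thesis
    using cmean_shift[OF b, of x] cmean_cnj[OF b2] by (simp add: autocorr_def ac_simps)
qed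

lemma autocorr_scale: "bdd_fun v \<Longrightarrow> autocorr (\<lambda>z. of_real r * v z) x = of_real (r\<^sup>2) * autocorr v x"
proof -
  assume v: "bdd_fun v"
  have b: "bdd_fun (\<lambda>z. v (x + z) * cnj (v z))"
    by (intro bdd_fun_mult bdd_fun_cnj bdd_shift[OF v] v)+
  show ?thesis using cmean_cmult[OF b, of "of_real (r\<^sup>2)"]
    by (simp add: autocorr_def power2_eq_square mult_ac)
qed

lemma energy_scale: "bdd_fun v \<Longrightarrow> energy (\<lambda>z. of_real r * v z) = r\<^sup>2 * energy v"
  unfolding energy_def by (simp add: norm_mult power_mult_distrib L_cmult bdd_fun_norm_sq)

text \<open>Adding a rotated translate to \<open>v\<close> is the variation that is later played
  against maximality. Its effect on the self-correlation is linear.\<close>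

lemma autocorr_twist:
  assumes v: "bdd_fun v" and c: "cmod c = 1"
  shows "autocorr (\<lambda>z. v z + c * v (z + a)) x
    = 2 * autocorr v x + c * autocorr v (x + a) + cnj c * autocorr v (x - a)"
proof -
  have b: "bdd_fun (\<lambda>z. v (y + z) * cnj (v z))" for y
    by (intro bdd_fun_mult bdd_fun_cnj bdd_shift[OF v] v)+
  have cc: "c * cnj c = 1" using c by (simp add: complex_norm_square[symmetric])
  have split: "(v (x + z) + c * v (x + z + a)) * cnj (v z + c * v (z + a))
     = (v (x + z) * cnj (v z) + v (x + (z + a)) * cnj (v (z + a)))
      + (c * (v ((x + a) + z) * cnj (v z)) + cnj c * (v ((x - a) + (z + a)) * cnj (v (z + a))))" for z
  proof -
    have "(p + c * q) * (p' + cnj c * q') = (p * p' + q * q') + (c * (q * p') + cnj c * (p * q'))" for p q p' q'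
      using cc by algebra
    from this[of "v (x + z)" "v (x + z + a)" "cnj (v z)" "cnj (v (z + a))"]
    show ?thesis by (simp add: algebra_simps)
  qed
  note b1 = bdd_fun_comp[OF b[of x], of "\<lambda>z. z + a"]
  have d1: "bdd_fun (\<lambda>z. c * (v ((x + a) + z) * cnj (v z)))"
    by (rule bdd_fun_mult[OF bdd_fun_const b])
  have d2: "bdd_fun (\<lambda>z. cnj c * (v ((x - a) + (z + a)) * cnj (v (z + a))))"
    by (rule bdd_fun_mult[OF bdd_fun_const bdd_fun_comp[OF b[of "x - a"], of "\<lambda>z. z + a"]])
  from split have "autocorr (\<lambda>z. v z + c * v (z + a)) x
     = cmean (\<lambda>z. (v (x + z) * cnj (v z) + v (x + (z + a)) * cnj (v (z + a)))
      + (c * (v ((x + a) + z) * cnj (v z)) + cnj c * (v ((x - a) + (z + a)) * cnj (v (z + a)))))"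
    by (simp add: autocorr_def)
  also have "\<dots> = (cmean (\<lambda>z. v (x + z) * cnj (v z)) + cmean (\<lambda>z. v (x + (z + a)) * cnj (v (z + a))))
      + (cmean (\<lambda>z. c * (v ((x + a) + z) * cnj (v z))) + cmean (\<lambda>z. cnj c * (v ((x - a) + (z + a)) * cnj (v (z + a)))))"
    by (simp only: cmean_add[OF bdd_fun_add[OF b b1] bdd_fun_add[OF d1 d2]] cmean_add[OF b b1] cmean_add[OF d1 d2])
  also have "\<dots> = 2 * autocorr v x + c * autocorr v (x + a) + cnj c * autocorr v (x - a)"
    using cmean_shift[OF b[of x], of a] cmean_shift[OF b[of "x - a"], of a]
      cmean_cmult[OF b[of "x + a"], of c] cmean_cmult[OF bdd_fun_comp[OF b[of "x - a"], of "\<lambda>z. z + a"], of "cnj c"]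
    by (simp add: autocorr_def)
  finally show ?thesis .
qed

lemma energy_twist:
  assumes v: "bdd_fun v" and c: "cmod c = 1"
  shows "energy (\<lambda>z. v z + c * v (z + a)) = 2 * energy v + 2 * Re (c * autocorr v a)"
proof -
  have "complex_of_real (energy (\<lambda>z. v z + c * v (z + a)))
    = 2 * of_real (energy v) + c * autocorr v a + cnj (c * autocorr v a)"
    using autocorr_twist[OF assms, of a 0] autocorr_uminus[OF v, of a] by (simp add: autocorr_0)
  then have "Re (complex_of_real (energy (\<lambda>z. v z + c * v (z + a))))
    = Re (2 * of_real (energy v) + c * autocorr v a + cnj (c * autocorr v a))" by simp
  then show ?thesis by simp
qed

text \<open>A convolution with \<open>w\<close>. The self-correlation of a bounded function need not
  be continuous; after smoothing by a continuous \<open>w\<close> such functions become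
  equicontinuous, which permits the passage to a limit.\<close>

definition smooth :: "('g \<Rightarrow> complex) \<Rightarrow> ('g \<Rightarrow> complex) \<Rightarrow> 'g \<Rightarrow> complex" where
  "smooth w \<phi> x = cmean (\<lambda>y. cnj (w y) * \<phi> (x + y))"

lemma bdd_smooth_aux: "bdd_fun w \<Longrightarrow> bdd_fun \<phi> \<Longrightarrow> bdd_fun (\<lambda>y. cnj (w y) * \<phi> (x + y))"
  by (rule bdd_fun_mult[OF bdd_fun_cnj bdd_shift])

lemma smooth_add: "bdd_fun w \<Longrightarrow> bdd_fun f \<Longrightarrow> bdd_fun g \<Longrightarrow>
    smooth w (\<lambda>x. f x + g x) x = smooth w f x + smooth w g x"
  using bdd_smooth_aux[of w f x] bdd_smooth_aux[of w g x]
  by (simp add: smooth_def distrib_left cmean_add)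

lemma smooth_cmult: "bdd_fun w \<Longrightarrow> bdd_fun f \<Longrightarrow> smooth w (\<lambda>x. c * f x) x = c * smooth w f x"
  using cmean_cmult[OF bdd_smooth_aux[of w f x], of c] by (simp add: smooth_def mult_ac)

lemma smooth_shift: "smooth w (\<lambda>x. f (x + a)) x = smooth w f (x + a)"
  by (simp add: smooth_def ac_simps)

lemma norm_smooth_le:
  assumes "bdd_fun w" "\<And>x. cmod (\<phi> x) \<le> B" "\<And>x. cmod (w x) \<le> W"
  shows "cmod (smooth w \<phi> x) \<le> W * B"
  unfolding smooth_def
proof (rule norm_cmean_le_const)
  fix y show "cmod (cnj (w y) * \<phi> (x + y)) \<le> W * B"
    using assms(2)[of "x + y"] assms(3)[of y] by (simp add: norm_mult) (meson mult_mono norm_ge_zero order_trans)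
qed

lemma bdd_smooth: assumes "bdd_fun w" "bdd_fun \<phi>" shows "bdd_fun (smooth w \<phi>)"
proof -
  obtain W B where "\<And>x. cmod (w x) \<le> W" "\<And>x. cmod (\<phi> x) \<le> B"
    using assms by (auto simp: bdd_fun_def)
  then show ?thesis by (intro bdd_funI[of _ "W * B"] norm_smooth_le[OF assms(1)])
qed

text \<open>The substitution moves the variable onto \<open>w\<close>, so that the regularity of
  \<open>w\<close> alone controls that of the result.\<close>

lemma smooth_alt:
  assumes "bdd_fun w" "bdd_fun \<phi>"
  shows "smooth w \<phi> x = cmean (\<lambda>y. cnj (w (y - x)) * \<phi> y)"
proof -
  have "bdd_fun (\<lambda>y. cnj (w (y - x)) * \<phi> y)"
    by (intro bdd_fun_mult bdd_fun_cnj bdd_fun_comp[OF assms(1)] assms(2))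
  from cmean_shift[OF this, of x] show ?thesis by (simp add: smooth_def add.commute)
qed

end

section \<open>Characters separate points of a compact abelian group\<close>

locale compact_ab_group =
  fixes T :: "'g::ab_group_add topology"
  assumes top_UNIV: "topspace T = UNIV"
    and add_cont: "continuous_map (prod_topology T T) T (\<lambda>(x, y). x + y)"
    and uminus_cont: "continuous_map T T uminus"
    and compact_T: "compact_space T"
    and Hausdorff_T: "Hausdorff_space T"
begin

lemma translate_cont: "continuous_map T T (\<lambda>x. x + a)"
proof -
  have "continuous_map T (prod_topology T T) (\<lambda>x. (x, a))"
    by (simp add: continuous_map_pairedI top_UNIV)
  from continuous_map_compose[OF this add_cont] show ?thesis by (simp add: o_def)
qed

lemma openin_translate: "openin T U \<Longrightarrow> openin T {x. x + a \<in> U}"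
  using openin_continuous_map_preimage[OF translate_cont, of U a] by (simp add: top_UNIV)

text \<open>This plays the part of the positivity of Haar measure on nonempty open sets.\<close>

lemma finite_translates_cover:
  assumes "openin T U" "U \<noteq> {}"
  shows "\<exists>D. finite D \<and> (\<forall>x. \<exists>g\<in>D. x + g \<in> U)"
proof -
  obtain u where u: "u \<in> U" using assms by blast
  define V where "V = (\<lambda>g. {x. x + g \<in> U})"
  have "\<forall>W\<in>range V. openin T W" using openin_translate assms(1) by (auto simp: V_def)
  moreover have "topspace T \<subseteq> \<Union>(range V)"
  proof
    fix x
    have "x \<in> V (u - x)" using u by (simp add: V_def)
    then show "x \<in> \<Union>(range V)" by blast
  qed
  ultimately obtain \<F> where "finite \<F>" "\<F> \<subseteq> range V" "topspace T \<subseteq> \<Union>\<F>"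
    using compact_T unfolding compact_space_alt by meson
  then obtain D where "finite D" "\<F> = V ` D" by (meson finite_subset_image)
  with \<open>topspace T \<subseteq> \<Union>\<F>\<close> show ?thesis
    unfolding V_def top_UNIV by (intro exI[of _ D]) auto
qed

definition ucont :: "('g \<Rightarrow> complex) \<Rightarrow> bool" where
  "ucont f \<longleftrightarrow> (\<forall>\<epsilon>>0. \<exists>V. openin T V \<and> 0 \<in> V \<and> (\<forall>x d. d \<in> V \<longrightarrow> cmod (f (x + d) - f x) \<le> \<epsilon>))"

text \<open>The tube lemma is applied to \<open>(d, x) \<mapsto> f (x + d) - f x\<close> along
  \<open>{0} \<times> UNIV\<close>.\<close>

lemma continuous_imp_ucont:
  assumes f: "continuous_map T euclidean f" shows "ucont f"
  unfolding ucont_def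
proof (intro allI impI)
  fix \<epsilon> :: real assume e: "\<epsilon> > 0"
  let ?h = "\<lambda>(d, x). f (x + d) - f x"
  have 1: "continuous_map (prod_topology T T) T (\<lambda>p. snd p + fst p)"
    using continuous_map_compose[OF continuous_map_pairedI[OF continuous_map_snd continuous_map_fst] add_cont]
    by (simp add: o_def case_prod_beta)
  have "continuous_map (prod_topology T T) euclidean (\<lambda>p. f (snd p + fst p) - f (snd p))"
    using continuous_map_compose[OF 1 f] continuous_map_compose[OF continuous_map_snd[of T T] f]
    by (intro continuous_map_diff) (auto simp: o_def)
  then have "openin (prod_topology T T) {p \<in> topspace (prod_topology T T). f (snd p + fst p) - f (snd p) \<in> ball 0 \<epsilon>}"
    by (rule openin_continuous_map_preimage) auto
  moreover have "{0} \<times> topspace T \<subseteq> {p \<in> topspace (prod_topology T T). f (snd p + fst p) - f (snd p) \<in> ball 0 \<epsilon>}"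
    using e by (auto simp: top_UNIV)
  ultimately obtain U V where UV: "openin T U" "0 \<in> U" "topspace T \<subseteq> V"
     "U \<times> V \<subseteq> {p \<in> topspace (prod_topology T T). f (snd p + fst p) - f (snd p) \<in> ball 0 \<epsilon>}"
    using tube_lemma_right[of T T "{p \<in> topspace (prod_topology T T). f (snd p + fst p) - f (snd p) \<in> ball 0 \<epsilon>}" "topspace T" 0]
      compact_T unfolding compact_space_def by (auto simp: top_UNIV)
  have "cmod (f (x + d) - f x) \<le> \<epsilon>" if "d \<in> U" for x d
  proof -
    have "(d, x) \<in> U \<times> V" using that UV(3) by (auto simp: top_UNIV)
    then have "f (x + d) - f x \<in> ball 0 \<epsilon>" using UV(4) by auto
    then show ?thesis by simp
  qed
  then show "\<exists>V. openin T V \<and> 0 \<in> V \<and> (\<forall>x d. d \<in> V \<longrightarrow> cmod (f (x + d) - f x) \<le> \<epsilon>)"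
    using UV by blast
qed

lemma ucont_imp_continuous:
  assumes f: "ucont f" shows "continuous_map T euclidean f"
  unfolding mtopology_is_euclidean[symmetric] Met_TC.continuous_map_to_metric
proof (intro ballI allI impI)
  fix x \<epsilon> assume "\<epsilon> > (0::real)"
  then have "\<epsilon> / 2 > 0" by simp
  then obtain V where V: "openin T V" "0 \<in> V" "\<And>x d. d \<in> V \<Longrightarrow> cmod (f (x + d) - f x) \<le> \<epsilon> / 2"
    using f unfolding ucont_def by meson
  have "y + (- x) \<in> V \<Longrightarrow> cmod (f y - f x) \<le> \<epsilon> / 2" for y
    using V(3)[of "y - x" x] by simp
  then show "\<exists>U. openin T U \<and> x \<in> U \<and> (\<forall>y\<in>U. f y \<in> Met_TC.mball (f x) \<epsilon>)"
    using V \<open>\<epsilon> > 0\<close> by (intro exI[of _ "{y. y + (- x) \<in> V}"] conjI openin_translate)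
      (force simp: dist_norm norm_minus_commute)+
qed

lemma ucont_bdd: assumes "ucont f" shows "bdd_fun f"
proof -
  have "compactin T (topspace T)" using compact_T by (simp add: compact_space_def)
  from image_compactin[OF this ucont_imp_continuous[OF assms]]
  have "compact (range f)" by (simp add: top_UNIV)
  then have "bounded (range f)" by (rule compact_imp_bounded)
  then show ?thesis by (auto simp: bounded_iff bdd_fun_def)
qed

lemma ucont_diff:
  assumes "ucont f" "ucont g" shows "ucont (\<lambda>x. f x - g x)"
  using assms ucont_imp_continuous continuous_imp_ucont continuous_map_diff by blast

lemma ucont_translate:
  assumes "ucont f" shows "ucont (\<lambda>x. f (x + a))"
proof -
  have "f (x + d + a) = f ((x + a) + d)" for x d by (simp add: algebra_simps)
  then show ?thesis using assms unfolding ucont_def by (simp only:) meson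
qed

lemma ucont_cmult:
  assumes "ucont f" shows "ucont (\<lambda>x. c * f x)"
  using continuous_map_compose[OF ucont_imp_continuous[OF assms], of euclidean "\<lambda>z. c * z"]
  by (intro continuous_imp_ucont) (simp add: o_def continuous_map_iff_continuous2 continuous_intros)

end

section \<open>The mean on continuous functions and the variational problem\<close>

locale compact_group_mean = compact_ab_group T + mean L
  for T :: "'g::ab_group_add topology" and L :: "('g \<Rightarrow> real) \<Rightarrow> real"
begin

text \<open>Finitely many translates of the open set where the modulus of \<open>f\<close> exceeds
  half its value at \<open>x\<close> cover the group. The sum of the corresponding translates of the
  squared modulus is bounded below by a positive constant, while its mean would be 0.\<close>

lemma L_faithful:
  assumes f: "ucont f" and 0: "L (\<lambda>x. (cmod (f x))\<^sup>2) = 0" shows "f x = 0"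
proof (rule ccontr)
  assume nz: "f x \<noteq> 0"
  define U where "U = {y. cmod (f y) > cmod (f x) / 2}"
  have "openin T {y \<in> topspace T. f y \<in> {z. cmod z > cmod (f x) / 2}}"
    by (intro openin_continuous_map_preimage[OF ucont_imp_continuous[OF f]])
       (simp add: open_Collect_less continuous_intros flip: open_openin)
  then have U: "openin T U" by (simp add: U_def top_UNIV)
  have "x \<in> U" using nz by (simp add: U_def)
  then obtain D where D: "finite D" "\<And>y. \<exists>g\<in>D. y + g \<in> U" using finite_translates_cover[OF U] by blast
  let ?F = "\<lambda>y. (cmod (f y))\<^sup>2"
  have bF: "bdd_fun ?F" using ucont_bdd[OF f] by (rule bdd_fun_norm_sq)
  have "(cmod (f x) / 2)\<^sup>2 \<le> (\<Sum>g\<in>D. ?F (y + g))" for y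
  proof -
    obtain g where g: "g \<in> D" "y + g \<in> U" using D by blast
    then have "(cmod (f x) / 2)\<^sup>2 \<le> ?F (y + g)" by (intro power_mono) (auto simp: U_def)
    also have "\<dots> \<le> (\<Sum>g\<in>D. ?F (y + g))" using g D(1) by (intro member_le_sum) auto
    finally show ?thesis .
  qed
  then have "L (\<lambda>_. (cmod (f x) / 2)\<^sup>2) \<le> L (\<lambda>y. \<Sum>g\<in>D. ?F (y + g))"
    using bF by (intro L_mono bdd_fun_sum) (auto intro: bdd_fun_comp)
  also have "\<dots> = (\<Sum>g\<in>D. L (\<lambda>y. ?F (y + g)))"
    using bF by (intro L_sum D(1)) (rule bdd_fun_comp)
  also have "\<dots> = 0" using L_shift[OF bF] 0 by simp
  finally show False using nz by simp
qed

lemma autocorr_ucont: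
  assumes u: "ucont u" shows "ucont (autocorr u)"
  unfolding ucont_def
proof (intro allI impI)
  fix \<epsilon> :: real assume e: "\<epsilon> > 0"
  have bu: "bdd_fun u" using u by (rule ucont_bdd)
  then obtain B where B: "\<And>x. cmod (u x) \<le> B" by (auto simp: bdd_fun_def)
  then have "B \<ge> 0" by (meson norm_ge_zero order_trans)
  define e' where "e' = \<epsilon> / (B + 1)"
  have "e' > 0" using e \<open>B \<ge> 0\<close> by (simp add: e'_def)
  then obtain V where V: "openin T V" "0 \<in> V" "\<And>x d. d \<in> V \<Longrightarrow> cmod (u (x + d) - u x) \<le> e'"
    using u unfolding ucont_def by meson
  have "cmod (autocorr u (x + d) - autocorr u x) \<le> \<epsilon>" if "d \<in> V" for x d
  proof -
    have "autocorr u (x + d) - autocorr u x = cmean (\<lambda>z. u (x + d + z) * cnj (u z) - u (x + z) * cnj (u z))"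
      unfolding autocorr_def by (rule cmean_diff[symmetric]) (intro bdd_fun_mult bdd_fun_cnj bdd_shift[OF bu] bu)+
    also have "\<dots> = cmean (\<lambda>z. (u ((x + z) + d) - u (x + z)) * cnj (u z))"
      by (simp add: algebra_simps)
    also have "cmod \<dots> \<le> \<epsilon>"
    proof (rule norm_cmean_le_const)
      fix z
      have "cmod ((u ((x + z) + d) - u (x + z)) * cnj (u z)) \<le> e' * B"
        unfolding norm_mult complex_mod_cnj using V(3)[OF that] B \<open>e' > 0\<close> by (intro mult_mono) auto
      also have "\<dots> \<le> \<epsilon>" using e \<open>B \<ge> 0\<close> by (simp add: e'_def field_simps)
      finally show "cmod ((u ((x + z) + d) - u (x + z)) * cnj (u z)) \<le> \<epsilon>" .
    qed
    finally show ?thesis .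
  qed
  then show "\<exists>V. openin T V \<and> 0 \<in> V \<and> (\<forall>x d. d \<in> V \<longrightarrow> cmod (autocorr u (x + d) - autocorr u x) \<le> \<epsilon>)"
    using V by blast
qed

text \<open>The neighbourhood depends on \<open>w\<close> and the precision only, not on the
  function that is smoothed.\<close>

lemma smooth_equicontinuous:
  assumes w: "ucont w" and e: "\<epsilon> > 0"
  shows "\<exists>V. openin T V \<and> 0 \<in> V \<and>
    (\<forall>\<phi> x d. (\<forall>y. cmod (\<phi> y) \<le> 1) \<longrightarrow> d \<in> V \<longrightarrow> cmod (smooth w \<phi> (x + d) - smooth w \<phi> x) \<le> \<epsilon>)"
proof -
  obtain V where V: "openin T V" "0 \<in> V" "\<And>x d. d \<in> V \<Longrightarrow> cmod (w (x + d) - w x) \<le> \<epsilon>"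
    using w e unfolding ucont_def by meson
  have bw: "bdd_fun w" using w by (rule ucont_bdd)
  have "cmod (smooth w \<phi> (x + d) - smooth w \<phi> x) \<le> \<epsilon>"
    if phi: "\<And>y. cmod (\<phi> y) \<le> 1" and d: "d \<in> V" for \<phi> x d
  proof -
    have bp: "bdd_fun \<phi>" using phi by (rule bdd_funI)
    have "smooth w \<phi> (x + d) - smooth w \<phi> x
      = cmean (\<lambda>y. cnj (w (y - (x + d))) * \<phi> y - cnj (w (y - x)) * \<phi> y)"
      unfolding smooth_alt[OF bw bp]
      by (rule cmean_diff[symmetric]) (intro bdd_fun_mult bdd_fun_cnj bdd_fun_comp[OF bw] bp)+
    also have "cmod \<dots> \<le> \<epsilon>"
    proof (rule norm_cmean_le_const)
      fix y
      have "cmod (cnj (w (y - (x + d))) * \<phi> y - cnj (w (y - x)) * \<phi> y)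
          = cmod (w (y - (x + d) + d) - w (y - (x + d))) * cmod (\<phi> y)"
        by (simp add: norm_minus_commute flip: left_diff_distrib norm_mult complex_cnj_diff)
           (simp add: norm_mult norm_minus_commute flip: complex_cnj_diff)
      also have "\<dots> \<le> \<epsilon> * 1" using V(3)[OF d, of "y - (x + d)"] phi e by (intro mult_mono) auto
      finally show "cmod (cnj (w (y - (x + d))) * \<phi> y - cnj (w (y - x)) * \<phi> y) \<le> \<epsilon>" by simp
    qed
    finally show ?thesis .
  qed
  then show ?thesis using V by blast
qed

lemma smooth_ucont:
  assumes w: "ucont w" and "bdd_fun \<phi>" shows "ucont (smooth w \<phi>)"
proof -
  obtain B where B: "\<And>x. cmod (\<phi> x) \<le> B" using assms(2) by (auto simp: bdd_fun_def)
  then have "B \<ge> 0" by (meson norm_ge_zero order_trans)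
  define \<phi>' where "\<phi>' x = of_real (1 / (B + 1)) * \<phi> x" for x
  have p1: "cmod (\<phi>' x) \<le> 1" for x using B[of x] \<open>B \<ge> 0\<close> by (simp add: \<phi>'_def norm_mult norm_divide field_simps flip: of_real_add)
  then have bp: "bdd_fun \<phi>'" by (rule bdd_funI)
  have "ucont (smooth w \<phi>')"
    unfolding ucont_def using smooth_equicontinuous[OF w] p1 by meson
  from ucont_cmult[OF this, of "of_real (B + 1)"]
  have "ucont (\<lambda>x. of_real (B + 1) * smooth w \<phi>' x)" .
  moreover have "of_real (B + 1) * smooth w \<phi>' x = smooth w \<phi> x" for x
  proof -
    have "of_real (B + 1) * \<phi>' y = \<phi> y" for y
      using \<open>B \<ge> 0\<close> by (simp add: \<phi>'_def field_simps flip: of_real_add of_real_mult)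
    then show ?thesis using smooth_cmult[OF ucont_bdd[OF w] bp, of "of_real (B + 1)" x] by simp
  qed
  ultimately show ?thesis by simp
qed

definition smooth_energy :: "('g \<Rightarrow> complex) \<Rightarrow> ('g \<Rightarrow> complex) \<Rightarrow> real" where
  "smooth_energy w v = energy (smooth w (autocorr v))"

definition max_energy :: "('g \<Rightarrow> complex) \<Rightarrow> real" where
  "max_energy w = Sup {smooth_energy w v | v. bdd_fun v \<and> energy v = 1}"

lemma smooth_energy_bdd_above:
  assumes "bdd_fun w" shows "bdd_above {smooth_energy w v | v. bdd_fun v \<and> energy v = 1}"
proof -
  obtain W where W: "\<And>x. cmod (w x) \<le> W" using assms by (auto simp: bdd_fun_def)
  have "smooth_energy w v \<le> W\<^sup>2" if v: "bdd_fun v" "energy v = 1" for v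
  proof -
    have "cmod (smooth w (autocorr v) x) \<le> W * 1" for x
      by (rule norm_smooth_le[OF assms _ W]) (use norm_autocorr_le[OF v(1)] v(2) in simp)
    then have "(cmod (smooth w (autocorr v) x))\<^sup>2 \<le> W\<^sup>2" for x
      by (intro power_mono) auto
    then show ?thesis unfolding smooth_energy_def energy_def
      by (intro L_le bdd_fun_norm_sq bdd_smooth assms bdd_autocorr v)
  qed
  then show ?thesis by (intro bdd_aboveI[of _ "W\<^sup>2"]) auto
qed

text \<open>Both sides are homogeneous of degree four in \<open>v\<close>, which reduces the claim
  to unit energy; energy 0 forces the self-correlation to vanish.\<close>

lemma smooth_energy_le:
  assumes w: "bdd_fun w" and v: "bdd_fun v"
  shows "smooth_energy w v \<le> max_energy w * (energy v)\<^sup>2"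
proof (cases "energy v = 0")
  case True
  then have "autocorr v x = 0" for x using norm_autocorr_le[OF v, of x] by simp
  then have "smooth w (autocorr v) x = 0" for x by (simp add: smooth_def)
  then show ?thesis using True by (simp add: smooth_energy_def energy_def)
next
  case False
  then have pos: "energy v > 0" using energy_nonneg[OF v] by simp
  define r where "r = 1 / sqrt (energy v)"
  have r2: "r\<^sup>2 = 1 / energy v" using pos by (simp add: r_def power_divide)
  define v' where "v' z = of_real r * v z" for z
  have v': "bdd_fun v'" unfolding v'_def using v by (intro bdd_fun_mult) auto
  have e1: "energy v' = 1" unfolding v'_def energy_scale[OF v] using pos by (simp add: r2)
  have "smooth w (autocorr v') x = of_real (1 / energy v) * smooth w (autocorr v) x" for x
    using smooth_cmult[OF w bdd_autocorr[OF v]] unfolding v'_def autocorr_scale[OF v] r2 .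
  then have "smooth w (autocorr v') = (\<lambda>x. of_real (1 / energy v) * smooth w (autocorr v) x)" by blast
  then have "smooth_energy w v' = (1 / energy v)\<^sup>2 * smooth_energy w v"
    unfolding smooth_energy_def using energy_scale[OF bdd_smooth[OF w bdd_autocorr[OF v]], of "1 / energy v"]
    by simp
  moreover have "smooth_energy w v' \<le> max_energy w"
    unfolding max_energy_def using v' e1 by (intro cSup_upper smooth_energy_bdd_above w) auto
  then have "(energy v)\<^sup>2 * smooth_energy w v' \<le> (energy v)\<^sup>2 * max_energy w"
    by (intro mult_left_mono) auto
  ultimately show ?thesis using pos by (simp add: field_simps power2_eq_square)
qed

text \<open>Characters arise as limits of near-maximizers of the smoothed energy.\<close>

lemma near_max_functional_eq:
  assumes w: "bdd_fun w" and v: "bdd_fun v" "energy v = 1" and c: "cmod c = 1"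
  defines "\<psi> \<equiv> smooth w (autocorr v)"
  shows "L (\<lambda>x. (cmod ((c * \<psi> (x + a) + cnj c * \<psi> (x - a)) / 2 - of_real (Re (c * autocorr v a)) * \<psi> x))\<^sup>2)
    \<le> max_energy w - smooth_energy w v"
proof -
  define M where "M = max_energy w"
  define p where "p = Re (c * autocorr v a)"
  define A where "A = \<psi>"
  define B where "B x = (c * \<psi> (x + a) + cnj c * \<psi> (x - a)) / 2" for x
  have bpsi: "bdd_fun \<psi>" unfolding \<psi>_def by (intro bdd_smooth w bdd_autocorr v)
  have bB: "bdd_fun B"
    unfolding B_def divide_inverse by (intro bdd_fun_mult bdd_fun_add bdd_fun_const bdd_fun_comp[OF bpsi])
  have bA: "bdd_fun A" using bpsi by (simp add: A_def)
  have cb: "cmod (c * autocorr v a) \<le> 1" using norm_autocorr_le[OF v(1), of a] v(2) c by (simp add: norm_mult)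
  have p: "\<bar>p\<bar> \<le> 1" unfolding p_def using abs_Re_le_cmod[of "c * autocorr v a"] cb by linarith
  \<comment> \<open>Maximality is tested on the trial functions \<open>v + s c v(z + a)\<close> with
    \<open>s = 1\<close> and \<open>s = -1\<close>. Their energies are
    \<open>2 * (1 + s * p)\<close> and their smoothed self-correlations are
    \<open>2 * (A + s * B)\<close>.\<close>
  have twist: "4 * energy (\<lambda>x. A x + of_real s * B x) \<le> M * (4 * (1 + s * p)\<^sup>2)" if s: "s = 1 \<or> s = -1" for s
  proof -
    define v' where "v' z = v z + (of_real s * c) * v (z + a)" for z
    have sc: "cmod (of_real s * c) = 1" using s c by (auto simp: norm_mult)
    have v': "bdd_fun v'" unfolding v'_def by (intro bdd_fun_add bdd_fun_mult bdd_fun_const bdd_fun_comp[OF v(1)] v)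
    have en: "energy v' = 2 * (1 + s * p)" unfolding v'_def energy_twist[OF v(1) sc] using v(2)
      by (simp add: p_def algebra_simps)
    have ac: "bdd_fun (autocorr v)" by (rule bdd_autocorr[OF v(1)])
    have bs: "bdd_fun (\<lambda>x. k * autocorr v (x + b))" for k b by (intro bdd_fun_mult bdd_fun_const bdd_fun_comp[OF ac])
    have "smooth w (autocorr v') x = 2 * (A x + of_real s * B x)" for x
    proof -
      have "autocorr v' = (\<lambda>x. (2 * autocorr v (x + 0) + (of_real s * c) * autocorr v (x + a)) + cnj (of_real s * c) * autocorr v (x + (- a)))"
        unfolding v'_def by (rule ext) (simp add: autocorr_twist[OF v(1) sc])
      then have "smooth w (autocorr v') x = smooth w (\<lambda>x. 2 * autocorr v (x + 0)) x
         + smooth w (\<lambda>x. (of_real s * c) * autocorr v (x + a)) x + smooth w (\<lambda>x. cnj (of_real s * c) * autocorr v (x + (- a))) x"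
        by (simp only: smooth_add[OF w bdd_fun_add[OF bs bs] bs] smooth_add[OF w bs bs])
      also have "\<dots> = 2 * \<psi> x + (of_real s * c) * \<psi> (x + a) + cnj (of_real s * c) * \<psi> (x - a)"
        unfolding smooth_cmult[OF w bdd_fun_comp[OF ac]] smooth_shift \<psi>_def by simp
      finally show ?thesis by (simp add: A_def B_def algebra_simps)
    qed
    then have "smooth w (autocorr v') = (\<lambda>x. of_real 2 * (A x + of_real s * B x))" by auto
    then have "smooth_energy w v' = 4 * energy (\<lambda>x. A x + of_real s * B x)"
      unfolding smooth_energy_def using energy_scale[of "\<lambda>x. A x + of_real s * B x" 2] bA bB
      by (simp add: bdd_fun_add bdd_fun_mult)
    with smooth_energy_le[OF w v'] show ?thesis by (simp add: en M_def power2_eq_square algebra_simps)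
  qed
  have bS: "bdd_fun (\<lambda>x. (cmod (A x + of_real s * B x))\<^sup>2)" for s
    using bA bB by (intro bdd_fun_norm_sq bdd_fun_add bdd_fun_mult bdd_fun_const)
  have bA2: "bdd_fun (\<lambda>x. (cmod (A x))\<^sup>2)" using bA by (rule bdd_fun_norm_sq)
  \<comment> \<open>A weighted parallelogram identity. The weights are chosen so that the two
    maximality bounds add up to exactly \<open>(1 - p\<^sup>2) * M\<close>.\<close>
  have pid: "(cmod (B x - of_real p * A x))\<^sup>2 = ((1 - p) / 2) * (cmod (A x + of_real 1 * B x))\<^sup>2
     + ((1 + p) / 2) * (cmod (A x + of_real (-1) * B x))\<^sup>2 - (1 - p\<^sup>2) * (cmod (A x))\<^sup>2" for x
    unfolding cmod_power2 by (simp add: power2_eq_square field_simps)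
  have "L (\<lambda>x. (cmod (B x - of_real p * A x))\<^sup>2) = ((1 - p) / 2) * energy (\<lambda>x. A x + of_real 1 * B x)
     + ((1 + p) / 2) * energy (\<lambda>x. A x + of_real (-1) * B x) - (1 - p\<^sup>2) * energy A"
    unfolding pid energy_def
    by (subst L_diff L_add L_cmult | intro bdd_fun_add bdd_fun_mult bdd_fun_const bS bA2 refl)+
  also have "\<dots> \<le> ((1 - p) / 2) * (M * (1 + p)\<^sup>2) + ((1 + p) / 2) * (M * (1 - p)\<^sup>2) - (1 - p\<^sup>2) * energy A"
    using twist[of 1] twist[of "-1"] p by (intro diff_right_mono add_mono mult_left_mono) auto
  also have "\<dots> = (1 - p\<^sup>2) * (M - energy A)" by (simp add: power2_eq_square field_simps)
  also have "\<dots> \<le> 1 * (M - energy A)"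
  proof (rule mult_right_mono)
    show "0 \<le> M - energy A" using smooth_energy_le[OF w v(1)] v(2) by (simp add: M_def A_def \<psi>_def smooth_energy_def)
  qed simp
  finally show ?thesis by (simp add: B_def A_def p_def M_def smooth_energy_def \<psi>_def)
qed

end

section \<open>From near-maximizers to characters\<close>

context compact_group_mean
begin

lemma finite_net:
  assumes "openin T V" "0 \<in> V"
  shows "\<exists>D. finite D \<and> (\<forall>x. \<exists>g\<in>D. x - g \<in> V)"
proof -
  obtain D where D: "finite D" "\<And>x. \<exists>g\<in>D. x + g \<in> V"
    using finite_translates_cover[OF assms(1)] assms(2) by blast
  have "\<exists>g\<in>uminus ` D. x - g \<in> V" for x using D(2)[of x] by force
  then show ?thesis using D(1) by blast
qed

text \<open>Pointwise approximation is enough for \<open>\<phi>\<close>, but \<open>\<psi>\<close>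
  has to be approximated uniformly. Equicontinuity of the smoothed functions and a finite net of
  base points upgrade pointwise to uniform closeness.\<close>

lemma maximizing_cluster_point:
  assumes w: "ucont w" and ne: "\<exists>v. bdd_fun v \<and> energy v \<noteq> 0"
  obtains \<phi> \<psi> where "\<And>x. cmod (\<phi> x) \<le> 1" "ucont \<psi>"
    "\<And>\<epsilon> X. \<epsilon> > 0 \<Longrightarrow> finite X \<Longrightarrow> \<exists>v. bdd_fun v \<and> energy v = 1 \<and> max_energy w - smooth_energy w v \<le> \<epsilon> \<and>
       (\<forall>x. cmod (smooth w (autocorr v) x - \<psi> x) \<le> \<epsilon>) \<and> (\<forall>x\<in>X. cmod (autocorr v x - \<phi> x) \<le> \<epsilon>)"
proof -
  have bw: "bdd_fun w" using w by (rule ucont_bdd)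
  obtain v0 where v0: "bdd_fun v0" "energy v0 > 0" using ne energy_nonneg by (metis less_eq_real_def)
  define v1 where "v1 z = of_real (1 / sqrt (energy v0)) * v0 z" for z
  have v1: "bdd_fun v1" "energy v1 = 1"
    unfolding v1_def using v0(2) energy_scale[OF v0(1), of "1 / sqrt (energy v0)"]
    by (intro bdd_fun_mult bdd_fun_const v0(1), simp add: power_divide)
  let ?A = "{smooth_energy w v | v. bdd_fun v \<and> energy v = 1}"
  have "\<exists>v. bdd_fun v \<and> energy v = 1 \<and> max_energy w - smooth_energy w v \<le> 1 / real (Suc n)" for n
  proof -
    have "\<exists>y\<in>?A. max_energy w - 1 / real (Suc n) < y"
      unfolding max_energy_def using v1 by (intro less_cSupD) (blast, simp)
    then show ?thesis by force
  qed
  then obtain vs where vs: "\<And>n. bdd_fun (vs n)" "\<And>n. energy (vs n) = 1"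
     "\<And>n. max_energy w - smooth_energy w (vs n) \<le> 1 / real (Suc n)" by metis
  obtain W where W: "\<And>x. cmod (w x) \<le> W" using bw by (auto simp: bdd_fun_def)
  \<comment> \<open>Both functions are stored in one point of the product, so that a single index
    approximates the two limits simultaneously.\<close>
  define P where "P n x = (autocorr (vs n) x, smooth w (autocorr (vs n)) x)" for n x
  have a1: "cmod (autocorr (vs n) x) \<le> 1" for n x using norm_autocorr_le[OF vs(1)] vs(2) by metis
  let ?K = "PiE UNIV (\<lambda>_::'g. cball (0::complex) 1 \<times> cball (0::complex) W)"
  have "compact ?K" by (intro compact_Pi_UNIV compact_Times) auto
  moreover have "P n \<in> ?K" for n
    using a1 norm_smooth_le[OF bw a1 W] by (auto simp: P_def)
  \<comment> \<open>A cluster point of the filter rather than the limit of a subsequence: the index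
    set of the product is the whole group and may be uncountable.\<close>
  ultimately obtain h where h: "h \<in> ?K" "inf (nhds h) (filtermap P sequentially) \<noteq> bot"
    unfolding compact_filter by (metis (no_types, lifting) always_eventually eventually_filtermap filtermap_bot_iff trivial_limit_sequentially)
  define \<phi> where "\<phi> x = fst (h x)" for x
  define \<psi> where "\<psi> x = snd (h x)" for x
  have near: "\<exists>n\<ge>N. \<forall>x\<in>X. cmod (autocorr (vs n) x - \<phi> x) \<le> \<epsilon> \<and> cmod (smooth w (autocorr (vs n)) x - \<psi> x) \<le> \<epsilon>"
    if e: "\<epsilon> > 0" and X: "finite X" for \<epsilon> X N
  proof -
    let ?U = "{f. \<forall>x\<in>X. f x \<in> ball (h x) \<epsilon>}"
    have "open ?U" using product_topology_basis'[OF X, of "\<lambda>x. ball (h x) \<epsilon>" id] by simp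
    then have "eventually (\<lambda>f. f \<in> ?U) (nhds h)" using e by (intro eventually_nhds_in_open) auto
    moreover have "eventually (\<lambda>f. \<exists>n\<ge>N. f = P n) (filtermap P sequentially)"
      unfolding eventually_filtermap eventually_sequentially by blast
    ultimately have "eventually (\<lambda>f. f \<in> ?U \<and> (\<exists>n\<ge>N. f = P n)) (inf (nhds h) (filtermap P sequentially))"
      by (auto simp: eventually_inf)
    then obtain f where "f \<in> ?U" "\<exists>n\<ge>N. f = P n" using h(2) eventually_happens' by blast
    then obtain n where n: "n \<ge> N" "\<And>x. x \<in> X \<Longrightarrow> dist (h x) (P n x) < \<epsilon>" by auto
    have "cmod (autocorr (vs n) x - \<phi> x) \<le> \<epsilon> \<and> cmod (smooth w (autocorr (vs n)) x - \<psi> x) \<le> \<epsilon>" if "x \<in> X" for x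
      using n(2)[OF that] dist_fst_le[of "h x" "P n x"] dist_snd_le[of "h x" "P n x"]
      by (auto simp: P_def \<phi>_def \<psi>_def dist_norm norm_minus_commute)
    then show ?thesis using n(1) by blast
  qed
  have phi1: "cmod (\<phi> x) \<le> 1" for x
    using h(1) by (auto simp: \<phi>_def PiE_iff mem_Times_iff)
  have equi: "\<exists>V. openin T V \<and> 0 \<in> V \<and> (\<forall>x d. d \<in> V \<longrightarrow> cmod (\<psi> (x + d) - \<psi> x) \<le> \<epsilon> \<and>
     (\<forall>n. cmod (smooth w (autocorr (vs n)) (x + d) - smooth w (autocorr (vs n)) x) \<le> \<epsilon>))" if e: "\<epsilon> > 0" for \<epsilon>
  proof -
    from e have "\<epsilon> / 3 > 0" by simp
    from smooth_equicontinuous[OF w this] obtain V where V: "openin T V" "0 \<in> V"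
      and sm: "\<And>n x d. d \<in> V \<Longrightarrow> cmod (smooth w (autocorr (vs n)) (x + d) - smooth w (autocorr (vs n)) x) \<le> \<epsilon> / 3"
      using a1 by metis
    have "cmod (\<psi> (x + d) - \<psi> x) \<le> \<epsilon>" if d: "d \<in> V" for x d
    proof -
      obtain n where "cmod (smooth w (autocorr (vs n)) x - \<psi> x) \<le> \<epsilon> / 3"
         "cmod (smooth w (autocorr (vs n)) (x + d) - \<psi> (x + d)) \<le> \<epsilon> / 3"
        using near[OF \<open>\<epsilon> / 3 > 0\<close>, of "{x, x + d}" 0] by auto
      then show ?thesis using sm[OF d, of n x] by norm
    qed
    then show ?thesis using V sm e by (intro exI[of _ V]) (auto intro: order_trans[OF sm])
  qed
  show ?thesis
  proof (rule that[of \<phi> \<psi>])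
    show "cmod (\<phi> x) \<le> 1" for x by (rule phi1)
    show "ucont \<psi>" unfolding ucont_def using equi by meson
    fix \<epsilon> :: real and X :: "'g set" assume e: "\<epsilon> > 0" and X: "finite X"
    then have e3: "\<epsilon> / 3 > 0" by simp
    obtain V where V: "openin T V" "0 \<in> V" "\<And>x d. d \<in> V \<Longrightarrow> cmod (\<psi> (x + d) - \<psi> x) \<le> \<epsilon> / 3"
      "\<And>x d n. d \<in> V \<Longrightarrow> cmod (smooth w (autocorr (vs n)) (x + d) - smooth w (autocorr (vs n)) x) \<le> \<epsilon> / 3"
      using equi[OF e3] by metis
    obtain D where D: "finite D" "\<And>x. \<exists>g\<in>D. x - g \<in> V" using finite_net[OF V(1,2)] by blast
    obtain N where N: "1 / real (Suc N) < \<epsilon>" using e nat_approx_posE by blast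
    obtain n where n: "n \<ge> N" "\<And>x. x \<in> D \<union> X \<Longrightarrow> cmod (autocorr (vs n) x - \<phi> x) \<le> \<epsilon> / 3 \<and> cmod (smooth w (autocorr (vs n)) x - \<psi> x) \<le> \<epsilon> / 3"
      using near[OF e3, of "D \<union> X" N] D(1) X by blast
    have "max_energy w - smooth_energy w (vs n) \<le> 1 / real (Suc n)" by (rule vs)
    also have "\<dots> \<le> 1 / real (Suc N)" using n(1) by (intro divide_left_mono) auto
    finally have 1: "max_energy w - smooth_energy w (vs n) \<le> \<epsilon>" using N by simp
    have 2: "cmod (smooth w (autocorr (vs n)) x - \<psi> x) \<le> \<epsilon>" for x
    proof -
      obtain g where g: "g \<in> D" "x - g \<in> V" using D by blast
      have "cmod (smooth w (autocorr (vs n)) g - \<psi> g) \<le> \<epsilon> / 3" using n(2) g by blast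
      moreover have "cmod (\<psi> x - \<psi> g) \<le> \<epsilon> / 3" using V(3)[OF g(2), of g] by simp
      moreover have "cmod (smooth w (autocorr (vs n)) x - smooth w (autocorr (vs n)) g) \<le> \<epsilon> / 3"
        using V(4)[OF g(2), of n g] by simp
      ultimately show ?thesis by norm
    qed
    have 3: "cmod (autocorr (vs n) x - \<phi> x) \<le> \<epsilon>" if "x \<in> X" for x
      using n(2)[of x] that e by (auto intro: order_trans)
    show "\<exists>v. bdd_fun v \<and> energy v = 1 \<and> max_energy w - smooth_energy w v \<le> \<epsilon> \<and>
       (\<forall>x. cmod (smooth w (autocorr v) x - \<psi> x) \<le> \<epsilon>) \<and> (\<forall>x\<in>X. cmod (autocorr v x - \<phi> x) \<le> \<epsilon>)"
      using vs 1 2 3 by blast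
  qed
qed

text \<open>Near-maximizers satisfy the equation up to a small mean square and are close to the
  limits, so the residual \<open>R\<close> of the limits has arbitrarily small mean square. Being
  continuous it vanishes, because the mean is faithful.\<close>

lemma cluster_functional_eq:
  assumes w: "bdd_fun w" and phi1: "\<And>x. cmod (\<phi> x) \<le> 1" and psi: "ucont \<psi>"
    and appr: "\<And>\<epsilon> X. \<epsilon> > 0 \<Longrightarrow> finite X \<Longrightarrow> \<exists>v. bdd_fun v \<and> energy v = 1 \<and> max_energy w - smooth_energy w v \<le> \<epsilon> \<and>
       (\<forall>x. cmod (smooth w (autocorr v) x - \<psi> x) \<le> \<epsilon>) \<and> (\<forall>x\<in>X. cmod (autocorr v x - \<phi> x) \<le> \<epsilon>)"
    and c: "cmod c = 1"
  shows "(c * \<psi> (x + b) + cnj c * \<psi> (x - b)) / 2 = of_real (Re (c * \<phi> b)) * \<psi> x"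
proof -
  define R where "R x = (1 / 2) * (c * \<psi> (x + b) - (- cnj c) * \<psi> (x + - b)) - of_real (Re (c * \<phi> b)) * \<psi> x" for x
  have uR: "ucont R"
    unfolding R_def by (intro ucont_diff ucont_cmult ucont_translate psi)
  have bpsi: "bdd_fun \<psi>" using psi by (rule ucont_bdd)
  then obtain W where W: "\<And>x. cmod (\<psi> x) \<le> W" by (auto simp: bdd_fun_def)
  then have W0: "W \<ge> 0" by (meson norm_ge_zero order_trans)
  have bR2: "bdd_fun (\<lambda>x. (cmod (R x))\<^sup>2)" by (intro bdd_fun_norm_sq ucont_bdd uR)
  have le: "L (\<lambda>x. (cmod (R x))\<^sup>2) \<le> 2 * \<epsilon> + 2 * (\<epsilon> * (2 + W))\<^sup>2" if e: "\<epsilon> > 0" for \<epsilon>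
  proof -
    obtain v where v: "bdd_fun v" "energy v = 1" "max_energy w - smooth_energy w v \<le> \<epsilon>"
       "\<And>x. cmod (smooth w (autocorr v) x - \<psi> x) \<le> \<epsilon>" "cmod (autocorr v b - \<phi> b) \<le> \<epsilon>"
      using appr[OF e, of "{b}"] by blast
    define \<psi>' where "\<psi>' = smooth w (autocorr v)"
    define R' where "R' x = (c * \<psi>' (x + b) + cnj c * \<psi>' (x - b)) / 2 - of_real (Re (c * autocorr v b)) * \<psi>' x" for x
    have bpsi': "bdd_fun \<psi>'" unfolding \<psi>'_def by (intro bdd_smooth w bdd_autocorr v)
    have bR': "bdd_fun R'" unfolding R'_def divide_inverse
      by (intro bdd_fun_diff bdd_fun_mult bdd_fun_add bdd_fun_const bpsi' bdd_fun_comp[OF bpsi'])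
    have R'le: "L (\<lambda>x. (cmod (R' x))\<^sup>2) \<le> \<epsilon>"
      using near_max_functional_eq[OF w v(1,2) c, of b] v(3) by (simp add: R'_def \<psi>'_def)
    \<comment> \<open>Passing to the limits costs \<open>\<epsilon>\<close> in the two translated
      terms together, \<open>\<epsilon> * W\<close> in the coefficient and \<open>\<epsilon>\<close>
      in the last factor.\<close>
    have diff: "cmod (R x - R' x) \<le> \<epsilon> * (2 + W)" for x
    proof -
      have p: "\<bar>Re (c * \<phi> b) - Re (c * autocorr v b)\<bar> \<le> \<epsilon>"
      proof -
        have "\<bar>Re (c * (autocorr v b - \<phi> b))\<bar> \<le> cmod (c * (autocorr v b - \<phi> b))" by (rule abs_Re_le_cmod)
        also have "\<dots> \<le> \<epsilon>" using v(5) c by (simp add: norm_mult)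
        finally show ?thesis by (simp add: algebra_simps abs_minus_commute)
      qed
      have q: "\<bar>Re (c * autocorr v b)\<bar> \<le> 1"
        using abs_Re_le_cmod[of "c * autocorr v b"] norm_autocorr_le[OF v(1), of b] v(2) c by (simp add: norm_mult)
      have d: "cmod (\<psi> y - \<psi>' y) \<le> \<epsilon>" for y using v(4)[of y] by (simp add: \<psi>'_def norm_minus_commute)
      have eq: "R x - R' x = (1/2) * (c * (\<psi> (x + b) - \<psi>' (x + b)) + cnj c * (\<psi> (x - b) - \<psi>' (x - b)))
         - (of_real (Re (c * \<phi> b) - Re (c * autocorr v b)) * \<psi> x + of_real (Re (c * autocorr v b)) * (\<psi> x - \<psi>' x))"
        unfolding R_def R'_def by (simp add: field_simps)
      have e1: "cmod ((1/2) * (c * (\<psi> (x + b) - \<psi>' (x + b)) + cnj c * (\<psi> (x - b) - \<psi>' (x - b)))) \<le> \<epsilon>"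
      proof -
        have "cmod (c * (\<psi> (x + b) - \<psi>' (x + b)) + cnj c * (\<psi> (x - b) - \<psi>' (x - b)))
            \<le> cmod (c * (\<psi> (x + b) - \<psi>' (x + b))) + cmod (cnj c * (\<psi> (x - b) - \<psi>' (x - b)))"
          by (rule norm_triangle_ineq)
        also have "\<dots> \<le> \<epsilon> + \<epsilon>" using c d by (intro add_mono) (simp_all add: norm_mult)
        finally show ?thesis by (simp add: norm_mult)
      qed
      have e2: "cmod (of_real (Re (c * \<phi> b) - Re (c * autocorr v b)) * \<psi> x) \<le> \<epsilon> * W"
        unfolding norm_mult norm_of_real using p W e by (intro mult_mono) auto
      have e3: "cmod (of_real (Re (c * autocorr v b)) * (\<psi> x - \<psi>' x)) \<le> 1 * \<epsilon>"
        unfolding norm_mult norm_of_real using q d by (intro mult_mono) auto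
      have "cmod (R x - R' x) \<le> \<epsilon> + (\<epsilon> * W + 1 * \<epsilon>)"
        unfolding eq by (rule order_trans[OF norm_triangle_ineq4 add_mono[OF e1 order_trans[OF norm_triangle_ineq add_mono[OF e2 e3]]]])
      then show ?thesis by (simp add: algebra_simps)
    qed
    have "(cmod (R x))\<^sup>2 \<le> 2 * (cmod (R' x))\<^sup>2 + 2 * (\<epsilon> * (2 + W))\<^sup>2" for x
    proof -
      have "cmod (R x) \<le> cmod (R' x) + \<epsilon> * (2 + W)" using diff[of x] norm_triangle_sub[of "R x" "R' x"] by linarith
      then have "(cmod (R x))\<^sup>2 \<le> (cmod (R' x) + \<epsilon> * (2 + W))\<^sup>2" by (rule power_mono) simp
      also have "\<dots> \<le> 2 * (cmod (R' x))\<^sup>2 + 2 * (\<epsilon> * (2 + W))\<^sup>2"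
        using sum_squares_bound[of "cmod (R' x)" "\<epsilon> * (2 + W)"] by (simp add: power2_sum)
      finally show ?thesis .
    qed
    then have "L (\<lambda>x. (cmod (R x))\<^sup>2) \<le> L (\<lambda>x. 2 * (cmod (R' x))\<^sup>2 + 2 * (\<epsilon> * (2 + W))\<^sup>2)"
      by (intro L_mono bR2 bdd_fun_add bdd_fun_mult bdd_fun_const bdd_fun_norm_sq bR')
    also have "\<dots> = 2 * L (\<lambda>x. (cmod (R' x))\<^sup>2) + 2 * (\<epsilon> * (2 + W))\<^sup>2"
      using bdd_fun_norm_sq[OF bR'] by (simp add: L_add L_cmult bdd_fun_mult)
    finally show ?thesis using R'le by simp
  qed
  have "L (\<lambda>x. (cmod (R x))\<^sup>2) \<le> 0"
  proof (rule tendsto_lowerbound)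
    have "((\<lambda>\<epsilon>. 2 * \<epsilon> + 2 * (\<epsilon> * (2 + W))\<^sup>2) \<longlongrightarrow> 2 * 0 + 2 * (0 * (2 + W))\<^sup>2) (at_right 0)"
      by (intro tendsto_intros)
    then show "((\<lambda>\<epsilon>. 2 * \<epsilon> + 2 * (\<epsilon> * (2 + W))\<^sup>2) \<longlongrightarrow> 0) (at_right 0)" by simp
    show "\<forall>\<^sub>F \<epsilon> in at_right 0. L (\<lambda>x. (cmod (R x))\<^sup>2) \<le> 2 * \<epsilon> + 2 * (\<epsilon> * (2 + W))\<^sup>2"
      using le by (auto simp: eventually_at_right_field intro: exI[of _ 1])
  qed simp
  moreover have "L (\<lambda>x. (cmod (R x))\<^sup>2) \<ge> 0" by (intro L_nonneg bR2) auto
  ultimately have "R x = 0" by (intro L_faithful uR) simp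
  then show ?thesis by (simp add: R_def)
qed

text \<open>The kernel \<open>w\<close> is the self-correlation of the difference between a function
  \<open>k\<close> and its translate by \<open>a\<close>, hence itself a difference along
  \<open>a\<close>. A character that is trivial at \<open>a\<close> is orthogonal to everything
  smoothed by such a kernel, so the character found by the variational problem cannot be trivial at
  \<open>a\<close>.\<close>

theorem separating_character:
  assumes a: "a \<noteq> 0"
  obtains ch where "continuous_map T euclidean ch" "\<And>x. cmod (ch x) = 1"
    "\<And>x y. ch (x + y) = ch x * ch y" "ch a \<noteq> 1"
proof -
  have cl: "closedin T {x}" for x :: 'g
    using Hausdorff_T by (simp add: closedin_Hausdorff_singleton top_UNIV)
  obtain k0 :: "'g \<Rightarrow> real" where k0: "continuous_map T euclideanreal k0" "k0 ` {0} \<subseteq> {0}" "k0 ` {a} \<subseteq> {1}"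
    using Urysohn_lemma_alt[of T "{0}" "{a}" 0 1] compact_Hausdorff_or_regular_imp_normal_space[OF compact_T] Hausdorff_T cl a
    by auto
  define k where "k x = complex_of_real (k0 x)" for x
  have "continuous_map T euclidean k"
    using continuous_map_compose[OF k0(1), of euclidean complex_of_real]
    by (simp add: k_def[abs_def] o_def continuous_map_iff_continuous2 continuous_intros)
  then have uk: "ucont k" by (rule continuous_imp_ucont)
  have bk: "bdd_fun k" using uk by (rule ucont_bdd)
  define u where "u x = k x + (-1) * k (x + a)" for x
  have uu: "ucont u" using ucont_diff[OF uk ucont_translate[OF uk, of a]] by (simp add: u_def[abs_def])
  have bu: "bdd_fun u" using uu by (rule ucont_bdd)
  have "u 0 \<noteq> 0" using k0 by (simp add: u_def k_def)
  then have eu: "energy u \<noteq> 0" using L_faithful[OF uu] unfolding energy_def by blast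
  define w where "w = autocorr u"
  have uw: "ucont w" unfolding w_def by (rule autocorr_ucont[OF uu])
  have bw: "bdd_fun w" using uw by (rule ucont_bdd)
  define r where "r = autocorr k"
  have br: "bdd_fun r" unfolding r_def by (rule bdd_autocorr[OF bk])
  define e where "e y = r y - r (y + a)" for y
  have be: "bdd_fun e" unfolding e_def by (intro bdd_fun_diff br bdd_fun_comp[OF br])
  have w_eq: "w y = e y - e (y - a)" for y
    unfolding w_def u_def using autocorr_twist[OF bk, of "-1" a y] by (simp add: e_def r_def)
  have smooth_diff: "smooth w \<phi> x = smooth e \<phi> x - smooth e \<phi> (x + a)" if p: "bdd_fun \<phi>" for \<phi> x
  proof -
    have b1: "bdd_fun (\<lambda>y. cnj (e y) * \<phi> (x + y))" by (rule bdd_smooth_aux[OF be p])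
    have b2: "bdd_fun (\<lambda>y. cnj (e (y - a)) * \<phi> (x + y))"
      by (intro bdd_fun_mult bdd_fun_cnj bdd_fun_comp[OF be] bdd_fun_comp[OF p])
    have "smooth w \<phi> x = cmean (\<lambda>y. cnj (e y) * \<phi> (x + y) - cnj (e (y - a)) * \<phi> (x + y))"
      by (simp add: smooth_def w_eq algebra_simps)
    also have "\<dots> = smooth e \<phi> x - cmean (\<lambda>y. cnj (e (y - a)) * \<phi> (x + y))"
      unfolding cmean_diff[OF b1 b2] by (simp add: smooth_def)
    also have "cmean (\<lambda>y. cnj (e (y - a)) * \<phi> (x + y)) = smooth e \<phi> (x + a)"
      using cmean_shift[OF b2, of a] by (simp add: smooth_def ac_simps)
    finally show ?thesis .
  qed
  obtain \<phi> \<psi> where phi1: "\<And>x. cmod (\<phi> x) \<le> 1" and psi: "ucont \<psi>" and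
    appr: "\<And>\<epsilon> X. \<epsilon> > 0 \<Longrightarrow> finite X \<Longrightarrow> \<exists>v. bdd_fun v \<and> energy v = 1 \<and> max_energy w - smooth_energy w v \<le> \<epsilon> \<and>
       (\<forall>x. cmod (smooth w (autocorr v) x - \<psi> x) \<le> \<epsilon>) \<and> (\<forall>x\<in>X. cmod (autocorr v x - \<phi> x) \<le> \<epsilon>)"
    using maximizing_cluster_point[OF uw] bu eu by metis
  \<comment> \<open>The choices \<open>c = 1\<close> and \<open>c = \<i>\<close> separate the real
    and the imaginary part of \<open>\<phi> b\<close>.\<close>
  have feq: "\<psi> (x + b) = \<phi> b * \<psi> x" for x b
  proof -
    have 1: "(\<psi> (x + b) + \<psi> (x - b)) / 2 = of_real (Re (\<phi> b)) * \<psi> x"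
      using cluster_functional_eq[OF bw phi1 psi appr, of 1 x b] by simp
    have 2: "(\<i> * \<psi> (x + b) - \<i> * \<psi> (x - b)) / 2 = - (of_real (Im (\<phi> b)) * \<psi> x)"
      using cluster_functional_eq[OF bw phi1 psi appr, of \<i> x b] by simp
    have "\<psi> (x + b) = (\<psi> (x + b) + \<psi> (x - b)) / 2 - \<i> * ((\<i> * \<psi> (x + b) - \<i> * \<psi> (x - b)) / 2)"
      by (simp add: field_simps)
    also have "\<dots> = (of_real (Re (\<phi> b)) + \<i> * of_real (Im (\<phi> b))) * \<psi> x"
      unfolding 1 2 by (simp add: algebra_simps)
    finally show ?thesis by (simp add: complex_eq[symmetric])
  qed
  \<comment> \<open>Faithfulness carries positivity from \<open>u\<close> to
    \<open>w = autocorr u\<close>, then to the value of \<open>smooth w w\<close> at 0, then to the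
    energy of \<open>smooth w w\<close>.\<close>
  have max_pos: "max_energy w > 0"
  proof -
    have "smooth w w 0 = of_real (energy w)"
      unfolding smooth_def energy_def cmean_of_real[symmetric]
      by (simp only: complex_norm_square add_0 mult.commute)
    moreover have "w 0 \<noteq> 0" using eu by (simp add: w_def autocorr_0)
    then have "energy w \<noteq> 0" using L_faithful[OF uw] unfolding energy_def by blast
    ultimately have "smooth w w 0 \<noteq> 0" by simp
    then have "energy (smooth w w) \<noteq> 0" using L_faithful[OF smooth_ucont[OF uw bw]] unfolding energy_def by blast
    moreover have "energy (smooth w w) \<ge> 0" by (intro energy_nonneg bdd_smooth bw)
    ultimately have "smooth_energy w u > 0" unfolding smooth_energy_def w_def[symmetric] by simp
    with smooth_energy_le[OF bw bu] have "max_energy w * (energy u)\<^sup>2 > 0" by simp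
    then show ?thesis by (simp add: zero_less_mult_iff)
  qed
  have "\<exists>x0. \<psi> x0 \<noteq> 0"
  proof (rule ccontr)
    assume "\<nexists>x0. \<psi> x0 \<noteq> 0"
    then have z: "\<psi> x = 0" for x by blast
    \<comment> \<open>With \<open>\<psi> = 0\<close> the maximum would be at most
      \<open>\<epsilon> + \<epsilon>\<^sup>2 \<le> 2 * \<epsilon>\<close>, which this choice puts
      below the maximum itself.\<close>
    define \<epsilon> where "\<epsilon> = min 1 (max_energy w / 3)"
    have e: "\<epsilon> > 0" using max_pos by (simp add: \<epsilon>_def)
    obtain v where v: "bdd_fun v" "energy v = 1" "max_energy w - smooth_energy w v \<le> \<epsilon>"
       "\<And>x. cmod (smooth w (autocorr v) x) \<le> \<epsilon>"
      using appr[OF e, of "{}"] z by auto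
    have "smooth_energy w v \<le> \<epsilon>\<^sup>2"
      unfolding smooth_energy_def energy_def using v(4)
      by (intro L_le bdd_fun_norm_sq bdd_smooth bw bdd_autocorr v power_mono) auto
    also have "\<dots> \<le> \<epsilon>"
      using e mult_left_mono[of \<epsilon> 1 \<epsilon>] by (simp add: power2_eq_square) (simp add: \<epsilon>_def)
    finally have "max_energy w \<le> 2 * \<epsilon>" using v(3) by simp
    also have "\<dots> \<le> 2 * (max_energy w / 3)" by (simp add: \<epsilon>_def)
    finally show False using max_pos by simp
  qed
  then obtain x0 where x0: "\<psi> x0 \<noteq> 0" by blast
  have mult: "\<phi> (x + y) = \<phi> x * \<phi> y" for x y
  proof -
    have "\<phi> (x + y) * \<psi> x0 = \<psi> (x0 + (x + y))" by (simp add: feq)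
    also have "\<dots> = \<psi> ((x0 + y) + x)" by (simp add: ac_simps)
    also have "\<dots> = \<phi> x * (\<phi> y * \<psi> x0)" by (simp only: feq)
    finally show ?thesis using x0 by simp
  qed
  have phi0: "\<phi> 0 = 1" using feq[of x0 0] x0 by simp
  have norm1: "cmod (\<phi> x) = 1" for x
  proof -
    have "\<phi> x * \<phi> (- x) = 1" using mult[of x "-x"] phi0 by simp
    then have "cmod (\<phi> x) * cmod (\<phi> (- x)) = 1" by (metis norm_mult norm_one)
    moreover have "cmod (\<phi> x) * cmod (\<phi> (- x)) \<le> cmod (\<phi> x) * 1"
      using phi1 by (intro mult_left_mono) auto
    ultimately show ?thesis using phi1[of x] by linarith
  qed
  have "\<phi> x = (1 / \<psi> x0) * \<psi> (x + x0)" for x using feq[of x0 x] x0 by (simp add: add.commute)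
  then have "\<phi> = (\<lambda>x. (1 / \<psi> x0) * \<psi> (x + x0))" by blast
  then have uphi: "ucont \<phi>" using ucont_cmult[OF ucont_translate[OF psi, of x0], of "1 / \<psi> x0"] by simp
  have bphi: "bdd_fun \<phi>" using uphi by (rule ucont_bdd)
  have psi_eq: "\<psi> x = \<phi> x * \<psi> 0" for x using feq[of 0 x] by simp
  have psi0: "\<psi> 0 \<noteq> 0" using x0 psi_eq[of x0] by (metis mult_zero_right)
  have "\<phi> a \<noteq> 1"
  proof
    assume pa: "\<phi> a = 1"
    define \<epsilon> where "\<epsilon> = cmod (\<psi> 0) / 2"
    have e: "\<epsilon> > 0" using psi0 by (simp add: \<epsilon>_def)
    obtain v where v: "bdd_fun v" "\<And>x. cmod (smooth w (autocorr v) x - \<psi> x) \<le> \<epsilon>"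
      using appr[OF e, of "{}"] by auto
    define g where "g = smooth e (autocorr v)"
    have bg: "bdd_fun g" unfolding g_def by (intro bdd_smooth be bdd_autocorr v)
    have b1: "bdd_fun (\<lambda>x. cnj (\<phi> x) * g x)" by (intro bdd_fun_mult bdd_fun_cnj bphi bg)
    have "cnj (\<phi> x) * smooth w (autocorr v) x = cnj (\<phi> x) * g x - cnj (\<phi> (x + a)) * g (x + a)" for x
      unfolding smooth_diff[OF bdd_autocorr[OF v(1)]] g_def mult[of x a] pa by (simp add: right_diff_distrib)
    then have "cmean (\<lambda>x. cnj (\<phi> x) * smooth w (autocorr v) x) = cmean (\<lambda>x. cnj (\<phi> x) * g x - cnj (\<phi> (x + a)) * g (x + a))"
      by simp
    also have "\<dots> = 0"
      using cmean_diff[OF b1 bdd_fun_comp[OF b1, of "\<lambda>x. x + a"]] cmean_shift[OF b1, of a] by simp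
    finally have z: "cmean (\<lambda>x. cnj (\<phi> x) * smooth w (autocorr v) x) = 0" .
    have b2: "bdd_fun (\<lambda>x. cnj (\<phi> x) * smooth w (autocorr v) x)"
      by (intro bdd_fun_mult bdd_fun_cnj bphi bdd_smooth bw bdd_autocorr v)
    have "cnj (\<phi> x) * \<psi> x = \<psi> 0" for x
    proof -
      have "cnj (\<phi> x) * \<phi> x = 1" using complex_norm_square[of "\<phi> x"] norm1[of x] by (simp add: mult.commute[of "cnj _"])
      then show ?thesis by (subst psi_eq) (simp flip: mult.assoc)
    qed
    then have "\<psi> 0 = cmean (\<lambda>x. cnj (\<phi> x) * \<psi> x)" by simp
    also have "\<dots> = cmean (\<lambda>x. cnj (\<phi> x) * \<psi> x) - cmean (\<lambda>x. cnj (\<phi> x) * smooth w (autocorr v) x)" by (simp add: z)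
    also have "\<dots> = cmean (\<lambda>x. cnj (\<phi> x) * \<psi> x - cnj (\<phi> x) * smooth w (autocorr v) x)"
      by (rule cmean_diff[symmetric, OF _ b2]) (intro bdd_fun_mult bdd_fun_cnj bphi ucont_bdd psi)
    finally have "cmod (\<psi> 0) = cmod (cmean (\<lambda>x. cnj (\<phi> x) * \<psi> x - cnj (\<phi> x) * smooth w (autocorr v) x))" by simp
    also have "\<dots> \<le> \<epsilon>"
    proof (rule norm_cmean_le_const)
      fix x
      have "cmod (cnj (\<phi> x) * \<psi> x - cnj (\<phi> x) * smooth w (autocorr v) x) = cmod (cnj (\<phi> x) * (\<psi> x - smooth w (autocorr v) x))"
        by (simp add: algebra_simps)
      also have "\<dots> \<le> \<epsilon>" using v(2)[of x] norm1 by (simp add: norm_mult norm_minus_commute)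
      finally show "cmod (cnj (\<phi> x) * \<psi> x - cnj (\<phi> x) * smooth w (autocorr v) x) \<le> \<epsilon>" .
    qed
    finally show False using e by (simp add: \<epsilon>_def)
  qed
  then show thesis using that[OF ucont_imp_continuous[OF uphi] norm1 mult] by blast
qed

end

section \<open>Closed subgroups of the torus\<close>

text \<open>A Laurent polynomial is read here as an exponent vector, so these are the characters of
  the infinite torus.\<close>

definition laurent_mono :: "(int \<Rightarrow> int) \<Rightarrow> (int \<Rightarrow> complex) \<Rightarrow> complex" where
  "laurent_mono c y = (\<Prod>n\<in>{n. c n \<noteq> 0}. y n powi c n)"

lemma laurent_mono_superset:
  assumes "finite A" "{n. c n \<noteq> 0} \<subseteq> A"
  shows "laurent_mono c y = (\<Prod>n\<in>A. y n powi c n)"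
  unfolding laurent_mono_def using assms by (intro prod.mono_neutral_left) auto

lemma laurent_polys_iff: "c \<in> laurent_polys \<longleftrightarrow> finite {n. c n \<noteq> 0}"
  by (simp add: laurent_polys_def)

lemma laurent_polys_add [intro]:
  assumes "c \<in> laurent_polys" "c' \<in> laurent_polys" shows "(\<lambda>n. c n + c' n) \<in> laurent_polys"
  using assms unfolding laurent_polys_iff
  by (rule_tac finite_subset[of _ "{n. c n \<noteq> 0} \<union> {n. c' n \<noteq> 0}"]) auto

lemma laurent_polys_uminus [intro]:
  assumes "c \<in> laurent_polys" shows "(\<lambda>n. - c n) \<in> laurent_polys"
  using assms unfolding laurent_polys_iff by simp

lemma laurent_mono_add:
  assumes "c \<in> laurent_polys" "c' \<in> laurent_polys" "\<And>n. y n \<noteq> 0"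
  shows "laurent_mono (\<lambda>n. c n + c' n) y = laurent_mono c y * laurent_mono c' y"
proof -
  let ?A = "{n. c n \<noteq> 0} \<union> {n. c' n \<noteq> 0}"
  have f: "finite ?A" using assms by (simp add: laurent_polys_iff)
  have "laurent_mono (\<lambda>n. c n + c' n) y = (\<Prod>n\<in>?A. y n powi (c n + c' n))"
    by (rule laurent_mono_superset[OF f]) auto
  also have "\<dots> = (\<Prod>n\<in>?A. y n powi c n) * (\<Prod>n\<in>?A. y n powi c' n)"
    by (simp add: power_int_add assms prod.distrib)
  also have "\<dots> = laurent_mono c y * laurent_mono c' y"
    using f by (simp add: laurent_mono_superset[OF f])
  finally show ?thesis .
qed

lemma cnj_powi:
  assumes "cmod z = 1" shows "cnj z powi k = z powi (- k)"
proof -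
  have "inverse z = cnj z" using assms by (simp add: inverse_complex_def complex_eq_iff cmod_def)
  then show ?thesis by (metis power_int_inverse power_int_minus)
qed

lemma cnj_laurent_mono:
  assumes "\<And>n. cmod (y n) = 1" shows "cnj (laurent_mono c y) = laurent_mono (\<lambda>n. - c n) y"
  using assms by (simp add: laurent_mono_def cnj_prod cnj_powi)

lemma laurent_mono_times:
  "laurent_mono c (\<lambda>n. y n * z n) = laurent_mono c y * laurent_mono c z"
  by (simp add: laurent_mono_def power_int_mult_distrib prod.distrib)

lemma norm_laurent_mono:
  assumes "\<And>n. cmod (y n) = 1" shows "cmod (laurent_mono c y) = 1"
  by (simp add: laurent_mono_def norm_power_int assms flip: prod_norm)

section \<open>Trigonometric polynomials on the infinite torus\<close>

lemma cis_powi: "cis x powi k = cis (of_int k * x)"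
  by (cases k rule: int_cases2) (simp_all add: Complex.DeMoivre power_int_minus cis_inverse)

lemma prod_cis: "finite A \<Longrightarrow> (\<Prod>i\<in>A. cis (f i)) = cis (\<Sum>i\<in>A. f i)"
  by (induction A rule: finite_induct) (auto simp: cis_mult)

lemma laurent_mono_cis:
  assumes "c \<in> laurent_polys"
  shows "laurent_mono c (\<lambda>n. cis (2 * pi * s n)) = cis (2 * pi * (\<Sum>n\<in>{n. c n \<noteq> 0}. of_int (c n) * s n))"
  using assms by (simp add: laurent_mono_def cis_powi prod_cis laurent_polys_iff sum_distrib_left mult_ac)

lemma cis_2pi_eq_1_iff: "cis (2 * pi * x) = 1 \<longleftrightarrow> x \<in> \<int>"
proof
  assume "cis (2 * pi * x) = 1"
  then have "cos (2 * pi * x) = 1" by (simp add: complex_eq_iff)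
  then obtain n :: int where "2 * pi * x = of_int n * 2 * pi" using cos_one_2pi_int by blast
  then have "x = of_int n" by simp
  then show "x \<in> \<int>" by simp
next
  assume "x \<in> \<int>"
  then show "cis (2 * pi * x) = 1" by (metis Ints_cases cis_2pi mult.commute mult.left_commute cis_multiple_2pi mult.assoc)
qed

inductive_set trig_polys :: "((int \<Rightarrow> complex) \<Rightarrow> real) set" where
  mono: "c \<in> laurent_polys \<Longrightarrow> (\<lambda>y. Re (\<kappa> * laurent_mono c y)) \<in> trig_polys"
| add: "f \<in> trig_polys \<Longrightarrow> g \<in> trig_polys \<Longrightarrow> (\<lambda>y. f y + g y) \<in> trig_polys"

definition torus :: "(int \<Rightarrow> complex) set" where
  "torus = PiE UNIV (\<lambda>_. sphere 0 1)"

lemma torus_iff: "y \<in> torus \<longleftrightarrow> (\<forall>n. cmod (y n) = 1)"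
  by (auto simp: torus_def PiE_iff)

lemma torus_nonzero: "y \<in> torus \<Longrightarrow> y n \<noteq> 0"
  unfolding torus_iff by (metis norm_zero zero_neq_one)

lemma compact_torus: "compact torus"
  unfolding torus_def by (rule compact_Pi_UNIV) simp

lemma trig_polys_continuous: "f \<in> trig_polys \<Longrightarrow> continuous_on torus f"
proof (induction rule: trig_polys.induct)
  case (mono c \<kappa>)
  have "continuous_on torus (\<lambda>y::int\<Rightarrow>complex. y n)" for n
    by (rule continuous_on_subset[OF continuous_on_product_coordinates]) auto
  then have "continuous_on torus (\<lambda>y. y n powi c n)" for n
    using torus_nonzero by (intro continuous_on_power_int) auto
  then show ?case unfolding laurent_mono_def
    by (intro continuous_on_Re continuous_on_mult continuous_on_const continuous_on_prod)
qed (auto intro: continuous_intros)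

text \<open>\<open>Re u * Re v\<close> is the real part of \<open>(u * v + u * cnj v) / 2\<close>,
  and conjugation on the torus negates exponents.\<close>

lemma trig_polys_mult:
  assumes "f \<in> trig_polys" "g \<in> trig_polys"
  shows "\<exists>h\<in>trig_polys. \<forall>y\<in>torus. f y * g y = h y"
  using assms(1)
proof (induction rule: trig_polys.induct)
  case (mono c \<kappa>)
  show ?case using assms(2)
  proof (induction rule: trig_polys.induct)
    case (mono c' \<kappa>')
    let ?h1 = "\<lambda>y. Re (\<kappa> * \<kappa>' / 2 * laurent_mono (\<lambda>n. c n + c' n) y)"
    let ?h2 = "\<lambda>y. Re (\<kappa> * cnj \<kappa>' / 2 * laurent_mono (\<lambda>n. c n + - c' n) y)"
    have c: "c \<in> laurent_polys" "c' \<in> laurent_polys" "(\<lambda>n. - c' n) \<in> laurent_polys"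
      using mono \<open>c \<in> laurent_polys\<close> by auto
    have "Re (\<kappa> * laurent_mono c y) * Re (\<kappa>' * laurent_mono c' y) = ?h1 y + ?h2 y" if "y \<in> torus" for y
    proof -
      have y: "\<And>n. cmod (y n) = 1" using that by (simp add: torus_iff)
      have nz: "\<And>n. y n \<noteq> 0" using y by (metis norm_zero zero_neq_one)
      have "Re (a * p) * Re (b * q) = Re (a * b / 2 * (p * q)) + Re (a * cnj b / 2 * (p * cnj q))" for a b p q
      proof -
        have eq: "a * b / 2 * (p * q) + a * cnj b / 2 * (p * cnj q) = (a * p * (b * q) + a * p * cnj (b * q)) / 2"
          by (simp add: field_simps)
        have "Re u * Re v = Re ((u * v + u * cnj v) / 2)" for u v by (simp add: algebra_simps)
        then show ?thesis unfolding plus_complex.sel(1)[symmetric] eq .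
      qed
      then show ?thesis
        by (simp only: laurent_mono_add[OF c(1,2) nz] laurent_mono_add[OF c(1,3) nz] cnj_laurent_mono[OF y])
    qed
    moreover have "(\<lambda>y. ?h1 y + ?h2 y) \<in> trig_polys"
      using trig_polys.add[OF trig_polys.mono[OF laurent_polys_add[OF c(1,2)], of "\<kappa> * \<kappa>' / 2"]
         trig_polys.mono[OF laurent_polys_add[OF c(1,3)], of "\<kappa> * cnj \<kappa>' / 2"]] .
    ultimately show ?case by (intro bexI[of _ "\<lambda>y. ?h1 y + ?h2 y"] ballI)
  next
    case (add f g)
    then obtain h h' where "h \<in> trig_polys" "h' \<in> trig_polys" "\<forall>y\<in>torus. Re (\<kappa> * laurent_mono c y) * f y = h y"
      "\<forall>y\<in>torus. Re (\<kappa> * laurent_mono c y) * g y = h' y" by blast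
    then show ?case by (intro bexI[of _ "\<lambda>y. h y + h' y"]) (auto simp: distrib_left intro: trig_polys.add)
  qed
next
  case (add f f')
  then obtain h h' where "h \<in> trig_polys" "h' \<in> trig_polys" "\<forall>y\<in>torus. f y * g y = h y"
      "\<forall>y\<in>torus. f' y * g y = h' y" by blast
  then show ?case by (intro bexI[of _ "\<lambda>y. h y + h' y"]) (auto simp: distrib_right intro: trig_polys.add)
qed

lemma trig_polys_dense:
  assumes f: "continuous_on torus f" and e: "e > 0"
  shows "\<exists>g\<in>trig_polys. \<forall>y\<in>torus. \<bar>f y - g y\<bar> < e"
proof -
  define P where "P h \<longleftrightarrow> (\<exists>g\<in>trig_polys. \<forall>y\<in>torus. h y = g y)" for h
  have "\<exists>g. P g \<and> (\<forall>y\<in>torus. \<bar>f y - g y\<bar> < e)"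
  proof (rule Stone_Weierstrass_HOL[OF compact_torus])
    fix c :: real
    have "(\<lambda>y. Re (of_real c * laurent_mono (\<lambda>_. 0) y)) \<in> trig_polys"
      by (rule trig_polys.mono) (simp add: laurent_polys_iff)
    then show "P (\<lambda>y. c)" unfolding P_def by (rule bexI[rotated]) (simp add: laurent_mono_def)
  next
    fix h assume "P h"
    then show "continuous_on torus h" unfolding P_def
      using trig_polys_continuous continuous_on_cong by metis
  next
    fix h h' assume "P h \<and> P h'"
    then show "P (\<lambda>y. h y + h' y)" unfolding P_def using trig_polys.add by fastforce
  next
    fix h h' assume "P h \<and> P h'"
    then obtain g g' where "g \<in> trig_polys" "g' \<in> trig_polys" "\<forall>y\<in>torus. h y = g y" "\<forall>y\<in>torus. h' y = g' y"
      unfolding P_def by blast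
    then show "P (\<lambda>y. h y * h' y)" unfolding P_def using trig_polys_mult[of g g'] by auto
  next
    fix x y assume xy: "x \<in> torus \<and> y \<in> torus \<and> x \<noteq> y"
    then obtain n where n: "x n \<noteq> y n" by blast
    define c where "c m = (if m = n then 1 else 0 :: int)" for m
    have "{m. c m \<noteq> 0} = {n}" by (auto simp: c_def)
    then have m: "laurent_mono c z = z n" and c: "c \<in> laurent_polys" for z
      by (auto simp: laurent_mono_def c_def laurent_polys_iff)
    \<comment> \<open>The coefficients \<open>1\<close> and \<open>-\<i>\<close> yield the real and
      the imaginary part of a coordinate, which together separate points.\<close>
    have "P (\<lambda>y. Re (\<kappa> * y n))" for \<kappa> unfolding P_def using trig_polys.mono[OF c, of \<kappa>] by (auto simp: m)
    note P = this[of 1] this[of "-\<i>"]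
    have "Re (x n) \<noteq> Re (y n) \<or> Im (x n) \<noteq> Im (y n)" using n complex_eqI by blast
    then show "\<exists>f. P f \<and> f x \<noteq> f y"
      using P by (elim disjE) (rule exI, rule conjI, assumption, simp)+
  qed (use f e in auto)
  then show ?thesis unfolding P_def by (metis (no_types, lifting))
qed

text \<open>If a point of the common kernel were outside the subgroup, the means over the subgroup and over
  its disjoint coset would agree on all characters.\<close>

theorem (in compact_ab_group) torus_subgroup_is_kernel:
  fixes E :: "'g \<Rightarrow> int \<Rightarrow> complex"
  assumes cont: "\<And>n. continuous_map T euclidean (\<lambda>g. E g n)"
    and norm1: "\<And>g n. cmod (E g n) = 1" and hom: "\<And>g h n. E (g + h) n = E g n * E h n"
    and z: "\<And>n. cmod (z n) = 1"
    and ann: "\<And>c. c \<in> laurent_polys \<Longrightarrow> (\<And>g. laurent_mono c (E g) = 1) \<Longrightarrow> laurent_mono c z = 1"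
  shows "\<exists>g. E g = z"
proof (rule ccontr)
  assume nex: "\<nexists>g. E g = z"
  obtain L :: "('g \<Rightarrow> real) \<Rightarrow> real" where L: "invariant_mean L" using invariant_mean_exists by blast
  interpret mean L by unfold_locales (rule L)
  have Econt: "continuous_map T euclidean E"
    using cont by (simp add: continuous_map_componentwise_UNIV flip: euclidean_product_topology)
  have zEcont: "continuous_map T euclidean (\<lambda>g n. z n * E g n)"
  proof -
    have "continuous_map T euclidean (\<lambda>g. z n * E g n)" for n
      using continuous_map_compose[OF cont[of n], of euclidean "\<lambda>w. z n * w"]
      by (simp add: o_def continuous_map_iff_continuous2 continuous_intros)
    then show ?thesis by (simp add: continuous_map_componentwise_UNIV flip: euclidean_product_topology)
  qed
  have cT: "compactin T (topspace T)" using compact_T by (simp add: compact_space_def)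
  define X where "X = range E"
  define Y where "Y = range (\<lambda>g n. z n * E g n)"
  have X: "compact X" using image_compactin[OF cT Econt] by (simp add: top_UNIV X_def)
  have Y: "compact Y" using image_compactin[OF cT zEcont] by (simp add: top_UNIV Y_def)
  have ne: "X \<noteq> {}" "Y \<noteq> {}" by (auto simp: X_def Y_def)
  have "X \<inter> Y = {}"
  proof (rule ccontr)
    assume "X \<inter> Y \<noteq> {}"
    then obtain g h where gh: "E g = (\<lambda>n. z n * E h n)" by (auto simp: X_def Y_def)
    have "E (g - h) n = z n" for n
    proof -
      have "E (g - h) n * E h n = z n * E h n" using hom[of "g - h" h n] fun_cong[OF gh, of n] by (metis diff_add_cancel)
      moreover have "E h n \<noteq> 0" using norm1[of h n] by auto
      ultimately show ?thesis by (metis mult_right_cancel)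
    qed
    with nex show False by blast
  qed
  \<comment> \<open>The distance to the subgroup vanishes on \<open>X\<close> and is at least
    \<open>F y0 > 0\<close> on the coset \<open>Y\<close>; a trigonometric polynomial within a third
    of that still tells the two apart.\<close>
  define F where "F y = infdist y X" for y
  have Fc: "continuous_on A F" for A unfolding F_def by (intro continuous_intros)
  have "F y > 0" if "y \<in> Y" for y
    unfolding F_def using that \<open>X \<inter> Y = {}\<close> ne X infdist_pos_not_in_closed[of X y] by (auto simp: compact_imp_closed)
  moreover obtain y0 where y0: "y0 \<in> Y" "\<And>y. y \<in> Y \<Longrightarrow> F y0 \<le> F y"
    using continuous_attains_inf[OF Y ne(2) Fc] by blast
  ultimately have pos: "F y0 > 0" by blast
  have EX: "E g \<in> torus" and EY: "(\<lambda>n. z n * E g n) \<in> torus" for g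
    using norm1 z by (auto simp: torus_iff norm_mult)
  have agree: "bdd_fun (\<lambda>g. f (E g)) \<and> bdd_fun (\<lambda>g. f (\<lambda>n. z n * E g n)) \<and>
     L (\<lambda>g. f (E g)) = L (\<lambda>g. f (\<lambda>n. z n * E g n))" if "f \<in> trig_polys" for f
    using that
  proof (induction rule: trig_polys.induct)
    case (mono c \<kappa>)
    define \<rho> where "\<rho> g = laurent_mono c (E g)" for g
    have rho1: "cmod (\<rho> g) = 1" for g unfolding \<rho>_def by (rule norm_laurent_mono) (rule norm1)
    then have br: "bdd_fun \<rho>" by (intro bdd_funI[of _ 1]) simp
    have zmult: "laurent_mono c (\<lambda>n. z n * E g n) = laurent_mono c z * \<rho> g" for g
      by (simp add: laurent_mono_times \<rho>_def)
    have b: "bdd_fun (\<lambda>g. k * \<rho> g)" for k by (intro bdd_fun_mult bdd_fun_const br)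
    have Lk: "L (\<lambda>g. Re (k * \<rho> g)) = Re (k * cmean \<rho>)" for k
      using cmean_cmult[OF br, of k] by (simp add: cmean_def complex_eq_iff)
    \<comment> \<open>A monomial that is trivial on the subgroup is trivial at \<open>z\<close> by
      assumption, and a nontrivial one has mean 0 by invariance. In both cases the factor
      \<open>laurent_mono c z\<close> has no effect.\<close>
    have "L (\<lambda>g. Re (\<kappa> * \<rho> g)) = L (\<lambda>g. Re (\<kappa> * laurent_mono c z * \<rho> g))"
    proof (cases "\<forall>g. \<rho> g = 1")
      case True
      then have "laurent_mono c z = 1" using ann[OF mono] by (simp add: \<rho>_def)
      then show ?thesis by simp
    next
      case False
      then obtain g0 where g0: "\<rho> g0 \<noteq> 1" by blast
      have "\<rho> (g + g0) = \<rho> g0 * \<rho> g" for g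
        by (simp add: \<rho>_def hom[abs_def] flip: laurent_mono_times) (simp add: mult.commute hom)
      then have "cmean \<rho> = \<rho> g0 * cmean \<rho>" using cmean_shift[OF br, of g0] cmean_cmult[OF br, of "\<rho> g0"] by simp
      then have "cmean \<rho> = 0" using g0 by simp
      then show ?thesis by (simp only: Lk) simp
    qed
    moreover have "bdd_fun (\<lambda>g. Re (\<kappa> * \<rho> g))" "bdd_fun (\<lambda>g. Re (\<kappa> * laurent_mono c z * \<rho> g))"
      by (rule bdd_fun_Re, rule b)+
    ultimately show ?case by (simp add: zmult mult.assoc flip: \<rho>_def)
  next
    case (add f g)
    then show ?case by (simp add: L_add bdd_fun_add)
  qed
  define e where "e = F y0 / 3"
  have e: "e > 0" using pos by (simp add: e_def)
  obtain t where t: "t \<in> trig_polys" "\<And>y. y \<in> torus \<Longrightarrow> \<bar>F y - t y\<bar> < e"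
    using trig_polys_dense[OF Fc e] by blast
  have "t (E g) \<le> e" for g
    using t(2)[OF EX[of g]] by (simp add: F_def X_def)
  then have "L (\<lambda>g. t (E g)) \<le> e" using agree[OF t(1)] by (intro L_le) auto
  moreover have "2 * e \<le> t (\<lambda>n. z n * E g n)" for g
  proof -
    have "F y0 \<le> F (\<lambda>n. z n * E g n)" by (rule y0(2)) (simp add: Y_def)
    moreover have "F y0 = 3 * e" by (simp add: e_def)
    ultimately show ?thesis using t(2)[OF EY[of g]] by linarith
  qed
  then have "L (\<lambda>_. 2 * e) \<le> L (\<lambda>g. t (\<lambda>n. z n * E g n))" using agree[OF t(1)] by (intro L_mono) auto
  ultimately show False using agree[OF t(1)] e by simp
qed

section \<open>The associated polynomial\<close>

text \<open>Two-sided sequences form a module over the polynomial ring, with \<open>x\<close> acting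
  as the shift that sends \<open>s\<close> to \<open>\<lambda>n. s (n + 1)\<close>.\<close>

definition pact :: "'a::comm_ring_1 poly \<Rightarrow> (int \<Rightarrow> 'a) \<Rightarrow> int \<Rightarrow> 'a" where
  "pact p s n = (\<Sum>i\<le>degree p. coeff p i * s (n + int i))"

lemma pact_altdef:
  assumes "degree p \<le> m" shows "pact p s n = (\<Sum>i\<le>m. coeff p i * s (n + int i))"
  unfolding pact_def using assms
  by (intro sum.mono_neutral_left) (auto simp: coeff_eq_0)

lemma pact_0 [simp]: "pact 0 s n = 0"
  by (simp add: pact_def)

lemma pact_add: "pact (p + q) s n = pact p s n + pact q s n"
proof -
  let ?m = "max (degree p) (degree q)"
  have "degree (p + q) \<le> ?m" by (rule degree_add_le_max)
  then show ?thesis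
    by (simp add: pact_altdef[of _ ?m] sum.distrib distrib_right)
qed

lemma pact_smult: "pact (smult c p) s n = c * pact p s n"
  unfolding pact_altdef[OF degree_smult_le] by (simp add: pact_def sum_distrib_left mult.assoc)

lemma pact_pCons: "pact (pCons a p) s n = a * s n + pact p s (n + 1)"
proof -
  have "pact (pCons a p) s n = (\<Sum>i\<le>Suc (degree p). coeff (pCons a p) i * s (n + int i))"
    by (rule pact_altdef) (rule degree_pCons_le)
  also have "\<dots> = a * s n + (\<Sum>i\<le>degree p. coeff p i * s (n + int (Suc i)))"
    by (simp add: sum.atMost_Suc_shift del: sum.atMost_Suc)
  finally show ?thesis by (simp add: pact_def algebra_simps)
qed

lemma pact_mult: "pact (p * q) s n = pact p (pact q s) n"
proof (induction p arbitrary: n)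
  case (pCons a p)
  have "pact (pCons a p * q) s n = a * pact q s n + pact (p * q) s (n + 1)"
    by (simp add: mult_pCons_left pact_add pact_smult pact_pCons)
  then show ?case by (simp add: pCons.IH pact_pCons)
qed simp

lemma pact_uminus: "pact (- p) s n = - pact p s n"
  using pact_smult[of "-1" p s n] by simp

lemma pact_diff: "pact (p - q) s n = pact p s n - pact q s n"
  using pact_add[of p "- q" s n] by (simp add: pact_uminus)

section \<open>Integer polynomials and Laurent polynomials\<close>

abbreviation rpoly :: "int poly \<Rightarrow> real poly" where
  "rpoly \<equiv> map_poly of_int"

lemma rpoly_mult: "rpoly (p * q) = rpoly p * rpoly q"
  by (simp add: poly_eq_iff coeff_map_poly coeff_mult)

lemma rpoly_smult: "rpoly (smult c p) = smult (of_int c) (rpoly p)"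
  by (simp add: poly_eq_iff coeff_map_poly)

lemma pact_rpoly: "pact (rpoly p) s n = (\<Sum>i\<le>degree p. of_int (coeff p i) * s (n + int i))"
  by (simp add: pact_def coeff_map_poly degree_map_poly)

lemma pact_rpoly_Ints:
  assumes "\<And>n. s n \<in> \<int>" shows "pact (rpoly p) s n \<in> \<int>"
  unfolding pact_rpoly using assms by (intro Ints_sum Ints_mult) auto

text \<open>The Laurent polynomial \<open>x^(-k) p\<close>. Every Laurent polynomial has this form,
  which turns questions of divisibility into questions about ordinary polynomials.\<close>

definition shift_poly :: "int poly \<Rightarrow> nat \<Rightarrow> int \<Rightarrow> int" where
  "shift_poly p k n = laurent_of_poly p (n + int k)"

lemma shift_poly_nonzero: "{n. shift_poly p k n \<noteq> 0} \<subseteq> (\<lambda>i. int i - int k) ` {..degree p}"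
proof
  fix n assume "n \<in> {n. shift_poly p k n \<noteq> 0}"
  then have n: "n + int k \<ge> 0" "coeff p (nat (n + int k)) \<noteq> 0"
    by (auto simp: shift_poly_def laurent_of_poly_def split: if_splits)
  then have "nat (n + int k) \<le> degree p" by (intro le_degree)
  moreover have "n = int (nat (n + int k)) - int k" using n by simp
  ultimately show "n \<in> (\<lambda>i. int i - int k) ` {..degree p}" by blast
qed

lemma shift_poly_laurent: "shift_poly p k \<in> laurent_polys"
  unfolding laurent_polys_iff using shift_poly_nonzero by (rule finite_subset) auto

lemma laurent_poly_is_shift:
  assumes "c \<in> laurent_polys" shows "\<exists>p k. c = shift_poly p k"
proof -
  have "finite {n. c n \<noteq> 0}" using assms by (simp add: laurent_polys_iff)
  then obtain B where B: "\<And>n. c n \<noteq> 0 \<Longrightarrow> \<bar>n\<bar> \<le> B"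
    using Max_ge[of "abs ` {n. c n \<noteq> 0}"] by blast
  define k where "k = nat B"
  define p where "p = Abs_poly (\<lambda>i. c (int i - int k))"
  have "eventually (\<lambda>i. c (int i - int k) = 0) cofinite"
  proof (rule eventually_mono[of "\<lambda>i. i > 2 * k"])
    show "\<forall>\<^sub>F i in cofinite. 2 * k < i" by (simp add: cofinite_eq_sequentially eventually_gt_at_top)
    fix i assume "2 * k < i"
    then show "c (int i - int k) = 0" using B[of "int i - int k"] by (force simp: k_def)
  qed
  then have cp: "coeff p i = c (int i - int k)" for i
    unfolding p_def by (simp add: Abs_poly_inverse MOST_iff_cofinite)
  have "c n = shift_poly p k n" for n
  proof (cases "n + int k \<ge> 0")
    case False
    then have "c n = 0" using B[of n] by (cases "c n = 0") (auto simp: k_def abs_le_iff split: if_splits)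
    then show ?thesis using False by (simp add: shift_poly_def laurent_of_poly_def)
  qed (simp add: shift_poly_def laurent_of_poly_def cp)
  then show ?thesis by blast
qed

lemma sum_shift_poly:
  fixes s :: "int \<Rightarrow> real"
  shows "(\<Sum>n\<in>{n. shift_poly p k n \<noteq> 0}. of_int (shift_poly p k n) * s n) = pact (rpoly p) s (- int k)"
proof -
  have "(\<Sum>n\<in>{n. shift_poly p k n \<noteq> 0}. of_int (shift_poly p k n) * s n)
    = (\<Sum>n\<in>(\<lambda>i. int i - int k) ` {..degree p}. of_int (shift_poly p k n) * s n)"
    using shift_poly_nonzero by (intro sum.mono_neutral_left) auto
  also have "\<dots> = (\<Sum>i\<le>degree p. of_int (coeff p i) * s (- int k + int i))"
    by (subst sum.reindex) (auto simp: inj_on_def shift_poly_def laurent_of_poly_def)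
  finally show ?thesis by (simp add: pact_rpoly)
qed

lemma laurent_conv_shift_poly:
  "laurent_conv (laurent_of_poly f) (shift_poly q k) = shift_poly (f * q) k"
proof
  fix n
  have sub: "{i. laurent_of_poly f i \<noteq> 0} \<subseteq> int ` {..degree f}"
    using shift_poly_nonzero[of f 0] by (simp add: shift_poly_def image_def)
  have "laurent_conv (laurent_of_poly f) (shift_poly q k) n
    = (\<Sum>i\<in>int ` {..degree f}. laurent_of_poly f i * shift_poly q k (n - i))"
    unfolding laurent_conv_def using sub by (intro sum.mono_neutral_left) auto
  also have "\<dots> = (\<Sum>i\<le>degree f. coeff f i * shift_poly q k (n - int i))"
    by (subst sum.reindex) (auto simp: inj_on_def laurent_of_poly_def)
  also have "\<dots> = shift_poly (f * q) k n"
  proof (cases "n + int k \<ge> 0")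
    case True
    define m where "m = nat (n + int k)"
    have sq: "shift_poly q k (n - int i) = (if i \<le> m then coeff q (m - i) else 0)" for i
      using True by (auto simp: shift_poly_def laurent_of_poly_def m_def nat_diff_distrib' algebra_simps)
    have "(\<Sum>i\<le>degree f. coeff f i * shift_poly q k (n - int i))
      = (\<Sum>i\<le>max (degree f) m. coeff f i * (if i \<le> m then coeff q (m - i) else 0))"
      unfolding sq by (intro sum.mono_neutral_left) (auto simp: coeff_eq_0)
    also have "\<dots> = (\<Sum>i\<le>m. coeff f i * coeff q (m - i))"
      by (intro sum.mono_neutral_cong_right) auto
    finally show ?thesis using True by (simp add: shift_poly_def laurent_of_poly_def m_def coeff_mult)
  next
    case False
    then show ?thesis by (simp add: shift_poly_def laurent_of_poly_def)
  qed
  finally show "laurent_conv (laurent_of_poly f) (shift_poly q k) n = shift_poly (f * q) k n" .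
qed

lemma shift_poly_eq_iff: "shift_poly p k = shift_poly q m \<longleftrightarrow> monom 1 m * p = monom 1 k * q"
proof
  assume eq: "shift_poly p k = shift_poly q m"
  show "monom 1 m * p = monom 1 k * q"
  proof (rule poly_eqI)
    fix i
    have e: "shift_poly p k (int i - int k - int m) = shift_poly q m (int i - int k - int m)" using eq by simp
    have "shift_poly p k (int i - int k - int m) = coeff (monom 1 m * p) i"
      by (auto simp: shift_poly_def laurent_of_poly_def coeff_monom_mult nat_diff_distrib' simp flip: of_nat_diff)
    moreover have "shift_poly q m (int i - int k - int m) = coeff (monom 1 k * q) i"
      by (auto simp: shift_poly_def laurent_of_poly_def coeff_monom_mult nat_diff_distrib' simp flip: of_nat_diff)
    ultimately show "coeff (monom 1 m * p) i = coeff (monom 1 k * q) i" using e by simp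
  qed
next
  assume eq: "monom 1 m * p = monom 1 k * q"
  show "shift_poly p k = shift_poly q m"
  proof
    fix n
    have e: "coeff (monom 1 m * p) i = coeff (monom 1 k * q) i" for i using eq by simp
    show "shift_poly p k n = shift_poly q m n"
    proof (cases "n + int k + int m \<ge> 0")
      case True
      define i where "i = nat (n + int k + int m)"
      have i: "int i = n + int k + int m" using True by (simp add: i_def)
      have "shift_poly p k n = coeff (monom 1 m * p) i" "shift_poly q m n = coeff (monom 1 k * q) i"
        using i by (auto simp: shift_poly_def laurent_of_poly_def coeff_monom_mult nat_diff_distrib' intro!: arg_cong[of _ _ "coeff _"])
      then show ?thesis using e by simp
    qed (auto simp: shift_poly_def laurent_of_poly_def)
  qed
qed

text \<open>The prime \<open>x\<close> does not divide \<open>f\<close>, so each factor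
  \<open>x\<close> belongs to the cofactor and can be cancelled.\<close>

lemma dvd_monom_mult_cancel:
  fixes f g :: "int poly"
  assumes "f dvd monom 1 k * g" "coeff f 0 \<noteq> 0" shows "f dvd g"
  using assms(1)
proof (induction k)
  case (Suc k)
  then obtain q where q: "monom 1 (Suc k) * g = f * q" by blast
  have m: "monom 1 (Suc k) * g = pCons 0 (monom 1 k * g)" by (simp add: monom_Suc)
  then have "coeff (f * q) 0 = 0" using q by (metis coeff_pCons_0)
  then have "coeff q 0 = 0" using assms(2) by (simp add: coeff_mult_0)
  then obtain q' where q': "q = pCons 0 q'" by (metis coeff_pCons_0 pCons_cases)
  have "pCons 0 (monom 1 k * g) = pCons 0 (f * q')" using q m by (simp add: q')
  then have "monom 1 k * g = f * q'" by simp
  then show ?case by (intro Suc.IH) simp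
qed simp

text \<open>Gauss's lemma: contents multiply, so \<open>a\<close> divides the content of
  \<open>q\<close> and can be cancelled.\<close>

lemma content_1_dvd_smult:
  fixes f h q :: "int poly"
  assumes "content f = 1" "a \<noteq> 0" "smult a h = f * q" shows "f dvd h"
proof -
  have "content q = content (smult a h)" using assms by (simp add: content_mult)
  then have "a dvd content q" by (simp add: content_smult)
  then have "[:a:] dvd q" by (simp add: const_poly_dvd_iff_dvd_content)
  then obtain q' where "q = smult a q'" by (auto elim!: dvdE)
  then have "smult a h = smult a (f * q')" using assms(3) by simp
  then have "smult a (h - f * q') = 0" by (simp add: smult_diff_right)
  then have "h = f * q'" using assms(2) by simp
  then show ?thesis by simp
qed

text \<open>Ideals of integer polynomials need not be principal; closure under division by constants
  and by \<open>x\<close> repairs this. An element of least degree may be taken primitive,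
  pseudo-division by it leaves remainder 0, and Gauss's lemma removes the multiplier introduced by
  pseudo-division.\<close>

lemma principal_ideal_primitive:
  fixes J :: "int poly set"
  assumes diff: "\<And>p q. p \<in> J \<Longrightarrow> q \<in> J \<Longrightarrow> p - q \<in> J"
    and mult: "\<And>p q. p \<in> J \<Longrightarrow> p * q \<in> J"
    and saturated: "\<And>m p. m \<noteq> 0 \<Longrightarrow> smult m p \<in> J \<Longrightarrow> p \<in> J"
    and shift: "\<And>p. pCons 0 p \<in> J \<Longrightarrow> p \<in> J"
    and ne: "\<exists>p\<in>J. p \<noteq> 0"
  obtains f where "content f = 1" "coeff f 0 \<noteq> 0" "lead_coeff f > 0" "J = {f * q | q. True}"
proof -
  obtain f0 where f0: "f0 \<in> J" "f0 \<noteq> 0" and min: "\<And>p. p \<in> J \<Longrightarrow> p \<noteq> 0 \<Longrightarrow> degree f0 \<le> degree p"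
    using ne ex_has_least_nat[of "\<lambda>p. p \<in> J \<and> p \<noteq> 0" _ degree] by blast
  define f1 where "f1 = primitive_part f0"
  have f1: "f1 \<in> J" "content f1 = 1" "f1 \<noteq> 0"
    using f0 saturated[of "content f0" f1] by (auto simp: f1_def)
  have d1: "degree f1 = degree f0" by (simp add: f1_def)
  define f where "f = smult (sgn (lead_coeff f1)) f1"
  have sg: "sgn (lead_coeff f1) = 1 \<or> sgn (lead_coeff f1) = -1" using f1(3) by (simp add: sgn_if)
  have f: "f \<in> J" using mult[OF f1(1), of "[:sgn (lead_coeff f1):]"] by (simp add: f_def)
  have fn: "f \<noteq> 0" using f1(3) sg by (auto simp: f_def)
  have cf: "content f = 1" using f1(2) sg by (auto simp: f_def content_smult)
  have df: "degree f = degree f0" using d1 sg by (auto simp: f_def)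
  have "lead_coeff f1 \<noteq> 0" using f1(3) by simp
  then have lf: "lead_coeff f > 0" unfolding f_def lead_coeff_smult by (metis abs_sgn mult.commute zero_less_abs_iff)
  have c0: "coeff f 0 \<noteq> 0"
  proof
    assume "coeff f 0 = 0"
    then obtain q where q: "f = pCons 0 q" by (metis coeff_pCons_0 pCons_cases)
    then have "q \<in> J" "q \<noteq> 0" using f fn shift by auto
    then have "degree f \<le> degree q" using min df by simp
    then show False using q \<open>q \<noteq> 0\<close> by simp
  qed
  have "h \<in> {f * q | q. True}" if h: "h \<in> J" for h
  proof -
    obtain a q where aq: "a \<noteq> 0" "smult a h = f * q + pseudo_mod h f" using pseudo_mod(1)[OF fn] by blast
    have "pseudo_mod h f = h * [:a:] - f * q" using aq(2) by (simp add: algebra_simps)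
    then have "pseudo_mod h f \<in> J" using diff mult h f by metis
    then have "pseudo_mod h f = 0" using pseudo_mod(2)[OF fn, of h] min df by force
    then have "f dvd h" using content_1_dvd_smult[OF cf aq(1), of h q] aq(2) by simp
    then show ?thesis by auto
  qed
  moreover have "f * q \<in> J" for q using mult f by blast
  ultimately have "J = {f * q | q. True}" by blast
  then show thesis using that cf c0 lf by blast
qed

lemma primitive_generator_unique:
  fixes f g :: "int poly"
  assumes "f dvd g" "g dvd f" "lead_coeff f > 0" "lead_coeff g > 0" shows "f = g"
proof -
  obtain a where a: "g = f * a" using assms(1) by (rule dvdE)
  obtain b where b: "f = g * b" using assms(2) by (rule dvdE)
  note ab = a b
  have "f \<noteq> 0" using assms by auto
  have "f * (a * b) = f * 1" using ab by (metis mult.assoc mult.right_neutral)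
  then have u: "a * b = 1" using \<open>f \<noteq> 0\<close> by (metis mult_cancel_left)
  then have "degree a = 0" by (metis add_is_0 degree_1 degree_mult_eq mult_zero_left mult_zero_right zero_neq_one)
  then obtain c where c: "a = [:c:]" by (metis degree_eq_zeroE)
  have "a dvd 1" using u by (metis dvd_triv_left)
  then have "c dvd 1" using c by (simp add: const_poly_dvd_const_poly_iff[of c 1, simplified one_pCons[symmetric]])
  then have "\<bar>c\<bar> = 1" by simp
  then have "c = 1 \<or> c = -1" by linarith
  moreover have "lead_coeff g = c * lead_coeff f" using ab(1) c by (simp add: lead_coeff_mult mult.commute)
  ultimately show ?thesis using assms ab(1) c by auto
qed

section \<open>Integer powers of the automorphism\<close>

lemma apow_Suc_right:
  assumes "bij \<alpha>" shows "apow \<alpha> (n + 1) g = apow \<alpha> n (\<alpha> g)"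
proof (cases "n \<ge> 0")
  case True
  then have "nat (n + 1) = Suc (nat n)" by simp
  then show ?thesis using True by (simp add: apow_def funpow_Suc_right del: funpow.simps)
next
  case False
  have i: "inv \<alpha> (\<alpha> g) = g" using assms by (simp add: bij_is_inj)
  have "nat (- n) = Suc (nat (- n - 1))" using False by simp
  then have "apow \<alpha> n (\<alpha> g) = (inv \<alpha> ^^ nat (- n - 1)) g"
    using False by (simp add: apow_def funpow_Suc_right i del: funpow.simps)
  moreover have "apow \<alpha> (n + 1) g = (inv \<alpha> ^^ nat (- n - 1)) g"
    using False by (cases "n = -1") (auto simp: apow_def)
  ultimately show ?thesis by simp
qed

lemma apow_add:
  assumes "bij \<alpha>" shows "apow \<alpha> (n + m) g = apow \<alpha> n (apow \<alpha> m g)"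
proof (induction m arbitrary: g rule: int_induct[where k = 0])
  case base
  then show ?case by (simp add: apow_def)
next
  case (step1 i)
  have "apow \<alpha> (n + (i + 1)) g = apow \<alpha> (n + i) (\<alpha> g)"
    using apow_Suc_right[OF assms, of "n + i" g] by (simp add: add.assoc)
  then show ?case by (simp add: step1 apow_Suc_right[OF assms])
next
  case (step2 i)
  have s: "\<alpha> (inv \<alpha> g) = g" using assms by (simp add: bij_is_surj surj_f_inv_f)
  have "apow \<alpha> (n + (i - 1)) g = apow \<alpha> (n + i) (inv \<alpha> g)"
    using apow_Suc_right[OF assms, of "n + (i - 1)" "inv \<alpha> g"] s by (simp add: algebra_simps)
  moreover have "apow \<alpha> (i - 1) g = apow \<alpha> i (inv \<alpha> g)"
    using apow_Suc_right[OF assms, of "i - 1" "inv \<alpha> g"] s by simp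
  ultimately show ?case by (simp add: step2)
qed

section \<open>Orbit coordinates of a cyclic system\<close>

locale cyclic_system = compact_ab_group T for T :: "'g::ab_group_add topology" +
  fixes \<alpha> :: "'g \<Rightarrow> 'g" and ch0 :: "'g \<Rightarrow> complex"
  assumes connected_T: "connected_space T"
    and iso: "tg_iso (add_tgroup T) (add_tgroup T) \<alpha>"
    and expansive: "expansive T \<alpha>"
    and generator: "is_cyclic_generator T \<alpha> ch0"
begin

lemma tg_simps [simp]:
  "tg_top (add_tgroup T) = T" "tg_op (add_tgroup T) = (+)" "tg_carrier (add_tgroup T) = UNIV"
  by (simp_all add: add_tgroup_def tg_top_def tg_op_def tg_carrier_def top_UNIV)

lemma bij_alpha: "bij \<alpha>"
  and alpha_cont: "continuous_map T T \<alpha>"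
  and inv_cont: "continuous_map T T (inv \<alpha>)"
  and alpha_add: "\<alpha> (x + y) = \<alpha> x + \<alpha> y"
proof -
  have h: "homeomorphic_map T T \<alpha>" and hom: "\<alpha> (x + y) = \<alpha> x + \<alpha> y" for x y
    using iso unfolding tg_iso_def tg_hom_def by auto
  show b: "bij \<alpha>" using homeomorphic_imp_injective_map[OF h] homeomorphic_imp_surjective_map[OF h] by (simp add: top_UNIV bij_def)
  show "continuous_map T T \<alpha>" using h by (rule homeomorphic_imp_continuous_map)
  show "\<alpha> (x + y) = \<alpha> x + \<alpha> y" by (rule hom)
  obtain \<beta> where "homeomorphic_maps T T \<alpha> \<beta>" using h homeomorphic_map_maps by blast
  then have "continuous_map T T \<beta>" "\<And>x. \<alpha> (\<beta> x) = x" "\<And>x. \<beta> (\<alpha> x) = x"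
    by (auto simp: homeomorphic_maps_def top_UNIV)
  moreover from this have "inv \<alpha> = \<beta>" by (intro inv_equality) auto
  ultimately show "continuous_map T T (inv \<alpha>)" by simp
qed

lemma inv_alpha_add: "inv \<alpha> (x + y) = inv \<alpha> x + inv \<alpha> y"
proof -
  have "\<alpha> (inv \<alpha> x + inv \<alpha> y) = x + y" by (simp add: alpha_add bij_alpha bij_is_surj surj_f_inv_f)
  then show ?thesis by (metis bij_alpha bij_inv_eq_iff)
qed

lemma apow_hom: "apow \<alpha> n (x + y) = apow \<alpha> n x + apow \<alpha> n y"
proof -
  have "(\<alpha> ^^ k) (x + y) = (\<alpha> ^^ k) x + (\<alpha> ^^ k) y" for k by (induction k) (auto simp: alpha_add)
  moreover have "(inv \<alpha> ^^ k) (x + y) = (inv \<alpha> ^^ k) x + (inv \<alpha> ^^ k) y" for k by (induction k) (auto simp: inv_alpha_add)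
  ultimately show ?thesis by (simp add: apow_def)
qed

lemma apow_cont: "continuous_map T T (apow \<alpha> n)"
proof -
  have "continuous_map T T (\<alpha> ^^ k)" for k
    by (induction k) (auto intro: continuous_map_compose[OF _ alpha_cont, unfolded o_def] simp: o_def)
  moreover have "continuous_map T T (inv \<alpha> ^^ k)" for k
    by (induction k) (auto intro: continuous_map_compose[OF _ inv_cont, unfolded o_def] simp: o_def)
  ultimately show ?thesis by (simp add: apow_def[abs_def])
qed

lemma characters_iff: "ch \<in> characters (add_tgroup T) \<longleftrightarrow> continuous_map T euclidean ch \<and>
    (\<forall>x. cmod (ch x) = 1) \<and> (\<forall>x y. ch (x + y) = ch x * ch y)"
  by (auto simp: characters_def circle_top_def continuous_map_in_subtopology top_UNIV image_subset_iff)

definition coords :: "'g \<Rightarrow> int \<Rightarrow> complex" where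
  "coords g n = ch0 (apow \<alpha> n g)"

lemma coords_add: "coords (g + h) n = coords g n * coords h n"
  and norm_coords [simp]: "cmod (coords g n) = 1"
  and coords_cont: "continuous_map T euclidean (\<lambda>g. coords g n)"
  and coords_apow: "coords (apow \<alpha> m g) n = coords g (n + m)"
proof -
  have ch0: "continuous_map T euclidean ch0" "\<And>x. cmod (ch0 x) = 1" "\<And>x y. ch0 (x + y) = ch0 x * ch0 y"
    using generator unfolding is_cyclic_generator_def characters_iff by auto
  show "coords (g + h) n = coords g n * coords h n" by (simp add: coords_def apow_hom ch0)
  show "cmod (coords g n) = 1" by (simp add: coords_def ch0)
  show "coords (apow \<alpha> m g) n = coords g (n + m)" by (simp add: coords_def apow_add[OF bij_alpha])
  show "continuous_map T euclidean (\<lambda>g. coords g n)"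
    using continuous_map_compose[OF apow_cont[of n] ch0(1)] by (simp add: coords_def o_def)
qed

lemma laurent_act_eq: "laurent_act \<alpha> c ch0 g = laurent_mono c (coords g)"
  by (simp add: laurent_act_def laurent_mono_def coords_def)

text \<open>Characters separate points and each of them is a monomial in the coordinates. Trivial
  coordinates therefore make every character trivial at \<open>g\<close>.\<close>

lemma coords_eq_1: "(\<And>n. coords g n = 1) \<Longrightarrow> g = 0"
proof (rule ccontr)
  assume 1: "\<And>n. coords g n = 1" and "g \<noteq> 0"
  obtain L :: "('g \<Rightarrow> real) \<Rightarrow> real" where L: "invariant_mean L" using invariant_mean_exists by blast
  interpret compact_group_mean T L by unfold_locales (rule L)
  obtain ch where "ch \<in> characters (add_tgroup T)" "ch g \<noteq> 1"
    using separating_character[OF \<open>g \<noteq> 0\<close>] unfolding characters_iff by metis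
  then obtain c where "ch g = laurent_act \<alpha> c ch0 g"
    using generator unfolding is_cyclic_generator_def by (auto simp: top_UNIV)
  then have "ch g = 1" using 1 by (simp add: laurent_act_eq laurent_mono_def)
  with \<open>ch g \<noteq> 1\<close> show False by simp
qed

lemma coords_0 [simp]: "coords 0 n = 1"
  using coords_add[of 0 0 n] norm_coords[of 0 n]
  by (metis add.right_neutral mult_cancel_right1 norm_zero zero_neq_one)

lemma coords_inj: "(\<And>n. coords g n = coords h n) \<Longrightarrow> g = h"
  using coords_eq_1[of "g - h"] coords_add[of "g - h" h] norm_coords
  by (metis diff_add_cancel eq_iff_diff_eq_0 mult_cancel_right1 norm_zero zero_neq_one)

text \<open>The closed boxes around 0 decrease to the point 0. By compactness one of them already
  misses the closed complement of \<open>U\<close>, so the coordinates determine the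
  topology.\<close>

lemma nbhd_contains_box:
  assumes U: "openin T U" "0 \<in> U"
  shows "\<exists>N. \<forall>g. (\<forall>n. \<bar>n\<bar> \<le> int N \<longrightarrow> cmod (coords g n - 1) \<le> 1 / real (Suc N)) \<longrightarrow> g \<in> U"
proof (rule ccontr)
  assume nex: "\<not> ?thesis"
  define C where "C N = {g. g \<notin> U \<and> (\<forall>n. \<bar>n\<bar> \<le> int N \<longrightarrow> cmod (coords g n - 1) \<le> 1 / real (Suc N))}" for N
  have clU: "closedin T (- U)" using U(1) by (simp add: closedin_def top_UNIV)
  have cl1: "closedin T {g. cmod (coords g n - 1) \<le> r}" for n r
  proof -
    have "closedin T {g \<in> topspace T. coords g n \<in> cball 1 r}"
      by (rule closedin_continuous_map_preimage[OF coords_cont]) auto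
    then show ?thesis by (simp add: top_UNIV dist_norm norm_minus_commute)
  qed
  have cl: "closedin T (C N)" for N
  proof -
    have "C N = (\<Inter>S\<in>insert (- U) ((\<lambda>n. {g. cmod (coords g n - 1) \<le> 1 / real (Suc N)}) ` {n. \<bar>n\<bar> \<le> int N}). S)"
      by (auto simp: C_def)
    also have "closedin T \<dots>" using clU cl1 by (intro closedin_INT) auto
    finally show ?thesis .
  qed
  have ne: "C N \<noteq> {}" for N using nex by (auto simp: C_def)
  have "decseq C"
    unfolding decseq_def
  proof (intro allI impI subsetI)
    fix m n g assume mn: "m \<le> n" and g: "g \<in> C n"
    have "1 / real (Suc n) \<le> 1 / real (Suc m)" using mn by (intro divide_left_mono) auto
    then show "g \<in> C m" using g mn unfolding C_def
      by (auto intro: order_trans[of _ "1 / real (Suc n)"])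
  qed
  then have "(\<Inter>N. C N) \<noteq> {}" using cl ne by (intro compact_space_imp_nest[OF compact_T])
  then obtain g where g: "\<And>N. g \<in> C N" by blast
  have "coords g n = 1" for n
  proof -
    have "cmod (coords g n - 1) \<le> 1 / real (Suc N)" if "N \<ge> nat \<bar>n\<bar>" for N
      using g[of N] that by (auto simp: C_def)
    moreover have "(\<lambda>N. 1 / real (Suc N)) \<longlonglongrightarrow> 0"
      by (rule LIMSEQ_Suc[of "\<lambda>N. 1 / real N"]) (rule lim_1_over_n)
    ultimately have "cmod (coords g n - 1) \<le> 0"
      using LIMSEQ_le_const[of "\<lambda>N. 1 / real (Suc N)" 0 "cmod (coords g n - 1)"] by blast
    then show ?thesis by simp
  qed
  then have "g = 0" by (rule coords_eq_1)
  then show False using g[of 0] U(2) by (simp add: C_def)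
qed

text \<open>Lifting to real sequences replaces multiplicative relations between the coordinates by
  integrality of linear combinations.\<close>

definition lifts :: "(int \<Rightarrow> real) set" where
  "lifts = {s. \<exists>g. \<forall>n. coords g n = cis (2 * pi * s n)}"

definition ann_polys :: "int poly set" where
  "ann_polys = {p. \<forall>s\<in>lifts. \<forall>n. pact (rpoly p) s n \<in> \<int>}"

section \<open>Lifts and annihilating polynomials\<close>

lemma lift_exists: "\<exists>s\<in>lifts. (\<forall>n. coords g n = cis (2 * pi * s n)) \<and> (\<forall>n. \<bar>s n\<bar> \<le> 1 / 2)"
proof -
  define s where "s n = Arg (coords g n) / (2 * pi)" for n
  have "coords g n = cis (2 * pi * s n)" for n
  proof -
    have "coords g n \<noteq> 0" using norm_coords[of g n] by (metis norm_zero zero_neq_one)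
    then show ?thesis using cis_Arg[of "coords g n"] by (simp add: s_def sgn_eq)
  qed
  moreover have "\<bar>s n\<bar> \<le> 1 / 2" for n
    using Arg_bounded[of "coords g n"] pi_gt_zero by (auto simp: s_def abs_le_iff field_simps)
  ultimately show ?thesis by (auto simp: lifts_def)
qed

lemma lifts_shift: assumes "s \<in> lifts" shows "(\<lambda>n. s (n + m)) \<in> lifts"
proof -
  obtain g where "\<And>n. coords g n = cis (2 * pi * s n)" using assms by (auto simp: lifts_def)
  then have "coords (apow \<alpha> m g) n = cis (2 * pi * s (n + m))" for n by (simp add: coords_apow)
  then show ?thesis by (auto simp: lifts_def)
qed

lemma pact_shift: "pact p (\<lambda>n. s (n + m)) n = pact p s (n + m)"
  by (simp add: pact_def ac_simps)

lemma shift_poly_act: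
  assumes "\<And>n. coords g n = cis (2 * pi * s n)"
  shows "laurent_act \<alpha> (shift_poly p k) ch0 g = cis (2 * pi * pact (rpoly p) s (- int k))"
proof -
  have "coords g = (\<lambda>n. cis (2 * pi * s n))" using assms by blast
  then show ?thesis
    using laurent_mono_cis[OF shift_poly_laurent, of p k s] by (simp add: laurent_act_eq sum_shift_poly)
qed

text \<open>The exponent \<open>k\<close> is immaterial because \<open>lifts\<close> is invariant
  under shifts.\<close>

lemma annihilates_iff: "(\<forall>g. laurent_act \<alpha> (shift_poly p k) ch0 g = 1) \<longleftrightarrow> p \<in> ann_polys"
proof
  assume 1: "\<forall>g. laurent_act \<alpha> (shift_poly p k) ch0 g = 1"
  have "pact (rpoly p) s n \<in> \<int>" if s: "s \<in> lifts" for s n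
  proof -
    have "(\<lambda>i. s (i + (n + int k))) \<in> lifts" by (rule lifts_shift[OF s])
    then obtain g where "\<And>i. coords g i = cis (2 * pi * s (i + (n + int k)))" by (auto simp: lifts_def)
    from shift_poly_act[OF this, of p k] 1
    have "pact (rpoly p) (\<lambda>i. s (i + (n + int k))) (- int k) \<in> \<int>" by (simp add: cis_2pi_eq_1_iff)
    then show ?thesis by (simp add: pact_shift)
  qed
  then show "p \<in> ann_polys" by (simp add: ann_polys_def)
next
  assume p: "p \<in> ann_polys"
  show "\<forall>g. laurent_act \<alpha> (shift_poly p k) ch0 g = 1"
  proof
    fix g
    obtain s where s: "s \<in> lifts" "\<And>n. coords g n = cis (2 * pi * s n)" using lift_exists by blast
    then show "laurent_act \<alpha> (shift_poly p k) ch0 g = 1"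
      using p shift_poly_act[OF s(2), of p k] by (simp add: cis_2pi_eq_1_iff ann_polys_def)
  qed
qed

text \<open>The image of the group in the torus is cut out by the monomials that are trivial on it;
  expressed through lifts, these are the polynomials in \<open>ann_polys\<close>.\<close>

lemma lifts_if_annihilated:
  assumes s: "\<And>p n. p \<in> ann_polys \<Longrightarrow> pact (rpoly p) s n \<in> \<int>" shows "s \<in> lifts"
proof -
  have "\<exists>g. coords g = (\<lambda>n. cis (2 * pi * s n))"
  proof (rule torus_subgroup_is_kernel)
    fix c assume c: "c \<in> laurent_polys" and 1: "\<And>g. laurent_mono c (coords g) = 1"
    obtain p k where pk: "c = shift_poly p k" using laurent_poly_is_shift[OF c] by blast
    have "p \<in> ann_polys" using 1 annihilates_iff[of p k] by (simp add: laurent_act_eq pk)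
    then have "pact (rpoly p) s (- int k) \<in> \<int>" by (rule s)
    then show "laurent_mono c (\<lambda>n. cis (2 * pi * s n)) = 1"
      using laurent_mono_cis[OF c, of s] by (simp add: pk sum_shift_poly cis_2pi_eq_1_iff)
  qed (auto simp: coords_cont coords_add)
  then show ?thesis unfolding lifts_def by (auto simp: fun_eq_iff)
qed

text \<open>Connectedness: a character with a trivial power takes finitely many values.\<close>

lemma ann_polys_saturated:
  assumes m: "m \<noteq> 0" and mp: "smult m p \<in> ann_polys" shows "p \<in> ann_polys"
proof -
  define \<rho> where "\<rho> g = laurent_act \<alpha> (shift_poly p 0) ch0 g" for g
  have cont: "continuous_map T euclidean \<rho>"
  proof -
    have "continuous_map T euclidean coords"
      using coords_cont by (simp add: continuous_map_componentwise_UNIV flip: euclidean_product_topology)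
    then have 1: "continuous_map T (top_of_set torus) coords"
      by (simp add: continuous_map_in_subtopology torus_iff image_subset_iff)
    have "continuous_on torus (laurent_mono c)" for c
      unfolding laurent_mono_def using torus_nonzero
      by (intro continuous_on_prod continuous_on_power_int continuous_on_subset[OF continuous_on_product_coordinates]) auto
    then have "continuous_map (top_of_set torus) euclidean (laurent_mono c)" for c by simp
    from continuous_map_compose[OF 1 this] show ?thesis by (simp add: \<rho>_def[abs_def] laurent_act_eq o_def)
  qed
  have pow: "\<rho> g powi m = 1" for g
  proof -
    obtain s where s: "s \<in> lifts" "\<And>n. coords g n = cis (2 * pi * s n)" using lift_exists by blast
    have "\<rho> g powi m = cis (2 * pi * (of_int m * pact (rpoly p) s 0))"
      unfolding \<rho>_def shift_poly_act[OF s(2)] by (simp add: cis_powi mult_ac)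
    also have "of_int m * pact (rpoly p) s 0 = pact (rpoly (smult m p)) s 0"
      by (simp add: rpoly_smult pact_smult)
    also have "\<dots> \<in> \<int>" using mp s by (auto simp: ann_polys_def)
    then have "cis (2 * pi * pact (rpoly (smult m p)) s 0) = 1" by (simp add: cis_2pi_eq_1_iff)
    finally show ?thesis .
  qed
  have "range \<rho> \<subseteq> {z. z ^ nat \<bar>m\<bar> = 1}"
  proof clarify
    fix g show "\<rho> g ^ nat \<bar>m\<bar> = 1"
      using pow[of g] by (cases m rule: int_cases2) (auto simp: power_int_minus)
  qed
  moreover have "finite {z::complex. z ^ nat \<bar>m\<bar> = 1}" using m by (intro finite_roots_unity) simp
  ultimately have fin: "finite (range \<rho>)" by (rule finite_subset)
  have "connectedin T (topspace T)" using connected_T by (simp add: connectedin_topspace)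
  from connectedin_continuous_map_image[OF cont this] have "connected (range \<rho>)" by (simp add: top_UNIV)
  then have "\<exists>a. range \<rho> = {a}" using fin connected_finite_iff_sing[of "range \<rho>"] by auto
  moreover have "\<rho> 0 = 1" by (simp add: \<rho>_def laurent_act_eq laurent_mono_def)
  ultimately have "\<rho> g = 1" for g by (metis rangeI singletonD)
  then show ?thesis using annihilates_iff[of p 0] by (simp add: \<rho>_def)
qed

text \<open>Expansiveness in terms of lifts: coordinates that all stay near 1 keep the whole orbit
  inside the expansive neighbourhood.\<close>

lemma small_lift_trivial:
  obtains \<epsilon> where "\<epsilon> > 0" "\<And>s. s \<in> lifts \<Longrightarrow> (\<And>n. \<bar>s n\<bar> \<le> \<epsilon>) \<Longrightarrow> s = (\<lambda>_. 0)"
proof -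
  obtain U where U: "openin T U" "0 \<in> U" "\<And>g. (\<And>n. apow \<alpha> n g \<in> U) \<Longrightarrow> g = 0"
    using expansive unfolding expansive_def by (auto simp: top_UNIV)
  obtain N where N: "\<And>g. (\<And>n. \<bar>n\<bar> \<le> int N \<Longrightarrow> cmod (coords g n - 1) \<le> 1 / real (Suc N)) \<Longrightarrow> g \<in> U"
    using nbhd_contains_box[OF U(1,2)] by blast
  \<comment> \<open>The second bound keeps every coordinate within \<open>1 / (N + 1)\<close> of 1;
    the first makes a lift with integer values zero.\<close>
  define \<epsilon> where "\<epsilon> = min (1 / 4) (1 / (2 * pi * real (Suc N)))"
  have cis_le: "cmod (cis x - 1) \<le> \<bar>x\<bar>" for x
    using dist_exp_i_1[of x] abs_sin_x_le_abs_x[of "x / 2"] by (simp add: cis_conv_exp)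
  show thesis
  proof (rule that[of \<epsilon>])
    show "\<epsilon> > 0" by (simp add: \<epsilon>_def)
    fix s assume s: "s \<in> lifts" and small: "\<And>n. \<bar>s n\<bar> \<le> \<epsilon>"
    obtain g where g: "\<And>n. coords g n = cis (2 * pi * s n)" using s by (auto simp: lifts_def)
    have "cmod (coords g n - 1) \<le> 1 / real (Suc N)" for n
    proof -
      have "cmod (coords g n - 1) \<le> 2 * pi * \<bar>s n\<bar>" using cis_le[of "2 * pi * s n"] by (simp add: g abs_mult)
      also have "\<dots> \<le> 2 * pi * (1 / (2 * pi * real (Suc N)))"
        using small[of n] by (intro mult_left_mono) (auto simp: \<epsilon>_def)
      finally show ?thesis by simp
    qed
    then have "apow \<alpha> m g \<in> U" for m by (intro N) (simp add: coords_apow)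
    then have "g = 0" by (rule U(3))
    then have "s n \<in> \<int>" for n using g[of n] by (simp flip: cis_2pi_eq_1_iff)
    moreover have "\<bar>s n\<bar> < 1" for n using small[of n] by (simp add: \<epsilon>_def)
    ultimately have "s n = 0" for n using Ints_nonzero_abs_ge1[of "s n"] by (metis linorder_not_le)
    then show "s = (\<lambda>_. 0)" by blast
  qed
qed

text \<open>Two properties of \<open>f\<close> are forced by test sequences. If only 0 were an
  annihilator, the constant sequence \<open>\<epsilon>\<close> would be a small nonzero lift; and a
  root \<open>z\<close> of modulus 1 would make the sequence
  \<open>\<epsilon> * Re (z powi n)\<close> such a lift.\<close>

theorem associated_poly:
  obtains f where "assoc_poly T \<alpha> ch0 = f" "f \<noteq> 0"
    "\<And>s. s \<in> lifts \<longleftrightarrow> (\<forall>n. pact (rpoly f) s n \<in> \<int>)"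
    "\<And>z :: complex. poly (map_poly of_int f) z = 0 \<Longrightarrow> cmod z \<noteq> 1"
proof -
  obtain \<epsilon> where e: "\<epsilon> > 0" "\<And>s. s \<in> lifts \<Longrightarrow> (\<And>n. \<bar>s n\<bar> \<le> \<epsilon>) \<Longrightarrow> s = (\<lambda>_. 0)"
    using small_lift_trivial by blast
  have ne: "\<exists>p\<in>ann_polys. p \<noteq> 0"
  proof (rule ccontr)
    assume "\<not> ?thesis"
    then have "(\<lambda>_. \<epsilon>) \<in> lifts" by (intro lifts_if_annihilated) auto
    then have "(\<lambda>_::int. \<epsilon>) = (\<lambda>_. 0)" using e by auto
    then show False using e(1) by (metis less_irrefl)
  qed
  obtain f where f: "content f = 1" "coeff f 0 \<noteq> 0" "lead_coeff f > 0" "ann_polys = {f * q | q. True}"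
  proof (rule principal_ideal_primitive[of ann_polys])
    show "p - q \<in> ann_polys" if "p \<in> ann_polys" "q \<in> ann_polys" for p q
    proof -
      have "rpoly (p - q) = rpoly p - rpoly q" by (simp add: poly_eq_iff coeff_map_poly)
      then show ?thesis using that by (auto simp: ann_polys_def pact_diff)
    qed
    show "p * q \<in> ann_polys" if "p \<in> ann_polys" for p q
    proof -
      have "pact (rpoly (p * q)) s n = pact (rpoly q) (pact (rpoly p) s) n" for s n
        by (simp add: rpoly_mult mult.commute[of "rpoly p"] pact_mult)
      then show ?thesis using that by (auto simp: ann_polys_def intro: pact_rpoly_Ints)
    qed
    show "p \<in> ann_polys" if "pCons 0 p \<in> ann_polys" for p
    proof -
      have "rpoly (pCons 0 p) = pCons 0 (rpoly p)" by (simp add: map_poly_pCons)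
      then have "pact (rpoly p) s (n + 1) \<in> \<int>" if "s \<in> lifts" for s n
        using that \<open>pCons 0 p \<in> ann_polys\<close> by (auto simp: ann_polys_def pact_pCons)
      from this[of _ "_ - 1"] show ?thesis by (simp add: ann_polys_def)
    qed
    show "p \<in> ann_polys" if "m \<noteq> 0" "smult m p \<in> ann_polys" for m p
      by (rule ann_polys_saturated[OF that])
    show "\<exists>p\<in>ann_polys. p \<noteq> 0" by (rule ne)
    fix f assume "content f = 1" "coeff f 0 \<noteq> 0" "lead_coeff f > 0" "ann_polys = {f * q | q. True}"
    then show thesis by (rule that)
  qed
  define I where "I = {c\<in>laurent_polys. \<forall>g\<in>topspace T. laurent_act \<alpha> c ch0 g = 1}"
  define M where "M h = {laurent_conv (laurent_of_poly h) q | q. q \<in> laurent_polys}" for h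
  have M_eq: "M h = {shift_poly (h * q) k | q k. True}" for h
    unfolding M_def using laurent_poly_is_shift shift_poly_laurent
    by (auto simp: laurent_conv_shift_poly) (metis laurent_conv_shift_poly)+
  have I_eq: "I = {shift_poly p k | p k. p \<in> ann_polys}"
    unfolding I_def using laurent_poly_is_shift shift_poly_laurent annihilates_iff
    by (auto simp: top_UNIV) metis+
  have IM: "I = M f" unfolding I_eq M_eq f(4) by auto
  have "assoc_poly T \<alpha> ch0 = f"
    unfolding assoc_poly_def I_def[symmetric] M_def[symmetric]
  proof (rule the_equality)
    show "content f = 1 \<and> coeff f 0 \<noteq> 0 \<and> 0 < lead_coeff f \<and> I = M f" using f IM by simp
    fix h assume h: "content h = 1 \<and> coeff h 0 \<noteq> 0 \<and> 0 < lead_coeff h \<and> I = M h"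
    \<comment> \<open>Equality of the two Laurent ideals gives divisibility only up to a power of
      \<open>x\<close>, which the nonzero constant coefficient allows to cancel.\<close>
    have dvd: "p dvd q" if "M p = M q" "coeff p 0 \<noteq> 0" for p q
    proof -
      have "shift_poly (q * 1) 0 \<in> M q" unfolding M_eq by blast
      then have "shift_poly q 0 \<in> M p" using that(1) by simp
      then obtain r k where "shift_poly q 0 = shift_poly (p * r) k" unfolding M_eq by blast
      then have "monom 1 k * q = p * r" by (simp add: shift_poly_eq_iff monom_0 one_pCons)
      then have "p dvd monom 1 k * q" by simp
      then show ?thesis using that(2) by (rule dvd_monom_mult_cancel)
    qed
    have "f dvd h" "h dvd f" using dvd[of f h] dvd[of h f] h f IM by auto
    then show "h = f" using primitive_generator_unique[of f h] h f by auto
  qed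
  moreover have lf: "s \<in> lifts \<longleftrightarrow> (\<forall>n. pact (rpoly f) s n \<in> \<int>)" for s
  proof
    have "f * 1 \<in> ann_polys" unfolding f(4) by blast
    then show "s \<in> lifts \<Longrightarrow> \<forall>n. pact (rpoly f) s n \<in> \<int>" by (simp add: ann_polys_def)
    assume s: "\<forall>n. pact (rpoly f) s n \<in> \<int>"
    show "s \<in> lifts"
    proof (rule lifts_if_annihilated)
      fix p n assume "p \<in> ann_polys"
      then obtain q where "p = f * q" using f(4) by auto
      then have "pact (rpoly p) s n = pact (rpoly q) (pact (rpoly f) s) n"
        by (simp add: rpoly_mult mult.commute[of "rpoly f"] pact_mult)
      then show "pact (rpoly p) s n \<in> \<int>" using s by (simp add: pact_rpoly_Ints)
    qed
  qed
  moreover have "cmod z \<noteq> 1" if z: "poly (map_poly of_int f) z = 0" for z :: complex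
  proof
    assume z1: "cmod z = 1"
    then have "z \<noteq> 0" by auto
    define s where "s n = \<epsilon> * Re (z powi n)" for n
    have "pact (rpoly f) s n = 0" for n
    proof -
      have "pact (rpoly f) s n = \<epsilon> * Re (\<Sum>i\<le>degree f. of_int (coeff f i) * z powi (n + int i))"
        by (simp add: pact_rpoly s_def sum_distrib_left mult_ac)
      also have "(\<Sum>i\<le>degree f. of_int (coeff f i) * z powi (n + int i)) = z powi n * poly (map_poly of_int f) z"
        using \<open>z \<noteq> 0\<close> by (simp add: poly_altdef degree_map_poly coeff_map_poly sum_distrib_left power_int_add mult_ac)
      finally show ?thesis using z by simp
    qed
    then have "s \<in> lifts" using lf by simp
    moreover have "\<bar>s n\<bar> \<le> \<epsilon>" for n
    proof -
      have "\<bar>Re (z powi n)\<bar> \<le> 1" using abs_Re_le_cmod[of "z powi n"] z1 by (simp add: norm_power_int)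
      then show ?thesis using e(1) by (simp add: s_def abs_mult)
    qed
    ultimately have "s = (\<lambda>_. 0)" by (rule e(2))
    then have "s 0 = 0" by simp
    then show False using e(1) by (simp add: s_def)
  qed
  moreover have "f \<noteq> 0" using f(3) by auto
  ultimately show thesis using that[of f] by blast
qed

end

section \<open>The fundamental solution\<close>

definition decays :: "(int \<Rightarrow> 'a::real_normed_vector) \<Rightarrow> bool" where
  "decays w \<longleftrightarrow> (\<exists>C \<rho>. 0 < \<rho> \<and> \<rho> < 1 \<and> (\<forall>n. norm (w n) \<le> C * \<rho> ^ nat \<bar>n\<bar>))"

text \<open>The solution is the series of \<open>\<mu> ^ k * u (n + \<sigma> * k)\<close>. A
  displacement by \<open>k\<close> steps worsens the decay estimate for \<open>u\<close> by at most
  \<open>\<rho> ^ k\<close> in the denominator, which \<open>\<mu> ^ k\<close> absorbs.\<close>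

lemma geometric_one_sided:
  fixes u :: "int \<Rightarrow> complex" and \<mu> :: complex and \<sigma> :: int
  assumes u: "decays u" and mu: "cmod \<mu> < 1" and \<sigma>: "\<bar>\<sigma>\<bar> = 1"
  obtains v where "decays v" "\<And>n. v n = u n + \<mu> * v (n + \<sigma>)"
proof -
  obtain C \<rho>0 where \<rho>0: "0 < \<rho>0" "\<rho>0 < 1" "\<And>n. cmod (u n) \<le> C * \<rho>0 ^ nat \<bar>n\<bar>"
    using u by (auto simp: decays_def)
  have C0: "C \<ge> 0" using \<rho>0(3)[of 0] by (simp) (meson norm_ge_zero order_trans)
  \<comment> \<open>A common rate that is valid for \<open>u\<close> and lies strictly above
    \<open>cmod \<mu>\<close>, so that the ratio \<open>q\<close> stays below 1.\<close>
  define \<rho> where "\<rho> = max \<rho>0 ((1 + cmod \<mu>) / 2)"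
  have \<rho>: "0 < \<rho>" "\<rho> < 1" "cmod \<mu> < \<rho>" using \<rho>0 mu by (auto simp: \<rho>_def less_max_iff_disj)
  have ub: "cmod (u n) \<le> C * \<rho> ^ nat \<bar>n\<bar>" for n
  proof -
    have "\<rho>0 ^ nat \<bar>n\<bar> \<le> \<rho> ^ nat \<bar>n\<bar>" using \<rho>0(1) by (intro power_mono) (auto simp: \<rho>_def)
    then show ?thesis using \<rho>0(3)[of n] C0 by (meson mult_left_mono order_trans)
  qed
  define q where "q = cmod \<mu> / \<rho>"
  have q: "0 \<le> q" "q < 1" using \<rho> by (auto simp: q_def)
  define t where "t n k = \<mu> ^ k * u (n + \<sigma> * int k)" for n k
  have tb: "cmod (t n k) \<le> C * \<rho> ^ nat \<bar>n\<bar> * q ^ k" for n k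
  proof -
    have "\<sigma> = 1 \<or> \<sigma> = -1" using \<sigma> by linarith
    then have "\<bar>n\<bar> \<le> \<bar>n + \<sigma> * int k\<bar> + int k" by auto
    then have "nat \<bar>n\<bar> \<le> nat \<bar>n + \<sigma> * int k\<bar> + k" by linarith
    then have "\<rho> ^ (nat \<bar>n + \<sigma> * int k\<bar> + k) \<le> \<rho> ^ nat \<bar>n\<bar>" using \<rho> by (intro power_decreasing) auto
    then have "\<rho> ^ nat \<bar>n + \<sigma> * int k\<bar> \<le> \<rho> ^ nat \<bar>n\<bar> / \<rho> ^ k" using \<rho> by (simp add: power_add field_simps)
    then have "cmod (u (n + \<sigma> * int k)) \<le> C * (\<rho> ^ nat \<bar>n\<bar> / \<rho> ^ k)"
      using ub[of "n + \<sigma> * int k"] C0 by (meson mult_left_mono order_trans)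
    then have "cmod \<mu> ^ k * cmod (u (n + \<sigma> * int k)) \<le> cmod \<mu> ^ k * (C * (\<rho> ^ nat \<bar>n\<bar> / \<rho> ^ k))"
      by (intro mult_left_mono) auto
    then show ?thesis by (simp add: t_def norm_mult norm_power q_def power_divide mult_ac)
  qed
  have gs: "summable (\<lambda>k. C * \<rho> ^ nat \<bar>n\<bar> * q ^ k)" for n
    using q by (intro summable_mult summable_geometric) auto
  have st: "summable (t n)" for n
    using summable_comparison_test'[OF gs, of 0 "t n"] tb by blast
  define v where "v n = suminf (t n)" for n
  have "cmod (v n) \<le> (C / (1 - q)) * \<rho> ^ nat \<bar>n\<bar>" for n
  proof -
    have "cmod (v n) \<le> (\<Sum>k. C * \<rho> ^ nat \<bar>n\<bar> * q ^ k)"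
      unfolding v_def by (rule norm_suminf_le[OF tb gs])
    also have "\<dots> = (C / (1 - q)) * \<rho> ^ nat \<bar>n\<bar>"
      using q by (simp add: suminf_mult suminf_geometric)
    finally show ?thesis .
  qed
  then have "decays v" using \<rho> unfolding decays_def by blast
  moreover have "v n = u n + \<mu> * v (n + \<sigma>)" for n
  proof -
    have "t n (Suc k) = \<mu> * t (n + \<sigma>) k" for k by (simp add: t_def algebra_simps)
    then have "(\<Sum>k. t n (Suc k)) = \<mu> * v (n + \<sigma>)"
      unfolding v_def using st[of "n + \<sigma>"] by (simp add: suminf_mult)
    then show ?thesis using suminf_split_head[OF st[of n]] by (simp add: v_def t_def)
  qed
  ultimately show thesis by (rule that)
qed

lemma decays_cmult: assumes "decays w" shows "decays (\<lambda>n. (c::complex) * w n)"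
proof -
  obtain C \<rho> where \<rho>: "0 < \<rho>" "\<rho> < 1" "\<And>n. cmod (w n) \<le> C * \<rho> ^ nat \<bar>n\<bar>"
    using assms by (auto simp: decays_def)
  have "cmod (c * w n) \<le> (cmod c * C) * \<rho> ^ nat \<bar>n\<bar>" for n
    using mult_left_mono[OF \<rho>(3)[of n], of "cmod c"] by (simp add: norm_mult mult_ac)
  then show ?thesis using \<rho> unfolding decays_def by blast
qed

lemma decays_shift_down: assumes "decays w" shows "decays (\<lambda>n. w (n - 1))"
proof -
  obtain C \<rho> where \<rho>: "0 < \<rho>" "\<rho> < 1" "\<And>n. norm (w n) \<le> C * \<rho> ^ nat \<bar>n\<bar>"
    using assms by (auto simp: decays_def)
  have C0: "C \<ge> 0" using \<rho>(3)[of 0] by simp (meson norm_ge_zero order_trans)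
  have "norm (w (n - 1)) \<le> (C / \<rho>) * \<rho> ^ nat \<bar>n\<bar>" for n
  proof -
    have "\<rho> ^ (nat \<bar>n - 1\<bar> + 1) \<le> \<rho> ^ nat \<bar>n\<bar>" using \<rho> by (intro power_decreasing) auto
    then have "\<rho> ^ nat \<bar>n - 1\<bar> \<le> \<rho> ^ nat \<bar>n\<bar> / \<rho>" using \<rho> by (simp add: field_simps)
    then have "C * \<rho> ^ nat \<bar>n - 1\<bar> \<le> C * (\<rho> ^ nat \<bar>n\<bar> / \<rho>)" using C0 by (rule mult_left_mono)
    then show ?thesis using \<rho>(3)[of "n - 1"] by simp
  qed
  then show ?thesis using \<rho> unfolding decays_def by blast
qed

text \<open>Roots are split off one at a time. For a root inside the unit circle the first-order
  equation is solved by a series over the past, for a root outside by a series over the future. Both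
  preserve exponential decay; on the circle neither series would converge geometrically.\<close>

lemma fundamental_solution_complex:
  fixes p :: "complex poly"
  assumes "p \<noteq> 0" "\<And>z. poly p z = 0 \<Longrightarrow> cmod z \<noteq> 1"
  shows "\<exists>w. decays w \<and> (\<forall>m. pact p w m = (if m = 0 then 1 else 0))"
  using assms
proof (induction "degree p" arbitrary: p)
  case 0
  then obtain c where c: "p = [:c:]" "c \<noteq> 0" by (metis degree_eq_zeroE pCons_0_0)
  define w where "w n = (if n = 0 then 1 / c else 0)" for n :: int
  have "norm (w n) \<le> cmod (1 / c) * (1/2) ^ nat \<bar>n\<bar>" for n by (simp add: w_def)
  moreover have "(0::real) < 1/2" "(1/2::real) < 1" by auto
  ultimately have "decays w" unfolding decays_def by blast
  moreover have "pact p w m = (if m = 0 then 1 else 0)" for m using c by (simp add: pact_def w_def)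
  ultimately show ?case by blast
next
  case (Suc d)
  obtain l where l: "poly p l = 0"
    using Suc(2) fundamental_theorem_of_algebra[of p] by (metis constant_degree nat.distinct(1))
  then obtain q where q: "p = [:- l, 1:] * q" by (metis dvdE poly_eq_0_iff_dvd)
  have q0: "q \<noteq> 0" using q Suc(3) by auto
  have "degree p = Suc (degree q)" unfolding q using q0 by (simp add: degree_mult_eq del: mult_pCons_left)
  then have "\<exists>w. decays w \<and> (\<forall>m. pact q w m = (if m = 0 then 1 else 0))"
    using Suc(1)[of q] Suc(2) q0 Suc(4) by (simp add: q)
  then obtain u where u: "decays u" "\<And>m. pact q u m = (if m = 0 then 1 else 0)" by blast
  have "\<exists>w. decays w \<and> (\<forall>n. w (n + 1) - l * w n = u n)"
  proof (cases "cmod l < 1")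
    case True
    obtain v where v: "decays v" "\<And>n. v n = u n + l * v (n + (-1))"
      using geometric_one_sided[OF u(1) True, of "-1"] by auto
    have "v ((n + 1) - 1) - l * v (n - 1) = u n" for n using v(2)[of n] by simp
    then show ?thesis using decays_shift_down[OF v(1)] by blast
  next
    case False
    then have l1: "cmod l > 1" using Suc(4)[OF l] by simp
    then have "cmod (1 / l) < 1" by (simp add: norm_divide divide_less_eq)
    then obtain v where v: "decays v" "\<And>n. v n = u n + (1 / l) * v (n + 1)"
      using geometric_one_sided[OF u(1), of "1 / l" 1] by auto
    have "(- (1 / l)) * v (n + 1) - l * ((- (1 / l)) * v n) = u n" for n
      using v(2)[of n] l1 by (auto simp: field_simps)
    then show ?thesis using decays_cmult[OF v(1), of "- (1 / l)"] by blast
  qed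
  then obtain w where w: "decays w" "\<And>n. w (n + 1) - l * w n = u n" by blast
  have "pact [:- l, 1:] w = u" using w(2) by (auto simp: pact_pCons fun_eq_iff)
  then have "pact p w m = (if m = 0 then 1 else 0)" for m
    unfolding q by (subst mult.commute) (simp only: pact_mult u(2))
  then show ?case using w(1) by blast
qed

lemma fundamental_solution_real:
  fixes f :: "int poly"
  assumes "f \<noteq> 0" "\<And>z :: complex. poly (map_poly of_int f) z = 0 \<Longrightarrow> cmod z \<noteq> 1"
  shows "\<exists>w. decays w \<and> (\<forall>m. pact (rpoly f) w m = (if m = 0 then 1 else 0))"
proof -
  have "map_poly of_int f \<noteq> (0 :: complex poly)" using assms(1) by (simp add: map_poly_eq_0_iff)
  then obtain w :: "int \<Rightarrow> complex" where w: "decays w" "\<And>m. pact (map_poly of_int f) w m = (if m = 0 then 1 else 0)"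
    using fundamental_solution_complex[of "map_poly of_int f"] assms(2) by blast
  have "norm (Re (w n)) \<le> norm (w n)" for n using abs_Re_le_cmod[of "w n"] by simp
  then have "decays (\<lambda>n. Re (w n))" using w(1) unfolding decays_def by (meson order_trans)
  moreover have "pact (rpoly f) (\<lambda>n. Re (w n)) m = Re (pact (map_poly of_int f) w m)" for m
    by (simp add: pact_def degree_map_poly coeff_map_poly)
  ultimately show ?thesis using w(2) by (intro exI[of _ "\<lambda>n. Re (w n)"]) auto
qed

section \<open>Summation over the integers\<close>

lemma summable_geometric_int:
  fixes \<rho> :: real
  assumes "0 \<le> \<rho>" "\<rho> < 1" shows "(\<lambda>n::int. \<rho> ^ nat \<bar>n\<bar>) summable_on UNIV"
proof -
  have s: "(\<lambda>n::nat. \<rho> ^ n) summable_on UNIV"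
    using assms by (intro norm_summable_imp_summable_on) simp
  have "(\<lambda>n::int. \<rho> ^ nat \<bar>n\<bar>) summable_on range int"
    by (subst summable_on_reindex) (auto simp: s o_def)
  moreover have "(\<lambda>n::int. \<rho> ^ nat \<bar>n\<bar>) summable_on range (\<lambda>n. - int n)"
    by (subst summable_on_reindex) (auto simp: s o_def inj_on_def)
  ultimately have "(\<lambda>n::int. \<rho> ^ nat \<bar>n\<bar>) summable_on (range int \<union> (range (\<lambda>n. - int n) - range int))"
    by (intro summable_on_Un_disjoint) (auto intro: summable_on_subset)
  moreover have "range int \<union> (range (\<lambda>n. - int n) - range int) = UNIV"
    using int_cases2 by (auto simp: image_iff) metis
  ultimately show ?thesis by simp
qed

lemma infsum_finite_sum:
  fixes f :: "'i \<Rightarrow> 'b \<Rightarrow> real"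
  assumes "finite I" "\<And>i. i \<in> I \<Longrightarrow> f i summable_on S"
  shows "(\<Sum>\<^sub>\<infinity>k\<in>S. \<Sum>i\<in>I. f i k) = (\<Sum>i\<in>I. \<Sum>\<^sub>\<infinity>k\<in>S. f i k)"
proof -
  have "(\<lambda>k. \<Sum>i\<in>I. f i k) summable_on S \<and> (\<Sum>\<^sub>\<infinity>k\<in>S. \<Sum>i\<in>I. f i k) = (\<Sum>i\<in>I. \<Sum>\<^sub>\<infinity>k\<in>S. f i k)"
    using assms by (induction I rule: finite_induct) (auto simp: infsum_add intro: summable_on_add)
  then show ?thesis by blast
qed

text \<open>The coefficients are indexed by a symmetric window of integers instead of by degrees, so
  that the assumptions are invariant under \<open>n \<mapsto> - n\<close>.\<close>

locale hyperbolic_kernel =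
  fixes F :: "int \<Rightarrow> int" and d :: nat and w :: "int \<Rightarrow> real" and C \<rho> :: real
  assumes F_supp: "\<And>i. F i \<noteq> 0 \<Longrightarrow> \<bar>i\<bar> \<le> int d"
    and rho: "0 < \<rho>" "\<rho> < 1"
    and w_decay: "\<And>n. \<bar>w n\<bar> \<le> C * \<rho> ^ nat \<bar>n\<bar>"
    and w_sol: "\<And>m. (\<Sum>i\<in>{- int d..int d}. of_int (F i) * w (i + m)) = (if m = 0 then 1 else 0)"
begin

text \<open>\<open>A\<close> is the convolution with the polynomial, \<open>cs\<close> the reflected convolution with its
  inverse; they invert each other on bounded sequences up to \<open>n \<mapsto> - n\<close>.\<close>
definition A :: "(int \<Rightarrow> real) \<Rightarrow> int \<Rightarrow> real" where
  "A s n = (\<Sum>i\<in>{- int d..int d}. of_int (F i) * s (n + i))"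

definition cs :: "(int \<Rightarrow> real) \<Rightarrow> int \<Rightarrow> real" where
  "cs a n = (\<Sum>\<^sub>\<infinity>k. a k * w (k + n))"

definition R :: real where "R = (\<Sum>\<^sub>\<infinity>n::int. \<rho> ^ nat \<bar>n\<bar>)"

text \<open>The summand 1 secures \<open>K > 0\<close> without a case distinction.\<close>

definition K :: real where "K = C * R + 1"

definition normF :: real where "normF = (\<Sum>i\<in>{- int d..int d}. \<bar>of_int (F i)\<bar>)"

section \<open>Estimates and inversion for the two convolutions\<close>

lemma C_nonneg: "C \<ge> 0"
  using w_decay[of 0] by simp

lemma rho_summable: "(\<lambda>n::int. \<rho> ^ nat \<bar>n\<bar>) summable_on UNIV"
  using rho by (intro summable_geometric_int) auto

lemma bij_shift: "bij (\<lambda>k::int. k + n)"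
  by (rule bij_betw_byWitness[of _ "\<lambda>k. k - n"]) auto

lemma rho_shift_summable: "(\<lambda>k::int. \<rho> ^ nat \<bar>k + n\<bar>) summable_on UNIV"
  using summable_on_reindex_bij_betw[OF bij_shift[of n], of "\<lambda>k. \<rho> ^ nat \<bar>k\<bar>"] rho_summable by simp

lemma rho_shift_infsum: "(\<Sum>\<^sub>\<infinity>k::int. \<rho> ^ nat \<bar>k + n\<bar>) = R"
  using infsum_reindex_bij_betw[OF bij_shift[of n], of "\<lambda>k. \<rho> ^ nat \<bar>k\<bar>"] by (simp add: R_def)

lemma R_nonneg: "R \<ge> 0"
  unfolding R_def using rho by (intro infsum_nonneg) auto

lemma K_pos: "K > 0"
  using C_nonneg R_nonneg by (simp add: K_def add_nonneg_pos)

lemma bdd_abs: "bdd_fun (a :: int \<Rightarrow> real) \<longleftrightarrow> (\<exists>B. \<forall>n. \<bar>a n\<bar> \<le> B)"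
  by (simp add: bdd_fun_def)

lemma w_bdd: "bdd_fun w"
proof (rule bdd_funI)
  fix n
  have "C * \<rho> ^ nat \<bar>n\<bar> \<le> C * 1" using rho C_nonneg by (intro mult_left_mono power_le_one) auto
  then show "norm (w n) \<le> C" using w_decay[of n] by simp
qed

lemma cs_summable:
  assumes "bdd_fun a" shows "(\<lambda>k. a k * w (k + n)) summable_on UNIV"
proof -
  obtain B where B: "\<And>k. \<bar>a k\<bar> \<le> B" using assms by (auto simp: bdd_abs)
  then have "B \<ge> 0" by (meson abs_ge_zero order_trans)
  have "(\<lambda>k. B * C * \<rho> ^ nat \<bar>k + n\<bar>) summable_on UNIV"
    by (intro summable_on_cmult_right rho_shift_summable)
  moreover have "norm (a k * w (k + n)) \<le> B * C * \<rho> ^ nat \<bar>k + n\<bar>" for k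
    using mult_mono[OF B[of k] w_decay[of "k + n"] \<open>B \<ge> 0\<close>] by (simp add: abs_mult mult_ac)
  ultimately show ?thesis
    by (rule abs_summable_summable[OF Infinite_Sum.abs_summable_on_comparison_test'])
qed

text \<open>Every index \<open>k\<close> that contributes satisfies
  \<open>k + n \<ge> p + n \<ge> 0\<close>, so a factor \<open>\<rho> ^ nat (p + n)\<close> can be
  taken out and a full geometric series remains.\<close>

lemma cs_estimate:
  assumes B: "\<And>k. \<bar>a k\<bar> \<le> B" and p: "\<And>k. k < p \<Longrightarrow> a k = 0" and pn: "p + n \<ge> 0"
  shows "\<bar>cs a n\<bar> \<le> B * K * \<rho> ^ nat (p + n)"
proof -
  have B0: "B \<ge> 0" using B by (meson abs_ge_zero order_trans)
  define e where "e = \<rho> ^ nat (p + n)"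
  have e0: "e \<ge> 0" using rho by (simp add: e_def)
  have bnd: "norm (a k * w (k + n)) \<le> (B * C * e) * \<rho> ^ nat \<bar>k + - p\<bar>" for k
  proof (cases "k < p")
    case True
    then show ?thesis using p B0 C_nonneg e0 rho by simp
  next
    case False
    then have "nat \<bar>k + n\<bar> = nat (p + n) + nat \<bar>k + - p\<bar>" using pn by auto
    then have "\<rho> ^ nat \<bar>k + n\<bar> = e * \<rho> ^ nat \<bar>k + - p\<bar>" by (simp add: e_def power_add)
    then show ?thesis
      using mult_mono[OF B[of k] w_decay[of "k + n"] B0] by (simp add: abs_mult mult_ac)
  qed
  have sm: "(\<lambda>k. (B * C * e) * \<rho> ^ nat \<bar>k + - p\<bar>) summable_on UNIV"
    by (intro summable_on_cmult_right rho_shift_summable)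
  have "norm (cs a n) \<le> (\<Sum>\<^sub>\<infinity>k. (B * C * e) * \<rho> ^ nat \<bar>k + - p\<bar>)"
    unfolding cs_def
    by (rule norm_infsum_le[OF has_sum_infsum[OF cs_summable] has_sum_infsum[OF sm] bnd])
       (use B in \<open>auto simp: bdd_abs\<close>)
  also have "\<dots> = (B * C * e) * R"
    using rho_shift_infsum[of "- p"] rho_shift_summable[of "- p"] by (subst infsum_cmult_right) auto
  also have "\<dots> \<le> B * K * e" using B0 e0 by (simp add: K_def algebra_simps)
  finally show ?thesis by (simp add: e_def)
qed

lemma cs_bound:
  assumes B: "\<And>k. \<bar>a k\<bar> \<le> B" shows "\<bar>cs a n\<bar> \<le> B * K"
proof -
  have B0: "B \<ge> 0" using B by (meson abs_ge_zero order_trans)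
  have bnd: "norm (a k * w (k + n)) \<le> (B * C) * \<rho> ^ nat \<bar>k + n\<bar>" for k
    using mult_mono[OF B[of k] w_decay[of "k + n"] B0] by (simp add: abs_mult mult_ac)
  have sm: "(\<lambda>k. (B * C) * \<rho> ^ nat \<bar>k + n\<bar>) summable_on UNIV"
    by (intro summable_on_cmult_right rho_shift_summable)
  have "norm (cs a n) \<le> (\<Sum>\<^sub>\<infinity>k. (B * C) * \<rho> ^ nat \<bar>k + n\<bar>)"
    unfolding cs_def
    by (rule norm_infsum_le[OF has_sum_infsum[OF cs_summable] has_sum_infsum[OF sm] bnd])
       (use B in \<open>auto simp: bdd_abs\<close>)
  also have "\<dots> = (B * C) * R"
    using rho_shift_infsum[of n] rho_shift_summable[of n] by (subst infsum_cmult_right) auto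
  also have "\<dots> \<le> B * K" using B0 by (simp add: K_def algebra_simps)
  finally show ?thesis by simp
qed

lemma cs_add: "bdd_fun a \<Longrightarrow> bdd_fun b \<Longrightarrow> cs (\<lambda>k. a k + b k) n = cs a n + cs b n"
  unfolding cs_def distrib_right by (intro infsum_add cs_summable)

lemma A_bound:
  assumes "\<And>n. \<bar>s n\<bar> \<le> B" shows "\<bar>A s n\<bar> \<le> normF * B"
proof -
  have "\<bar>A s n\<bar> \<le> (\<Sum>i\<in>{- int d..int d}. \<bar>of_int (F i) * s (n + i)\<bar>)" unfolding A_def by (rule sum_abs)
  also have "\<dots> \<le> (\<Sum>i\<in>{- int d..int d}. \<bar>of_int (F i)\<bar> * B)"
    using assms by (intro sum_mono) (simp add: abs_mult mult_left_mono)
  finally show ?thesis by (simp add: normF_def sum_distrib_right)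
qed

lemma A_local_bound:
  assumes "\<And>i. \<bar>i\<bar> \<le> int d \<Longrightarrow> \<bar>s (n + i)\<bar> \<le> B" shows "\<bar>A s n\<bar> \<le> normF * B"
proof -
  have "\<bar>A s n\<bar> \<le> (\<Sum>i\<in>{- int d..int d}. \<bar>of_int (F i) * s (n + i)\<bar>)" unfolding A_def by (rule sum_abs)
  also have "\<dots> \<le> (\<Sum>i\<in>{- int d..int d}. \<bar>of_int (F i)\<bar> * B)"
    using assms by (intro sum_mono) (auto simp: abs_mult intro!: mult_left_mono)
  finally show ?thesis by (simp add: normF_def sum_distrib_right)
qed

lemma A_bdd: "bdd_fun s \<Longrightarrow> bdd_fun (A s)"
  using A_bound unfolding bdd_abs by meson

text \<open>Exchanging the finite sum with the series leaves the defining equation of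
  \<open>w\<close>, which selects the index \<open>k = - n\<close>.\<close>

lemma A_cs: assumes "bdd_fun a" shows "A (cs a) n = a (- n)"
proof -
  have "A (cs a) n = (\<Sum>i\<in>{- int d..int d}. \<Sum>\<^sub>\<infinity>k. of_int (F i) * (a k * w (k + (n + i))))"
    unfolding A_def cs_def using cs_summable[OF assms] by (intro sum.cong refl infsum_cmult_right[symmetric])
  also have "\<dots> = (\<Sum>\<^sub>\<infinity>k. \<Sum>i\<in>{- int d..int d}. of_int (F i) * (a k * w (k + (n + i))))"
    using cs_summable[OF assms] by (intro infsum_finite_sum[symmetric] summable_on_cmult_right) auto
  also have "\<dots> = (\<Sum>\<^sub>\<infinity>k. a k * (if k + n = 0 then 1 else 0))"
  proof (intro infsum_cong)
    fix k
    have "(\<Sum>i\<in>{- int d..int d}. of_int (F i) * (a k * w (k + (n + i))))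
      = a k * (\<Sum>i\<in>{- int d..int d}. of_int (F i) * w (i + (k + n)))"
      by (simp add: sum_distrib_left algebra_simps)
    then show "(\<Sum>i\<in>{- int d..int d}. of_int (F i) * (a k * w (k + (n + i)))) = a k * (if k + n = 0 then 1 else 0)"
      by (simp add: w_sol)
  qed
  also have "\<dots> = (\<Sum>\<^sub>\<infinity>k\<in>{- n}. a k)"
    by (rule infsum_cong_neutral) auto
  finally show ?thesis by simp
qed

text \<open>The shifts of the finite convolution are moved from \<open>s\<close> to
  \<open>w\<close>; then the other inversion formula applies to \<open>s\<close> read
  backwards.\<close>

lemma cs_A: assumes "bdd_fun s" shows "cs (\<lambda>k. A s (- k)) n = s n"
proof -
  have bs: "bdd_fun (\<lambda>k. s (- k))" using assms by (rule bdd_fun_comp)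
  have sm: "(\<lambda>k. of_int (F i) * (s (- k + i) * w (k + n))) summable_on UNIV" for i
    using cs_summable[OF bdd_fun_comp[OF assms, of "\<lambda>k. - k + i"], of n] by (rule summable_on_cmult_right)
  have "cs (\<lambda>k. A s (- k)) n = (\<Sum>\<^sub>\<infinity>k. \<Sum>i\<in>{- int d..int d}. of_int (F i) * (s (- k + i) * w (k + n)))"
    by (simp add: cs_def A_def sum_distrib_right mult.assoc)
  also have "\<dots> = (\<Sum>i\<in>{- int d..int d}. \<Sum>\<^sub>\<infinity>k. of_int (F i) * (s (- k + i) * w (k + n)))"
    using sm by (intro infsum_finite_sum) auto
  also have "\<dots> = (\<Sum>i\<in>{- int d..int d}. \<Sum>\<^sub>\<infinity>k. of_int (F i) * (s (- k) * w (k + (n + i))))"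
  proof (intro sum.cong refl)
    fix i
    show "(\<Sum>\<^sub>\<infinity>k. of_int (F i) * (s (- k + i) * w (k + n))) = (\<Sum>\<^sub>\<infinity>k. of_int (F i) * (s (- k) * w (k + (n + i))))"
      using infsum_reindex_bij_betw[OF bij_shift[of i], of "\<lambda>k. of_int (F i) * (s (- k + i) * w (k + n))"]
      by (simp add: algebra_simps)
  qed
  also have "\<dots> = A (cs (\<lambda>k. s (- k))) n"
    unfolding A_def cs_def using cs_summable[OF bs] by (intro sum.cong refl infsum_cmult_right)
  also have "\<dots> = s n" using A_cs[OF bs] by simp
  finally show ?thesis .
qed

text \<open>Uniqueness of bounded solutions. This is what will identify \<open>w\<close> with
  \<open>fund_sol\<close>.\<close>

lemma A_inj: assumes "bdd_fun s" "bdd_fun t" "\<And>n. A s n = A t n" shows "s = t"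
  using cs_A[OF assms(1)] cs_A[OF assms(2)] assms(3) by (metis ext)

lemma reflected: "hyperbolic_kernel (\<lambda>i. F (- i)) d (\<lambda>n. w (- n)) C \<rho>"
proof
  show "\<bar>i\<bar> \<le> int d" if "F (- i) \<noteq> 0" for i using F_supp[OF that] by simp
  show "\<bar>w (- n)\<bar> \<le> C * \<rho> ^ nat \<bar>n\<bar>" for n using w_decay[of "- n"] by simp
  fix m
  have "(\<Sum>i\<in>{- int d..int d}. of_int (F (- i)) * w (- (i + m))) = (\<Sum>i\<in>{- int d..int d}. of_int (F i) * w (i + - m))"
    by (rule sum.reindex_bij_witness[of _ uminus uminus]) (auto simp: algebra_simps)
  then show "(\<Sum>i\<in>{- int d..int d}. of_int (F (- i)) * w (- (i + m))) = (if m = 0 then 1 else 0)"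
    unfolding w_sol by simp
qed (use rho in auto)

end

section \<open>Digit expansions\<close>

lemma norm_cis_diff_1: "cmod (cis (2 * pi * s) - 1) = 2 * \<bar>sin (pi * s)\<bar>"
  using dist_exp_i_1[of "2 * pi * s"] by (simp add: cis_conv_exp)

lemma norm_cis_diff_1_le: "cmod (cis (2 * pi * s) - 1) \<le> 2 * pi * \<bar>s\<bar>"
  using abs_sin_x_le_abs_x[of "pi * s"] by (simp add: norm_cis_diff_1 abs_mult)

text \<open>For lifts in \<open>[-1/2, 1/2]\<close> the chord length, twice the sine of
  \<open>pi * \<bar>s\<bar>\<close>, increases with \<open>\<bar>s\<bar>\<close>; a short chord
  therefore bounds the lift.\<close>

lemma small_angle:
  assumes "0 < \<eta>" "\<eta> \<le> 1 / 2" "\<bar>s\<bar> \<le> 1 / 2" "cmod (cis (2 * pi * s) - 1) < 2 * sin (pi * \<eta>)"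
  shows "\<bar>s\<bar> < \<eta>"
proof (rule ccontr)
  assume "\<not> \<bar>s\<bar> < \<eta>"
  then have "pi * \<eta> \<le> pi * \<bar>s\<bar>" by simp
  moreover have "pi * \<bar>s\<bar> \<le> pi / 2" "- (pi / 2) \<le> pi * \<eta>" using assms by (auto simp: field_simps intro: order_trans[of _ 0])
  ultimately have "sin (pi * \<eta>) \<le> sin (pi * \<bar>s\<bar>)" by (intro sin_monotone_2pi_le) auto
  also have "sin (pi * \<bar>s\<bar>) \<le> \<bar>sin (pi * s)\<bar>" by (cases "s \<ge> 0") auto
  finally show False using assms(4) by (simp add: norm_cis_diff_1)
qed

section \<open>Bounded integer sequences\<close>

definition ri :: "(int \<Rightarrow> int) \<Rightarrow> int \<Rightarrow> real" where
  "ri a = (\<lambda>k. of_int (a k))"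

lemma ri_simps [simp]: "ri (\<lambda>k. a k + b k) = (\<lambda>k. ri a k + ri b k)"
    "ri (\<lambda>k. a k - b k) = (\<lambda>k. ri a k - ri b k)" "ri (\<lambda>k. - a k) = (\<lambda>k. - ri a k)"
    "ri (\<lambda>_. 0) = (\<lambda>_. 0)"
  by (auto simp: ri_def)

definition bounded_seq :: "(int \<Rightarrow> int) \<Rightarrow> bool" where
  "bounded_seq a \<longleftrightarrow> (\<exists>N. \<forall>k. \<bar>a k\<bar> \<le> N)"

lemma bounded_seq_ri: "bounded_seq a \<Longrightarrow> bdd_fun (ri a)"
  unfolding bounded_seq_def bdd_fun_def ri_def by (metis of_int_abs of_int_le_iff real_norm_def)

lemma bdiI: "(\<And>k. \<bar>a k\<bar> \<le> N) \<Longrightarrow> bounded_seq a"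
  by (auto simp: bounded_seq_def)

lemma bounded_seq_add [intro]: assumes "bounded_seq a" "bounded_seq b" shows "bounded_seq (\<lambda>k. a k + b k)"
proof -
  obtain M N where "\<And>k. \<bar>a k\<bar> \<le> M" "\<And>k. \<bar>b k\<bar> \<le> N" using assms by (auto simp: bounded_seq_def)
  then have "\<bar>a k + b k\<bar> \<le> M + N" for k by (meson abs_triangle_ineq add_mono order_trans)
  then show ?thesis by (rule bdiI)
qed

lemma bounded_seq_uminus [intro]: "bounded_seq a \<Longrightarrow> bounded_seq (\<lambda>k. - a k)"
  by (simp add: bounded_seq_def)

lemma bounded_seq_diff [intro]: assumes "bounded_seq a" "bounded_seq b" shows "bounded_seq (\<lambda>k. a k - b k)"
  using bounded_seq_add[OF assms(1) bounded_seq_uminus[OF assms(2)]] by simp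

lemma Bplus_bounded_seq: "a \<in> Bplus N k \<Longrightarrow> bounded_seq a"
  by (auto simp: Bplus_def bounded_seq_def)

lemma Bplus_mono: "N \<le> N' \<Longrightarrow> k \<le> k' \<Longrightarrow> Bplus N k \<subseteq> Bplus N' k'"
proof
  fix a assume a: "a \<in> Bplus N k" and N: "N \<le> N'" and k: "k \<le> k'"
  have "\<bar>a i\<bar> \<le> int N'" for i using a N unfolding Bplus_def by (auto intro: order_trans[of _ "int N"])
  moreover have "a i = 0" if "i < - int k'" for i using a k that unfolding Bplus_def by auto
  ultimately show "a \<in> Bplus N' k'" by (simp add: Bplus_def)
qed

lemma Bplus_add: "a \<in> Bplus M k \<Longrightarrow> b \<in> Bplus N l \<Longrightarrow> (\<lambda>i. a i + b i) \<in> Bplus (M + N) (max k l)"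
  unfolding Bplus_def by (auto intro: order_trans[OF abs_triangle_ineq add_mono])

text \<open>The map \<open>E\<close> gives the coordinates of a point, and the last two assumptions
  say that a real sequence lifts a point exactly when its convolution with \<open>F\<close> is
  integral. The locale asks for no topology on the group, and reversing the index gives another
  instance.\<close>

locale kernel_group = hyperbolic_kernel F d w C \<rho>
  for F d w C \<rho> +
  fixes E :: "'g::ab_group_add \<Rightarrow> int \<Rightarrow> complex"
  assumes E_add: "E (g + h) n = E g n * E h n"
    and E_norm [simp]: "cmod (E g n) = 1"
    and E_inj: "(\<And>n. E g n = E h n) \<Longrightarrow> g = h"
    and E_onto: "(\<And>n. A s n \<in> \<int>) \<Longrightarrow> \<exists>g. \<forall>n. E g n = cis (2 * pi * s n)"
    and E_lift: "(\<And>n. E g n = cis (2 * pi * s n)) \<Longrightarrow> A s n \<in> \<int>"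
begin

lemma reflected_group: "kernel_group (\<lambda>i. F (- i)) d (\<lambda>n. w (- n)) C \<rho> (\<lambda>g n. E g (- n))"
proof -
  interpret r: hyperbolic_kernel "\<lambda>i. F (- i)" d "\<lambda>n. w (- n)" C \<rho> by (rule reflected)
  have rA: "r.A s n = A (\<lambda>n. s (- n)) (- n)" for s n
    unfolding A_def r.A_def
    by (rule sum.reindex_bij_witness[of _ uminus uminus]) (auto simp: algebra_simps)
  show ?thesis
  proof
    show "\<exists>g. \<forall>n. E g (- n) = cis (2 * pi * s n)" if "\<And>n. r.A s n \<in> \<int>" for s
    proof -
      have "A (\<lambda>n. s (- n)) n \<in> \<int>" for n using that[of "- n"] by (simp add: rA)
      then obtain g where "\<forall>n. E g n = cis (2 * pi * s (- n))" using E_onto by blast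
      then show ?thesis by (metis minus_minus)
    qed
    show "r.A s n \<in> \<int>" if "\<And>n. E g (- n) = cis (2 * pi * s n)" for g s n
      unfolding rA by (rule E_lift[of g]) (metis that minus_minus)
    show "g = h" if "\<And>n. E g (- n) = E h (- n)" for g h
      by (rule E_inj) (metis that minus_minus)
  qed (auto simp: E_add)
qed

lemma reflected_cs:
  "hyperbolic_kernel.cs (\<lambda>n. w (- n)) a n = cs (\<lambda>k. a (- k)) (- n)"
proof -
  interpret r: hyperbolic_kernel "\<lambda>i. F (- i)" d "\<lambda>n. w (- n)" C \<rho> by (rule reflected)
  have "bij (uminus :: int \<Rightarrow> int)" by (rule bij_uminus)
  from infsum_reindex_bij_betw[OF this, of "\<lambda>k. a (- k) * w (k + - n)"]
  show ?thesis unfolding cs_def r.cs_def by (simp add: algebra_simps)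
qed

section \<open>Points represented by bounded digits\<close>

definition \<theta> :: "(int \<Rightarrow> int) \<Rightarrow> 'g" where
  "\<theta> a = (THE g. \<forall>n. E g n = cis (2 * pi * cs (ri a) n))"

lemma E_0 [simp]: "E 0 n = 1"
  using E_add[of 0 0 n] E_norm[of 0 n] by (metis add.right_neutral mult_cancel_right1 norm_zero zero_neq_one)

lemma E_nonzero [simp]: "E g n \<noteq> 0"
  using E_norm[of g n] by (metis norm_zero zero_neq_one)

lemma E_uminus: "E (- g) n = inverse (E g n)"
proof -
  have "E g n * E (- g) n = 1" using E_add[of g "- g" n] by simp
  from inverse_unique[OF this] show ?thesis by simp
qed

lemma E_diff: "E (g - h) n = E g n / E h n"
  using E_add[of g "- h" n] by (simp add: E_uminus divide_inverse)

lemma E_dist: "cmod (E g n - E h n) = cmod (E (g - h) n - 1)"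
proof -
  have "E g n - E h n = (E (g - h) n - 1) * E h n" by (simp add: E_diff field_simps)
  then show ?thesis by (simp add: norm_mult)
qed

lemma \<theta>_eqI: "(\<And>n. E g n = cis (2 * pi * cs (ri a) n)) \<Longrightarrow> \<theta> a = g"
  unfolding \<theta>_def by (rule the_equality) (auto intro: E_inj)

lemma E_\<theta>: assumes "bounded_seq a" shows "E (\<theta> a) n = cis (2 * pi * cs (ri a) n)"
proof -
  have "A (cs (ri a)) n \<in> \<int>" for n unfolding A_cs[OF bounded_seq_ri[OF assms]] by (simp add: ri_def)
  then obtain g where "\<And>n. E g n = cis (2 * pi * cs (ri a) n)" using E_onto by blast
  with \<theta>_eqI[OF this] show ?thesis by simp
qed

lemma \<theta>_add: assumes "bounded_seq a" "bounded_seq b" shows "\<theta> (\<lambda>k. a k + b k) = \<theta> a + \<theta> b"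
  by (rule \<theta>_eqI) (simp add: E_add E_\<theta> assms cs_add bounded_seq_ri cis_mult distrib_left)

lemma \<theta>_0 [simp]: "\<theta> (\<lambda>_. 0) = 0"
  by (rule \<theta>_eqI) (simp add: cs_def)

lemma \<theta>_uminus: assumes "bounded_seq a" shows "\<theta> (\<lambda>k. - a k) = - \<theta> a"
  using \<theta>_add[OF assms bounded_seq_uminus[OF assms]] by (simp add: minus_unique)

lemma \<theta>_diff: assumes "bounded_seq a" "bounded_seq b" shows "\<theta> (\<lambda>k. a k - b k) = \<theta> a - \<theta> b"
  using \<theta>_add[OF assms(1) bounded_seq_uminus[OF assms(2)]] \<theta>_uminus[OF assms(2)] by simp

lemma \<theta>_eq_0_iff: assumes "bounded_seq a" shows "\<theta> a = 0 \<longleftrightarrow> (\<forall>n. cs (ri a) n \<in> \<int>)"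
proof
  assume "\<theta> a = 0"
  then show "\<forall>n. cs (ri a) n \<in> \<int>" using E_\<theta>[OF assms] by (simp flip: cis_2pi_eq_1_iff)
next
  assume "\<forall>n. cs (ri a) n \<in> \<int>"
  then show "\<theta> a = 0" by (intro \<theta>_eqI) (simp add: cis_2pi_eq_1_iff)
qed

lemma \<theta>_eq_iff:
  assumes "bounded_seq a" "bounded_seq b" shows "\<theta> a = \<theta> b \<longleftrightarrow> (\<forall>n. cs (ri (\<lambda>k. a k - b k)) n \<in> \<int>)"
  using \<theta>_eq_0_iff[OF bounded_seq_diff[OF assms]] \<theta>_diff[OF assms] by simp

text \<open>Lifting all coordinates to \<open>[-1/2, 1/2]\<close> gives digits bounded by \<open>normF / 2\<close>; coordinates
  below \<open>\<eta>0\<close> on a window force the digit there to vanish, because it is an integer of modulus less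
  than 1.\<close>
definition N0 :: nat where "N0 = nat \<lceil>normF / 2\<rceil>"

definition \<eta>0 :: real where "\<eta>0 = 1 / (2 * (normF + 1))"

definition \<delta>0 :: real where "\<delta>0 = 2 * sin (pi * \<eta>0)"

lemma normF_nonneg: "normF \<ge> 0"
  unfolding normF_def by (intro sum_nonneg) auto

lemma \<eta>0: "0 < \<eta>0" "\<eta>0 \<le> 1 / 2" "normF * \<eta>0 < 1"
  using normF_nonneg by (auto simp: \<eta>0_def field_simps)

lemma \<delta>0_pos: "\<delta>0 > 0"
  unfolding \<delta>0_def using \<eta>0 by (auto intro!: sin_gt_zero simp: field_simps)

text \<open>Digits are read off from any bounded lift by applying the polynomial; being a lift makes
  the result integral, and convolution with \<open>w\<close> recovers the lift.\<close>

lemma lift_rep: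
  assumes s: "bdd_fun s" "\<And>n. E g n = cis (2 * pi * s n)"
  shows "\<exists>a. bounded_seq a \<and> \<theta> a = g \<and> cs (ri a) = s \<and> (\<forall>n. ri a n = A s (- n))"
proof -
  define a where "a n = \<lfloor>A s (- n)\<rfloor>" for n
  have ra: "ri a n = A s (- n)" for n
    using E_lift[OF s(2), of "- n"] by (simp add: ri_def a_def)
  have "bdd_fun (ri a)" using bdd_fun_comp[OF A_bdd[OF s(1)], of uminus] by (simp add: ra[abs_def])
  then obtain B where B: "\<And>n. \<bar>ri a n\<bar> \<le> B" by (auto simp: bdd_abs)
  have "\<bar>a n\<bar> \<le> \<lfloor>B\<rfloor>" for n using B[of n] by (simp add: ri_def le_floor_iff)
  then have b: "bounded_seq a" by (rule bdiI)
  have "ri a = (\<lambda>n. A s (- n))" using ra by blast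
  then have cs: "cs (ri a) = s" using cs_A[OF s(1)] by auto
  have "\<theta> a = g" by (rule \<theta>_eqI) (simp add: cs s)
  then show ?thesis using b cs ra by blast
qed

lemma bounded_rep:
  "\<exists>a. (\<forall>k. \<bar>a k\<bar> \<le> int N0) \<and> \<theta> a = g \<and>
     (\<forall>n. (\<forall>m. \<bar>m - n\<bar> \<le> int d \<longrightarrow> cmod (E g m - 1) < \<delta>0) \<longrightarrow> a (- n) = 0)"
proof -
  define s where "s n = Arg (E g n) / (2 * pi)" for n
  have Es: "E g n = cis (2 * pi * s n)" for n
    using cis_Arg[of "E g n"] by (simp add: s_def sgn_eq)
  have s12: "\<bar>s n\<bar> \<le> 1 / 2" for n
    using Arg_bounded[of "E g n"] pi_gt_zero by (auto simp: s_def abs_le_iff field_simps)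
  then have "bdd_fun s" by (intro bdd_funI[of _ "1 / 2"]) simp
  then obtain a where a: "bounded_seq a" "\<theta> a = g" "\<And>n. ri a n = A s (- n)" using lift_rep[OF _ Es] by blast
  have "\<bar>a k\<bar> \<le> int N0" for k
  proof -
    have "\<bar>ri a k\<bar> \<le> normF * (1 / 2)" unfolding a(3) by (rule A_bound) (rule s12)
    then have "real_of_int \<bar>a k\<bar> \<le> normF / 2" by (simp add: ri_def)
    then have "\<bar>a k\<bar> \<le> \<lceil>normF / 2\<rceil>" by linarith
    then show ?thesis using normF_nonneg by (simp add: N0_def)
  qed
  moreover have "a (- n) = 0" if "\<And>m. \<bar>m - n\<bar> \<le> int d \<Longrightarrow> cmod (E g m - 1) < \<delta>0" for n
  proof -
    have "\<bar>A s n\<bar> \<le> normF * \<eta>0"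
    proof (rule A_local_bound)
      fix i assume "\<bar>i\<bar> \<le> int d"
      then have "cmod (cis (2 * pi * s (n + i)) - 1) < 2 * sin (pi * \<eta>0)"
        using that[of "n + i"] by (simp add: Es \<delta>0_def)
      then show "\<bar>s (n + i)\<bar> \<le> \<eta>0" using small_angle[OF \<eta>0(1,2) s12] by (meson less_imp_le)
    qed
    then have "\<bar>ri a (- n)\<bar> < 1" using a(3)[of "- n"] \<eta>0(3) by simp
    then show ?thesis by (simp add: ri_def)
  qed
  ultimately show ?thesis using a by blast
qed

lemma \<theta>_surj_bounded: "\<exists>a. (\<forall>k. \<bar>a k\<bar> \<le> int N0) \<and> \<theta> a = g"
  using bounded_rep by blast

text \<open>The digit at \<open>- n\<close> depends on the coordinates within distance
  \<open>d\<close> of \<open>n\<close>, hence the loss of \<open>d\<close> in the support.\<close>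

lemma tail_rep:
  assumes "\<And>m. m \<ge> l \<Longrightarrow> cmod (E g m - 1) < \<delta>0"
  shows "\<exists>a. (\<forall>k. \<bar>a k\<bar> \<le> int N0) \<and> \<theta> a = g \<and> (\<forall>i. i \<le> - l - int d \<longrightarrow> a i = 0)"
proof -
  obtain a where a: "\<And>k. \<bar>a k\<bar> \<le> int N0" "\<theta> a = g"
     "\<And>n. (\<And>m. \<bar>m - n\<bar> \<le> int d \<Longrightarrow> cmod (E g m - 1) < \<delta>0) \<Longrightarrow> a (- n) = 0" using bounded_rep by metis
  have "a i = 0" if "i \<le> - l - int d" for i
    using a(3)[of "- i"] assms that by force
  then show ?thesis using a by blast
qed

text \<open>Defined through coordinates, as no topology is available here; \<open>stable_grp\<close>
  is identified with it later.\<close>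

definition stable :: "'g set" where
  "stable = {g. (\<lambda>n. E g (int n)) \<longlonglongrightarrow> 1}"

lemma stable_0: "0 \<in> stable"
  by (simp add: stable_def)

lemma stable_add: "g \<in> stable \<Longrightarrow> h \<in> stable \<Longrightarrow> g + h \<in> stable"
  unfolding stable_def using tendsto_mult[of "\<lambda>n. E g (int n)" 1 sequentially "\<lambda>n. E h (int n)" 1] by (simp add: E_add)

lemma stable_uminus: "g \<in> stable \<Longrightarrow> - g \<in> stable"
  unfolding stable_def using tendsto_inverse[of "\<lambda>n. E g (int n)" 1 sequentially] by (simp add: E_uminus)

text \<open>Coordinates near 1 from some index on force all digits far to the left to
  vanish.\<close>

lemma stable_rep:
  assumes "g \<in> stable" shows "\<exists>k. \<exists>a\<in>Bplus N0 k. \<theta> a = g"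
proof -
  have "\<forall>\<^sub>F n in sequentially. dist (E g (int n)) 1 < \<delta>0"
    using assms \<delta>0_pos unfolding stable_def by (simp add: tendsto_iff)
  then obtain l where l: "\<And>n. n \<ge> l \<Longrightarrow> cmod (E g (int n) - 1) < \<delta>0"
    by (auto simp: eventually_sequentially dist_norm)
  have "cmod (E g m - 1) < \<delta>0" if "m \<ge> int l" for m using l[of "nat m"] that by simp
  then obtain a where a: "\<And>k. \<bar>a k\<bar> \<le> int N0" "\<theta> a = g" "\<And>i. i \<le> - int l - int d \<Longrightarrow> a i = 0"
    using tail_rep by metis
  then have "a \<in> Bplus N0 (l + d)" by (auto simp: Bplus_def)
  then show ?thesis using a by blast
qed

lemma coord_estimate:
  assumes a: "a \<in> Bplus M k" and n: "n \<ge> int k"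
  shows "\<bar>cs (ri a) n\<bar> \<le> real M * K * \<rho> ^ nat (n - int k)"
proof -
  have "\<bar>ri a i\<bar> \<le> real M" for i using a unfolding Bplus_def ri_def by simp (metis of_int_abs of_int_le_iff of_int_of_nat_eq)
  moreover have "ri a i = 0" if "i < - int k" for i using a that by (simp add: Bplus_def ri_def)
  ultimately show ?thesis using cs_estimate[of "ri a" "real M" "- int k" n] n by simp
qed

lemma \<theta>_Bplus_stable:
  assumes a: "a \<in> Bplus M k" shows "\<theta> a \<in> stable"
proof -
  have "(\<lambda>n. cs (ri a) (int n)) \<longlonglongrightarrow> 0"
  proof (rule Lim_null_comparison)
    show "\<forall>\<^sub>F n in sequentially. norm (cs (ri a) (int n)) \<le> real M * K * \<rho> ^ (n - k)"
    proof (rule eventually_sequentiallyI[of k])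
      fix n assume "k \<le> n"
      then show "norm (cs (ri a) (int n)) \<le> real M * K * \<rho> ^ (n - k)"
        using coord_estimate[OF a, of "int n"] by (simp add: nat_diff_distrib)
    qed
    have "(\<lambda>n. \<rho> ^ n) \<longlonglongrightarrow> 0" using rho by (intro LIMSEQ_power_zero) auto
    then have "(\<lambda>n. \<rho> ^ (n - k)) \<longlonglongrightarrow> 0" by (intro LIMSEQ_offset[of "\<lambda>n. \<rho> ^ (n - k)" k]) simp
    from tendsto_mult_left[OF this, of "real M * K"]
    show "(\<lambda>n. real M * K * \<rho> ^ (n - k)) \<longlonglongrightarrow> 0" by simp
  qed
  then have "(\<lambda>n. cis (2 * pi * cs (ri a) (int n))) \<longlonglongrightarrow> cis (2 * pi * 0)"
    unfolding cis_conv_exp by (intro tendsto_intros)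
  then show ?thesis by (simp add: stable_def E_\<theta>[OF Bplus_bounded_seq[OF a]])
qed

lemma image_Bplus_N0: "\<theta> ` (\<Union>k. Bplus N0 k) = stable"
  using stable_rep \<theta>_Bplus_stable by blast

text \<open>If two digit sequences represent the same point and one of them vanishes on a long block, then
  two windows of their integral difference on that block agree, and the part in between can be cut
  out of the other sequence.\<close>
lemma splice:
  "\<exists>m. \<forall>k. \<forall>a\<in>Bplus M k. (\<exists>j. \<theta> a \<in> \<theta> ` Bplus N j) \<longrightarrow> \<theta> a \<in> \<theta> ` Bplus N (k + m)"
proof -
  define B where "B = \<lceil>real (N + M) * K\<rceil>"
  \<comment> \<open>Windows have length \<open>2 * d\<close> because \<open>A\<close> reads
    \<open>d\<close> entries on either side. Their entries are bounded integers, so there are only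
    finitely many windows.\<close>
  define \<W> where "\<W> = PiE {..<2 * d} (\<lambda>_. {- B..B})"
  have fW: "finite \<W>" unfolding \<W>_def by (intro finite_PiE) auto
  \<comment> \<open>Room for \<open>card \<W> + 1\<close> window positions beyond \<open>k\<close>,
    and a margin \<open>d\<close> at the far end.\<close>
  define m where "m = Suc (card \<W>) + d"
  have "\<theta> a \<in> \<theta> ` Bplus N (k + m)" if a: "a \<in> Bplus M k" and ex: "\<exists>j. \<theta> a \<in> \<theta> ` Bplus N j" for a k
  proof (rule ccontr)
    assume neg: "\<theta> a \<notin> \<theta> ` Bplus N (k + m)"
    \<comment> \<open>The shortest possible support leads to a contradiction: removing a block of
      length \<open>L\<close> shortens it.\<close>
    define j where "j = (LEAST j. \<theta> a \<in> \<theta> ` Bplus N j)"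
    have j: "\<theta> a \<in> \<theta> ` Bplus N j" unfolding j_def using ex by (rule LeastI_ex)
    have jmin: "\<theta> a \<notin> \<theta> ` Bplus N i" if "i < j" for i using not_less_Least that unfolding j_def by blast
    have jk: "j > k + m"
    proof (rule ccontr)
      assume "\<not> j > k + m"
      then have "Bplus N j \<subseteq> Bplus N (k + m)" by (intro Bplus_mono) auto
      then show False using j neg by blast
    qed
    obtain a' where a': "a' \<in> Bplus N j" "\<theta> a' = \<theta> a" using j by (metis imageE)
    define c where "c = (\<lambda>i. a' i - a i)"
    have bc: "bounded_seq c" unfolding c_def using a' a Bplus_bounded_seq by blast
    have "cs (ri c) n \<in> \<int>" for n
      using \<theta>_eq_iff[OF Bplus_bounded_seq[OF a'(1)] Bplus_bounded_seq[OF a]] a'(2) by (simp add: c_def)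
    then obtain h where h: "\<And>n. cs (ri c) n = of_int (h n)" unfolding Ints_def image_def by simp metis
    have c_bound: "\<bar>ri c i\<bar> \<le> real (N + M)" for i
    proof -
      have "\<bar>a' i\<bar> \<le> int N" "\<bar>a i\<bar> \<le> int M" using a' a by (auto simp: Bplus_def)
      then have "\<bar>c i\<bar> \<le> int N + int M" using abs_triangle_ineq4[of "a' i" "a i"] by (simp add: c_def)
      then have "real_of_int \<bar>c i\<bar> \<le> real_of_int (int N + int M)" by (simp only: of_int_le_iff)
      then show ?thesis by (simp add: ri_def)
    qed
    have hB: "\<bar>h n\<bar> \<le> B" for n
    proof -
      have "\<bar>cs (ri c) n\<bar> \<le> real (N + M) * K" by (rule cs_bound) (rule c_bound)
      then show ?thesis by (simp add: h B_def) linarith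
    qed
    have Ah: "A (ri h) n = ri c (- n)" for n
    proof -
      have "ri h = cs (ri c)" using h by (auto simp: ri_def[of h])
      then show ?thesis using A_cs[OF bounded_seq_ri[OF bc]] by simp
    qed
    define win where "win p = restrict (\<lambda>i. h (int p + int i)) {..<2 * d}" for p :: nat
    have "win ` {k + 1..k + 1 + card \<W>} \<subseteq> \<W>"
      unfolding win_def \<W>_def image_subset_iff restrict_PiE_iff using hB by (auto simp: abs_le_iff minus_le_iff)
    then have "card (win ` {k + 1..k + 1 + card \<W>}) \<le> card \<W>" by (rule card_mono[OF fW])
    then have "\<not> inj_on win {k + 1..k + 1 + card \<W>}" using card_image[of win "{k + 1..k + 1 + card \<W>}"] by force
    then obtain p p' where stable_pairing: "p \<in> {k + 1..k + 1 + card \<W>}" "p' \<in> {k + 1..k + 1 + card \<W>}" "p < p'" "win p = win p'"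
      unfolding inj_on_def by (metis linorder_neqE_nat)
    define L where "L = int p' - int p"
    have L: "L \<ge> 1" using stable_pairing by (simp add: L_def)
    have weq: "h n = h (n + L)" if "int p \<le> n" "n < int p + 2 * int d" for n
    proof -
      have "win p (nat (n - int p)) = win p' (nat (n - int p))" using stable_pairing(4) by simp
      then show ?thesis using that by (simp add: win_def L_def split: if_splits) (simp add: algebra_simps)
    qed
    \<comment> \<open>A block of length \<open>L\<close> is removed from \<open>h\<close>. As the
      two windows agree, both branches are valid on the overlap, so around every index
      \<open>h'\<close> coincides with \<open>h\<close> or with a translate of it.\<close>
    define h' where "h' n = (if n < int p + 2 * int d then h n else h (n + L))" for n
    have h'2: "h' n = h (n + L)" if "n \<ge> int p" for n using weq that by (simp add: h'_def)
    have Ah': "A (ri h') n = (if n < int p + int d then ri c (- n) else ri c (- n - L))" for n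
    proof (cases "n < int p + int d")
      case True
      have "A (ri h') n = A (ri h) n" unfolding A_def
        using True by (intro sum.cong refl) (auto simp: ri_def h'_def)
      then show ?thesis using True Ah by simp
    next
      case False
      have "A (ri h') n = A (ri h) (n + L)" unfolding A_def
        using False by (intro sum.cong refl) (auto simp: ri_def h'2 algebra_simps)
      then show ?thesis using False Ah[of "n + L"] by simp
    qed
    define a'' where "a'' i = (if - i < int p + int d then a' i else a' (i - L))" for i
    \<comment> \<open>The cut lies to the left of the support of \<open>a\<close>, so only the
      digits of \<open>a'\<close> are affected.\<close>
    have a0: "a i = 0" if "- i \<ge> int p + int d" for i using a that stable_pairing(1) by (auto simp: Bplus_def)
    have diff: "ri (\<lambda>i. a'' i - a i) i = A (ri h') (- i)" for i
    proof (cases "- i < int p + int d")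
      case False
      then have "a i = 0" "a (i - L) = 0" using a0 L by auto
      then show ?thesis using False unfolding Ah' by (simp add: a''_def ri_def c_def)
    next
      case True
      then show ?thesis unfolding Ah' by (simp add: a''_def ri_def c_def)
    qed
    have a''N: "\<bar>a'' i\<bar> \<le> int N" for i using a'(1) by (simp add: a''_def Bplus_def)
    have pj: "int p' + int d \<le> int j" using stable_pairing(2) jk by (simp add: m_def)
    have a''0: "a'' i = 0" if "i < - (int j - L)" for i
    proof -
      have "- i \<ge> int p + int d" using that pj by (simp add: L_def)
      moreover have "i - L < - int j" using that by simp
      ultimately show ?thesis using a'(1) by (simp add: a''_def Bplus_def)
    qed
    define j' where "j' = nat (int j - L)"
    have j': "int j' = int j - L" using pj by (simp add: j'_def L_def)
    have "a'' \<in> Bplus N j'" using a''N a''0 by (simp add: Bplus_def j')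
    moreover have "\<theta> a'' = \<theta> a"
    proof -
      have bh': "bdd_fun (ri h')" by (rule bounded_seq_ri, rule bdiI[of _ B]) (simp add: h'_def hB)
      have "ri (\<lambda>i. a'' i - a i) = (\<lambda>i. A (ri h') (- i))" using diff by blast
      then have "cs (ri (\<lambda>i. a'' i - a i)) n = ri h' n" for n using cs_A[OF bh'] by simp
      then have "cs (ri (\<lambda>i. a'' i - a i)) n \<in> \<int>" for n by (simp add: ri_def)
      then show ?thesis using \<theta>_eq_iff[OF Bplus_bounded_seq[OF \<open>a'' \<in> Bplus N j'\<close>] Bplus_bounded_seq[OF a]] by blast
    qed
    ultimately have "\<theta> a \<in> \<theta> ` Bplus N j'" by (metis imageI)
    moreover have "j' < j" using j' L by simp
    ultimately show False using jmin by blast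
  qed
  then show ?thesis by blast
qed

text \<open>The assumption on \<open>N\<close> is just that digits bounded by \<open>N\<close> reach
  all stable points, which is what a least admissible bound provides. That \<open>m\<close> is
  uniform in \<open>k\<close> places each compact piece inside a single
  \<open>Bplus N (k + m)\<close>.\<close>

lemma image_Bplus_bound:
  assumes N: "\<theta> ` (\<Union>k. Bplus N k) = stable"
  shows "\<exists>m. \<forall>k. \<theta> ` Bplus M k \<subseteq> \<theta> ` Bplus N (k + m)"
proof -
  obtain m where m: "\<And>k a. a \<in> Bplus M k \<Longrightarrow> (\<exists>j. \<theta> a \<in> \<theta> ` Bplus N j) \<Longrightarrow> \<theta> a \<in> \<theta> ` Bplus N (k + m)"
    using splice by blast
  have "\<exists>j. \<theta> a \<in> \<theta> ` Bplus N j" if "a \<in> Bplus M k" for a k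
    using \<theta>_Bplus_stable[OF that] N by blast
  then show ?thesis using m by blast
qed

end

section \<open>Metrics for the strong topologies\<close>

definition weight :: "(int \<Rightarrow> real) \<Rightarrow> bool" where
  "weight u \<longleftrightarrow> (\<forall>n. 0 < u n \<and> u n \<le> 1)"

text \<open>Nonnegative indices are not damped by \<open>w_up\<close>: closeness is uniform along
  the forward orbit, as suits points whose coordinates tend to 1 there, and only coordinatewise
  along the backward orbit. The weight \<open>w_both\<close> describes coordinatewise closeness in
  both directions.\<close>

definition w_up :: "int \<Rightarrow> real" where "w_up n = (1 / 2) ^ nat (- n)"
definition w_down :: "int \<Rightarrow> real" where "w_down n = (1 / 2) ^ nat n"
definition w_both :: "int \<Rightarrow> real" where "w_both n = (1 / 2) ^ nat \<bar>n\<bar>"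

lemma weights [simp]: "weight w_up" "weight w_down" "weight w_both"
  by (auto simp: weight_def w_up_def w_down_def w_both_def power_le_one)

definition subgroup_set :: "'g::ab_group_add set \<Rightarrow> bool" where
  "subgroup_set S \<longleftrightarrow> 0 \<in> S \<and> (\<forall>x\<in>S. \<forall>y\<in>S. x + y \<in> S) \<and> (\<forall>x\<in>S. - x \<in> S)"

lemma subgroup_set_diff: "subgroup_set S \<Longrightarrow> x \<in> S \<Longrightarrow> y \<in> S \<Longrightarrow> x - y \<in> S"
  unfolding subgroup_set_def by (metis add_uminus_conv_diff)

lemma power_half_small: assumes "e > (0::real)" obtains R :: nat where "2 * (1 / 2) ^ R \<le> e"
proof -
  obtain R where "(1 / 2 :: real) ^ R < e / 2" using assms real_arch_pow_inv[of "e / 2" "1 / 2"] by auto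
  then show thesis using that[of R] by simp
qed

lemma seq_top_topspace [simp]: "topspace seq_top = UNIV"
  by (simp add: seq_top_def PiE_UNIV_domain)

lemma openin_seq_top_box:
  assumes "finite I" shows "openin seq_top {b. \<forall>i\<in>I. b i = a i}"
  using assms
proof (induction I rule: finite_induct)
  case (insert j I)
  have "continuous_map seq_top (discrete_topology UNIV) (\<lambda>b. b j)"
    unfolding seq_top_def by (rule continuous_map_product_projection) simp
  then have "openin seq_top {b \<in> topspace seq_top. b j \<in> {a j}}"
    by (rule openin_continuous_map_preimage) simp
  then have "openin seq_top ({b. b j = a j} \<inter> {b. \<forall>i\<in>I. b i = a i})" using insert by auto
  moreover have "{b. b j = a j} \<inter> {b. \<forall>i\<in>I. b i = a i} = {b. \<forall>i\<in>insert j I. b i = a i}" by auto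
  ultimately show ?case by simp
qed (use openin_topspace[of seq_top] in simp)

lemma compactin_Bplus: "compactin seq_top (Bplus M k)"
proof -
  have "Bplus M k = PiE UNIV (\<lambda>i. if i < - int k then {0} else {- int M..int M})"
    unfolding Bplus_def PiE_UNIV_domain Pi_def by (intro Collect_cong all_cong1) (auto simp: abs_le_iff)
  then show ?thesis unfolding seq_top_def by (auto simp: compactin_PiE compactin_discrete_topology)
qed

lemma ri_bound: assumes "\<bar>a i\<bar> \<le> int M" shows "\<bar>ri a i\<bar> \<le> real M"
proof -
  have "real_of_int \<bar>a i\<bar> \<le> real_of_int (int M)" using assms by (simp only: of_int_le_iff)
  then show ?thesis by (simp add: ri_def)
qed

section \<open>Weighted supremum metrics on the group\<close>

context kernel_group
begin

definition wdist :: "(int \<Rightarrow> real) \<Rightarrow> 'g \<Rightarrow> 'g \<Rightarrow> real" where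
  "wdist u g h = (SUP n. u n * cmod (E g n - E h n))"

lemma wdist_self [simp]: "wdist u g g = 0"
  by (simp add: wdist_def)

lemma wdist_upper: assumes "weight u" shows "u n * cmod (E g n - E h n) \<le> wdist u g h"
proof -
  have "u m * cmod (E g m - E h m) \<le> 2" for m
  proof -
    have "cmod (E g m - E h m) \<le> 2" using norm_triangle_ineq4[of "E g m" "E h m"] by simp
    moreover have "0 \<le> u m" "u m \<le> 1" using assms by (auto simp: weight_def less_imp_le)
    ultimately have "u m * cmod (E g m - E h m) \<le> 1 * 2" by (intro mult_mono) auto
    then show ?thesis by simp
  qed
  then show ?thesis unfolding wdist_def by (intro cSUP_upper bdd_aboveI2) auto
qed

lemma wdist_least: "(\<And>n. u n * cmod (E g n - E h n) \<le> c) \<Longrightarrow> wdist u g h \<le> c"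
  unfolding wdist_def by (intro cSUP_least) auto

lemma wdist_nonneg: "weight u \<Longrightarrow> 0 \<le> wdist u g h"
  using wdist_upper[of u 0 g h] unfolding weight_def by (meson less_imp_le mult_nonneg_nonneg norm_ge_zero order_trans)

lemma wdist_commute: "wdist u g h = wdist u h g"
  by (simp add: wdist_def norm_minus_commute)

lemma wdist_eq_0: assumes "weight u" shows "wdist u g h = 0 \<longleftrightarrow> g = h"
proof
  assume "wdist u g h = 0"
  then have "u n * cmod (E g n - E h n) \<le> 0" for n using wdist_upper[OF assms, of n g h] by simp
  moreover have "u n > 0" for n using assms by (simp add: weight_def)
  ultimately have "cmod (E g n - E h n) \<le> 0" for n by (simp add: mult_le_0_iff) (meson less_le_not_le)
  then show "g = h" by (intro E_inj) simp
qed (simp add: wdist_def)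

lemma wdist_triangle: assumes "weight u" shows "wdist u g k \<le> wdist u g h + wdist u h k"
proof (rule wdist_least)
  fix n
  have "u n * cmod (E g n - E k n) \<le> u n * (cmod (E g n - E h n) + cmod (E h n - E k n))"
    using assms norm_triangle_ineq[of "E g n - E h n" "E h n - E k n"]
    by (intro mult_left_mono) (auto simp: weight_def less_imp_le)
  also have "\<dots> \<le> wdist u g h + wdist u h k"
    unfolding distrib_left by (intro add_mono wdist_upper assms)
  finally show "u n * cmod (E g n - E k n) \<le> wdist u g h + wdist u h k" .
qed

lemma wdist_Metric_space: "weight u \<Longrightarrow> Metric_space S (wdist u)"
  by unfold_locales (auto simp: wdist_nonneg wdist_commute wdist_eq_0 wdist_triangle)

lemma wdist_diff: "wdist u g h = wdist u (g - h) 0"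
  unfolding wdist_def by (subst E_dist) simp

lemma wdist_translate: "wdist u (g + k) (h + k) = wdist u g h"
  by (subst (1 2) wdist_diff) simp

lemma wdist_add: assumes "weight u" shows "wdist u (g + g') (h + h') \<le> wdist u g h + wdist u g' h'"
  using wdist_triangle[OF assms, of "g + g'" "h + h'" "h + g'"] wdist_translate[of u g g' h]
    wdist_translate[of u g' h h'] by (simp add: add.commute)

lemma wdist_uminus: "wdist u (- g) (- h) = wdist u g h"
  using wdist_diff[of u "- g" "- h"] wdist_diff[of u h g] wdist_commute[of u g h] by simp

definition wtop :: "(int \<Rightarrow> real) \<Rightarrow> 'g set \<Rightarrow> 'g topology" where
  "wtop u S = Metric_space.mtopology S (wdist u)"

lemma topspace_wtop [simp]: "weight u \<Longrightarrow> topspace (wtop u S) = S"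
  by (simp add: wtop_def Metric_space.topspace_mtopology[OF wdist_Metric_space])

lemma openin_wtop:
  assumes "weight u"
  shows "openin (wtop u S) U \<longleftrightarrow> U \<subseteq> S \<and> (\<forall>x\<in>U. \<exists>r>0. \<forall>y\<in>S. wdist u y x < r \<longrightarrow> y \<in> U)"
proof -
  interpret Metric_space S "wdist u" by (rule wdist_Metric_space[OF assms])
  have "mball x r \<subseteq> U \<longleftrightarrow> (\<forall>y\<in>S. wdist u y x < r \<longrightarrow> y \<in> U)" if "x \<in> S" for x r
    using that unfolding mball_def wdist_commute[of u x] by blast
  then show ?thesis unfolding wtop_def openin_mtopology by blast
qed

lemma openin_wtop_ball:
  assumes "weight u" shows "openin (wtop u S) {y \<in> S. wdist u y x < r}"
proof -
  have "\<exists>s>0. \<forall>z\<in>S. wdist u z y < s \<longrightarrow> z \<in> {y \<in> S. wdist u y x < r}" if "wdist u y x < r" for y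
  proof (intro exI[of _ "r - wdist u y x"] conjI ballI impI)
    fix z assume "z \<in> S" "wdist u z y < r - wdist u y x"
    then show "z \<in> {y \<in> S. wdist u y x < r}" using wdist_triangle[OF assms, of z x y] by simp
  qed (use that in simp)
  then show ?thesis unfolding openin_wtop[OF assms] by auto
qed

lemma continuous_map_to_wtop:
  assumes "weight u"
  shows "continuous_map X (wtop u S) f \<longleftrightarrow> (\<forall>x\<in>topspace X. f x \<in> S) \<and>
    (\<forall>x\<in>topspace X. \<forall>e>0. \<exists>U. openin X U \<and> x \<in> U \<and> (\<forall>y\<in>U. wdist u (f y) (f x) < e))"
  (is "?L \<longleftrightarrow> ?R")
proof
  assume L: ?L
  then have S: "f x \<in> S" if "x \<in> topspace X" for x using that assms by (auto simp: continuous_map_def)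
  moreover have "\<exists>U. openin X U \<and> x \<in> U \<and> (\<forall>y\<in>U. wdist u (f y) (f x) < e)" if "x \<in> topspace X" "e > 0" for x e
    using openin_continuous_map_preimage[OF L openin_wtop_ball[OF assms], of "f x" e] that S assms
    by (intro exI[of _ "{y \<in> topspace X. f y \<in> {y \<in> S. wdist u y (f x) < e}}"]) (auto simp: wdist_eq_0)
  ultimately show ?R by blast
next
  assume R: ?R
  show ?L unfolding continuous_map_def
  proof (intro conjI allI impI)
    show "f \<in> topspace X \<rightarrow> topspace (wtop u S)" using R assms by auto
    fix V assume V: "openin (wtop u S) V"
    show "openin X {x \<in> topspace X. f x \<in> V}"
    proof (subst openin_subopen, intro ballI)
      fix x assume x: "x \<in> {x \<in> topspace X. f x \<in> V}"
      then obtain r where r: "r > 0" "\<And>y. y \<in> S \<Longrightarrow> wdist u y (f x) < r \<Longrightarrow> y \<in> V"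
        using V unfolding openin_wtop[OF assms] by auto
      have "x \<in> topspace X" using x by simp
      from conjunct2[OF R, THEN bspec, OF this, rule_format, OF r(1)]
      obtain U where U: "openin X U" "x \<in> U" "\<And>y. y \<in> U \<Longrightarrow> wdist u (f y) (f x) < r" by meson
      have "z \<in> topspace X \<and> f z \<in> V" if z: "z \<in> U" for z
      proof
        show zX: "z \<in> topspace X" using openin_subset[OF U(1)] z by (rule subsetD)
        have "f z \<in> S" using R zX by simp
        then show "f z \<in> V" using r(2) U(3)[OF z] by simp
      qed
      then have "U \<subseteq> {x \<in> topspace X. f x \<in> V}" by blast
      then show "\<exists>T. openin X T \<and> x \<in> T \<and> T \<subseteq> {x \<in> topspace X. f x \<in> V}" using U by blast
    qed
  qed
qed

lemma Hausdorff_wtop: "weight u \<Longrightarrow> Hausdorff_space (wtop u S)"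
  unfolding wtop_def by (rule Metric_space.Hausdorff_space_mtopology[OF wdist_Metric_space])

lemma abelian_wtop:
  assumes u: "weight u" and S: "subgroup_set S" shows "abelian_tgroup (add_tgroup (wtop u S))"
proof -
  have add: "x + y \<in> S" if "x \<in> S" "y \<in> S" for x y using S that by (auto simp: subgroup_set_def)
  have um: "- x \<in> S" if "x \<in> S" for x using S that by (auto simp: subgroup_set_def)
  have "continuous_map (prod_topology (wtop u S) (wtop u S)) (wtop u S) (\<lambda>(x, y). x + y)"
    unfolding continuous_map_to_wtop[OF u]
  proof (intro conjI ballI allI impI)
    fix p e assume p: "p \<in> topspace (prod_topology (wtop u S) (wtop u S))"
    then show "(case p of (x, y) \<Rightarrow> x + y) \<in> S" using u add by auto
    assume e: "e > (0::real)"
    obtain x y where xy: "p = (x, y)" "x \<in> S" "y \<in> S" using p u by auto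
    let ?B = "\<lambda>x. {z \<in> S. wdist u z x < e / 2}"
    have "openin (prod_topology (wtop u S) (wtop u S)) (?B x \<times> ?B y)"
      using openin_wtop_ball[OF u, of S x "e / 2"] openin_wtop_ball[OF u, of S y "e / 2"]
      by (simp only: openin_prod_Times_iff) simp
    moreover have "wdist u (x' + y') (x + y) < e" if "x' \<in> ?B x" "y' \<in> ?B y" for x' y'
      using that wdist_add[OF u, of x' y' x y] by auto
    moreover have "p \<in> ?B x \<times> ?B y" using xy e u by (simp add: wdist_eq_0)
    ultimately show "\<exists>U. openin (prod_topology (wtop u S) (wtop u S)) U \<and> p \<in> U \<and>
        (\<forall>q\<in>U. wdist u (case q of (x, y) \<Rightarrow> x + y) (case p of (x, y) \<Rightarrow> x + y) < e)"
      using xy by (intro exI[of _ "?B x \<times> ?B y"]) auto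
  qed
  moreover have "continuous_map (wtop u S) (wtop u S) uminus"
    unfolding continuous_map_to_wtop[OF u]
  proof (intro conjI ballI allI impI)
    fix x e assume x: "x \<in> topspace (wtop u S)"
    then show "- x \<in> S" using u um by simp
    assume "e > (0::real)"
    then show "\<exists>U. openin (wtop u S) U \<and> x \<in> U \<and> (\<forall>y\<in>U. wdist u (- y) (- x) < e)"
      using x u openin_wtop_ball[OF u, of S x e] by (intro exI[of _ "{y \<in> S. wdist u y x < e}"]) (auto simp: wdist_uminus wdist_eq_0)
  qed
  ultimately show ?thesis using S u unfolding abelian_tgroup_def Let_def add_tgroup_def
    by (auto simp: tg_carrier_def tg_top_def tg_op_def tg_unit_def subgroup_set_def ac_simps intro!: exI[of _ uminus])
qed

text \<open>Coordinates below \<open>- q\<close> contribute at most \<open>2 * (1 / 2) ^ q\<close>,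
  whatever they are.\<close>

lemma wdist_up_small:
  fixes q :: nat
  assumes "\<And>n. n \<ge> - int q \<Longrightarrow> cmod (E g n - E h n) \<le> e" "2 * (1 / 2) ^ q \<le> e"
  shows "wdist w_up g h \<le> e"
proof (rule wdist_least)
  fix n
  have e0: "e \<ge> 0" using assms(2) by (smt (verit) zero_less_power zero_less_divide_1_iff)
  show "w_up n * cmod (E g n - E h n) \<le> e"
  proof (cases "n \<ge> - int q")
    case True
    have "w_up n * cmod (E g n - E h n) \<le> 1 * e"
      using assms(1)[OF True] by (intro mult_mono) (auto simp: w_up_def power_le_one)
    then show ?thesis by simp
  next
    case False
    then have "q \<le> nat (- n)" by linarith
    then have "w_up n \<le> (1 / 2) ^ q" unfolding w_up_def by (intro power_decreasing) auto
    moreover have "cmod (E g n - E h n) \<le> 2" using norm_triangle_ineq4[of "E g n" "E h n"] by simp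
    ultimately have "w_up n * cmod (E g n - E h n) \<le> (1 / 2) ^ q * 2" by (intro mult_mono) auto
    then show ?thesis using assms(2) by simp
  qed
qed

lemma wdist_both_small:
  fixes q :: nat
  assumes "\<And>n. \<bar>n\<bar> \<le> int q \<Longrightarrow> cmod (E g n - E h n) \<le> e" "2 * (1 / 2) ^ q \<le> e"
  shows "wdist w_both g h \<le> e"
proof (rule wdist_least)
  fix n
  have e0: "e \<ge> 0" using assms(2) by (smt (verit) zero_less_power zero_less_divide_1_iff)
  show "w_both n * cmod (E g n - E h n) \<le> e"
  proof (cases "\<bar>n\<bar> \<le> int q")
    case True
    have "w_both n * cmod (E g n - E h n) \<le> 1 * e"
      using assms(1)[OF True] by (intro mult_mono) (auto simp: w_both_def power_le_one)
    then show ?thesis by simp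
  next
    case False
    then have "q \<le> nat \<bar>n\<bar>" by linarith
    then have "w_both n \<le> (1 / 2) ^ q" unfolding w_both_def by (intro power_decreasing) auto
    moreover have "cmod (E g n - E h n) \<le> 2" using norm_triangle_ineq4[of "E g n" "E h n"] by simp
    ultimately have "w_both n * cmod (E g n - E h n) \<le> (1 / 2) ^ q * 2" by (intro mult_mono) auto
    then show ?thesis using assms(2) by simp
  qed
qed

text \<open>The number \<open>R\<close> makes the damped coordinates below \<open>- R\<close>
  harmless; moving the support by \<open>m\<close> further to the right makes the remaining ones
  small through the decay of \<open>w\<close>.\<close>

lemma tail_small:
  assumes "e > 0"
  shows "\<exists>P::nat. \<forall>b. (\<forall>i. \<bar>b i\<bar> \<le> int M) \<and> (\<forall>i. i < int P \<longrightarrow> b i = 0) \<longrightarrow> wdist w_up (\<theta> b) 0 \<le> e"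
proof -
  obtain R :: nat where R: "2 * (1 / 2) ^ R \<le> e" using power_half_small[OF assms] by blast
  \<comment> \<open>The summand 1 keeps \<open>c\<close> positive when \<open>M = 0\<close>.\<close>
  define c where "c = 2 * pi * (real M * K) + 1"
  have c: "c > 0" using K_pos by (simp add: c_def add_nonneg_pos)
  obtain m where m: "\<rho> ^ m < e / c" using real_arch_pow_inv[of "e / c" \<rho>] assms c rho by auto
  have "wdist w_up (\<theta> b) 0 \<le> e" if b: "\<And>i. \<bar>b i\<bar> \<le> int M" "\<And>i. i < int (R + m) \<Longrightarrow> b i = 0" for b
  proof (rule wdist_up_small[OF _ R])
    fix n assume n: "n \<ge> - int R"
    have bb: "bounded_seq b" using b(1) by (rule bdiI)
    have "\<bar>ri b i\<bar> \<le> real M" for i using b(1)[of i] by (rule ri_bound)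
    moreover have "ri b i = 0" if "i < int (R + m)" for i using b(2)[OF that] by (simp add: ri_def)
    ultimately have "\<bar>cs (ri b) n\<bar> \<le> real M * K * \<rho> ^ nat (int (R + m) + n)"
      using n by (intro cs_estimate) auto
    also have "\<dots> \<le> real M * K * \<rho> ^ m"
      using n rho K_pos by (intro mult_left_mono power_decreasing) auto
    finally have cs: "\<bar>cs (ri b) n\<bar> \<le> real M * K * \<rho> ^ m" .
    have "cmod (E (\<theta> b) n - E 0 n) \<le> 2 * pi * \<bar>cs (ri b) n\<bar>"
      using norm_cis_diff_1_le by (simp add: E_\<theta>[OF bb])
    also have "\<dots> \<le> 2 * pi * (real M * K * \<rho> ^ m)" using cs by (intro mult_left_mono) auto
    also have "\<dots> \<le> c * \<rho> ^ m" using rho by (simp add: c_def algebra_simps)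
    also have "\<dots> \<le> e" using m c by (simp add: field_simps)
    finally show "cmod (E (\<theta> b) n - E 0 n) \<le> e" .
  qed
  then show ?thesis by blast
qed

text \<open>Sequences in \<open>Bplus M k\<close> that agree up to a far index differ by a sequence
  supported far to the right, and such sequences represent small points.\<close>

lemma \<theta>_continuous: "continuous_map (subtopology seq_top (Bplus M k)) (wtop w_up stable) \<theta>"
  unfolding continuous_map_to_wtop[OF weights(1)]
proof (intro conjI ballI allI impI)
  fix a e assume "a \<in> topspace (subtopology seq_top (Bplus M k))"
  then have a: "a \<in> Bplus M k" by simp
  then show "\<theta> a \<in> stable" by (rule \<theta>_Bplus_stable)
  assume e: "e > (0::real)"
  then obtain P :: nat where P: "\<And>b. (\<And>i. \<bar>b i\<bar> \<le> int (M + M)) \<Longrightarrow> (\<And>i. i < int P \<Longrightarrow> b i = 0) \<Longrightarrow> wdist w_up (\<theta> b) 0 \<le> e / 2"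
    using tail_small[of "e / 2" "M + M"] by auto
  let ?U = "Bplus M k \<inter> {b. \<forall>i\<in>{- int k..int P}. b i = a i}"
  have "openin (subtopology seq_top (Bplus M k)) ?U"
    by (intro openin_subtopology_Int2 openin_seq_top_box) auto
  moreover have "wdist w_up (\<theta> b) (\<theta> a) < e" if b: "b \<in> ?U" for b
  proof -
    have "wdist w_up (\<theta> b) (\<theta> a) = wdist w_up (\<theta> (\<lambda>i. b i - a i)) 0"
      using \<theta>_diff[of b a] Bplus_bounded_seq[of b M k] Bplus_bounded_seq[of a M k] b a wdist_diff[of w_up "\<theta> b" "\<theta> a"] by simp
    also have "\<dots> \<le> e / 2"
    proof (rule P)
      fix i
      have "\<bar>b i\<bar> \<le> int M" "\<bar>a i\<bar> \<le> int M" using a b by (auto simp: Bplus_def)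
      then show "\<bar>b i - a i\<bar> \<le> int (M + M)" using abs_triangle_ineq4[of "b i" "a i"] by simp
      show "b i - a i = 0" if "i < int P"
        using that a b by (cases "i < - int k") (auto simp: Bplus_def)
    qed
    finally show ?thesis using e by simp
  qed
  ultimately show "\<exists>U. openin (subtopology seq_top (Bplus M k)) U \<and> a \<in> U \<and> (\<forall>y\<in>U. wdist w_up (\<theta> y) (\<theta> a) < e)"
    using a by (intro exI[of _ ?U]) auto
qed

section \<open>Compact pieces and the strong topology\<close>

lemma compactin_image_Bplus: "compactin (wtop w_up stable) (\<theta> ` Bplus M k)"
  using image_compactin[OF _ \<theta>_continuous[of M k], of "Bplus M k"] compactin_Bplus
  by (simp add: compactin_subtopology)

lemma wdist_up_small_imp_rep:
  assumes "wdist w_up g 0 < \<delta>0" shows "\<exists>a\<in>Bplus N0 d. \<theta> a = g"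
proof -
  have "cmod (E g m - 1) < \<delta>0" if "m \<ge> 0" for m
    using wdist_upper[OF weights(1), of m g 0] that assms by (simp add: w_up_def)
  then obtain a where "\<And>k. \<bar>a k\<bar> \<le> int N0" "\<theta> a = g" "\<And>i. i \<le> - 0 - int d \<Longrightarrow> a i = 0" using tail_rep by metis
  then show ?thesis by (intro bexI[of _ a]) (auto simp: Bplus_def)
qed

text \<open>A representative of the centre is added to one of the small difference, whence the bound
  \<open>N0 + N0\<close>.\<close>

lemma ball_in_image_Bplus:
  assumes "h \<in> stable"
  shows "\<exists>k. {y \<in> stable. wdist w_up y h < \<delta>0} \<subseteq> \<theta> ` Bplus (N0 + N0) k"
proof -
  obtain k b where b: "b \<in> Bplus N0 k" "\<theta> b = h" using stable_rep[OF assms] by blast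
  have "y \<in> \<theta> ` Bplus (N0 + N0) (max d k)" if y: "wdist w_up y h < \<delta>0" for y
  proof -
    have "wdist w_up (y - h) 0 < \<delta>0" using y wdist_diff by metis
    then obtain a where a: "a \<in> Bplus N0 d" "\<theta> a = y - h" using wdist_up_small_imp_rep by blast
    then have "\<theta> (\<lambda>i. a i + b i) = y" using b by (simp add: \<theta>_add Bplus_bounded_seq)
    then show ?thesis using Bplus_add[OF a(1) b(1)] by blast
  qed
  then show ?thesis by blast
qed

lemma locally_compact_stable: "locally_compact_space (wtop w_up stable)"
  unfolding locally_compact_space_def
proof
  fix x assume "x \<in> topspace (wtop w_up stable)"
  then have x: "x \<in> stable" by simp
  obtain k where "{y \<in> stable. wdist w_up y x < \<delta>0} \<subseteq> \<theta> ` Bplus (N0 + N0) k" using ball_in_image_Bplus[OF x] by blast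
  then show "\<exists>U K. openin (wtop w_up stable) U \<and> compactin (wtop w_up stable) K \<and> x \<in> U \<and> U \<subseteq> K"
    using openin_wtop_ball[OF weights(1), of stable x \<delta>0] compactin_image_Bplus x \<delta>0_pos
    by (intro exI[of _ "{y \<in> stable. wdist w_up y x < \<delta>0}"] exI[of _ "\<theta> ` Bplus (N0 + N0) k"]) (auto simp: wdist_eq_0)
qed

lemma stable_subgroup: "subgroup_set stable"
  by (auto simp: subgroup_set_def stable_0 stable_add stable_uminus)

text \<open>Near \<open>h\<close> every point has digits in a single compact set
  \<open>Bplus N l\<close>. In it the digits of points outside \<open>U\<close> form a compact set,
  whose image is closed and does not contain \<open>h\<close>.\<close>

lemma openin_wtop_if_preimages:
  assumes N: "\<theta> ` (\<Union>k. Bplus N k) = stable" and U: "U \<subseteq> stable"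
    and pre: "\<And>k. openin (subtopology seq_top (Bplus N k)) {a \<in> Bplus N k. \<theta> a \<in> U}"
  shows "openin (wtop w_up stable) U"
  unfolding openin_wtop[OF weights(1)]
proof (intro conjI ballI U)
  fix h assume h: "h \<in> U"
  obtain k where k: "{y \<in> stable. wdist w_up y h < \<delta>0} \<subseteq> \<theta> ` Bplus (N0 + N0) k"
    using ball_in_image_Bplus h U by blast
  obtain m where m: "\<theta> ` Bplus (N0 + N0) k \<subseteq> \<theta> ` Bplus N (k + m)" using image_Bplus_bound[OF N, of "N0 + N0"] by meson
  define l where "l = k + m"
  define Z where "Z = {a \<in> Bplus N l. \<theta> a \<notin> U}"
  have "Z = topspace (subtopology seq_top (Bplus N l)) - {a \<in> Bplus N l. \<theta> a \<in> U}" by (auto simp: Z_def)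
  then have "closedin (subtopology seq_top (Bplus N l)) Z" using pre[of l] by (simp add: closedin_diff)
  moreover have "compact_space (subtopology seq_top (Bplus N l))"
    using compactin_Bplus by (simp add: compact_space_subtopology)
  ultimately have "compactin (subtopology seq_top (Bplus N l)) Z" by (rule closedin_compact_space[rotated])
  then have "compactin (wtop w_up stable) (\<theta> ` Z)" by (rule image_compactin[OF _ \<theta>_continuous])
  then have "closedin (wtop w_up stable) (\<theta> ` Z)" by (rule compactin_imp_closedin[OF Hausdorff_wtop[OF weights(1)]])
  then have "openin (wtop w_up stable) (stable - \<theta> ` Z)" by (simp add: closedin_def)
  moreover have "h \<in> stable - \<theta> ` Z" using h U by (auto simp: Z_def)
  ultimately have "\<exists>r>0. \<forall>y\<in>stable. wdist w_up y h < r \<longrightarrow> y \<in> stable - \<theta> ` Z"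
    unfolding openin_wtop[OF weights(1)] by (elim conjE bspec)
  then obtain r where r: "r > 0" "\<And>y. y \<in> stable \<Longrightarrow> wdist w_up y h < r \<Longrightarrow> y \<in> stable - \<theta> ` Z"
    by meson
  have "y \<in> U" if "y \<in> stable" "wdist w_up y h < min r \<delta>0" for y
  proof -
    have "y \<in> \<theta> ` Bplus N l" using k m that by (auto simp: l_def)
    moreover have "y \<notin> \<theta> ` Z" using r(2) that by auto
    ultimately show ?thesis by (auto simp: Z_def)
  qed
  then show "\<exists>r>0. \<forall>y\<in>stable. wdist w_up y h < r \<longrightarrow> y \<in> U"
    using r(1) \<delta>0_pos by (intro exI[of _ "min r \<delta>0"]) auto
qed

theorem strong_top_eq_wtop:
  assumes N: "\<theta> ` (\<Union>k. Bplus N k) = stable"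
  shows "strong_top \<theta> (Bplus N) stable = wtop w_up stable"
proof -
  let ?G = "{U. U \<subseteq> stable \<and> (\<forall>k. openin (subtopology seq_top (Bplus N k)) {a \<in> Bplus N k. \<theta> a \<in> U})}"
  have "openin (topology_generated_by ?G) U \<longleftrightarrow> openin (wtop w_up stable) U" for U
  proof
    assume "openin (topology_generated_by ?G) U"
    then have "generate_topology_on ?G U" by (simp add: openin_topology_generated_by_iff)
    then show "openin (wtop w_up stable) U"
      by (rule generate_topology_on_coarsest[rotated 2])
         (auto simp: istopology_openin intro: openin_wtop_if_preimages[OF N])
  next
    assume U: "openin (wtop w_up stable) U"
    have "{a \<in> Bplus N k. \<theta> a \<in> U} = {a \<in> topspace (subtopology seq_top (Bplus N k)). \<theta> a \<in> U}" for k by auto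
    then have "openin (subtopology seq_top (Bplus N k)) {a \<in> Bplus N k. \<theta> a \<in> U}" for k
      using openin_continuous_map_preimage[OF \<theta>_continuous U] by simp
    moreover have "U \<subseteq> stable" using openin_subset[OF U] by simp
    ultimately show "openin (topology_generated_by ?G) U" by (intro topology_generated_by_Basis) auto
  qed
  then show ?thesis unfolding strong_top_def by (simp add: topology_eq)
qed

text \<open>The identity is continuous from a compact onto a Hausdorff topology, hence a
  homeomorphism.\<close>

lemma compact_top_eq_wtop:
  assumes "compact_space T" "topspace T = UNIV" "\<And>n. continuous_map T euclidean (\<lambda>g. E g n)"
  shows "T = wtop w_both UNIV"
proof -
  have "continuous_map T (wtop w_both UNIV) id"
    unfolding continuous_map_to_wtop[OF weights(3)]
  proof (intro conjI ballI allI impI)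
    fix x e assume "e > (0::real)"
    then have e: "e / 2 > 0" by simp
    obtain R :: nat where R: "2 * (1 / 2) ^ R \<le> e / 2" using power_half_small[OF e] by blast
    have op: "openin T {y. cmod (E y n - E x n) < e / 2}" for n
    proof -
      have "openin T {y \<in> topspace T. E y n \<in> ball (E x n) (e / 2)}"
        by (rule openin_continuous_map_preimage[OF assms(3)]) auto
      then show ?thesis using assms(2) by (simp add: dist_norm norm_minus_commute)
    qed
    let ?U = "\<Inter>n\<in>{- int R..int R}. {y. cmod (E y n - E x n) < e / 2}"
    have "openin T ?U" using op by (intro openin_INT2) auto
    moreover have "wdist w_both (id y) (id x) < e" if "y \<in> ?U" for y
    proof -
      have "cmod (E y n - E x n) < e / 2" if "\<bar>n\<bar> \<le> int R" for n using \<open>y \<in> ?U\<close> that by (auto simp: abs_le_iff)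
      then have "wdist w_both y x \<le> e / 2" by (intro wdist_both_small[OF _ R]) (auto intro: less_imp_le)
      then show ?thesis using e by simp
    qed
    ultimately show "\<exists>U. openin T U \<and> x \<in> U \<and> (\<forall>y\<in>U. wdist w_both (id y) (id x) < e)"
      using e by (intro exI[of _ ?U]) auto
  qed auto
  then have "homeomorphic_map T (wtop w_both UNIV) id"
    by (rule continuous_imp_homeomorphic_map) (use assms in \<open>auto simp: Hausdorff_wtop\<close>)
  then show ?thesis by simp
qed

end

section \<open>Pairings\<close>

text \<open>Each nonzero integer adds at least 1 to the absolute sum, so only finitely many terms
  are nonzero.\<close>

lemma Ints_infsum:
  fixes f :: "int \<Rightarrow> real"
  assumes f: "f summable_on UNIV" and int: "\<And>i. f i \<in> \<int>" shows "infsum f UNIV \<in> \<int>"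
proof -
  have abs: "(\<lambda>i. \<bar>f i\<bar>) summable_on UNIV"
    using f summable_on_iff_abs_summable_on_real[of f UNIV] by simp
  define B where "B = infsum (\<lambda>i. \<bar>f i\<bar>) UNIV"
  have card: "real (card G) \<le> B" if G: "finite G" "G \<subseteq> {i. f i \<noteq> 0}" for G
  proof -
    have "real (card G) = (\<Sum>i\<in>G. 1)" by simp
    also have "\<dots> \<le> (\<Sum>i\<in>G. \<bar>f i\<bar>)" using G int by (intro sum_mono Ints_nonzero_abs_ge1) auto
    also have "\<dots> \<le> B" unfolding B_def using abs G by (intro finite_sum_le_infsum) auto
    finally show ?thesis .
  qed
  have fin: "finite {i. f i \<noteq> 0}"
  proof (rule ccontr)
    assume "infinite {i. f i \<noteq> 0}"
    then obtain G where "G \<subseteq> {i. f i \<noteq> 0}" "finite G" "card G = nat \<lceil>B\<rceil> + 1"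
      using infinite_arbitrarily_large by blast
    then show False using card[of G] by linarith
  qed
  have "infsum f UNIV = infsum f {i. f i \<noteq> 0}" by (rule infsum_cong_neutral) auto
  also have "\<dots> = (\<Sum>i\<in>{i. f i \<noteq> 0}. f i)" using fin by simp
  also have "\<dots> \<in> \<int>" using int by (intro Ints_sum) auto
  finally show ?thesis .
qed

definition delta :: "int \<Rightarrow> int \<Rightarrow> int" where
  "delta n m = (if m = n then 1 else 0)"

lemma delta_laurent [simp]: "delta n \<in> laurent_polys"
  by (simp add: laurent_polys_iff delta_def)

lemma laurent_polys_bounded_seq: assumes "c \<in> laurent_polys" shows "bounded_seq c"
proof (rule bdiI)
  fix k
  show "\<bar>c k\<bar> \<le> Max (insert 0 ((\<lambda>k. \<bar>c k\<bar>) ` {n. c n \<noteq> 0}))"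
    using assms by (cases "c k = 0") (auto simp: laurent_polys_iff intro!: Max_ge)
qed

lemma laurent_polys_Bplus: assumes "c \<in> laurent_polys" shows "\<exists>M k. c \<in> Bplus M k"
proof -
  obtain M where M: "\<And>k. \<bar>c k\<bar> \<le> M" using laurent_polys_bounded_seq[OF assms] by (auto simp: bounded_seq_def)
  have "\<bar>n\<bar> \<le> Max (abs ` {n. c n \<noteq> 0})" if "c n \<noteq> 0" for n
    using assms that by (intro Max_ge) (auto simp: laurent_polys_iff)
  then obtain B where B: "\<And>n. c n \<noteq> 0 \<Longrightarrow> \<bar>n\<bar> \<le> B" by blast
  have "M \<ge> 0" using M[of 0] by simp
  then have "\<bar>c i\<bar> \<le> int (nat M)" for i using M[of i] by simp
  moreover have "c i = 0" if "i < - int (nat B)" for i using B[of i] that by (cases "c i = 0") (auto split: if_splits)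
  ultimately have "c \<in> Bplus (nat M) (nat B)" by (simp add: Bplus_def)
  then show ?thesis by blast
qed

text \<open>The Laurent polynomials are free abelian on the unit sequences \<open>delta n\<close>; a
  character is determined by its values there.\<close>

lemma hom_laurent_mono:
  fixes f :: "(int \<Rightarrow> int) \<Rightarrow> complex"
  assumes add: "\<And>a b. a \<in> laurent_polys \<Longrightarrow> b \<in> laurent_polys \<Longrightarrow> f (\<lambda>n. a n + b n) = f a * f b"
    and nz: "\<And>a. a \<in> laurent_polys \<Longrightarrow> f a \<noteq> 0" and c: "c \<in> laurent_polys"
  shows "f c = laurent_mono c (\<lambda>n. f (delta n))"
proof -
  have z: "(\<lambda>n. 0) \<in> laurent_polys" by (simp add: laurent_polys_iff)
  have f0: "f (\<lambda>n. 0) = 1" using add[OF z z] nz[OF z] by simp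
  have mul: "(\<lambda>m. k * delta n m) \<in> laurent_polys" for k n
    by (rule laurent_polys_iff[THEN iffD2], rule finite_subset[of _ "{n}"]) (auto simp: delta_def)
  have nat: "f (\<lambda>m. int j * delta n m) = f (delta n) ^ j" for j n
  proof (induction j)
    case (Suc j)
    have "(\<lambda>m. int (Suc j) * delta n m) = (\<lambda>m. int j * delta n m + delta n m)" by (auto simp: algebra_simps)
    then show ?case using add[OF mul[of "int j" n] delta_laurent[of n]] Suc by simp
  qed (simp add: f0)
  have powi: "f (\<lambda>m. k * delta n m) = f (delta n) powi k" for k n
  proof (cases k rule: int_cases2)
    case (nonpos j)
    have "f (\<lambda>m. int j * delta n m + k * delta n m) = f (\<lambda>m. int j * delta n m) * f (\<lambda>m. k * delta n m)"
      by (rule add[OF mul mul])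
    then have "f (delta n) ^ j * f (\<lambda>m. k * delta n m) = 1" using nonpos f0 by (simp add: nat)
    then show ?thesis using nonpos nz[OF delta_laurent[of n]] by (simp add: power_int_minus field_simps)
  qed (simp add: nat)
  have fin: "finite {n. c n \<noteq> 0}" using c by (simp add: laurent_polys_iff)
  have "\<forall>c. {n. c n \<noteq> 0} \<subseteq> S \<longrightarrow> f c = (\<Prod>n\<in>S. f (delta n) powi c n)" if "finite S" for S
    using that
  proof (induction S rule: finite_induct)
    case empty
    show ?case
    proof (intro allI impI)
      fix c :: "int \<Rightarrow> int" assume "{n. c n \<noteq> 0} \<subseteq> {}"
      then have "c = (\<lambda>_. 0)" by auto
      then show "f c = (\<Prod>n\<in>{}. f (delta n) powi c n)" using f0 by simp
    qed
  next
    case (insert m S)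
    show ?case
    proof (intro allI impI)
      fix c :: "int \<Rightarrow> int" assume c: "{n. c n \<noteq> 0} \<subseteq> insert m S"
      define c' where "c' = (\<lambda>n. if n = m then 0 else c n)"
      have sub: "{n. c' n \<noteq> 0} \<subseteq> S" using c by (auto simp: c'_def)
      then have c'l: "c' \<in> laurent_polys" using insert(1) finite_subset by (auto simp: laurent_polys_iff)
      have "c = (\<lambda>n. c' n + c m * delta m n)" by (auto simp: c'_def delta_def)
      then have "f c = f c' * f (\<lambda>n. c m * delta m n)" using add[OF c'l mul[of "c m" m]] by simp
      also have "f c' = (\<Prod>n\<in>S. f (delta n) powi c n)"
        using insert(3) sub insert(2) by (auto simp: c'_def intro!: prod.cong)
      finally show "f c = (\<Prod>n\<in>insert m S. f (delta n) powi c n)"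
        using insert by (simp add: powi mult.commute)
    qed
  qed
  then show ?thesis using fin by (simp add: laurent_mono_def)
qed

context kernel_group
begin

section \<open>The bilinear form on digit sequences\<close>

definition pterm :: "(int \<Rightarrow> real) \<Rightarrow> (int \<Rightarrow> real) \<Rightarrow> int \<times> int \<Rightarrow> real" where
  "pterm a b = (\<lambda>(i, j). a i * b j * w (i + j))"

text \<open>Summability over pairs of indices permits either order of summation. Two bounded
  sequences need not have it; two right-sided ones, or one finite and one bounded, do.\<close>

definition pairable :: "(int \<Rightarrow> real) \<Rightarrow> (int \<Rightarrow> real) \<Rightarrow> bool" where
  "pairable a b \<longleftrightarrow> pterm a b summable_on UNIV"

definition beta :: "(int \<Rightarrow> real) \<Rightarrow> (int \<Rightarrow> real) \<Rightarrow> real" where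
  "beta a b = infsum (pterm a b) UNIV"

lemma pterm_swap: "pterm b a p = pterm a b (prod.swap p)"
  by (cases p) (simp add: pterm_def ac_simps)

lemma bij_prod_swap: "bij (prod.swap :: int \<times> int \<Rightarrow> int \<times> int)"
  by simp

lemma pairable_commute: "pairable a b \<Longrightarrow> pairable b a"
  using summable_on_reindex_bij_betw[OF bij_prod_swap, of "pterm a b"]
  unfolding pairable_def by (simp add: pterm_swap[of b a, abs_def])

lemma beta_commute: "beta b a = beta a b"
  using infsum_reindex_bij_betw[OF bij_prod_swap, of "pterm a b"]
  unfolding beta_def by (simp add: pterm_swap[of b a, abs_def])

text \<open>Summing over the index of \<open>b\<close> first exposes the lift \<open>cs b\<close>,
  and this is how integrality enters the form.\<close>

lemma beta_eq:
  assumes "pairable a b" "bdd_fun b"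
  shows "(\<lambda>i. a i * cs b i) summable_on UNIV" "beta a b = (\<Sum>\<^sub>\<infinity>i. a i * cs b i)"
proof -
  have inner: "(\<Sum>\<^sub>\<infinity>j. pterm a b (i, j)) = a i * cs b i" for i
  proof -
    have "(\<Sum>\<^sub>\<infinity>j. pterm a b (i, j)) = (\<Sum>\<^sub>\<infinity>j. a i * (b j * w (j + i)))"
      by (simp add: pterm_def ac_simps)
    also have "\<dots> = a i * cs b i" unfolding cs_def using cs_summable[OF assms(2)] by (intro infsum_cmult_right)
    finally show ?thesis .
  qed
  have s: "pterm a b summable_on (SIGMA i:UNIV. UNIV)" using assms(1) by (simp add: pairable_def)
  show "(\<lambda>i. a i * cs b i) summable_on UNIV"
    using summable_on_Sigma_banach[OF s[unfolded pterm_def]] inner by (simp add: pterm_def)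
  show "beta a b = (\<Sum>\<^sub>\<infinity>i. a i * cs b i)"
    using infsum_Sigma_banach[OF s] inner by (simp add: beta_def)
qed

lemma pterm_add: "pterm (\<lambda>k. a k + a' k) b p = pterm a b p + pterm a' b p"
  by (cases p) (simp add: pterm_def algebra_simps)

lemma pairable_add: "pairable a b \<Longrightarrow> pairable a' b \<Longrightarrow> pairable (\<lambda>k. a k + a' k) b"
  unfolding pairable_def using summable_on_add by (simp add: pterm_add[abs_def])

lemma beta_add: "pairable a b \<Longrightarrow> pairable a' b \<Longrightarrow> beta (\<lambda>k. a k + a' k) b = beta a b + beta a' b"
  unfolding pairable_def beta_def by (simp add: pterm_add[abs_def] infsum_add)

lemma pterm_uminus: "pterm (\<lambda>k. - a k) b p = - pterm a b p"
  by (cases p) (simp add: pterm_def)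

lemma pairable_uminus: "pairable a b \<Longrightarrow> pairable (\<lambda>k. - a k) b"
  unfolding pairable_def by (simp add: pterm_uminus[abs_def] summable_on_uminus)

lemma beta_uminus: "beta (\<lambda>k. - a k) b = - beta a b"
  unfolding beta_def by (simp add: pterm_uminus[abs_def] infsum_uminus)

text \<open>The difference \<open>c\<close> of two representatives of a point has an integral lift
  \<open>cs (ri c)\<close>. Summing over the index of \<open>c\<close> first leaves a summable
  series of integers.\<close>

lemma beta_diff_Ints:
  assumes a: "bounded_seq a" "bounded_seq a'" "\<theta> a = \<theta> a'" and p: "pairable (ri a) (ri b)" "pairable (ri a') (ri b)"
  shows "beta (ri a) (ri b) - beta (ri a') (ri b) \<in> \<int>"
proof -
  define c where "c = (\<lambda>k. a k - a' k)"
  have rc: "ri c = (\<lambda>k. ri a k + - ri a' k)" by (simp add: c_def)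
  have pc: "pairable (ri c) (ri b)" unfolding rc by (intro pairable_add pairable_uminus p)
  have "beta (ri c) (ri b) = beta (ri a) (ri b) - beta (ri a') (ri b)"
    unfolding rc using p by (subst beta_add) (auto simp: pairable_uminus beta_uminus)
  moreover have bc: "bdd_fun (ri c)" using a unfolding c_def by (intro bounded_seq_ri bounded_seq_diff)
  have "beta (ri c) (ri b) = (\<Sum>\<^sub>\<infinity>i. ri b i * cs (ri c) i)"
    using beta_eq(2)[OF pairable_commute[OF pc] bc] beta_commute by simp
  moreover have "\<dots> \<in> \<int>"
  proof (rule Ints_infsum)
    show "(\<lambda>i. ri b i * cs (ri c) i) summable_on UNIV"
      by (rule beta_eq(1)[OF pairable_commute[OF pc] bc])
    show "ri b i * cs (ri c) i \<in> \<int>" for i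
      using a \<theta>_eq_iff[OF a(1,2)] by (intro Ints_mult) (auto simp: ri_def c_def)
  qed
  ultimately show ?thesis by simp
qed

section \<open>Descent of the form to points\<close>

definition good_pair :: "(int \<Rightarrow> int) set \<Rightarrow> (int \<Rightarrow> int) set \<Rightarrow> bool" where
  "good_pair X Y \<longleftrightarrow> (\<forall>a\<in>X. bounded_seq a) \<and> (\<forall>b\<in>Y. bounded_seq b) \<and> (\<forall>a\<in>X. \<forall>b\<in>Y. pairable (ri a) (ri b)) \<and>
     (\<forall>a\<in>X. \<forall>a'\<in>X. (\<lambda>k. a k + a' k) \<in> X) \<and> (\<forall>b\<in>Y. \<forall>b'\<in>Y. (\<lambda>k. b k + b' k) \<in> Y)"

text \<open>The choice of representatives is immaterial once \<open>good_pair X Y\<close> holds: changing one changes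
  \<open>beta\<close> by an integer.\<close>
definition rep_pairing :: "(int \<Rightarrow> int) set \<Rightarrow> (int \<Rightarrow> int) set \<Rightarrow> 'g \<Rightarrow> 'g \<Rightarrow> complex" where
  "rep_pairing X Y g h = cis (2 * pi * beta (ri (SOME a. a \<in> X \<and> \<theta> a = g)) (ri (SOME b. b \<in> Y \<and> \<theta> b = h)))"

lemma cis_eq_if_Ints: "x - y \<in> \<int> \<Longrightarrow> cis (2 * pi * x) = cis (2 * pi * y)"
proof -
  assume "x - y \<in> \<int>"
  then have "cis (2 * pi * (x - y)) = 1" by (simp add: cis_2pi_eq_1_iff)
  then have "cis (2 * pi * (x - y)) * cis (2 * pi * y) = cis (2 * pi * y)" by simp
  then show ?thesis by (simp add: cis_mult algebra_simps)
qed

lemma rep_pairing_eq: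
  assumes good: "good_pair X Y" and a: "a \<in> X" and b: "b \<in> Y"
  shows "rep_pairing X Y (\<theta> a) (\<theta> b) = cis (2 * pi * beta (ri a) (ri b))"
proof -
  define a' where "a' = (SOME a'. a' \<in> X \<and> \<theta> a' = \<theta> a)"
  define b' where "b' = (SOME b'. b' \<in> Y \<and> \<theta> b' = \<theta> b)"
  have a': "a' \<in> X" "\<theta> a' = \<theta> a" using someI[of "\<lambda>a'. a' \<in> X \<and> \<theta> a' = \<theta> a" a] a by (auto simp: a'_def)
  have b': "b' \<in> Y" "\<theta> b' = \<theta> b" using someI[of "\<lambda>b'. b' \<in> Y \<and> \<theta> b' = \<theta> b" b] b by (auto simp: b'_def)
  \<comment> \<open>The two arguments are changed one after the other, the second one through the
    symmetry of \<open>beta\<close>.\<close>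
  have 1: "beta (ri a') (ri b') - beta (ri a) (ri b') \<in> \<int>"
    using good a a' b' unfolding good_pair_def by (intro beta_diff_Ints) auto
  have 2: "beta (ri b') (ri a) - beta (ri b) (ri a) \<in> \<int>"
    using good a b b' unfolding good_pair_def by (intro beta_diff_Ints) (auto intro: pairable_commute)
  have eq: "beta (ri a') (ri b') - beta (ri a) (ri b) = (beta (ri a') (ri b') - beta (ri a) (ri b')) + (beta (ri b') (ri a) - beta (ri b) (ri a))"
    using beta_commute[of "ri b'" "ri a"] beta_commute[of "ri b" "ri a"] by simp
  have "beta (ri a') (ri b') - beta (ri a) (ri b) \<in> \<int>" unfolding eq by (rule Ints_add[OF 1 2])
  then show ?thesis unfolding rep_pairing_def a'_def[symmetric] b'_def[symmetric] by (rule cis_eq_if_Ints)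
qed

lemma norm_rep_pairing [simp]: "cmod (rep_pairing X Y g h) = 1"
  by (simp add: rep_pairing_def)

lemma rep_pairing_add_left:
  assumes good: "good_pair X Y" and "a \<in> X" "a' \<in> X" "b \<in> Y"
  shows "rep_pairing X Y (\<theta> a + \<theta> a') (\<theta> b) = rep_pairing X Y (\<theta> a) (\<theta> b) * rep_pairing X Y (\<theta> a') (\<theta> b)"
proof -
  have "\<theta> a + \<theta> a' = \<theta> (\<lambda>k. a k + a' k)" using assms by (simp add: \<theta>_add good_pair_def)
  moreover have "(\<lambda>k. a k + a' k) \<in> X" using assms by (simp add: good_pair_def)
  ultimately show ?thesis
    using assms by (simp add: rep_pairing_eq[OF good] cis_mult beta_add good_pair_def distrib_left)
qed

lemma rep_pairing_add_right:
  assumes good: "good_pair X Y" and "a \<in> X" "b \<in> Y" "b' \<in> Y"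
  shows "rep_pairing X Y (\<theta> a) (\<theta> b + \<theta> b') = rep_pairing X Y (\<theta> a) (\<theta> b) * rep_pairing X Y (\<theta> a) (\<theta> b')"
proof -
  have "\<theta> b + \<theta> b' = \<theta> (\<lambda>k. b k + b' k)" using assms by (simp add: \<theta>_add good_pair_def)
  moreover have "(\<lambda>k. b k + b' k) \<in> Y" using assms by (simp add: good_pair_def)
  moreover have "beta (ri a) (\<lambda>k. ri b k + ri b' k) = beta (ri a) (ri b) + beta (ri a) (ri b')"
    using assms by (subst (1 2 3) beta_commute) (simp add: beta_add pairable_commute good_pair_def)
  ultimately show ?thesis
    using assms by (simp add: rep_pairing_eq[OF good] cis_mult distrib_left)
qed

lemma pairable_finite:
  assumes c: "finite {n. c n \<noteq> 0}" and b: "bdd_fun b" shows "pairable c b"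
proof -
  have "(\<lambda>x. norm (pterm c b x)) summable_on (SIGMA i:UNIV. UNIV)"
    unfolding Infinite_Sum.abs_summable_on_Sigma_iff
  proof (intro conjI ballI)
    fix i
    have "(\<lambda>j. c i * (b j * w (j + i))) summable_on UNIV" by (intro summable_on_cmult_right cs_summable b)
    then have 1: "(\<lambda>j. pterm c b (i, j)) summable_on UNIV" by (simp add: pterm_def ac_simps)
    show "(\<lambda>j. norm (pterm c b (i, j))) summable_on UNIV"
      by (rule summable_on_iff_abs_summable_on_real[THEN iffD1, OF 1])
    have "finite {i. infsum (\<lambda>j. norm (pterm c b (i, j))) UNIV \<noteq> 0}"
      by (rule finite_subset[OF _ c]) (auto simp: pterm_def)
    then have 2: "(\<lambda>i. infsum (\<lambda>j. norm (pterm c b (i, j))) UNIV) summable_on UNIV"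
      by (intro finite_nonzero_values_imp_summable_on) simp
    show "(\<lambda>i. norm (infsum (\<lambda>j. norm (pterm c b (i, j))) UNIV)) summable_on UNIV"
      by (rule summable_on_iff_abs_summable_on_real[THEN iffD1, OF 2])
  qed
  then have "(\<lambda>x. norm (pterm c b x)) summable_on UNIV" by simp
  then show ?thesis unfolding pairable_def by (rule summable_on_iff_abs_summable_on_real[THEN iffD2])
qed

text \<open>On the supports \<open>i + j\<close> exceeds \<open>p + q\<close> by
  \<open>(i - p) + (j - q)\<close>, so the terms are dominated by two independent geometric series
  and a factor \<open>\<rho> powi (p + q)\<close>. The exponent is an integer because
  \<open>p + q\<close> may be negative.\<close>

lemma pairable_right_supported:
  assumes a: "\<And>i. \<bar>a i\<bar> \<le> M" "\<And>i. i < p \<Longrightarrow> a i = 0" and b: "\<And>i. \<bar>b i\<bar> \<le> N" "\<And>i. i < q \<Longrightarrow> b i = 0"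
  shows "pairable a b" "\<bar>beta a b\<bar> \<le> M * N * C * R * R * \<rho> powi (p + q)"
proof -
  define c where "c = M * N * C * \<rho> powi (p + q)"
  have M0: "M \<ge> 0" "N \<ge> 0" using a(1) b(1) by (meson abs_ge_zero order_trans)+
  have c0: "c \<ge> 0" using M0 C_nonneg rho by (simp add: c_def)
  define G where "G = (\<lambda>(i, j). c * \<rho> ^ nat \<bar>i + - p\<bar> * \<rho> ^ nat \<bar>j + - q\<bar>)"
  have G_in: "(\<lambda>j. G (i, j)) summable_on UNIV" "(\<Sum>\<^sub>\<infinity>j. G (i, j)) = c * \<rho> ^ nat \<bar>i + - p\<bar> * R" for i
    using rho_shift_summable[of "- q"] rho_shift_infsum[of "- q"]
    by (auto simp: G_def infsum_cmult_right intro!: summable_on_cmult_right)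
  have G0: "G x \<ge> 0" for x using c0 rho by (auto simp: G_def split: prod.split)
  have out: "(\<lambda>i. c * \<rho> ^ nat \<bar>i + - p\<bar> * R) summable_on UNIV"
    by (intro summable_on_cmult_left summable_on_cmult_right rho_shift_summable)
  have "(\<lambda>x. norm (G x)) summable_on (SIGMA i:UNIV. UNIV)"
    unfolding Infinite_Sum.abs_summable_on_Sigma_iff using G_in out G0 c0 rho R_nonneg by simp
  then have Gs: "G summable_on UNIV" using G0 by simp
  have "(\<Sum>\<^sub>\<infinity>x. G x) = (\<Sum>\<^sub>\<infinity>i. \<Sum>\<^sub>\<infinity>j. G (i, j))"
    using infsum_Sigma_banach[of G UNIV "\<lambda>_. UNIV"] Gs by simp
  also have "\<dots> = c * R * R"
    using G_in(2) rho_shift_summable[of "- p"] rho_shift_infsum[of "- p"]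
    by (simp add: infsum_cmult_right infsum_cmult_left summable_on_cmult_right)
  finally have Gsum: "(\<Sum>\<^sub>\<infinity>x. G x) = c * R * R" .
  have le: "norm (pterm a b x) \<le> G x" for x
  proof (cases x)
    case (Pair i j)
    show ?thesis
    proof (cases "i < p \<or> j < q")
      case True
      then show ?thesis using a(2) b(2) G0[of x] by (auto simp: pterm_def Pair)
    next
      case False
      have "\<rho> ^ nat \<bar>i + j\<bar> = \<rho> powi \<bar>i + j\<bar>" by (simp add: power_int_def)
      also have "\<dots> \<le> \<rho> powi ((p + q) + ((i - p) + (j - q)))"
        using rho by (intro power_int_decreasing) auto
      also have "\<dots> = \<rho> powi (p + q) * (\<rho> ^ nat \<bar>i + - p\<bar> * \<rho> ^ nat \<bar>j + - q\<bar>)"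
      proof -
        have "\<rho> ^ nat \<bar>i + - p\<bar> = \<rho> powi (i - p)" "\<rho> ^ nat \<bar>j + - q\<bar> = \<rho> powi (j - q)"
          using False by (simp_all add: power_int_def)
        moreover have "\<rho> \<noteq> 0" using rho by simp
        then have "\<rho> powi (m + n) = \<rho> powi m * \<rho> powi n" for m n by (intro power_int_add) simp
        ultimately show ?thesis by (simp only:)
      qed
      finally have "C * \<rho> ^ nat \<bar>i + j\<bar> \<le> C * (\<rho> powi (p + q) * (\<rho> ^ nat \<bar>i + - p\<bar> * \<rho> ^ nat \<bar>j + - q\<bar>))"
        using C_nonneg by (rule mult_left_mono)
      then have wle: "\<bar>w (i + j)\<bar> \<le> C * (\<rho> powi (p + q) * (\<rho> ^ nat \<bar>i + - p\<bar> * \<rho> ^ nat \<bar>j + - q\<bar>))"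
        using w_decay[of "i + j"] by linarith
      have "\<bar>a i * b j\<bar> \<le> M * N" unfolding abs_mult using a(1) b(1) M0 by (intro mult_mono) auto
      then have "\<bar>a i * b j\<bar> * \<bar>w (i + j)\<bar> \<le> (M * N) * (C * (\<rho> powi (p + q) * (\<rho> ^ nat \<bar>i + - p\<bar> * \<rho> ^ nat \<bar>j + - q\<bar>)))"
        using wle M0 by (intro mult_mono) auto
      then show ?thesis by (simp add: pterm_def Pair G_def c_def abs_mult mult_ac)
    qed
  qed
  show pair: "pairable a b" unfolding pairable_def
    by (rule abs_summable_summable[OF Infinite_Sum.abs_summable_on_comparison_test'[OF Gs]]) (rule le)
  have "norm (beta a b) \<le> (\<Sum>\<^sub>\<infinity>x. G x)" unfolding beta_def
    by (rule norm_infsum_le[OF has_sum_infsum has_sum_infsum[OF Gs] le]) (use pair in \<open>simp add: pairable_def\<close>)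
  then show "\<bar>beta a b\<bar> \<le> M * N * C * R * R * \<rho> powi (p + q)" by (simp add: Gsum c_def mult_ac)
qed

definition half_bounded :: "(int \<Rightarrow> int) set" where "half_bounded = (\<Union>M k. Bplus M k)"

lemma good_half_bounded: "good_pair half_bounded half_bounded"
  unfolding good_pair_def
proof (intro conjI ballI)
  fix a b assume "a \<in> half_bounded" "b \<in> half_bounded"
  then obtain M k N l where ab: "a \<in> Bplus M k" "b \<in> Bplus N l" by (auto simp: half_bounded_def)
  show "pairable (ri a) (ri b)"
  proof (rule pairable_right_supported(1))
    show "\<bar>ri a i\<bar> \<le> real M" "\<bar>ri b i\<bar> \<le> real N" for i using ab by (auto simp: Bplus_def intro: ri_bound)
    show "ri a i = 0" if "i < - int k" for i using ab that by (simp add: Bplus_def ri_def)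
    show "ri b i = 0" if "i < - int l" for i using ab that by (simp add: Bplus_def ri_def)
  qed
  show "(\<lambda>k. a k + b k) \<in> half_bounded" "(\<lambda>k. a k + b k) \<in> half_bounded" using Bplus_add[OF ab] by (auto simp: half_bounded_def)
qed (auto simp: half_bounded_def Bplus_bounded_seq)

lemma good_fin: "good_pair laurent_polys (Collect bounded_seq)"
  unfolding good_pair_def
proof (intro conjI ballI)
  fix a b assume "a \<in> laurent_polys" "b \<in> Collect bounded_seq"
  then show "pairable (ri a) (ri b)" by (intro pairable_finite bounded_seq_ri) (auto simp: laurent_polys_iff ri_def)
qed (auto simp: laurent_polys_bounded_seq)

lemma laurent_half_bounded: "c \<in> laurent_polys \<Longrightarrow> c \<in> half_bounded"
  using laurent_polys_Bplus by (auto simp: half_bounded_def)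

lemma half_bounded_bounded_seq: "a \<in> half_bounded \<Longrightarrow> bounded_seq a"
  by (auto simp: half_bounded_def Bplus_bounded_seq)

text \<open>Summed over its finite side last, the form is a finite integral combination of lifts,
  that is, the value of a character of the torus. This links the pairings to the dual of the
  group.\<close>

lemma beta_finite:
  assumes c: "c \<in> laurent_polys" and a: "bounded_seq a"
  shows "cis (2 * pi * beta (ri c) (ri a)) = laurent_mono c (E (\<theta> a))"
proof -
  have fin: "finite {n. c n \<noteq> 0}" using c by (simp add: laurent_polys_iff)
  have "pairable (ri c) (ri a)" using good_fin c a by (auto simp: good_pair_def)
  then have "beta (ri c) (ri a) = (\<Sum>\<^sub>\<infinity>i. ri c i * cs (ri a) i)" using a by (intro beta_eq(2) bounded_seq_ri)
  also have "\<dots> = (\<Sum>\<^sub>\<infinity>i\<in>{n. c n \<noteq> 0}. ri c i * cs (ri a) i)"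
    by (rule infsum_cong_neutral) (auto simp: ri_def)
  also have "\<dots> = (\<Sum>i\<in>{n. c n \<noteq> 0}. of_int (c i) * cs (ri a) i)" using fin by (simp add: ri_def)
  finally have "beta (ri c) (ri a) = (\<Sum>i\<in>{n. c n \<noteq> 0}. of_int (c i) * cs (ri a) i)" .
  moreover have "E (\<theta> a) = (\<lambda>n. cis (2 * pi * cs (ri a) n))" using E_\<theta>[OF a] by blast
  ultimately show ?thesis using laurent_mono_cis[OF c, of "cs (ri a)"] by simp
qed

section \<open>The stable and the homoclinic pairing\<close>

definition stable_pairing :: "'g \<Rightarrow> 'g \<Rightarrow> complex" where "stable_pairing = rep_pairing half_bounded half_bounded"

lemma stable_eq: "stable = \<theta> ` half_bounded"
proof (intro equalityI subsetI)
  fix g assume "g \<in> stable"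
  then obtain k a where "a \<in> Bplus N0 k" "g = \<theta> a" using stable_rep by metis
  then show "g \<in> \<theta> ` half_bounded" unfolding half_bounded_def by auto
qed (auto simp: half_bounded_def intro: \<theta>_Bplus_stable)

lemma stable_pairing_finite: assumes "c \<in> laurent_polys" "u \<in> stable" shows "stable_pairing (\<theta> c) u = laurent_mono c (E u)"
proof -
  obtain a where a: "a \<in> half_bounded" "u = \<theta> a" using assms(2) by (auto simp: stable_eq)
  then show ?thesis using assms(1)
    by (simp add: stable_pairing_def rep_pairing_eq[OF good_half_bounded] laurent_half_bounded beta_finite half_bounded_bounded_seq)
qed

lemma stable_pairing_commute: assumes "u \<in> stable" "v \<in> stable" shows "stable_pairing u v = stable_pairing v u"
  using assms by (auto simp: stable_eq stable_pairing_def rep_pairing_eq[OF good_half_bounded] beta_commute)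

lemma stable_pairing_add_right: assumes "v \<in> stable" "x \<in> stable" "y \<in> stable" shows "stable_pairing v (x + y) = stable_pairing v x * stable_pairing v y"
  using assms by (auto simp: stable_eq stable_pairing_def rep_pairing_add_right[OF good_half_bounded])

lemma stable_pairing_add_left: assumes "v \<in> stable" "x \<in> stable" "y \<in> stable" shows "stable_pairing (x + y) v = stable_pairing x v * stable_pairing y v"
  using assms by (auto simp: stable_eq stable_pairing_def rep_pairing_add_left[OF good_half_bounded])

lemma norm_stable_pairing [simp]: "cmod (stable_pairing u v) = 1"
  by (simp add: stable_pairing_def)

lemma \<theta>_laurent_stable: "c \<in> laurent_polys \<Longrightarrow> \<theta> c \<in> stable"
  by (simp add: stable_eq laurent_half_bounded)

lemma laurent_mono_delta: "laurent_mono (delta n) y = y n"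
proof -
  have "{m. delta n m \<noteq> 0} = {n}" by (auto simp: delta_def)
  then show ?thesis by (simp add: laurent_mono_def delta_def)
qed

text \<open>The coordinates are themselves values of the pairing, so closeness of characters can be
  converted into closeness in the metric.\<close>

lemma stable_pairing_delta: assumes "v \<in> stable" shows "stable_pairing v (\<theta> (delta n)) = E v n"
  using stable_pairing_finite[OF delta_laurent assms, of n] stable_pairing_commute[OF assms \<theta>_laurent_stable[OF delta_laurent[of n]]]
  by (simp add: laurent_mono_delta)

definition homoclinic_pairing :: "'g \<Rightarrow> 'g \<Rightarrow> complex" where "homoclinic_pairing = rep_pairing laurent_polys (Collect bounded_seq)"

lemma homoclinic_pairing_eq: assumes "c \<in> laurent_polys" shows "homoclinic_pairing (\<theta> c) g = laurent_mono c (E g)"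
proof -
  obtain a where a: "\<And>k. \<bar>a k\<bar> \<le> int N0" "\<theta> a = g" using \<theta>_surj_bounded by blast
  then have "bounded_seq a" by (intro bdiI)
  then show ?thesis using assms rep_pairing_eq[OF good_fin, of c a] a(2) by (simp add: homoclinic_pairing_def beta_finite)
qed

text \<open>A converse to \<open>tail_small\<close>: the metric sees the coordinates down to index
  \<open>- (P + d)\<close> with weight at least \<open>(1 / 2) ^ (P + d)\<close>, and when all of
  these are near 1 the digits below \<open>P\<close> vanish.\<close>

lemma far_rep:
  "\<exists>\<delta>>0. \<forall>v. wdist w_up v 0 < \<delta> \<longrightarrow> (\<exists>a. (\<forall>i. \<bar>a i\<bar> \<le> int N0) \<and> (\<forall>i. i < int P \<longrightarrow> a i = 0) \<and> \<theta> a = v)"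
proof (rule exI[of _ "\<delta>0 * (1 / 2) ^ (P + d)"], intro conjI allI impI)
  let ?\<delta> = "\<delta>0 * (1 / 2) ^ (P + d)"
  show "?\<delta> > 0" using \<delta>0_pos by simp
  fix v assume v: "wdist w_up v 0 < ?\<delta>"
  have "cmod (E v m - 1) < \<delta>0" if "m \<ge> - int (P + d)" for m
  proof -
    have "w_up m \<ge> (1 / 2) ^ (P + d)" unfolding w_up_def using that by (intro power_decreasing) auto
    then have "(1 / 2) ^ (P + d) * cmod (E v m - 1) \<le> w_up m * cmod (E v m - E 0 m)" by (simp add: mult_right_mono)
    also have "\<dots> \<le> wdist w_up v 0" by (rule wdist_upper) simp
    finally have "(1 / 2) ^ (P + d) * cmod (E v m - 1) < (1 / 2) ^ (P + d) * \<delta>0"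
      using v mult.commute[of \<delta>0 "(1 / 2) ^ (P + d)"] by linarith
    then show ?thesis by (rule mult_left_less_imp_less) simp
  qed
  then obtain a where "\<And>k. \<bar>a k\<bar> \<le> int N0" "\<theta> a = v" "\<And>i. i \<le> - (- int (P + d)) - int d \<Longrightarrow> a i = 0"
    using tail_rep by metis
  then show "\<exists>a. (\<forall>i. \<bar>a i\<bar> \<le> int N0) \<and> (\<forall>i. i < int P \<longrightarrow> a i = 0) \<and> \<theta> a = v" by (intro exI[of _ a]) auto
qed

text \<open>A small point has digits starting only at \<open>m + k\<close>, while \<open>b\<close>
  starts at \<open>- k\<close>. Index sums are then at least \<open>m\<close>, where the kernel is
  of order \<open>\<rho> ^ m\<close>.\<close>

lemma stable_pairing_small:
  assumes "e > 0"
  shows "\<exists>\<delta>>0. \<forall>v. wdist w_up v 0 < \<delta> \<longrightarrow> (\<forall>b\<in>Bplus M k. cmod (stable_pairing v (\<theta> b) - 1) \<le> e)"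
proof -
  define c where "c = 2 * pi * (real N0 * real M * C * R * R) + 1"
  have c: "c > 0" using C_nonneg R_nonneg by (simp add: c_def add_nonneg_pos)
  obtain m where m: "\<rho> ^ m < e / c" using real_arch_pow_inv[of "e / c" \<rho>] assms c rho by auto
  obtain \<delta> where \<delta>: "\<delta> > 0" "\<And>v. wdist w_up v 0 < \<delta> \<Longrightarrow>
     (\<exists>a. (\<forall>i. \<bar>a i\<bar> \<le> int N0) \<and> (\<forall>i. i < int (m + k) \<longrightarrow> a i = 0) \<and> \<theta> a = v)"
    using far_rep by meson
  have "cmod (stable_pairing v (\<theta> b) - 1) \<le> e" if v: "wdist w_up v 0 < \<delta>" and b: "b \<in> Bplus M k" for v b
  proof -
    obtain a where a: "\<And>i. \<bar>a i\<bar> \<le> int N0" "\<And>i. i < int (m + k) \<Longrightarrow> a i = 0" "\<theta> a = v" using \<delta>(2)[OF v] by blast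
    have "a \<in> Bplus N0 0" using a(1,2) by (auto simp: Bplus_def)
    then have half_bounded: "a \<in> half_bounded" "b \<in> half_bounded" using b by (auto simp: half_bounded_def)
    have "\<bar>beta (ri a) (ri b)\<bar> \<le> real N0 * real M * C * R * R * \<rho> powi (int (m + k) + - int k)"
    proof (rule pairable_right_supported(2))
      show "\<bar>ri a i\<bar> \<le> real N0" "\<bar>ri b i\<bar> \<le> real M" for i using a b by (auto simp: Bplus_def intro: ri_bound)
      show "ri a i = 0" if "i < int (m + k)" for i using a(2)[OF that] by (simp add: ri_def)
      show "ri b i = 0" if "i < - int k" for i using b that by (simp add: Bplus_def ri_def)
    qed
    then have "2 * pi * \<bar>beta (ri a) (ri b)\<bar> \<le> 2 * pi * (real N0 * real M * C * R * R * \<rho> ^ m)"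
      by (intro mult_left_mono) simp_all
    also have "\<dots> \<le> c * \<rho> ^ m" using rho by (simp add: c_def algebra_simps)
    also have "\<dots> \<le> e" using m c by (simp add: field_simps)
    finally show ?thesis
      using norm_cis_diff_1_le[of "beta (ri a) (ri b)"] rep_pairing_eq[OF good_half_bounded half_bounded] a(3) by (simp add: stable_pairing_def)
  qed
  then show ?thesis using \<delta>(1) by blast
qed

end

section \<open>Duality of the stable group\<close>

text \<open>Subbasic sets only prescribe open targets for compact sets. The circle is covered by
  finitely many discs of radius \<open>e / 3\<close>, and \<open>K\<close> is divided into the
  compact pieces that \<open>ch0\<close> maps into the closed discs; finitely many subbasic
  conditions then express uniform closeness on \<open>K\<close>.\<close>

lemma char_nbhd_open:
  assumes ch0: "ch0 \<in> characters G" and K: "compactin (tg_top G) K" and e: "e > 0"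
  shows "\<exists>Q. openin (compact_open_top G) Q \<and> ch0 \<in> Q \<and>
    (\<forall>ch\<in>Q. ch \<in> characters G \<and> (\<forall>x\<in>K. dist (ch x) (ch0 x) < e))"
proof -
  let ?S = "sphere (0::complex) 1"
  have "?S \<subseteq> (\<Union>z\<in>?S. ball z (e / 3))" using e by auto
  then obtain D where D: "D \<subseteq> ?S" "finite D" "?S \<subseteq> (\<Union>z\<in>D. ball z (e / 3))"
    using compactE_image[of ?S ?S "\<lambda>z. ball z (e / 3)"] by auto
  have cont: "continuous_map (tg_top G) circle_top ch0" using ch0 by (simp add: characters_def)
  then have conte: "continuous_map (tg_top G) euclidean ch0" "ch0 ` topspace (tg_top G) \<subseteq> ?S"
    by (auto simp: circle_top_def continuous_map_in_subtopology)
  have Ksub: "K \<subseteq> topspace (tg_top G)" using K by (simp add: compactin_def)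
  define Kz where "Kz z = {x \<in> topspace (tg_top G). ch0 x \<in> cball z (e / 3)} \<inter> K" for z
  have cK: "compactin (tg_top G) (Kz z)" for z unfolding Kz_def
    by (intro closed_Int_compactin closedin_continuous_map_preimage[OF conte(1)] K) auto
  define Uz where "Uz z = ?S \<inter> ball z (2 * e / 3)" for z
  have oU: "openin circle_top (Uz z)" for z unfolding circle_top_def Uz_def by (simp add: openin_open_Int)
  define Q where "Q = (\<Inter>W\<in>insert (characters G) ((\<lambda>z. {ch \<in> characters G. ch ` Kz z \<subseteq> Uz z}) ` D). W)"
  have "openin (compact_open_top G) Q"
    unfolding Q_def compact_open_top_def using D(2) cK oU
    by (intro openin_INT2 topology_generated_by_Basis) auto
  moreover have "ch0 \<in> Q"
  proof -
    have "ch0 x \<in> Uz z" if "x \<in> Kz z" for x z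
    proof -
      have "dist z (ch0 x) \<le> e / 3" "ch0 x \<in> ?S" using that conte(2) by (auto simp: Kz_def)
      then show ?thesis using e by (simp add: Uz_def)
    qed
    then show ?thesis using ch0 by (auto simp: Q_def)
  qed
  moreover have "ch \<in> characters G \<and> (\<forall>x\<in>K. dist (ch x) (ch0 x) < e)" if ch: "ch \<in> Q" for ch
  proof
    show "ch \<in> characters G" using ch by (simp add: Q_def)
    show "\<forall>x\<in>K. dist (ch x) (ch0 x) < e"
    proof
      fix x assume x: "x \<in> K"
      then have "ch0 x \<in> ?S" using conte(2) Ksub by blast
      then obtain z where z: "z \<in> D" "dist z (ch0 x) < e / 3" using D(3) by auto
      then have "x \<in> Kz z" using x Ksub by (auto simp: Kz_def)
      then have "ch x \<in> Uz z" using ch z(1) by (auto simp: Q_def)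
      then have "dist z (ch x) < 2 * e / 3" by (simp add: Uz_def)
      then show "dist (ch x) (ch0 x) < e" using z(2) dist_triangle3[of "ch x" "ch0 x" z] by linarith
    qed
  qed
  ultimately show ?thesis by blast
qed

text \<open>Induction on the generation of the topology. For a subbasic set, the compact image of
  \<open>K\<close> has an open neighbourhood of uniform radius inside the open target.\<close>

lemma char_nbhd_basis:
  assumes Q: "openin (compact_open_top G) Q" and ch0: "ch0 \<in> Q"
  shows "\<exists>K e. compactin (tg_top G) K \<and> e > 0 \<and>
    (\<forall>ch\<in>characters G. (\<forall>x\<in>K. dist (ch x) (ch0 x) < e) \<longrightarrow> ch \<in> Q)"
proof -
  have "generate_topology_on (insert (characters G)
        {{ch \<in> characters G. ch ` K \<subseteq> U} | K U. compactin (tg_top G) K \<and> openin circle_top U}) Q"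
    using Q unfolding compact_open_top_def by (simp add: openin_topology_generated_by_iff)
  then show ?thesis using ch0
  proof (induction rule: generate_topology_on.induct)
    case (Int a b)
    then obtain K1 e1 K2 e2 where 1: "compactin (tg_top G) K1" "e1 > 0" "\<forall>ch\<in>characters G. (\<forall>x\<in>K1. dist (ch x) (ch0 x) < e1) \<longrightarrow> ch \<in> a"
      and 2: "compactin (tg_top G) K2" "e2 > 0" "\<forall>ch\<in>characters G. (\<forall>x\<in>K2. dist (ch x) (ch0 x) < e2) \<longrightarrow> ch \<in> b" by auto
    have "compactin (tg_top G) (K1 \<union> K2)" using 1 2 by (intro compactin_Un)
    moreover have "\<forall>ch\<in>characters G. (\<forall>x\<in>K1 \<union> K2. dist (ch x) (ch0 x) < min e1 e2) \<longrightarrow> ch \<in> a \<inter> b"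
      using 1 2 by auto
    ultimately show ?case using 1(2) 2(2) by (intro exI[of _ "K1 \<union> K2"] exI[of _ "min e1 e2"]) auto
  next
    case (UN \<K>)
    then obtain k where k: "k \<in> \<K>" "ch0 \<in> k" by blast
    then obtain K e where "compactin (tg_top G) K" "e > 0" "\<forall>ch\<in>characters G. (\<forall>x\<in>K. dist (ch x) (ch0 x) < e) \<longrightarrow> ch \<in> k"
      using UN.IH by blast
    then show ?case using k(1) by (intro exI[of _ K] exI[of _ e]) auto
  next
    case (Basis s)
    show ?case
    proof (cases "s = characters G")
      case True
      then show ?thesis by (intro exI[of _ "{}"] exI[of _ 1]) auto
    next
      case False
      then obtain K U where KU: "s = {ch \<in> characters G. ch ` K \<subseteq> U}" "compactin (tg_top G) K" "openin circle_top U"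
        using Basis by auto
      obtain V where V: "open V" "U = V \<inter> sphere 0 1"
        using KU(3) by (auto simp: circle_top_def openin_subtopology)
      have ch0: "ch0 \<in> characters G" "ch0 ` K \<subseteq> U" using Basis KU(1) by auto
      then have "continuous_map (tg_top G) euclidean ch0"
        by (auto simp: characters_def circle_top_def continuous_map_in_subtopology)
      then have "compact (ch0 ` K)" using image_compactin[OF KU(2), of euclidean ch0] by simp
      then obtain e where e: "e > 0" "(\<Union>z\<in>ch0 ` K. ball z e) \<subseteq> V"
        using compact_subset_open_imp_ball_epsilon_subset[of "ch0 ` K" V] V ch0(2) by auto
      have "ch \<in> s" if ch: "ch \<in> characters G" "\<forall>x\<in>K. dist (ch x) (ch0 x) < e" for ch
      proof -
        have "ch x \<in> U" if x: "x \<in> K" for x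
        proof -
          have "ch x \<in> ball (ch0 x) e" using ch(2) x by (simp add: dist_commute)
          then have "ch x \<in> V" using e(2) x by blast
          moreover have "ch x \<in> sphere 0 1"
          proof -
            have "ch ` topspace (tg_top G) \<subseteq> sphere 0 1"
              using ch(1) by (auto simp: characters_def circle_top_def continuous_map_in_subtopology)
            moreover have "x \<in> topspace (tg_top G)" using x KU(2) unfolding compactin_def by blast
            ultimately show ?thesis by blast
          qed
          ultimately show ?thesis by (simp add: V(2))
        qed
        then show ?thesis using ch(1) KU(1) by auto
      qed
      then show ?thesis using KU(2) e(1) by blast
    qed
  qed auto
qed

lemma topspace_compact_open: "topspace (compact_open_top G) = characters G"
  unfolding compact_open_top_def topology_generated_by_topspace by auto

text \<open>In the compact-open topology the characters uniformly close to a given one on a compact set form a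
  neighbourhood base.\<close>

theorem pairing_iso_pdual:
  fixes GA :: "'a tgroup" and GC :: "'b tgroup" and q :: "'a \<Rightarrow> 'b \<Rightarrow> complex"
  assumes char: "\<And>v. v \<in> tg_carrier GA \<Longrightarrow> restrict (q v) (tg_carrier GC) \<in> characters GC"
    and add: "\<And>v v' x. v \<in> tg_carrier GA \<Longrightarrow> v' \<in> tg_carrier GA \<Longrightarrow> x \<in> tg_carrier GC \<Longrightarrow>
        q (tg_op GA v v') x = q v x * q v' x"
    and surj: "\<And>ch. ch \<in> characters GC \<Longrightarrow> \<exists>v\<in>tg_carrier GA. \<forall>x\<in>tg_carrier GC. ch x = q v x"
    and cont: "\<And>v0 K e. v0 \<in> tg_carrier GA \<Longrightarrow> compactin (tg_top GC) K \<Longrightarrow> e > 0 \<Longrightarrow>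
        \<exists>U. openin (tg_top GA) U \<and> v0 \<in> U \<and> (\<forall>v\<in>U. \<forall>x\<in>K. dist (q v x) (q v0 x) < e)"
    and opn: "\<And>v0 U. v0 \<in> U \<Longrightarrow> openin (tg_top GA) U \<Longrightarrow>
        \<exists>K e. compactin (tg_top GC) K \<and> e > 0 \<and> (\<forall>v\<in>tg_carrier GA. (\<forall>x\<in>K. dist (q v x) (q v0 x) < e) \<longrightarrow> v \<in> U)"
    and haus: "Hausdorff_space (tg_top GA)"
  shows "tg_iso GA (pdual GC) (\<lambda>v. restrict (q v) (tg_carrier GC))"
proof -
  define \<phi> where "\<phi> v = restrict (q v) (tg_carrier GC)" for v
  have ptop: "tg_top (pdual GC) = compact_open_top GC" by (simp add: pdual_def tg_top_def)
  have phi_char: "\<phi> v \<in> characters GC" if "v \<in> tg_carrier GA" for v using char[OF that] by (simp add: \<phi>_def)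
  have phi_q: "\<phi> v x = q v x" if "compactin (tg_top GC) K" "x \<in> K" for v x K
    using that by (auto simp: \<phi>_def compactin_def tg_carrier_def)
  have phi_cont: "continuous_map (tg_top GA) (compact_open_top GC) \<phi>"
    unfolding continuous_map_def
  proof (intro conjI allI impI)
    show "\<phi> \<in> topspace (tg_top GA) \<rightarrow> topspace (compact_open_top GC)"
      using phi_char by (auto simp: topspace_compact_open tg_carrier_def)
    fix Q assume Q: "openin (compact_open_top GC) Q"
    show "openin (tg_top GA) {v \<in> topspace (tg_top GA). \<phi> v \<in> Q}"
    proof (subst openin_subopen, intro ballI)
      fix v0 assume "v0 \<in> {v \<in> topspace (tg_top GA). \<phi> v \<in> Q}"
      then have v0: "v0 \<in> tg_carrier GA" "\<phi> v0 \<in> Q" by (auto simp: tg_carrier_def)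
      obtain K e where K: "compactin (tg_top GC) K" "e > 0" "\<And>ch. ch \<in> characters GC \<Longrightarrow> (\<And>x. x \<in> K \<Longrightarrow> dist (ch x) (\<phi> v0 x) < e) \<Longrightarrow> ch \<in> Q"
        using char_nbhd_basis[OF Q v0(2)] by meson
      obtain U where U: "openin (tg_top GA) U" "v0 \<in> U" "\<And>v x. v \<in> U \<Longrightarrow> x \<in> K \<Longrightarrow> dist (q v x) (q v0 x) < e"
        using cont[OF v0(1) K(1,2)] by meson
      have "U \<subseteq> {v \<in> topspace (tg_top GA). \<phi> v \<in> Q}"
      proof
        fix v assume v: "v \<in> U"
        then have vS: "v \<in> tg_carrier GA" using openin_subset[OF U(1)] by (auto simp: tg_carrier_def)
        have "\<phi> v \<in> Q" by (rule K(3)[OF phi_char[OF vS]]) (simp add: phi_q[OF K(1)] U(3)[OF v])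
        then show "v \<in> {v \<in> topspace (tg_top GA). \<phi> v \<in> Q}" using vS by (simp add: tg_carrier_def)
      qed
      then show "\<exists>T. openin (tg_top GA) T \<and> v0 \<in> T \<and> T \<subseteq> {v \<in> topspace (tg_top GA). \<phi> v \<in> Q}" using U by blast
    qed
  qed
  \<comment> \<open>Two points with the same character cannot be separated by open sets, since
    \<open>opn\<close> puts each of them into every neighbourhood of the other.\<close>
  have inj: "inj_on \<phi> (tg_carrier GA)"
  proof (rule inj_onI)
    fix v v0 assume v: "v \<in> tg_carrier GA" "v0 \<in> tg_carrier GA" "\<phi> v = \<phi> v0"
    show "v = v0"
    proof (rule ccontr)
      assume "v \<noteq> v0"
      then obtain U V where UV: "openin (tg_top GA) U" "openin (tg_top GA) V" "v \<in> U" "v0 \<in> V" "disjnt U V"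
        using haus v(1,2) unfolding Hausdorff_space_def tg_carrier_def by meson
      obtain K e where K: "compactin (tg_top GC) K" "e > 0" "\<And>v. v \<in> tg_carrier GA \<Longrightarrow> (\<And>x. x \<in> K \<Longrightarrow> dist (q v x) (q v0 x) < e) \<Longrightarrow> v \<in> V"
        using opn[OF UV(4,2)] by meson
      have "q v x = q v0 x" if "x \<in> K" for x using phi_q[OF K(1) that] v(3) by metis
      then have "v \<in> V" using K(2) by (intro K(3) v(1)) simp
      then show False using UV by (auto simp: disjnt_def)
    qed
  qed
  have img: "\<phi> ` tg_carrier GA = characters GC"
  proof
    show "characters GC \<subseteq> \<phi> ` tg_carrier GA"
    proof
      fix ch assume ch: "ch \<in> characters GC"
      obtain v where v: "v \<in> tg_carrier GA" "\<And>x. x \<in> tg_carrier GC \<Longrightarrow> ch x = q v x" using surj[OF ch] by blast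
      have "ch \<in> extensional (tg_carrier GC)" using ch by (simp add: characters_def)
      then have "ch = \<phi> v" unfolding \<phi>_def using v(2) by (intro extensionalityI[of _ "tg_carrier GC"]) auto
      then show "ch \<in> \<phi> ` tg_carrier GA" using v(1) by blast
    qed
  qed (use phi_char in auto)
  have phi_open: "open_map (tg_top GA) (compact_open_top GC) \<phi>"
    unfolding open_map_def
  proof (intro allI impI)
    fix U assume U: "openin (tg_top GA) U"
    show "openin (compact_open_top GC) (\<phi> ` U)"
    proof (subst openin_subopen, intro ballI)
      fix ch0 assume "ch0 \<in> \<phi> ` U"
      then obtain v0 where v0: "v0 \<in> U" "ch0 = \<phi> v0" by blast
      have v0S: "v0 \<in> tg_carrier GA" using v0(1) openin_subset[OF U] by (auto simp: tg_carrier_def)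
      obtain K e where K: "compactin (tg_top GC) K" "e > 0" "\<And>v. v \<in> tg_carrier GA \<Longrightarrow> (\<And>x. x \<in> K \<Longrightarrow> dist (q v x) (q v0 x) < e) \<Longrightarrow> v \<in> U"
        using opn[OF v0(1) U] by meson
      obtain Q where Q: "openin (compact_open_top GC) Q" "\<phi> v0 \<in> Q"
        "\<And>ch. ch \<in> Q \<Longrightarrow> ch \<in> characters GC" "\<And>ch x. ch \<in> Q \<Longrightarrow> x \<in> K \<Longrightarrow> dist (ch x) (\<phi> v0 x) < e"
        using char_nbhd_open[OF phi_char[OF v0S] K(1,2)] by meson
      have "Q \<subseteq> \<phi> ` U"
      proof
        fix ch assume ch: "ch \<in> Q"
        then obtain v where v: "v \<in> tg_carrier GA" "ch = \<phi> v" using Q(3) img by blast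
        have "v \<in> U" using Q(4)[OF ch] phi_q[OF K(1)] v(2) by (intro K(3) v(1)) metis
        then show "ch \<in> \<phi> ` U" using v(2) by blast
      qed
      then show "\<exists>T. openin (compact_open_top GC) T \<and> ch0 \<in> T \<and> T \<subseteq> \<phi> ` U" using Q(1,2) v0(2) by blast
    qed
  qed
  have "homeomorphic_map (tg_top GA) (compact_open_top GC) \<phi>"
    using phi_cont phi_open img inj unfolding tg_carrier_def
    by (intro bijective_open_imp_homeomorphic_map) (auto simp: topspace_compact_open)
  moreover have "\<phi> (tg_op GA v v') = tg_op (pdual GC) (\<phi> v) (\<phi> v')" if "v \<in> tg_carrier GA" "v' \<in> tg_carrier GA" for v v'
    using add[OF that] by (auto simp: \<phi>_def pdual_def tg_op_def fun_eq_iff)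
  ultimately have "tg_iso GA (pdual GC) \<phi>"
    using phi_cont by (simp add: tg_iso_def tg_hom_def ptop)
  then show ?thesis by (simp add: \<phi>_def[abs_def])
qed

text \<open>The circle has no small subgroups: squaring \<open>y\<close> multiplies its distance to
  1 by \<open>cmod (y + 1)\<close>, which is at least \<open>3 / 2\<close> as long as
  \<open>y\<close> is within distance 1 of 1.\<close>

lemma unit_near_1_imp_1:
  assumes z: "cmod z = 1" and near: "\<And>n. cmod (z ^ n - 1) < 1" shows "z = 1"
proof (rule ccontr)
  assume "z \<noteq> 1"
  define r where "r k = cmod (z ^ 2 ^ k - 1)" for k
  have step: "r (Suc k) \<ge> (3 / 2) * r k" for k
  proof -
    define y where "y = z ^ 2 ^ k"
    have y1: "cmod y = 1" using z by (simp add: y_def norm_power)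
    have yn: "cmod (y - 1) < 1" using near by (simp add: y_def)
    have "(cmod (y + 1))\<^sup>2 + (cmod (y - 1))\<^sup>2 = 2 * (cmod y)\<^sup>2 + 2"
      unfolding cmod_power2 by (simp add: power2_eq_square algebra_simps)
    moreover have "(cmod (y - 1))\<^sup>2 \<le> 1" using yn by (simp add: power_le_one)
    ultimately have "(cmod (y + 1))\<^sup>2 \<ge> 3" using y1 by simp
    then have "(3 / 2)\<^sup>2 \<le> (cmod (y + 1))\<^sup>2" by (simp add: power2_eq_square)
    then have y2: "3 / 2 \<le> cmod (y + 1)" by (rule power2_le_imp_le) simp
    have "z ^ 2 ^ Suc k - 1 = (y - 1) * (y + 1)"
      by (simp add: y_def power_mult[symmetric] algebra_simps power2_eq_square flip: power_add) (simp add: mult_2 power_add)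
    then have "r (Suc k) = r k * cmod (y + 1)" by (simp add: r_def y_def norm_mult)
    then show ?thesis using y2 mult_left_mono[of "3 / 2" "cmod (y + 1)" "r k"] by (simp add: r_def)
  qed
  have "r k \<ge> (3 / 2) ^ k * r 0" for k
  proof (induction k)
    case (Suc k)
    then show ?case using step[of k] by simp
  qed simp
  moreover have r0: "r 0 > 0" using \<open>z \<noteq> 1\<close> by (simp add: r_def)
  obtain k where "(3 / 2) ^ k > 1 / r 0" using real_arch_pow[of "3 / 2" "1 / r 0"] by auto
  then have "(3 / 2) ^ k * r 0 > 1" using r0 by (simp add: field_simps)
  ultimately have "r k > 1" by (meson less_le_trans)
  then show False using near[of "2 ^ k"] by (simp add: r_def)
qed

section \<open>The stable pairing as a duality\<close>

context kernel_group
begin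

lemma laurent_decomp_tail:
  assumes b: "b \<in> Bplus M k"
  obtains c a where "c \<in> laurent_polys" "\<And>i. \<bar>a i\<bar> \<le> int M" "\<And>i. i < int P \<Longrightarrow> a i = 0" "b = (\<lambda>i. c i + a i)"
proof -
  define c where "c i = (if i < int P then b i else 0)" for i
  have "{n. c n \<noteq> 0} \<subseteq> {- int k..int P}"
  proof
    fix n assume "n \<in> {n. c n \<noteq> 0}"
    then have n: "n < int P" "b n \<noteq> 0" by (auto simp: c_def split: if_splits)
    then have "\<not> n < - int k" using b by (auto simp: Bplus_def)
    then show "n \<in> {- int k..int P}" using n by simp
  qed
  then have "c \<in> laurent_polys" unfolding laurent_polys_iff by (rule finite_subset) simp
  then show thesis using b by (intro that[of c "\<lambda>i. if i < int P then 0 else b i"]) (auto simp: c_def Bplus_def)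
qed

lemma compact_in_image_Bplus:
  assumes Kc: "compactin (wtop w_up stable) Z" shows "\<exists>k. Z \<subseteq> \<theta> ` Bplus (N0 + N0) k"
proof -
  define B where "B h = {y \<in> stable. wdist w_up y h < \<delta>0}" for h
  have Ks: "Z \<subseteq> stable" using Kc by (simp add: compactin_def)
  have "\<forall>W\<in>B ` Z. openin (wtop w_up stable) W" using openin_wtop_ball by (auto simp: B_def)
  moreover have "Z \<subseteq> \<Union>(B ` Z)" using Ks \<delta>0_pos by (auto simp: B_def)
  ultimately obtain \<F> where "finite \<F>" "\<F> \<subseteq> B ` Z" "Z \<subseteq> \<Union>\<F>" using Kc unfolding compactin_def by meson
  then obtain H where H: "finite H" "H \<subseteq> Z" "Z \<subseteq> \<Union>(B ` H)" by (metis finite_subset_image)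
  have "\<forall>h\<in>H. \<exists>k. B h \<subseteq> \<theta> ` Bplus (N0 + N0) k" using ball_in_image_Bplus H(2) Ks unfolding B_def by blast
  then obtain kf where kf: "\<And>h. h \<in> H \<Longrightarrow> B h \<subseteq> \<theta> ` Bplus (N0 + N0) (kf h)" by metis
  define k where "k = Max (insert 0 (kf ` H))"
  have "B h \<subseteq> \<theta> ` Bplus (N0 + N0) k" if "h \<in> H" for h
  proof -
    have "kf h \<le> k" unfolding k_def using H(1) that by (intro Max_ge) auto
    then have "Bplus (N0 + N0) (kf h) \<subseteq> Bplus (N0 + N0) k" by (intro Bplus_mono) auto
    then show ?thesis using kf[OF that] by blast
  qed
  then have "\<Union>(B ` H) \<subseteq> \<theta> ` Bplus (N0 + N0) k" by blast
  then show ?thesis using H(3) by blast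
qed

lemma stable_pairing_diff_left: assumes "v \<in> stable" "v0 \<in> stable" "x \<in> stable"
  shows "dist (stable_pairing v x) (stable_pairing v0 x) = cmod (stable_pairing (v - v0) x - 1)"
proof -
  have "stable_pairing v x = stable_pairing (v - v0) x * stable_pairing v0 x"
    using stable_pairing_add_left[of x "v - v0" v0] assms subgroup_set_diff[OF stable_subgroup] by simp
  then have "stable_pairing v x - stable_pairing v0 x = (stable_pairing (v - v0) x - 1) * stable_pairing v0 x" by (simp add: algebra_simps)
  then show ?thesis by (simp add: dist_norm norm_mult)
qed

lemma stable_pairing_uniform:
  assumes Kc: "compactin (wtop w_up stable) Z" and e: "e > 0"
  shows "\<exists>\<delta>>0. \<forall>v\<in>stable. \<forall>v0\<in>stable. wdist w_up v v0 < \<delta> \<longrightarrow> (\<forall>x\<in>Z. dist (stable_pairing v x) (stable_pairing v0 x) < e)"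
proof -
  obtain k where k: "Z \<subseteq> \<theta> ` Bplus (N0 + N0) k" using compact_in_image_Bplus[OF Kc] by blast
  have "e / 2 > 0" using e by simp
  from stable_pairing_small[OF this] obtain \<delta> where \<delta>: "\<delta> > 0" "\<And>v b. wdist w_up v 0 < \<delta> \<Longrightarrow> b \<in> Bplus (N0 + N0) k \<Longrightarrow> cmod (stable_pairing v (\<theta> b) - 1) \<le> e / 2"
    by meson
  have "dist (stable_pairing v x) (stable_pairing v0 x) < e" if v: "v \<in> stable" "v0 \<in> stable" "wdist w_up v v0 < \<delta>" and x: "x \<in> Z" for v v0 x
  proof -
    obtain b where b: "b \<in> Bplus (N0 + N0) k" "x = \<theta> b" using k x by blast
    have "wdist w_up (v - v0) 0 < \<delta>" using v(3) wdist_diff[of w_up v v0] by simp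
    then have "cmod (stable_pairing (v - v0) x - 1) \<le> e / 2" using \<delta>(2) b by simp
    then show ?thesis using stable_pairing_diff_left[OF v(1,2), of x] b \<theta>_Bplus_stable e by simp
  qed
  then show ?thesis using \<delta>(1) by blast
qed

text \<open>By symmetry, continuity in the second argument is the uniform statement for the compact
  set \<open>{v}\<close>.\<close>

lemma stable_pairing_continuous: assumes v: "v \<in> stable" shows "continuous_map (wtop w_up stable) euclidean (stable_pairing v)"
  unfolding mtopology_is_euclidean[symmetric] Met_TC.continuous_map_to_metric
proof (intro ballI allI impI)
  fix x e assume "x \<in> topspace (wtop w_up stable)" and e: "e > (0::real)"
  then have x: "x \<in> stable" by simp
  have "compactin (wtop w_up stable) {v}" using v by simp
  from stable_pairing_uniform[OF this e] obtain \<delta> where \<delta>: "\<delta> > 0"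
    "\<And>y. y \<in> stable \<Longrightarrow> wdist w_up y x < \<delta> \<Longrightarrow> dist (stable_pairing y v) (stable_pairing x v) < e" using x by blast
  have "dist (stable_pairing v x) (stable_pairing v y) < e" if "y \<in> stable" "wdist w_up y x < \<delta>" for y
    using \<delta>(2)[OF that] stable_pairing_commute v x that by (metis dist_commute)
  then show "\<exists>U. openin (wtop w_up stable) U \<and> x \<in> U \<and> (\<forall>y\<in>U. stable_pairing v y \<in> Met_TC.mball (stable_pairing v x) e)"
    using openin_wtop_ball[OF weights(1), of stable x \<delta>] x \<delta>(1)
    by (intro exI[of _ "{y \<in> stable. wdist w_up y x < \<delta>}"]) auto
qed

text \<open>The compact set is the image of \<open>Bplus 1 q\<close>, which contains the unit digits
  of all indices from \<open>- q\<close> on. One compact set thus controls infinitely many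
  coordinates, as a metric without damping at nonnegative indices demands.\<close>

lemma stable_pairing_separates:
  assumes "\<delta> > 0"
  shows "\<exists>K e. compactin (wtop w_up stable) K \<and> e > 0 \<and>
    (\<forall>v\<in>stable. \<forall>v0\<in>stable. (\<forall>x\<in>K. dist (stable_pairing v x) (stable_pairing v0 x) < e) \<longrightarrow> wdist w_up v v0 < \<delta>)"
proof -
  have d2: "\<delta> / 2 > 0" using assms by simp
  obtain q :: nat where q: "2 * (1 / 2) ^ q \<le> \<delta> / 2" using power_half_small[OF d2] by blast
  have "wdist w_up v v0 < \<delta>" if v: "v \<in> stable" "v0 \<in> stable" "\<And>x. x \<in> \<theta> ` Bplus 1 q \<Longrightarrow> dist (stable_pairing v x) (stable_pairing v0 x) < \<delta> / 2" for v v0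
  proof -
    have "wdist w_up v v0 \<le> \<delta> / 2"
    proof (rule wdist_up_small[OF _ q])
      fix n assume "n \<ge> - int q"
      then have "delta n \<in> Bplus 1 q" by (auto simp: Bplus_def delta_def)
      then have "dist (stable_pairing v (\<theta> (delta n))) (stable_pairing v0 (\<theta> (delta n))) < \<delta> / 2" using v(3) by blast
      then show "cmod (E v n - E v0 n) \<le> \<delta> / 2" using v by (simp add: stable_pairing_delta dist_norm)
    qed
    then show ?thesis using d2 by simp
  qed
  then show ?thesis using compactin_image_Bplus[of 1 q] d2 by blast
qed

lemma delta_tendsto_0:
  assumes "e > 0" shows "\<exists>P. \<forall>n\<ge>int P. wdist w_up (\<theta> (delta n)) 0 \<le> e"
proof -
  obtain P :: nat where P: "\<And>b. (\<And>i. \<bar>b i\<bar> \<le> int 1) \<Longrightarrow> (\<And>i. i < int P \<Longrightarrow> b i = 0) \<Longrightarrow> wdist w_up (\<theta> b) 0 \<le> e"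
    using tail_small[OF assms, of 1] by meson
  have "wdist w_up (\<theta> (delta n)) 0 \<le> e" if "n \<ge> int P" for n using that by (intro P) (auto simp: delta_def)
  then show ?thesis by blast
qed

lemma unit_lift: assumes "cmod z = 1" shows "\<exists>s. cis (2 * pi * s) = z"
proof
  have "z \<noteq> 0" using assms by auto
  then show "cis (2 * pi * (Arg z / (2 * pi))) = z" using assms cis_Arg[of z] by (simp add: sgn_eq)
qed

text \<open>The values at unit digits are lifted arbitrarily to a real sequence \<open>s\<close>.
  The translates of \<open>F\<close> represent 0, because convolution with \<open>w\<close> turns
  them into unit sequences, so \<open>f\<close> is trivial on them. This says that
  \<open>A s\<close> is integral, hence that \<open>s\<close> lifts a point.\<close>

lemma hom_on_homoclinic:
  assumes hom: "\<And>a b. a \<in> laurent_polys \<Longrightarrow> b \<in> laurent_polys \<Longrightarrow> f (\<theta> a + \<theta> b) = f (\<theta> a) * f (\<theta> b)"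
    and norm: "\<And>a. a \<in> laurent_polys \<Longrightarrow> cmod (f (\<theta> a)) = 1"
  shows "\<exists>g. \<forall>c\<in>laurent_polys. f (\<theta> c) = laurent_mono c (E g)"
proof -
  have f_mono: "f (\<theta> c) = laurent_mono c (\<lambda>n. f (\<theta> (delta n)))" if "c \<in> laurent_polys" for c
  proof (rule hom_laurent_mono[of "\<lambda>c. f (\<theta> c)", OF _ _ that])
    show "f (\<theta> (\<lambda>n. a n + b n)) = f (\<theta> a) * f (\<theta> b)" if "a \<in> laurent_polys" "b \<in> laurent_polys" for a b
      using hom[OF that] that by (simp add: \<theta>_add laurent_polys_bounded_seq)
    show "f (\<theta> a) \<noteq> 0" if "a \<in> laurent_polys" for a using norm[OF that] by auto
  qed
  have f0: "f 0 = 1"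
    using f_mono[of "\<lambda>_. 0"] by (simp add: laurent_mono_def laurent_polys_iff)
  define s where "s n = (SOME s. cis (2 * pi * s) = f (\<theta> (delta n)))" for n
  have s: "cis (2 * pi * s n) = f (\<theta> (delta n))" for n
    unfolding s_def by (rule someI_ex) (rule unit_lift[OF norm[OF delta_laurent]])
  have "A s n \<in> \<int>" for n
  proof -
    define c where "c i = F (i - n)" for i
    have c: "c \<in> laurent_polys" unfolding laurent_polys_iff
      by (rule finite_subset[of _ "{n - int d..n + int d}"]) (use F_supp in \<open>force simp: c_def\<close>)+
    have "cs (ri c) m = (if m + n = 0 then 1 else 0)" for m
    proof -
      have "cs (ri c) m = (\<Sum>\<^sub>\<infinity>i\<in>{n - int d..n + int d}. ri c i * w (i + m))"
        unfolding cs_def by (rule infsum_cong_neutral) (use F_supp in \<open>force simp: c_def ri_def\<close>)+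
      also have "\<dots> = (\<Sum>i\<in>{n - int d..n + int d}. of_int (F (i - n)) * w (i + m))"
        by (simp add: ri_def c_def)
      also have "\<dots> = (\<Sum>i\<in>{- int d..int d}. of_int (F i) * w (i + (n + m)))"
        by (rule sum.reindex_bij_witness[of _ "\<lambda>i. i + n" "\<lambda>i. i - n"]) (auto simp: algebra_simps)
      finally show ?thesis by (simp add: w_sol add.commute)
    qed
    then have "\<theta> c = 0" using \<theta>_eq_0_iff[OF laurent_polys_bounded_seq[OF c]] by simp
    then have "laurent_mono c (\<lambda>n. cis (2 * pi * s n)) = 1" using f_mono[OF c] f0 by (simp add: s)
    then have "(\<Sum>i\<in>{i. c i \<noteq> 0}. of_int (c i) * s i) \<in> \<int>"
      using laurent_mono_cis[OF c, of s] by (simp add: cis_2pi_eq_1_iff)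
    also have "(\<Sum>i\<in>{i. c i \<noteq> 0}. of_int (c i) * s i) = (\<Sum>i\<in>{n - int d..n + int d}. of_int (c i) * s i)"
      by (rule sum.mono_neutral_left) (use F_supp in \<open>force simp: c_def\<close>)+
    also have "\<dots> = A s n" unfolding A_def
      by (rule sum.reindex_bij_witness[of _ "\<lambda>i. n + i" "\<lambda>i. i - n"]) (auto simp: c_def)
    finally show ?thesis .
  qed
  then obtain g where "\<And>n. E g n = cis (2 * pi * s n)" using E_onto by blast
  then have Eg: "E g = (\<lambda>n. f (\<theta> (delta n)))" by (simp add: s fun_eq_iff)
  have "f (\<theta> c) = laurent_mono c (E g)" if "c \<in> laurent_polys" for c
    unfolding Eg by (rule f_mono[OF that])
  then show ?thesis by blast
qed

text \<open>Finite digits yield a candidate \<open>g\<close>. Unit digits far to the right represent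
  points tending to 0, so continuity of \<open>f\<close> makes the coordinates of \<open>g\<close>
  tend to 1 and \<open>g\<close> is stable. Points with finite digits are dense, and agreement there
  extends to all stable points.\<close>

lemma stable_dual_surj:
  assumes cont: "continuous_map (wtop w_up stable) euclidean f" and norm: "\<And>x. x \<in> stable \<Longrightarrow> cmod (f x) = 1"
    and hom: "\<And>x y. x \<in> stable \<Longrightarrow> y \<in> stable \<Longrightarrow> f (x + y) = f x * f y"
  shows "\<exists>v\<in>stable. \<forall>x\<in>stable. f x = stable_pairing v x"
proof -
  obtain g where g: "\<And>c. c \<in> laurent_polys \<Longrightarrow> f (\<theta> c) = laurent_mono c (E g)"
    using hom_on_homoclinic[of f] hom norm \<theta>_laurent_stable by metis
  have f0: "f 0 = 1" using hom[OF stable_0 stable_0] norm[OF stable_0] by (metis add_0 mult_cancel_right1 norm_zero zero_neq_one)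
  have near: "\<exists>\<delta>>0. \<forall>x\<in>stable. wdist w_up x 0 < \<delta> \<longrightarrow> cmod (f x - 1) < e" if "e > 0" for e
  proof -
    have "\<exists>U. openin (wtop w_up stable) U \<and> 0 \<in> U \<and> (\<forall>y\<in>U. f y \<in> Met_TC.mball (f 0) e)"
      using cont that stable_0 unfolding mtopology_is_euclidean[symmetric] Met_TC.continuous_map_to_metric
      by (simp only: topspace_wtop[OF weights(1)])
    then obtain U where U: "openin (wtop w_up stable) U" "0 \<in> U" "\<And>y. y \<in> U \<Longrightarrow> dist (f 0) (f y) < e" by auto
    obtain r where r: "r > 0" "\<And>y. y \<in> stable \<Longrightarrow> wdist w_up y 0 < r \<Longrightarrow> y \<in> U"
      using U(1,2) unfolding openin_wtop[OF weights(1)] by auto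
    have "cmod (f x - 1) < e" if "x \<in> stable" "wdist w_up x 0 < r" for x
      using U(3)[OF r(2)[OF that]] by (simp add: f0 dist_norm norm_minus_commute)
    then show ?thesis using r(1) by blast
  qed
  have "(\<lambda>n. E g (int n)) \<longlonglongrightarrow> 1"
  proof (rule LIMSEQ_I)
    fix e :: real assume "e > 0"
    then obtain \<delta> where \<delta>: "\<delta> > 0" "\<And>x. x \<in> stable \<Longrightarrow> wdist w_up x 0 < \<delta> \<Longrightarrow> cmod (f x - 1) < e" using near by blast
    obtain P where P: "\<And>n. n \<ge> int P \<Longrightarrow> wdist w_up (\<theta> (delta n)) 0 \<le> \<delta> / 2" using delta_tendsto_0[of "\<delta> / 2"] \<delta>(1) by auto
    have "cmod (E g (int n) - 1) < e" if "n \<ge> P" for n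
    proof -
      have "f (\<theta> (delta (int n))) = E g (int n)" using g[OF delta_laurent] by (simp add: laurent_mono_delta)
      moreover have "wdist w_up (\<theta> (delta (int n))) 0 < \<delta>" using P[of "int n"] that \<delta>(1) by simp
      ultimately show ?thesis using \<delta>(2)[OF \<theta>_laurent_stable[OF delta_laurent]] by metis
    qed
    then show "\<exists>no. \<forall>n\<ge>no. cmod (E g (int n) - 1) < e" by blast
  qed
  then have gs: "g \<in> stable" by (simp add: stable_def)
  have "f x = stable_pairing g x" if x: "x \<in> stable" for x
  proof -
    obtain k b where b: "b \<in> Bplus N0 k" "\<theta> b = x" using stable_rep[OF x] by blast
    have "cmod (f x - stable_pairing g x) \<le> 2 * e" if e: "e > 0" for e
    proof -
      obtain \<delta>1 where \<delta>1: "\<delta>1 > 0" "\<And>x. x \<in> stable \<Longrightarrow> wdist w_up x 0 < \<delta>1 \<Longrightarrow> cmod (f x - 1) < e" using near[OF e] by blast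
      have "compactin (wtop w_up stable) {g}" using gs by simp
      from stable_pairing_uniform[OF this e] obtain \<delta>2 where \<delta>2: "\<delta>2 > 0" "\<And>y. y \<in> stable \<Longrightarrow> wdist w_up y 0 < \<delta>2 \<Longrightarrow> dist (stable_pairing y g) (stable_pairing 0 g) < e"
        using stable_0 by blast
      have pp0: "stable_pairing 0 g = 1" using stable_pairing_add_left[OF gs stable_0 stable_0] norm_stable_pairing[of 0 g] by (metis add_0 mult_cancel_right1 norm_zero zero_neq_one)
      define \<delta> where "\<delta> = min \<delta>1 \<delta>2 / 2"
      have "\<delta> > 0" using \<delta>1 \<delta>2 by (simp add: \<delta>_def)
      from tail_small[OF this] obtain P :: nat where P: "\<And>b. (\<And>i. \<bar>b i\<bar> \<le> int N0) \<Longrightarrow> (\<And>i. i < int P \<Longrightarrow> b i = 0) \<Longrightarrow> wdist w_up (\<theta> b) 0 \<le> \<delta>"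
        by meson
      \<comment> \<open>On the finite part the two characters agree; on the tail both are within
        \<open>e\<close> of 1.\<close>
      obtain c a where ca: "c \<in> laurent_polys" "\<And>i. \<bar>a i\<bar> \<le> int N0" "\<And>i. i < int P \<Longrightarrow> a i = 0" "b = (\<lambda>i. c i + a i)"
        using laurent_decomp_tail[OF b(1), of P] by metis
      have ab: "bounded_seq a" using ca(2) by (rule bdiI)
      have cst: "\<theta> c \<in> stable" using ca(1) by (rule \<theta>_laurent_stable)
      have x_eq: "x = \<theta> c + \<theta> a" using b(2) ca by (simp add: \<theta>_add ab laurent_polys_bounded_seq)
      then have ast: "\<theta> a \<in> stable" using subgroup_set_diff[OF stable_subgroup x cst] by simp
      have small: "wdist w_up (\<theta> a) 0 \<le> \<delta>" using ca by (intro P)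
      have 1: "cmod (f (\<theta> a) - 1) < e" using small \<open>\<delta> > 0\<close> by (intro \<delta>1(2) ast) (auto simp: \<delta>_def)
      have "dist (stable_pairing (\<theta> a) g) (stable_pairing 0 g) < e" using small \<open>\<delta> > 0\<close> by (intro \<delta>2(2) ast) (auto simp: \<delta>_def)
      then have 2: "cmod (stable_pairing g (\<theta> a) - 1) < e" using stable_pairing_commute[OF gs ast] by (simp add: pp0 dist_norm)
      have c_eq: "f (\<theta> c) = stable_pairing g (\<theta> c)" using g[OF ca(1)] stable_pairing_finite[OF ca(1) gs] stable_pairing_commute[OF gs cst] by simp
      have "f x - stable_pairing g x = f (\<theta> c) * ((f (\<theta> a) - 1) - (stable_pairing g (\<theta> a) - 1))"
        using hom[OF cst ast] stable_pairing_add_right[OF gs cst ast] c_eq x_eq by (simp add: algebra_simps)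
      then have "cmod (f x - stable_pairing g x) = cmod ((f (\<theta> a) - 1) - (stable_pairing g (\<theta> a) - 1))" using norm[OF cst] by (simp add: norm_mult)
      also have "\<dots> \<le> 2 * e" using norm_triangle_ineq4[of "f (\<theta> a) - 1" "stable_pairing g (\<theta> a) - 1"] 1 2 by linarith
      finally show ?thesis .
    qed
    then have "cmod (f x - stable_pairing g x) \<le> 0 + e" if "e > 0" for e using that by (metis add_0 field_sum_of_halves half_gt_zero mult_2)
    then have "cmod (f x - stable_pairing g x) \<le> 0" by (rule field_le_epsilon)
    then show ?thesis by simp
  qed
  then show ?thesis using gs by blast
qed

end

section \<open>The exact sequence\<close>

lemma abelian_pair_tgroup:
  assumes X: "abelian_tgroup (add_tgroup X)" and Y: "abelian_tgroup (add_tgroup Y)"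
  shows "abelian_tgroup (pair_tgroup X Y)"
proof -
  let ?P = "prod_topology X Y"
  have cX: "continuous_map (prod_topology X X) X (\<lambda>(x, y). x + y)" and cY: "continuous_map (prod_topology Y Y) Y (\<lambda>(x, y). x + y)"
    using X Y by (auto simp: abelian_tgroup_def add_tgroup_def tg_top_def tg_op_def Let_def)
  obtain i j where i: "continuous_map X X i" "\<And>x. x \<in> topspace X \<Longrightarrow> x + i x = 0"
    and j: "continuous_map Y Y j" "\<And>x. x \<in> topspace Y \<Longrightarrow> x + j x = 0"
    using X Y by (auto simp: abelian_tgroup_def add_tgroup_def tg_top_def tg_op_def tg_unit_def tg_carrier_def Let_def)
  have 1: "continuous_map (prod_topology ?P ?P) X (\<lambda>p. fst (fst p) + fst (snd p))"
    using continuous_map_compose[OF continuous_map_pairedI[OF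
        continuous_map_compose[OF continuous_map_fst continuous_map_fst] continuous_map_compose[OF continuous_map_snd continuous_map_fst]] cX]
    by (simp add: o_def case_prod_beta)
  have 2: "continuous_map (prod_topology ?P ?P) Y (\<lambda>p. snd (fst p) + snd (snd p))"
    using continuous_map_compose[OF continuous_map_pairedI[OF
        continuous_map_compose[OF continuous_map_fst continuous_map_snd] continuous_map_compose[OF continuous_map_snd continuous_map_snd]] cY]
    by (simp add: o_def case_prod_beta)
  have add': "continuous_map (prod_topology ?P ?P) ?P (\<lambda>((a, b), c, d). (a + c, b + d))"
    using continuous_map_pairedI[OF 1 2] by (simp add: case_prod_unfold)
  have "continuous_map ?P ?P (\<lambda>p. (i (fst p), j (snd p)))"
    using continuous_map_compose[OF continuous_map_fst i(1)] continuous_map_compose[OF continuous_map_snd j(1)]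
    by (intro continuous_map_pairedI) (auto simp: o_def)
  then have inv: "\<exists>k. continuous_map ?P ?P k \<and> (\<forall>x\<in>topspace ?P. (case x of (a, b) \<Rightarrow> \<lambda>(c, d). (a + c, b + d)) (k x) = (0, 0))"
    using i(2) j(2) by (intro exI[of _ "\<lambda>p. (i (fst p), j (snd p))"]) auto
  show ?thesis
    using X Y inv unfolding abelian_tgroup_def pair_tgroup_def add_tgroup_def Let_def tg_carrier_def tg_top_def tg_op_def tg_unit_def
    by (auto simp: case_prod_beta intro: add')
qed

lemma LCA_discrete:
  assumes "subgroup_set S" shows "LCA (add_tgroup (discrete_topology S))"
proof -
  have eq: "prod_topology (discrete_topology S) (discrete_topology S) = discrete_topology (S \<times> S)"
    by (simp add: prod_topology_discrete_topology)
  have "continuous_map (discrete_topology S) (discrete_topology S) uminus"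
    using assms by (auto simp: continuous_map_from_discrete_topology subgroup_set_def)
  then have "abelian_tgroup (add_tgroup (discrete_topology S))"
    using assms unfolding abelian_tgroup_def Let_def add_tgroup_def tg_carrier_def tg_top_def tg_op_def tg_unit_def
    by (auto simp: eq continuous_map_from_discrete_topology subgroup_set_def ac_simps intro!: exI[of _ uminus])
  moreover have "locally_compact_space (discrete_topology S)"
    unfolding locally_compact_space_def by (auto intro!: exI[of _ "{_}"])
  ultimately show ?thesis by (simp add: LCA_def add_tgroup_def tg_top_def)
qed

lemma unit_inverse_cnj: "cmod z = 1 \<Longrightarrow> z * y = 1 \<Longrightarrow> y = cnj z"
  using complex_norm_square[of z] by (metis mult.commute mult_left_cancel norm_zero of_real_1 power_one zero_neq_one)

section \<open>Comparison of the one-sided and two-sided metrics\<close>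

context kernel_group
begin

definition unstable :: "'g set" where
  "unstable = {g. (\<lambda>n. E g (- int n)) \<longlonglongrightarrow> 1}"

lemma \<theta>_split:
  assumes "\<And>i. \<bar>a i\<bar> \<le> int N"
  defines "a1 \<equiv> \<lambda>i. if i < 0 then a i else 0" and "a2 \<equiv> \<lambda>i. if i < 0 then 0 else a i"
  shows "\<theta> a = \<theta> a1 + \<theta> a2"
proof -
  have "bounded_seq a1" "bounded_seq a2" using assms(1) by (auto simp: a1_def a2_def intro!: bdiI[of _ "int N"])
  moreover have "a = (\<lambda>i. a1 i + a2 i)" by (auto simp: a1_def a2_def)
  ultimately show ?thesis using \<theta>_add by metis
qed

lemma stable_pairing_uminus_left: assumes "u \<in> stable" "x \<in> stable" shows "stable_pairing (- u) x = cnj (stable_pairing u x)"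
proof (rule unit_inverse_cnj)
  have "stable_pairing 0 x = 1" using stable_pairing_add_left[OF assms(2) stable_0 stable_0] norm_stable_pairing[of 0 x]
    by (metis add_0 mult_cancel_right1 norm_zero zero_neq_one)
  then show "stable_pairing u x * stable_pairing (- u) x = 1"
    using stable_pairing_add_left[OF assms(2,1) stable_uminus[OF assms(1)]] by simp
qed simp

lemma wdist_both_le: "wdist w_both g h \<le> wdist w_up g h" "wdist w_both g h \<le> wdist w_down g h"
proof -
  have "w_both n \<le> w_up n" "w_both n \<le> w_down n" for n
    unfolding w_both_def w_up_def w_down_def by (auto intro!: power_decreasing)
  then have le: "w_both n * cmod (E g n - E h n) \<le> w_up n * cmod (E g n - E h n)"
    "w_both n * cmod (E g n - E h n) \<le> w_down n * cmod (E g n - E h n)" for n by (auto intro!: mult_right_mono)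
  show "wdist w_both g h \<le> wdist w_up g h" using le(1) by (intro wdist_least) (meson order_trans wdist_upper weights)
  show "wdist w_both g h \<le> wdist w_down g h" using le(2) by (intro wdist_least) (meson order_trans wdist_upper weights)
qed

text \<open>Together the two one-sided metrics control all coordinates without damping, so every
  digit vanishes. This is the source of the discreteness of the homoclinic group inside the
  product.\<close>

lemma both_small_imp_0:
  assumes "wdist w_up g 0 < \<delta>0" "wdist w_down g 0 < \<delta>0" shows "g = 0"
proof -
  have "cmod (E g m - 1) < \<delta>0" for m
  proof (cases "m \<ge> 0")
    case True
    then show ?thesis using wdist_upper[OF weights(1), of m g 0] assms(1) by (simp add: w_up_def)
  next
    case False
    then show ?thesis using wdist_upper[OF weights(2), of m g 0] assms(2) by (simp add: w_down_def)
  qed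
  then obtain a where "\<theta> a = g" "\<And>n. a (- n) = 0" using bounded_rep by metis
  moreover from this have "a = (\<lambda>_. 0)" by (metis ext minus_minus)
  ultimately show ?thesis by simp
qed

lemma homoclinic_pairing_add_right: assumes "c \<in> laurent_polys" shows "homoclinic_pairing (\<theta> c) (g + h) = homoclinic_pairing (\<theta> c) g * homoclinic_pairing (\<theta> c) h"
proof -
  have "E (g + h) = (\<lambda>n. E g n * E h n)" using E_add by blast
  then show ?thesis by (simp add: homoclinic_pairing_eq[OF assms] laurent_mono_times)
qed

lemma homoclinic_pairing_add_left:
  assumes "c \<in> laurent_polys" "c' \<in> laurent_polys" shows "homoclinic_pairing (\<theta> c + \<theta> c') g = homoclinic_pairing (\<theta> c) g * homoclinic_pairing (\<theta> c') g"
proof -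
  have "homoclinic_pairing (\<theta> c + \<theta> c') g = laurent_mono (\<lambda>n. c n + c' n) (E g)"
    using homoclinic_pairing_eq[OF laurent_polys_add[OF assms], of g] assms by (simp add: \<theta>_add laurent_polys_bounded_seq)
  then show ?thesis using assms by (simp add: laurent_mono_add homoclinic_pairing_eq)
qed

lemma norm_homoclinic_pairing [simp]: "cmod (homoclinic_pairing u v) = 1"
  by (simp add: homoclinic_pairing_def)

end

text \<open>The unstable side is the stable side of the reflected system.\<close>

locale kernel_pair = kernel_group F d w C \<rho> E
  for F d w C \<rho> and E :: "'g::ab_group_add \<Rightarrow> int \<Rightarrow> complex"
begin

sublocale r: kernel_group "\<lambda>i. F (- i)" d "\<lambda>n. w (- n)" C \<rho> "\<lambda>g n. E g (- n)"
  by (rule reflected_group)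

section \<open>Transfer through reflection\<close>

lemma r_stable: "r.stable = unstable"
  by (simp add: r.stable_def unstable_def)

lemma r_wdist: "r.wdist u g h = wdist (\<lambda>n. u (- n)) g h"
proof -
  have "range (\<lambda>n. u n * cmod (E g (- n) - E h (- n))) = range (\<lambda>n. u (- n) * cmod (E g n - E h n))"
    by (auto simp: image_iff) (metis minus_minus)+
  then show ?thesis by (simp add: r.wdist_def wdist_def)
qed

lemma r_wdist_up: "r.wdist w_up = wdist w_down"
  by (intro ext) (simp add: r_wdist w_up_def w_down_def wdist_def)

lemma r_wtop: "r.wtop w_up S = wtop w_down S"
  by (simp add: r.wtop_def wtop_def r_wdist_up)

lemma r_theta: "r.\<theta> a = \<theta> (\<lambda>k. a (- k))"
proof -
  have "ri (\<lambda>k. a (- k)) = (\<lambda>k. ri a (- k))" by (simp add: ri_def)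
  then have eq: "r.cs (ri a) n = cs (ri (\<lambda>k. a (- k))) (- n)" for n using reflected_cs[of "ri a" n] by simp
  have "(\<forall>n. E g (- n) = cis (2 * pi * r.cs (ri a) n)) \<longleftrightarrow> (\<forall>n. E g n = cis (2 * pi * cs (ri (\<lambda>k. a (- k))) n))" for g
    unfolding eq by (metis minus_minus)
  then show ?thesis unfolding \<theta>_def r.\<theta>_def by simp
qed

lemma laurent_reflect: "c \<in> laurent_polys \<Longrightarrow> (\<lambda>k. c (- k)) \<in> laurent_polys"
proof -
  assume "c \<in> laurent_polys"
  then have "finite (uminus ` {n. c n \<noteq> 0})" by (simp add: laurent_polys_iff)
  moreover have "{n. c (- n) \<noteq> 0} \<subseteq> uminus ` {n. c n \<noteq> 0}" by (auto simp: image_iff) (metis minus_minus)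
  ultimately show ?thesis unfolding laurent_polys_iff by (rule finite_subset[rotated])
qed

lemma theta_reflect: "\<theta> c = r.\<theta> (\<lambda>k. c (- k))"
  by (simp add: r_theta)

lemma laurent_mono_reflect: "laurent_mono (\<lambda>k. c (- k)) (\<lambda>n. y (- n)) = laurent_mono c y"
  unfolding laurent_mono_def
  by (rule prod.reindex_bij_witness[of _ uminus uminus]) auto

definition homoclinic :: "'g set" where "homoclinic = stable \<inter> unstable"

text \<open>Coordinates near 1 in both directions kill all digits outside a bounded range;
  conversely, a finite digit sequence is one-sided in both senses.\<close>

lemma homoclinic_eq: "homoclinic = \<theta> ` laurent_polys"
proof (intro equalityI subsetI)
  fix g assume "g \<in> \<theta> ` laurent_polys"
  then obtain c where c: "c \<in> laurent_polys" "g = \<theta> c" by blast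
  have "g \<in> r.stable" unfolding c(2) theta_reflect by (rule r.\<theta>_laurent_stable) (rule laurent_reflect[OF c(1)])
  then show "g \<in> homoclinic" using c \<theta>_laurent_stable by (simp add: homoclinic_def r_stable)
next
  fix g assume "g \<in> homoclinic"
  then have lim: "(\<lambda>n. E g (int n)) \<longlonglongrightarrow> 1" "(\<lambda>n. E g (- int n)) \<longlonglongrightarrow> 1"
    by (auto simp: homoclinic_def stable_def unstable_def)
  obtain p where p: "\<And>n. n \<ge> p \<Longrightarrow> cmod (E g (int n) - 1) < \<delta>0" using LIMSEQ_D[OF lim(1) \<delta>0_pos] by blast
  obtain q where q: "\<And>n. n \<ge> q \<Longrightarrow> cmod (E g (- int n) - 1) < \<delta>0" using LIMSEQ_D[OF lim(2) \<delta>0_pos] by blast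
  have far: "cmod (E g m - 1) < \<delta>0" if "\<bar>m\<bar> \<ge> int p + int q" for m
  proof (cases "m \<ge> 0")
    case True
    then show ?thesis using p[of "nat m"] that by simp
  next
    case False
    then show ?thesis using q[of "nat (- m)"] that by simp
  qed
  obtain a where a: "\<theta> a = g" "\<And>n. (\<And>m. \<bar>m - n\<bar> \<le> int d \<Longrightarrow> cmod (E g m - 1) < \<delta>0) \<Longrightarrow> a (- n) = 0"
    using bounded_rep by metis
  define B where "B = int p + int q + int d"
  have "a i = 0" if "\<bar>i\<bar> > B" for i
    using a(2)[of "- i"] far that by (force simp: B_def)
  then have "{i. a i \<noteq> 0} \<subseteq> {- B..B}" by (force simp: abs_le_iff)
  then have "a \<in> laurent_polys" unfolding laurent_polys_iff by (rule finite_subset) simp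
  then show "g \<in> \<theta> ` laurent_polys" using a(1) by blast
qed

lemma unstable_subgroup: "subgroup_set unstable"
  using r.stable_subgroup by (simp add: r_stable)

lemma homoclinic_subgroup: "subgroup_set homoclinic"
  using stable_subgroup unstable_subgroup by (auto simp: subgroup_set_def homoclinic_def)

text \<open>If \<open>h\<close> is small in the two-sided metric, its digits vanish on a long
  central block. Both halves are then supported far from 0 and are small in their own metrics, which
  is what makes addition an open map.\<close>

lemma group_decomposition:
  assumes "e > 0"
  shows "\<exists>\<eta>>0. \<forall>h. wdist w_both h 0 < \<eta> \<longrightarrow>
    (\<exists>x\<in>unstable. \<exists>y\<in>stable. h = x + y \<and> wdist w_down x 0 < e \<and> wdist w_up y 0 < e)"
    and "\<exists>x\<in>unstable. \<exists>y\<in>stable. h = x + y"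
proof -
  have split: "\<exists>x\<in>unstable. \<exists>y\<in>stable. h = x + y \<and>
      (\<exists>b. (\<forall>i. \<bar>b i\<bar> \<le> int N0) \<and> (\<forall>i. i \<le> 0 \<or> a (- i) = 0 \<longrightarrow> b i = 0) \<and> r.\<theta> b = x) \<and>
      (\<exists>b. (\<forall>i. \<bar>b i\<bar> \<le> int N0) \<and> (\<forall>i. i < 0 \<or> a i = 0 \<longrightarrow> b i = 0) \<and> \<theta> b = y)"
    if a: "\<And>i. \<bar>a i\<bar> \<le> int N0" "\<theta> a = h" for a h
  proof -
    define a1 where "a1 = (\<lambda>i. if i < 0 then a i else 0)"
    define a2 where "a2 = (\<lambda>i. if i < 0 then 0 else a i)"
    \<comment> \<open>The left half is stored with reversed index, as a digit sequence of the
      reflected system.\<close>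
    define b where "b = (\<lambda>i. a1 (- i))"
    have "b \<in> Bplus N0 0" "a2 \<in> Bplus N0 0" using a(1) by (auto simp: b_def a1_def a2_def Bplus_def)
    then have "r.\<theta> b \<in> unstable" "\<theta> a2 \<in> stable" using r.\<theta>_Bplus_stable \<theta>_Bplus_stable r_stable by auto
    moreover have "\<theta> a = \<theta> a1 + \<theta> a2" unfolding a1_def a2_def by (rule \<theta>_split[OF a(1)])
    moreover have "r.\<theta> b = \<theta> a1" by (simp add: r_theta b_def)
    then have "h = r.\<theta> b + \<theta> a2" using calculation a(2) by simp
    moreover note this
    moreover have "\<exists>b'. (\<forall>i. \<bar>b' i\<bar> \<le> int N0) \<and> (\<forall>i. i \<le> 0 \<or> a (- i) = 0 \<longrightarrow> b' i = 0) \<and> r.\<theta> b' = r.\<theta> b"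
      using a(1) by (intro exI[of _ b]) (auto simp: b_def a1_def)
    moreover have "\<exists>b'. (\<forall>i. \<bar>b' i\<bar> \<le> int N0) \<and> (\<forall>i. i < 0 \<or> a i = 0 \<longrightarrow> b' i = 0) \<and> \<theta> b' = \<theta> a2"
      using a(1) by (intro exI[of _ a2]) (auto simp: a2_def)
    ultimately show ?thesis by (intro bexI[of _ "r.\<theta> b"] bexI[of _ "\<theta> a2"] conjI)
  qed
  show "\<exists>x\<in>unstable. \<exists>y\<in>stable. h = x + y"
  proof -
    obtain a where "\<And>k. \<bar>a k\<bar> \<le> int N0" "\<theta> a = h" using \<theta>_surj_bounded by blast
    from split[OF this] show ?thesis by blast
  qed
  have e2: "e / 2 > 0" using assms by simp
  obtain P1 :: nat where P1: "\<And>b. (\<And>i. \<bar>b i\<bar> \<le> int N0) \<Longrightarrow> (\<And>i. i < int P1 \<Longrightarrow> b i = 0) \<Longrightarrow> wdist w_up (\<theta> b) 0 \<le> e / 2"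
    using tail_small[OF e2, of N0] by meson
  obtain P2 :: nat where P2: "\<And>b. (\<And>i. \<bar>b i\<bar> \<le> int N0) \<Longrightarrow> (\<And>i. i < int P2 \<Longrightarrow> b i = 0) \<Longrightarrow> wdist w_down (r.\<theta> b) 0 \<le> e / 2"
    using r.tail_small[OF e2, of N0] unfolding r_wdist_up by meson
  define Q where "Q = P1 + P2"
  \<comment> \<open>The factor is the weight at the edge of the window from \<open>- (Q + d)\<close>
    to \<open>Q + d\<close>; the extra \<open>d\<close> is how far a digit sees beyond its own
    index.\<close>
  define \<eta> where "\<eta> = \<delta>0 * (1 / 2) ^ (Q + d)"
  have "\<exists>x\<in>unstable. \<exists>y\<in>stable. h = x + y \<and> wdist w_down x 0 < e \<and> wdist w_up y 0 < e" if h: "wdist w_both h 0 < \<eta>" for h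
  proof -
    have near: "cmod (E h m - 1) < \<delta>0" if "\<bar>m\<bar> \<le> int (Q + d)" for m
    proof -
      have "w_both m \<ge> (1 / 2) ^ (Q + d)" unfolding w_both_def using that by (intro power_decreasing) auto
      then have "(1 / 2) ^ (Q + d) * cmod (E h m - 1) \<le> w_both m * cmod (E h m - E 0 m)" by (simp add: mult_right_mono)
      also have "\<dots> \<le> wdist w_both h 0" by (rule wdist_upper) simp
      finally have "(1 / 2) ^ (Q + d) * cmod (E h m - 1) < (1 / 2) ^ (Q + d) * \<delta>0"
        using h mult.commute[of \<delta>0 "(1 / 2) ^ (Q + d)"] unfolding \<eta>_def by linarith
      then show ?thesis by (rule mult_left_less_imp_less) simp
    qed
    obtain a where a: "\<And>k. \<bar>a k\<bar> \<le> int N0" "\<theta> a = h"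
       "\<And>n. (\<And>m. \<bar>m - n\<bar> \<le> int d \<Longrightarrow> cmod (E h m - 1) < \<delta>0) \<Longrightarrow> a (- n) = 0" using bounded_rep by metis
    have a0: "a i = 0" if "\<bar>i\<bar> \<le> int Q" for i
      using a(3)[of "- i"] near that by force
    obtain x y where xy: "x \<in> unstable" "y \<in> stable" "h = x + y"
      and ex_b: "\<exists>b. (\<forall>i. \<bar>b i\<bar> \<le> int N0) \<and> (\<forall>i. i \<le> 0 \<or> a (- i) = 0 \<longrightarrow> b i = 0) \<and> r.\<theta> b = x"
      and ex_c: "\<exists>b. (\<forall>i. \<bar>b i\<bar> \<le> int N0) \<and> (\<forall>i. i < 0 \<or> a i = 0 \<longrightarrow> b i = 0) \<and> \<theta> b = y"
      using split[OF a(1,2)] by (elim bexE conjE) (rule that)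
    from ex_b obtain b where b0: "(\<forall>i. \<bar>b i\<bar> \<le> int N0) \<and> (\<forall>i. i \<le> 0 \<or> a (- i) = 0 \<longrightarrow> b i = 0) \<and> r.\<theta> b = x" ..
    note b = b0[THEN conjunct1, rule_format] b0[THEN conjunct2, THEN conjunct1, rule_format] b0[THEN conjunct2, THEN conjunct2]
    from ex_c obtain c where c0: "(\<forall>i. \<bar>c i\<bar> \<le> int N0) \<and> (\<forall>i. i < 0 \<or> a i = 0 \<longrightarrow> c i = 0) \<and> \<theta> c = y" ..
    note c = c0[THEN conjunct1, rule_format] c0[THEN conjunct2, THEN conjunct1, rule_format] c0[THEN conjunct2, THEN conjunct2]
    have bz: "b i = 0" if "i < int P2" for i using b(2)[of i] a0[of "- i"] that by (cases "i \<le> 0") (auto simp: Q_def)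
    have "wdist w_down (r.\<theta> b) 0 \<le> e / 2" by (rule P2[OF b(1) bz])
    then have "wdist w_down x 0 < e" using b(3) assms by simp
    moreover have cz: "c i = 0" if "i < int P1" for i using c(2)[of i] a0[of i] that by (cases "i < 0") (auto simp: Q_def)
    have "wdist w_up (\<theta> c) 0 \<le> e / 2" by (rule P1[OF c(1) cz])
    then have "wdist w_up y 0 < e" using c(3) assms by simp
    ultimately show ?thesis using xy by (intro bexI[of _ x] bexI[of _ y] conjI)
  qed
  moreover have "\<eta> > 0" using \<delta>0_pos by (simp add: \<eta>_def)
  ultimately show "\<exists>\<eta>>0. \<forall>h. wdist w_both h 0 < \<eta> \<longrightarrow>
    (\<exists>x\<in>unstable. \<exists>y\<in>stable. h = x + y \<and> wdist w_down x 0 < e \<and> wdist w_up y 0 < e)" by blast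
qed

section \<open>The three groups and exactness\<close>

abbreviation "GA \<equiv> add_tgroup (discrete_topology homoclinic)"
abbreviation "GB \<equiv> pair_tgroup (wtop w_down unstable) (wtop w_up stable)"
abbreviation "GC \<equiv> add_tgroup (wtop w_both UNIV)"
abbreviation "inc \<equiv> (\<lambda>\<omega>. (- \<omega>, \<omega>)) :: 'g \<Rightarrow> 'g \<times> 'g"
abbreviation "plus_map \<equiv> (\<lambda>(u, v). u + v) :: 'g \<times> 'g \<Rightarrow> 'g"

lemma GA_simps [simp]: "tg_top GA = discrete_topology homoclinic" "tg_op GA = (+)" "tg_unit GA = 0" "tg_carrier GA = homoclinic"
  by (simp_all add: add_tgroup_def tg_top_def tg_op_def tg_unit_def tg_carrier_def)

lemma GB_simps [simp]: "tg_top GB = prod_topology (wtop w_down unstable) (wtop w_up stable)"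
  "tg_op GB = (\<lambda>(a, b) (c, d). (a + c, b + d))" "tg_unit GB = (0, 0)" "tg_carrier GB = unstable \<times> stable"
  by (simp_all add: pair_tgroup_def tg_top_def tg_op_def tg_unit_def tg_carrier_def)

lemma GC_simps [simp]: "tg_top GC = wtop w_both UNIV" "tg_op GC = (+)" "tg_unit GC = 0" "tg_carrier GC = UNIV"
  by (simp_all add: add_tgroup_def tg_top_def tg_op_def tg_unit_def tg_carrier_def)

lemma LCA_GB: "LCA GB"
  unfolding LCA_def
proof (intro conjI)
  show "abelian_tgroup GB"
    by (intro abelian_pair_tgroup abelian_wtop stable_subgroup unstable_subgroup) simp_all
  show "Hausdorff_space (tg_top GB)"
    by (simp add: Hausdorff_space_prod_topology Hausdorff_wtop)
  show "locally_compact_space (tg_top GB)"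
    using locally_compact_stable r.locally_compact_stable
    by (simp add: locally_compact_space_prod_topology r_stable r_wtop)
qed

lemma plus_map_continuous: "continuous_map (tg_top GB) (tg_top GC) plus_map"
  unfolding GC_simps continuous_map_to_wtop[OF weights(3)]
proof (intro conjI ballI allI impI)
  fix p e assume "p \<in> topspace (tg_top GB)" and e: "e > (0::real)"
  then obtain u v where p: "p = (u, v)" "u \<in> unstable" "v \<in> stable" by auto
  let ?U = "{x \<in> unstable. wdist w_down x u < e / 2} \<times> {y \<in> stable. wdist w_up y v < e / 2}"
  have "openin (tg_top GB) ?U"
    using openin_wtop_ball[OF weights(2), of unstable u "e / 2"] openin_wtop_ball[OF weights(1), of stable v "e / 2"]
    by (simp only: GB_simps openin_prod_Times_iff) simp
  moreover have "wdist w_both (x + y) (u + v) < e" if "wdist w_down x u < e / 2" "wdist w_up y v < e / 2" for x y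
    using wdist_add[OF weights(3), of x y u v] wdist_both_le(1)[of y v] wdist_both_le(2)[of x u] that by linarith
  ultimately show "\<exists>U. openin (tg_top GB) U \<and> p \<in> U \<and> (\<forall>q\<in>U. wdist w_both (plus_map q) (plus_map p) < e)"
    using p e by (intro exI[of _ ?U]) auto
qed auto

theorem exact: "short_exact GA GB GC inc plus_map"
proof -
  have um: "- x \<in> unstable" if "x \<in> unstable" for x using unstable_subgroup that by (auto simp: subgroup_set_def)
  have inc_in: "inc ` homoclinic \<subseteq> unstable \<times> stable" by (auto simp: homoclinic_def um)
  have inc_cont: "continuous_map (tg_top GA) (tg_top GB) inc"
    using inc_in by (auto simp: continuous_map_from_discrete_topology)
  have ker: "inc ` homoclinic = {y \<in> unstable \<times> stable. plus_map y = 0}"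
  proof (intro equalityI subsetI)
    fix y assume "y \<in> {y \<in> unstable \<times> stable. plus_map y = 0}"
    then obtain u v where y: "y = (u, v)" "u \<in> unstable" "v \<in> stable" "u + v = 0" by auto
    then have "u = - v" by (simp add: eq_neg_iff_add_eq_0)
    moreover from this have "v \<in> unstable" using um[OF y(2)] by simp
    ultimately show "y \<in> inc ` homoclinic" using y by (auto simp: homoclinic_def)
  qed (use inc_in in auto)
  have surj: "plus_map ` (unstable \<times> stable) = UNIV"
  proof (intro equalityI subsetI)
    fix h :: 'g
    obtain x y where "x \<in> unstable" "y \<in> stable" "h = x + y" using group_decomposition(2)[OF zero_less_one] by blast
    then show "h \<in> plus_map ` (unstable \<times> stable)" by force
  qed auto
  \<comment> \<open>Two homoclinic points whose images are closer than \<open>\<delta>0\<close> in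
    both components differ by a point all of whose digits vanish.\<close>
  have disc: "discrete_topology (inc ` homoclinic) = subtopology (tg_top GB) (inc ` homoclinic)"
    unfolding discrete_topology_unique
  proof (intro conjI ballI)
    show "topspace (subtopology (tg_top GB) (inc ` homoclinic)) = inc ` homoclinic"
      using inc_in by (auto simp: topspace_subtopology)
    fix p assume "p \<in> inc ` homoclinic"
    then obtain \<omega> where p: "p = (- \<omega>, \<omega>)" "\<omega> \<in> homoclinic" by blast
    let ?U = "{x \<in> unstable. wdist w_down x (- \<omega>) < \<delta>0} \<times> {y \<in> stable. wdist w_up y \<omega> < \<delta>0}"
    have "openin (tg_top GB) ?U"
      using openin_wtop_ball[OF weights(2), of unstable "- \<omega>" \<delta>0] openin_wtop_ball[OF weights(1), of stable \<omega> \<delta>0]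
      by (simp only: GB_simps openin_prod_Times_iff) simp
    moreover have "{p} = ?U \<inter> inc ` homoclinic"
    proof (intro equalityI subsetI)
      fix q assume "q \<in> ?U \<inter> inc ` homoclinic"
      then obtain \<omega>' where q: "q = (- \<omega>', \<omega>')" "wdist w_down (- \<omega>') (- \<omega>) < \<delta>0" "wdist w_up \<omega>' \<omega> < \<delta>0" by blast
      have "wdist w_down (\<omega>' - \<omega>) 0 < \<delta>0" "wdist w_up (\<omega>' - \<omega>) 0 < \<delta>0"
        using q(2,3) wdist_uminus[of w_down \<omega>' \<omega>] wdist_diff[of w_down \<omega>' \<omega>] wdist_diff[of w_up \<omega>' \<omega>] by auto
      then have "\<omega>' - \<omega> = 0" by (intro both_small_imp_0)
      then show "q \<in> {p}" using q p by simp
    qed (use p inc_in \<delta>0_pos in auto)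
    ultimately show "openin (subtopology (tg_top GB) (inc ` homoclinic)) {p}"
      by (auto simp: openin_subtopology)
  qed
  have inj: "inj_on inc homoclinic" by (auto simp: inj_on_def)
  have homeo: "homeomorphic_map (discrete_topology homoclinic) (subtopology (tg_top GB) (inc ` homoclinic)) inc"
    unfolding disc[symmetric] by (rule bijective_open_imp_homeomorphic_map)
      (auto simp: continuous_map_from_discrete_topology open_map_def inj)
  have closed: "closedin (tg_top GB) (inc ` homoclinic)"
  proof -
    have "closedin (tg_top GC) {0}" using Hausdorff_wtop[OF weights(3)] by (simp add: closedin_Hausdorff_singleton)
    from closedin_continuous_map_preimage[OF plus_map_continuous this]
    show ?thesis unfolding ker by (simp add: mem_Times_iff)
  qed
  have open_map: "open_map (tg_top GB) (tg_top GC) plus_map"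
    unfolding open_map_def
  proof (intro allI impI)
    fix U assume U: "openin (tg_top GB) U"
    show "openin (tg_top GC) (plus_map ` U)"
      unfolding GC_simps openin_wtop[OF weights(3)]
    proof (intro conjI ballI)
      fix s assume "s \<in> plus_map ` U"
      then obtain u v where uv: "(u, v) \<in> U" "s = u + v" by auto
      obtain U1 U2 where U12: "openin (wtop w_down unstable) U1" "openin (wtop w_up stable) U2" "u \<in> U1" "v \<in> U2" "U1 \<times> U2 \<subseteq> U"
        using U uv(1) unfolding GB_simps openin_prod_topology_alt by meson
      obtain r1 where r1: "r1 > 0" "\<And>x. x \<in> unstable \<Longrightarrow> wdist w_down x u < r1 \<Longrightarrow> x \<in> U1"
        using U12(1,3) unfolding openin_wtop[OF weights(2)] by blast
      obtain r2 where r2: "r2 > 0" "\<And>x. x \<in> stable \<Longrightarrow> wdist w_up x v < r2 \<Longrightarrow> x \<in> U2"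
        using U12(2,4) unfolding openin_wtop[OF weights(1)] by blast
      have us: "u \<in> unstable" "v \<in> stable"
        using U12 openin_subset[OF U12(1)] openin_subset[OF U12(2)] by auto
      have "min r1 r2 > 0" using r1 r2 by simp
      from group_decomposition(1)[OF this] obtain \<eta> where \<eta>: "\<eta> > 0" "\<And>h. wdist w_both h 0 < \<eta> \<Longrightarrow>
          \<exists>x\<in>unstable. \<exists>y\<in>stable. h = x + y \<and> wdist w_down x 0 < min r1 r2 \<and> wdist w_up y 0 < min r1 r2" by meson
      have "y \<in> plus_map ` U" if y: "wdist w_both y s < \<eta>" for y
      proof -
        have "wdist w_both (y - s) 0 < \<eta>" using y wdist_diff[of w_both y s] by simp
        then obtain x z where xz: "x \<in> unstable" "z \<in> stable" "y - s = x + z" "wdist w_down x 0 < r1" "wdist w_up z 0 < r2"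
          using \<eta>(2)[of "y - s"] by auto
        have "wdist w_down (x + u) u < r1" "wdist w_up (z + v) v < r2"
          using xz(4,5) wdist_translate[of w_down x u 0] wdist_translate[of w_up z v 0] by auto
        moreover have "x + u \<in> unstable" "z + v \<in> stable"
          using xz us stable_subgroup unstable_subgroup by (auto simp: subgroup_set_def)
        ultimately have "(x + u, z + v) \<in> U" using r1(2) r2(2) U12(5) by blast
        moreover have "y = (x + u) + (z + v)" using xz(3) uv(2) by (simp add: algebra_simps)
        ultimately show ?thesis by force
      qed
      then show "\<exists>r>0. \<forall>y\<in>UNIV. wdist w_both y s < r \<longrightarrow> y \<in> plus_map ` U" using \<eta>(1) by blast
    qed auto
  qed
  show ?thesis
    unfolding short_exact_def tg_hom_def
    using inc_cont plus_map_continuous ker surj homeo closed open_map inj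
    by (auto simp: algebra_simps)
qed

end

section \<open>Self-duality\<close>

lemma continuous_map_complex_mult:
  fixes f g :: "'a \<Rightarrow> complex"
  assumes "continuous_map X euclidean f" "continuous_map X euclidean g"
  shows "continuous_map X euclidean (\<lambda>x. f x * g x)"
proof -
  have 1: "continuous_map X (prod_topology euclidean euclidean) (\<lambda>x. (f x, g x))"
    using assms by (rule continuous_map_pairedI)
  have 2: "continuous_map (prod_topology euclidean euclidean) euclidean (\<lambda>p :: complex \<times> complex. fst p * snd p)"
    unfolding prod_topology_euclidean continuous_map_iff_continuous2 by (intro continuous_intros)
  show ?thesis using continuous_map_compose[OF 1 2] by (simp add: o_def)
qed

lemma continuous_map_cnj:
  assumes "continuous_map X euclidean f" shows "continuous_map X euclidean (\<lambda>x. cnj (f x))"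
  using continuous_map_compose[OF assms, of euclidean cnj]
  by (simp add: o_def continuous_map_iff_continuous2 continuous_on_cnj)

lemma laurent_mono_continuous: "continuous_on torus (laurent_mono c)"
  unfolding laurent_mono_def using torus_nonzero
  by (intro continuous_on_prod continuous_on_power_int continuous_on_subset[OF continuous_on_product_coordinates]) auto

lemma dist_mult_unit:
  assumes "cmod a0 = 1" "cmod b = 1" shows "dist (a * b) (a0 * b0) \<le> dist a a0 + dist b b0"
proof -
  have "a * b - a0 * b0 = (a - a0) * b + a0 * (b - b0)" by (simp add: algebra_simps)
  then show ?thesis using norm_triangle_ineq[of "(a - a0) * b" "a0 * (b - b0)"] assms
    by (simp add: dist_norm norm_mult)
qed

lemma dist_cnj: "dist (cnj a) (cnj b) = dist a b"
  by (simp add: dist_norm flip: complex_cnj_diff)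

lemma characters_iff:
  "ch \<in> characters G \<longleftrightarrow> continuous_map (tg_top G) euclidean ch \<and> (\<forall>x\<in>tg_carrier G. cmod (ch x) = 1) \<and>
     ch \<in> extensional (tg_carrier G) \<and>
     (\<forall>x\<in>tg_carrier G. \<forall>y\<in>tg_carrier G. ch (tg_op G x y) = ch x * ch y)"
  by (auto simp: characters_def circle_top_def continuous_map_in_subtopology tg_carrier_def image_subset_iff)

lemma restrict_character:
  assumes "continuous_map (tg_top G) euclidean f" "\<And>x. x \<in> tg_carrier G \<Longrightarrow> cmod (f x) = 1"
    "\<And>x y. x \<in> tg_carrier G \<Longrightarrow> y \<in> tg_carrier G \<Longrightarrow> tg_op G x y \<in> tg_carrier G"
    "\<And>x y. x \<in> tg_carrier G \<Longrightarrow> y \<in> tg_carrier G \<Longrightarrow> f (tg_op G x y) = f x * f y"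
  shows "restrict f (tg_carrier G) \<in> characters G"
proof -
  have "continuous_map (tg_top G) euclidean (restrict f (tg_carrier G))"
    using assms(1) by (rule continuous_map_eq) (simp add: tg_carrier_def)
  then show ?thesis using assms unfolding characters_iff by simp
qed

text \<open>Adds compactness and the form that cyclicity takes here: each continuous character is a
  monomial in the coordinates.\<close>

locale kernel_dual = kernel_pair F d w C \<rho> E
  for F d w C \<rho> and E :: "'g::ab_group_add \<Rightarrow> int \<Rightarrow> complex" +
  assumes compact_all: "compact_space (wtop w_both UNIV)"
    and generated: "continuous_map (wtop w_both UNIV) euclidean ch \<Longrightarrow> (\<And>g. cmod (ch g) = 1) \<Longrightarrow>
      (\<And>g h. ch (g + h) = ch g * ch h) \<Longrightarrow> \<exists>c\<in>laurent_polys. \<forall>g. ch g = laurent_mono c (E g)"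
begin

section \<open>Continuity of coordinates and monomials\<close>

lemma openin_ball: "weight u \<Longrightarrow> x \<in> S \<Longrightarrow> e > 0 \<Longrightarrow> \<exists>U. openin (wtop u S) U \<and> x \<in> U \<and> (\<forall>y\<in>U. y \<in> S \<and> wdist u y x < e)"
  using openin_wtop_ball[of u S x e] by (intro exI[of _ "{y \<in> S. wdist u y x < e}"]) auto

lemma E_continuous: "continuous_map (wtop w_both UNIV) euclidean (\<lambda>g. E g n)"
  unfolding mtopology_is_euclidean[symmetric] Met_TC.continuous_map_to_metric
proof (intro ballI allI impI)
  fix g e assume e: "e > (0::real)"
  have "w_both n * e > 0" using e by (simp add: w_both_def)
  from openin_ball[OF weights(3) UNIV_I this, of g] obtain U where U: "openin (wtop w_both UNIV) U" "g \<in> U" "\<And>y. y \<in> U \<Longrightarrow> wdist w_both y g < w_both n * e" by blast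
  have "dist (E g n) (E y n) < e" if "y \<in> U" for y
  proof -
    have "w_both n * cmod (E y n - E g n) < w_both n * e" using wdist_upper[OF weights(3), of n y g] U(3)[OF that] by linarith
    then have "cmod (E y n - E g n) < e" by (rule mult_left_less_imp_less) (simp add: w_both_def)
    then show ?thesis by (simp add: dist_norm norm_minus_commute)
  qed
  then show "\<exists>U. openin (wtop w_both UNIV) U \<and> g \<in> U \<and> (\<forall>y\<in>U. E y n \<in> Met_TC.mball (E g n) e)"
    using U by (intro exI[of _ U]) simp
qed

lemma laurent_mono_E_continuous: "continuous_map (wtop w_both UNIV) euclidean (\<lambda>g. laurent_mono c (E g))"
proof -
  have "continuous_map (wtop w_both UNIV) euclidean E"
    using E_continuous by (simp add: continuous_map_componentwise_UNIV flip: euclidean_product_topology)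
  then have 1: "continuous_map (wtop w_both UNIV) (top_of_set torus) E"
    by (simp add: continuous_map_in_subtopology torus_iff image_subset_iff)
  have 2: "continuous_map (top_of_set torus) euclidean (laurent_mono c)" using laurent_mono_continuous by simp
  show ?thesis using continuous_map_compose[OF 1 2] by (simp add: o_def)
qed

text \<open>Between two finite sequences the form is symmetric, so the coordinates of a homoclinic
  point are values of its own character and the character determines the point.\<close>

lemma homoclinic_pairing_delta: assumes "c \<in> laurent_polys" shows "homoclinic_pairing (\<theta> c) (\<theta> (delta m)) = E (\<theta> c) m"
proof -
  have "homoclinic_pairing (\<theta> c) (\<theta> (delta m)) = cis (2 * pi * beta (ri c) (ri (delta m)))"
    using assms by (simp add: homoclinic_pairing_eq beta_finite laurent_polys_bounded_seq)
  also have "\<dots> = cis (2 * pi * beta (ri (delta m)) (ri c))" by (simp add: beta_commute)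
  also have "\<dots> = E (\<theta> c) m" using assms by (simp add: beta_finite laurent_polys_bounded_seq laurent_mono_delta)
  finally show ?thesis .
qed

text \<open>The values of a character are closed under powers; values that all stay near 1 are
  therefore equal to 1.\<close>

lemma homoclinic_pairing_near_1:
  assumes c: "c \<in> laurent_polys" and near: "\<And>g. cmod (homoclinic_pairing (\<theta> c) g - 1) < 1" shows "\<theta> c = 0"
proof -
  have fb0: "homoclinic_pairing (\<theta> c) 0 = 1" using c by (simp add: homoclinic_pairing_eq laurent_mono_def)
  have "homoclinic_pairing (\<theta> c) g = 1" for g
  proof (rule unit_near_1_imp_1)
    fix n
    have "\<exists>h. homoclinic_pairing (\<theta> c) h = homoclinic_pairing (\<theta> c) g ^ n"
    proof (induction n)
      case (Suc n)
      then obtain h where "homoclinic_pairing (\<theta> c) h = homoclinic_pairing (\<theta> c) g ^ n" by blast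
      then have "homoclinic_pairing (\<theta> c) (g + h) = homoclinic_pairing (\<theta> c) g ^ Suc n" by (simp add: homoclinic_pairing_add_right[OF c])
      then show ?case by blast
    qed (use fb0 in auto)
    then show "cmod (homoclinic_pairing (\<theta> c) g ^ n - 1) < 1" using near by metis
  qed simp
  then have "E (\<theta> c) m = E 0 m" for m using homoclinic_pairing_delta[OF c, of m] by simp
  then show ?thesis by (rule E_inj)
qed

lemma homoclinic_pairing_left_hom: "x \<in> homoclinic \<Longrightarrow> y \<in> homoclinic \<Longrightarrow> homoclinic_pairing (x + y) g = homoclinic_pairing x g * homoclinic_pairing y g"
  using homoclinic_pairing_add_left by (auto simp: homoclinic_eq)

lemma homoclinic_pairing_right_hom: "x \<in> homoclinic \<Longrightarrow> homoclinic_pairing x (g + h) = homoclinic_pairing x g * homoclinic_pairing x h"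
  using homoclinic_pairing_add_right by (auto simp: homoclinic_eq)

lemma homoclinic_add: "x \<in> homoclinic \<Longrightarrow> y \<in> homoclinic \<Longrightarrow> x + y \<in> homoclinic"
  using homoclinic_subgroup by (auto simp: subgroup_set_def)

lemma delta_homoclinic: "\<theta> (delta n) \<in> homoclinic"
  by (simp add: homoclinic_eq)

lemma homoclinic_pairing_continuous: "x \<in> homoclinic \<Longrightarrow> continuous_map (wtop w_both UNIV) euclidean (homoclinic_pairing x)"
proof -
  assume "x \<in> homoclinic"
  then obtain c where c: "c \<in> laurent_polys" "x = \<theta> c" by (auto simp: homoclinic_eq)
  have "homoclinic_pairing x = (\<lambda>g. laurent_mono c (E g))" using c by (simp add: fun_eq_iff homoclinic_pairing_eq)
  then show ?thesis using laurent_mono_E_continuous by simp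
qed

text \<open>Surjectivity is cyclicity. Openness is the discreteness of the dual of a compact group,
  tested with the whole group as compact set and radius 1.\<close>

theorem iso_A: "tg_iso GA (pdual GC) (\<lambda>v. restrict (homoclinic_pairing v) (tg_carrier GC))"
proof (rule pairing_iso_pdual)
  show "restrict (homoclinic_pairing v) (tg_carrier GC) \<in> characters GC" if "v \<in> tg_carrier GA" for v
    using that homoclinic_pairing_continuous homoclinic_pairing_right_hom by (intro restrict_character) auto
  show "homoclinic_pairing (tg_op GA v v') x = homoclinic_pairing v x * homoclinic_pairing v' x" if "v \<in> tg_carrier GA" "v' \<in> tg_carrier GA" for v v' x
    using that homoclinic_pairing_left_hom by simp
  show "\<exists>v\<in>tg_carrier GA. \<forall>x\<in>tg_carrier GC. ch x = homoclinic_pairing v x" if "ch \<in> characters GC" for ch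
  proof -
    have "continuous_map (wtop w_both UNIV) euclidean ch" "\<And>g. cmod (ch g) = 1" "\<And>g h. ch (g + h) = ch g * ch h"
      using that by (simp_all add: characters_iff)
    from generated[OF this] obtain c where c: "c \<in> laurent_polys" "\<And>g. ch g = laurent_mono c (E g)" by blast
    then have "\<theta> c \<in> homoclinic" by (simp add: homoclinic_eq)
    then show ?thesis using c by (intro bexI[of _ "\<theta> c"]) (simp_all add: homoclinic_pairing_eq)
  qed
  show "\<exists>U. openin (tg_top GA) U \<and> v0 \<in> U \<and> (\<forall>v\<in>U. \<forall>x\<in>K. dist (homoclinic_pairing v x) (homoclinic_pairing v0 x) < e)"
    if "v0 \<in> tg_carrier GA" "e > 0" for v0 K e
    using that by (intro exI[of _ "{v0}"]) auto
  show "\<exists>K e. compactin (tg_top GC) K \<and> e > 0 \<and> (\<forall>v\<in>tg_carrier GA. (\<forall>x\<in>K. dist (homoclinic_pairing v x) (homoclinic_pairing v0 x) < e) \<longrightarrow> v \<in> U)"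
    if "v0 \<in> U" "openin (tg_top GA) U" for v0 U
  proof (intro exI[of _ UNIV] exI[of _ 1] conjI ballI impI)
    show "compactin (tg_top GC) UNIV" using compact_all by (simp add: compact_space_def)
    fix v assume v: "v \<in> tg_carrier GA" "\<forall>x\<in>UNIV. dist (homoclinic_pairing v x) (homoclinic_pairing v0 x) < 1"
    have v0: "v0 \<in> homoclinic" using that by auto
    have dv: "v - v0 \<in> homoclinic" using subgroup_set_diff[OF homoclinic_subgroup] v(1) v0 by simp
    then obtain c where c: "c \<in> laurent_polys" "v - v0 = \<theta> c" by (auto simp: homoclinic_eq)
    have "cmod (homoclinic_pairing (\<theta> c) g - 1) < 1" for g
    proof -
      have "homoclinic_pairing v g = homoclinic_pairing (\<theta> c) g * homoclinic_pairing v0 g" using homoclinic_pairing_left_hom[OF dv v0, of g] unfolding c(2)[symmetric] by simp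
      then have "homoclinic_pairing v g - homoclinic_pairing v0 g = (homoclinic_pairing (\<theta> c) g - 1) * homoclinic_pairing v0 g" by (simp add: algebra_simps)
      then have "dist (homoclinic_pairing v g) (homoclinic_pairing v0 g) = cmod (homoclinic_pairing (\<theta> c) g - 1)" by (simp add: dist_norm norm_mult)
      then show ?thesis using v(2) by (metis UNIV_I)
    qed
    then have "\<theta> c = 0" by (rule homoclinic_pairing_near_1[OF c(1)])
    then show "v \<in> U" using c(2) that(1) by simp
  qed simp
  show "Hausdorff_space (tg_top GA)" by simp
qed

text \<open>Both topologies are governed by finitely many coordinates: compact subsets of a discrete
  group are finite, and finitely many unit digits control a ball of the two-sided metric.
  Surjectivity needs no continuity, as \<open>hom_on_homoclinic\<close> is algebraic.\<close>

theorem iso_C: "tg_iso GC (pdual GA) (\<lambda>g. restrict (\<lambda>\<omega>. homoclinic_pairing \<omega> g) (tg_carrier GA))"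
proof (rule pairing_iso_pdual)
  show "restrict (\<lambda>\<omega>. homoclinic_pairing \<omega> g) (tg_carrier GA) \<in> characters GA" for g
    using homoclinic_pairing_left_hom homoclinic_add by (intro restrict_character) (auto simp: continuous_map_from_discrete_topology)
  show "homoclinic_pairing x (tg_op GC v v') = homoclinic_pairing x v * homoclinic_pairing x v'" if "x \<in> tg_carrier GA" for v v' x
    using that homoclinic_pairing_right_hom by simp
  show "\<exists>v\<in>tg_carrier GC. \<forall>x\<in>tg_carrier GA. ch x = homoclinic_pairing x v" if "ch \<in> characters GA" for ch
  proof -
    have ch: "\<And>x. x \<in> homoclinic \<Longrightarrow> cmod (ch x) = 1" "\<And>x y. x \<in> homoclinic \<Longrightarrow> y \<in> homoclinic \<Longrightarrow> ch (x + y) = ch x * ch y"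
      using that by (auto simp: characters_iff)
    have "\<exists>g. \<forall>c\<in>laurent_polys. ch (\<theta> c) = laurent_mono c (E g)"
      by (rule hom_on_homoclinic) (auto simp: homoclinic_eq intro!: ch)
    then obtain g where g: "\<And>c. c \<in> laurent_polys \<Longrightarrow> ch (\<theta> c) = laurent_mono c (E g)" by blast
    have "ch x = homoclinic_pairing x g" if "x \<in> homoclinic" for x using that by (auto simp: homoclinic_eq homoclinic_pairing_eq g)
    then show ?thesis by (intro bexI[of _ g]) simp_all
  qed
  show "\<exists>U. openin (tg_top GC) U \<and> g0 \<in> U \<and> (\<forall>g\<in>U. \<forall>x\<in>K. dist (homoclinic_pairing x g) (homoclinic_pairing x g0) < e)"
    if "compactin (tg_top GA) K" "e > 0" for g0 K e
  proof -
    have K: "K \<subseteq> homoclinic" "finite K" using that by (auto simp: compactin_discrete_topology)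
    have "openin (wtop w_both UNIV) {g. dist (homoclinic_pairing x g) (homoclinic_pairing x g0) < e}" if "x \<in> K" for x
    proof -
      have "openin (wtop w_both UNIV) {g \<in> topspace (wtop w_both UNIV). homoclinic_pairing x g \<in> ball (homoclinic_pairing x g0) e}"
        using K(1) that by (intro openin_continuous_map_preimage[OF homoclinic_pairing_continuous]) auto
      then show ?thesis by (simp add: dist_commute)
    qed
    then have "openin (wtop w_both UNIV) (\<Inter>S\<in>insert UNIV ((\<lambda>x. {g. dist (homoclinic_pairing x g) (homoclinic_pairing x g0) < e}) ` K). S)"
      using K(2) openin_topspace[of "wtop w_both UNIV"] by (intro openin_INT2) auto
    then show ?thesis using that(2)
      by (intro exI[of _ "\<Inter>S\<in>insert UNIV ((\<lambda>x. {g. dist (homoclinic_pairing x g) (homoclinic_pairing x g0) < e}) ` K). S"]) auto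
  qed
  show "\<exists>K e. compactin (tg_top GA) K \<and> e > 0 \<and> (\<forall>g\<in>tg_carrier GC. (\<forall>x\<in>K. dist (homoclinic_pairing x g) (homoclinic_pairing x g0) < e) \<longrightarrow> g \<in> U)"
    if "g0 \<in> U" "openin (tg_top GC) U" for g0 U
  proof -
    have "\<exists>r>0. \<forall>y\<in>UNIV. wdist w_both y g0 < r \<longrightarrow> y \<in> U"
      using that unfolding GC_simps openin_wtop[OF weights(3)] by (elim conjE) (erule bspec)
    then obtain r where r: "r > 0" "\<And>y. wdist w_both y g0 < r \<Longrightarrow> y \<in> U" by blast
    have r2: "r / 2 > 0" using r by simp
    obtain q :: nat where q: "2 * (1 / 2) ^ q \<le> r / 2" using power_half_small[OF r2] by blast
    define K where "K = (\<lambda>n. \<theta> (delta n)) ` {- int q..int q}"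
    have "g \<in> U" if g: "\<And>x. x \<in> K \<Longrightarrow> dist (homoclinic_pairing x g) (homoclinic_pairing x g0) < r / 2" for g
    proof -
      have "wdist w_both g g0 \<le> r / 2"
      proof (rule wdist_both_small[OF _ q])
        fix n assume "\<bar>n\<bar> \<le> int q"
        then have "\<theta> (delta n) \<in> K" by (auto simp: K_def abs_le_iff)
        then have "dist (E g n) (E g0 n) < r / 2" using g[of "\<theta> (delta n)"] by (simp add: homoclinic_pairing_eq laurent_mono_delta)
        then show "cmod (E g n - E g0 n) \<le> r / 2" by (simp add: dist_norm)
      qed
      then show ?thesis using r(2) r(1) by simp
    qed
    moreover have "compactin (tg_top GA) K" using delta_homoclinic by (auto simp: compactin_discrete_topology K_def)
    ultimately show ?thesis using r2 by blast
  qed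
  show "Hausdorff_space (tg_top GC)" by (simp add: Hausdorff_wtop)
qed

text \<open>The conjugate on the unstable factor compensates the sign in
  \<open>\<omega> \<mapsto> (- \<omega>, \<omega>)\<close>: pairing the image of
  \<open>\<omega>\<close> with \<open>(u, v)\<close> becomes the value of the character of
  \<open>\<omega>\<close> at \<open>u + v\<close>.\<close>

definition product_pairing :: "'g \<times> 'g \<Rightarrow> 'g \<times> 'g \<Rightarrow> complex" where
  "product_pairing p q = cnj (r.stable_pairing (fst p) (fst q)) * stable_pairing (snd p) (snd q)"

section \<open>Self-duality of the middle term\<close>

lemmas r_facts = r.stable_pairing_uniform[unfolded r_wtop r_stable r_wdist_up] r.stable_pairing_separates[unfolded r_wtop r_stable r_wdist_up]
  r.stable_pairing_continuous[unfolded r_wtop r_stable] r.stable_dual_surj[unfolded r_wtop r_stable]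
  r.stable_pairing_add_left[unfolded r_stable] r.stable_pairing_add_right[unfolded r_stable] r.stable_pairing_commute[unfolded r_stable]
  r.stable_pairing_uminus_left[unfolded r_stable]

lemma stable_pairing_0: "x \<in> stable \<Longrightarrow> stable_pairing x 0 = 1"
  using stable_pairing_add_right[of x 0 0] stable_0 norm_stable_pairing[of x 0] by (metis add_0 mult_cancel_right1 norm_zero zero_neq_one)

lemma r_stable_pairing_0: "x \<in> unstable \<Longrightarrow> r.stable_pairing x 0 = 1"
  using r.stable_pairing_add_right[of x 0 0] r.stable_0 r.norm_stable_pairing[of x 0] unfolding r_stable
  by (metis add_0 mult_cancel_right1 norm_zero zero_neq_one)

lemma unstable_0: "0 \<in> unstable"
  using r.stable_0 by (simp add: r_stable)

theorem iso_B: "tg_iso GB (pdual GB) (\<lambda>v. restrict (product_pairing v) (tg_carrier GB))"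
proof (rule pairing_iso_pdual)
  have add_in: "x + y \<in> unstable" if "x \<in> unstable" "y \<in> unstable" for x y
    using that unstable_subgroup by (auto simp: subgroup_set_def)
  have um: "- x \<in> unstable" if "x \<in> unstable" for x
    using that unstable_subgroup by (auto simp: subgroup_set_def)
  show "restrict (product_pairing v) (tg_carrier GB) \<in> characters GB" if "v \<in> tg_carrier GB" for v
  proof (rule restrict_character)
    have v: "fst v \<in> unstable" "snd v \<in> stable" using that by auto
    show "continuous_map (tg_top GB) euclidean (product_pairing v)"
      using continuous_map_compose[OF continuous_map_fst r_facts(3)[OF v(1)]]
        continuous_map_compose[OF continuous_map_snd stable_pairing_continuous[OF v(2)]]
      unfolding product_pairing_def[abs_def] GB_simps by (intro continuous_map_complex_mult continuous_map_cnj) (auto simp: o_def)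
    show "product_pairing v (tg_op GB x y) = product_pairing v x * product_pairing v y" if "x \<in> tg_carrier GB" "y \<in> tg_carrier GB" for x y
      using that v by (auto simp: product_pairing_def r_facts(6) stable_pairing_add_right)
  qed (auto simp: product_pairing_def norm_mult add_in stable_add)
  show "product_pairing (tg_op GB v v') x = product_pairing v x * product_pairing v' x" if "v \<in> tg_carrier GB" "v' \<in> tg_carrier GB" "x \<in> tg_carrier GB" for v v' x
    using that by (auto simp: product_pairing_def r_facts(5) stable_pairing_add_left)
  show "\<exists>v\<in>tg_carrier GB. \<forall>x\<in>tg_carrier GB. ch x = product_pairing v x" if ch: "ch \<in> characters GB" for ch
  proof -
    have chc: "continuous_map (tg_top GB) euclidean ch"
      and ch1: "\<And>x y. x \<in> unstable \<Longrightarrow> y \<in> stable \<Longrightarrow> cmod (ch (x, y)) = 1"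
      and chm: "\<And>x y x' y'. x \<in> unstable \<Longrightarrow> y \<in> stable \<Longrightarrow> x' \<in> unstable \<Longrightarrow> y' \<in> stable \<Longrightarrow>
         ch (x + x', y + y') = ch (x, y) * ch (x', y')"
      using ch by (auto simp: characters_iff)
    have "continuous_map (wtop w_down unstable) (tg_top GB) (\<lambda>x. (x, 0))"
      by (simp add: continuous_map_pairedI stable_0)
    from continuous_map_compose[OF this chc]
    have "\<exists>u\<in>unstable. \<forall>x\<in>unstable. ch (x, 0) = r.stable_pairing u x"
      using ch1 chm[of _ 0 _ 0] stable_0 by (intro r_facts(4)) (auto simp: o_def)
    then obtain u where u: "u \<in> unstable" "\<And>x. x \<in> unstable \<Longrightarrow> ch (x, 0) = r.stable_pairing u x" by blast
    have "continuous_map (wtop w_up stable) (tg_top GB) (\<lambda>x. (0, x))"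
      by (simp add: continuous_map_pairedI unstable_0)
    from continuous_map_compose[OF this chc]
    have "\<exists>v\<in>stable. \<forall>x\<in>stable. ch (0, x) = stable_pairing v x"
      using ch1 chm[of 0 _ 0] unstable_0 by (intro stable_dual_surj) (auto simp: o_def)
    then obtain v where v: "v \<in> stable" "\<And>x. x \<in> stable \<Longrightarrow> ch (0, x) = stable_pairing v x" by blast
    \<comment> \<open>The sign of \<open>u\<close> undoes the conjugation in
      \<open>product_pairing\<close>.\<close>
    have "ch (x, y) = product_pairing (- u, v) (x, y)" if "x \<in> unstable" "y \<in> stable" for x y
      using chm[of x 0 0 y] that u v stable_0 unstable_0 by (simp add: product_pairing_def r_facts(8))
    then show ?thesis using u(1) v(1) um by (intro bexI[of _ "(- u, v)"]) auto
  qed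
  show "\<exists>U. openin (tg_top GB) U \<and> p0 \<in> U \<and> (\<forall>p\<in>U. \<forall>x\<in>K. dist (product_pairing p x) (product_pairing p0 x) < e)"
    if p0: "p0 \<in> tg_carrier GB" and K: "compactin (tg_top GB) K" and e: "e > 0" for p0 K e
  proof -
    obtain u0 v0 where uv: "p0 = (u0, v0)" "u0 \<in> unstable" "v0 \<in> stable" using p0 by auto
    have K1: "compactin (wtop w_down unstable) (fst ` K)" and K2: "compactin (wtop w_up stable) (snd ` K)"
      using image_compactin[OF K[unfolded GB_simps] continuous_map_fst] image_compactin[OF K[unfolded GB_simps] continuous_map_snd] by auto
    have e2: "e / 2 > 0" using e by simp
    obtain d1 where d1: "d1 > 0" "\<And>u x. u \<in> unstable \<Longrightarrow> wdist w_down u u0 < d1 \<Longrightarrow> x \<in> fst ` K \<Longrightarrow> dist (r.stable_pairing u x) (r.stable_pairing u0 x) < e / 2"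
      using r_facts(1)[OF K1 e2] uv(2) by meson
    obtain d2 where d2: "d2 > 0" "\<And>v x. v \<in> stable \<Longrightarrow> wdist w_up v v0 < d2 \<Longrightarrow> x \<in> snd ` K \<Longrightarrow> dist (stable_pairing v x) (stable_pairing v0 x) < e / 2"
      using stable_pairing_uniform[OF K2 e2] uv(3) by meson
    let ?U = "{x \<in> unstable. wdist w_down x u0 < d1} \<times> {y \<in> stable. wdist w_up y v0 < d2}"
    have "openin (tg_top GB) ?U"
      using openin_wtop_ball[OF weights(2), of unstable u0 d1] openin_wtop_ball[OF weights(1), of stable v0 d2]
      by (simp only: GB_simps openin_prod_Times_iff) simp
    moreover have "dist (product_pairing p x) (product_pairing p0 x) < e" if p: "p \<in> ?U" and x: "x \<in> K" for p x
    proof -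
      have "dist (product_pairing p x) (product_pairing p0 x) \<le> dist (cnj (r.stable_pairing (fst p) (fst x))) (cnj (r.stable_pairing u0 (fst x))) + dist (stable_pairing (snd p) (snd x)) (stable_pairing v0 (snd x))"
        unfolding product_pairing_def uv(1) fst_conv snd_conv by (rule dist_mult_unit) simp_all
      also have "\<dots> < e / 2 + e / 2"
        unfolding dist_cnj using p x by (intro add_strict_mono d1(2) d2(2)) auto
      finally show ?thesis by simp
    qed
    ultimately show ?thesis using uv d1(1) d2(1) by (intro exI[of _ ?U]) auto
  qed
  show "\<exists>K e. compactin (tg_top GB) K \<and> e > 0 \<and> (\<forall>p\<in>tg_carrier GB. (\<forall>x\<in>K. dist (product_pairing p x) (product_pairing p0 x) < e) \<longrightarrow> p \<in> U)"
    if p0: "p0 \<in> U" and U: "openin (tg_top GB) U" for p0 U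
  proof -
    obtain u0 v0 where uv: "p0 = (u0, v0)" by (cases p0)
    obtain U1 U2 where U12: "openin (wtop w_down unstable) U1" "openin (wtop w_up stable) U2" "u0 \<in> U1" "v0 \<in> U2" "U1 \<times> U2 \<subseteq> U"
      using U p0 unfolding GB_simps openin_prod_topology_alt uv by meson
    have in0: "u0 \<in> unstable" "v0 \<in> stable" using U12 openin_subset[OF U12(1)] openin_subset[OF U12(2)] by auto
    obtain r1 where r1: "r1 > 0" "\<And>x. x \<in> unstable \<Longrightarrow> wdist w_down x u0 < r1 \<Longrightarrow> x \<in> U1"
      using U12(1,3) unfolding openin_wtop[OF weights(2)] by blast
    obtain r2 where r2: "r2 > 0" "\<And>x. x \<in> stable \<Longrightarrow> wdist w_up x v0 < r2 \<Longrightarrow> x \<in> U2"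
      using U12(2,4) unfolding openin_wtop[OF weights(1)] by blast
    obtain K1 e1 where K1: "compactin (wtop w_down unstable) K1" "e1 > 0"
      "\<And>u. u \<in> unstable \<Longrightarrow> (\<And>x. x \<in> K1 \<Longrightarrow> dist (r.stable_pairing u x) (r.stable_pairing u0 x) < e1) \<Longrightarrow> wdist w_down u u0 < r1"
      using r_facts(2)[OF r1(1)] in0(1) by meson
    obtain K2 e2 where K2: "compactin (wtop w_up stable) K2" "e2 > 0"
      "\<And>v. v \<in> stable \<Longrightarrow> (\<And>x. x \<in> K2 \<Longrightarrow> dist (stable_pairing v x) (stable_pairing v0 x) < e2) \<Longrightarrow> wdist w_up v v0 < r2"
      using stable_pairing_separates[OF r2(1)] in0(2) by meson
    \<comment> \<open>On each of the two slices one factor of the pairing is 1, so closeness on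
      \<open>K\<close> splits into closeness of the two components.\<close>
    define K where "K = K1 \<times> {0} \<union> {0} \<times> K2"
    have "compactin (tg_top GB) K"
      unfolding K_def GB_simps using K1(1) K2(1) stable_0 unstable_0
      by (intro compactin_Un) (simp_all add: compactin_Times)
    moreover have "p \<in> U" if p: "p \<in> tg_carrier GB" and near: "\<forall>x\<in>K. dist (product_pairing p x) (product_pairing p0 x) < min e1 e2" for p
    proof -
      obtain u v where puv: "p = (u, v)" "u \<in> unstable" "v \<in> stable" using p by auto
      have "dist (r.stable_pairing u x) (r.stable_pairing u0 x) < e1" if x: "x \<in> K1" for x
      proof -
        have "dist (product_pairing p (x, 0)) (product_pairing p0 (x, 0)) < min e1 e2" using near x by (auto simp: K_def)
        then show ?thesis using puv in0 by (simp add: product_pairing_def uv stable_pairing_0 dist_cnj)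
      qed
      then have "u \<in> U1" using r1(2) K1(3) puv by blast
      moreover have "dist (stable_pairing v x) (stable_pairing v0 x) < e2" if x: "x \<in> K2" for x
      proof -
        have "dist (product_pairing p (0, x)) (product_pairing p0 (0, x)) < min e1 e2" using near x by (auto simp: K_def)
        then show ?thesis using puv in0 by (simp add: product_pairing_def uv r_stable_pairing_0)
      qed
      then have "v \<in> U2" using r2(2) K2(3) puv by blast
      ultimately show ?thesis using U12(5) puv by blast
    qed
    ultimately show ?thesis using K1(2) K2(2) by (intro exI[of _ K] exI[of _ "min e1 e2"]) auto
  qed
  show "Hausdorff_space (tg_top GB)" by (simp add: Hausdorff_space_prod_topology Hausdorff_wtop)
qed

section \<open>Compatibility of the pairings\<close>

lemma stable_pairing_eq_homoclinic_pairing: assumes "x \<in> homoclinic" "v \<in> stable" shows "stable_pairing x v = homoclinic_pairing x v"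
  using assms by (auto simp: homoclinic_eq stable_pairing_finite homoclinic_pairing_eq)

lemma r_stable_pairing_eq_homoclinic_pairing: assumes "x \<in> homoclinic" "u \<in> unstable" shows "r.stable_pairing x u = homoclinic_pairing x u"
proof -
  obtain c where c: "c \<in> laurent_polys" "x = \<theta> c" using assms(1) by (auto simp: homoclinic_eq)
  have "r.stable_pairing (r.\<theta> (\<lambda>k. c (- k))) u = laurent_mono (\<lambda>k. c (- k)) (\<lambda>n. E u (- n))"
    using assms(2) laurent_reflect[OF c(1)] by (intro r.stable_pairing_finite) (simp_all add: r_stable)
  then show ?thesis using c by (simp add: theta_reflect[symmetric] laurent_mono_reflect homoclinic_pairing_eq)
qed

theorem self_dual: "self_dual_seq GA GB GC inc plus_map"
  unfolding self_dual_seq_def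
proof (intro exI conjI ballI)
  show "tg_iso GA (pdual GC) (\<lambda>v. restrict (homoclinic_pairing v) (tg_carrier GC))" by (rule iso_A)
  show "tg_iso GB (pdual GB) (\<lambda>v. restrict (product_pairing v) (tg_carrier GB))" by (rule iso_B)
  show "tg_iso GC (pdual GA) (\<lambda>g. restrict (\<lambda>\<omega>. homoclinic_pairing \<omega> g) (tg_carrier GA))" by (rule iso_C)
  fix \<omega> assume "\<omega> \<in> tg_carrier GA"
  then have o: "\<omega> \<in> homoclinic" by simp
  then have os: "\<omega> \<in> stable" "\<omega> \<in> unstable" by (simp_all add: homoclinic_def)
  show "restrict (product_pairing (inc \<omega>)) (tg_carrier GB) = dual_map GB plus_map (restrict (homoclinic_pairing \<omega>) (tg_carrier GC))"
    using o os by (auto simp: dual_map_def fun_eq_iff restrict_def product_pairing_def r_facts(8) r_stable_pairing_eq_homoclinic_pairing stable_pairing_eq_homoclinic_pairing homoclinic_pairing_right_hom)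
next
  fix p assume "p \<in> tg_carrier GB"
  then obtain u v where p: "p = (u, v)" "u \<in> unstable" "v \<in> stable" by auto
  have "homoclinic_pairing \<omega> (u + v) = product_pairing (u, v) (- \<omega>, \<omega>)" if o: "\<omega> \<in> homoclinic" for \<omega>
  proof -
    have os: "\<omega> \<in> stable" "\<omega> \<in> unstable" "- \<omega> \<in> unstable" using o unstable_subgroup by (auto simp: homoclinic_def subgroup_set_def)
    have "r.stable_pairing u (- \<omega>) = cnj (homoclinic_pairing \<omega> u)"
      using r_facts(7)[OF p(2) os(3)] r_facts(8)[OF os(2) p(2)] r_stable_pairing_eq_homoclinic_pairing[OF o p(2)] by simp
    moreover have "stable_pairing v \<omega> = homoclinic_pairing \<omega> v" using stable_pairing_commute[OF p(3) os(1)] stable_pairing_eq_homoclinic_pairing[OF o p(3)] by simp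
    ultimately show ?thesis by (simp add: product_pairing_def homoclinic_pairing_right_hom[OF o])
  qed
  moreover have in_GB: "- \<omega> \<in> unstable \<and> \<omega> \<in> stable" if "\<omega> \<in> homoclinic" for \<omega>
    using that unstable_subgroup by (auto simp: homoclinic_def subgroup_set_def)
  ultimately show "restrict (\<lambda>\<omega>. homoclinic_pairing \<omega> (plus_map p)) (tg_carrier GA) = dual_map GA inc (restrict (product_pairing p) (tg_carrier GB))"
    using p in_GB by (simp add: dual_map_def fun_eq_iff restrict_def)
qed

lemma LCA_GC: "LCA GC"
  unfolding LCA_def
proof (intro conjI)
  show "abelian_tgroup GC" by (intro abelian_wtop) (auto simp: subgroup_set_def)
  show "locally_compact_space (tg_top GC)" using compact_all by (simp add: compact_imp_locally_compact_space)
qed (simp add: Hausdorff_wtop)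

end

section \<open>Cyclic expansive automorphisms\<close>

lemma sum_laurent_of_poly:
  fixes u :: "int \<Rightarrow> real"
  shows "(\<Sum>i\<in>{- int (degree f)..int (degree f)}. of_int (laurent_of_poly f i) * u i) =
    (\<Sum>i\<le>degree f. of_int (coeff f i) * u (int i))"
proof -
  have "(\<Sum>i\<le>degree f. of_int (coeff f i) * u (int i)) = (\<Sum>i\<in>int ` {..degree f}. of_int (laurent_of_poly f i) * u i)"
    by (subst sum.reindex) (auto simp: laurent_of_poly_def)
  also have "\<dots> = (\<Sum>i\<in>{- int (degree f)..int (degree f)}. of_int (laurent_of_poly f i) * u i)"
  proof (rule sum.mono_neutral_left)
    show "\<forall>i\<in>{- int (degree f)..int (degree f)} - int ` {..degree f}. of_int (laurent_of_poly f i) * u i = 0"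
    proof
      fix i assume i: "i \<in> {- int (degree f)..int (degree f)} - int ` {..degree f}"
      have "i < 0"
      proof (rule ccontr)
        assume "\<not> i < 0"
        then have "i = int (nat i)" "nat i \<in> {..degree f}" using i by auto
        then show False using i by blast
      qed
      then show "of_int (laurent_of_poly f i) * u i = 0" by (simp add: laurent_of_poly_def)
    qed
  qed auto
  finally show ?thesis by simp
qed

section \<open>Reversal of digit sequences\<close>

lemma continuous_map_reflect: "continuous_map seq_top seq_top (\<lambda>a k. a (- k))"
proof -
  have "continuous_map seq_top (discrete_topology UNIV) (\<lambda>a. a (- k))" for k
    unfolding seq_top_def by (rule continuous_map_product_projection) simp
  then show ?thesis by (subst (2) seq_top_def) (simp add: continuous_map_componentwise_UNIV)
qed

lemma reflect_Bminus: "(\<lambda>k. a (- k)) \<in> Bplus N k \<longleftrightarrow> a \<in> Bminus N k"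
proof -
  have "(\<forall>i. P (a (- i)) i) \<longleftrightarrow> (\<forall>i. P (a i) (- i))" for P by (metis minus_minus)
  from this[of "\<lambda>b i. \<bar>b\<bar> \<le> int N \<and> (i < - int k \<longrightarrow> b = 0)"] show ?thesis by (simp add: Bplus_def Bminus_def)
qed

lemma reflect_Bplus: "(\<lambda>k. a (- k)) \<in> Bminus N k \<longleftrightarrow> a \<in> Bplus N k"
  using reflect_Bminus[of "\<lambda>k. a (- k)" N k] by simp

text \<open>Index reversal is a homeomorphism of the sequence space that exchanges the two families
  of compact sets.\<close>

lemma strong_top_reflect: "strong_top \<theta> (Bminus N) S = strong_top (\<lambda>a. \<theta> (\<lambda>k. a (- k))) (Bplus N) S"
proof -
  have cont: "continuous_map (subtopology seq_top X) (subtopology seq_top Y) (\<lambda>a k. a (- k))"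
    if "\<And>a. a \<in> X \<Longrightarrow> (\<lambda>k. a (- k)) \<in> Y" for X Y
    using that by (auto simp: continuous_map_in_subtopology continuous_map_from_subtopology continuous_map_reflect image_subset_iff)
  have "openin (subtopology seq_top (Bminus N k)) {a \<in> Bminus N k. \<theta> a \<in> U} \<longleftrightarrow>
    openin (subtopology seq_top (Bplus N k)) {a \<in> Bplus N k. \<theta> (\<lambda>k. a (- k)) \<in> U}" for k U
    using openin_continuous_map_preimage[OF cont[of "Bminus N k" "Bplus N k"], of "{a \<in> Bplus N k. \<theta> (\<lambda>k. a (- k)) \<in> U}"]
      openin_continuous_map_preimage[OF cont[of "Bplus N k" "Bminus N k"], of "{a \<in> Bminus N k. \<theta> a \<in> U}"]
    by (auto simp: reflect_Bminus reflect_Bplus cong: conj_cong)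
  then show ?thesis by (simp add: strong_top_def)
qed

lemma image_Bminus: "\<theta> ` (\<Union>k. Bminus N k) = (\<lambda>a. \<theta> (\<lambda>k. a (- k))) ` (\<Union>k. Bplus N k)"
proof -
  have "\<exists>b\<in>Bplus N k. \<theta> a = \<theta> (\<lambda>k. b (- k))" if "a \<in> Bminus N k" for a k
    using that by (intro bexI[of _ "\<lambda>k. a (- k)"]) (auto simp: reflect_Bminus)
  moreover have "\<exists>a\<in>Bminus N k. \<theta> (\<lambda>k. b (- k)) = \<theta> a" if "b \<in> Bplus N k" for b k
    using that by (intro bexI[of _ "\<lambda>k. b (- k)"]) (auto simp: reflect_Bplus)
  ultimately show ?thesis by (fastforce simp: image_iff)
qed

section \<open>The cyclic system as an instance of the abstract setting\<close>

context cyclic_system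
begin

text \<open>The solution built from the roots is the one selected by the description in
  \<open>fund_sol\<close>, because bounded solutions are unique. Exponential decay, which that
  description does not mention, is gained in this way.\<close>

lemma kernel_system:
  obtains C \<rho> where "kernel_dual (laurent_of_poly (assoc_poly T \<alpha> ch0)) (degree (assoc_poly T \<alpha> ch0))
    (fund_sol (assoc_poly T \<alpha> ch0)) C \<rho> coords"
proof -
  obtain f where f: "assoc_poly T \<alpha> ch0 = f" "f \<noteq> 0"
    and lift: "\<And>s. s \<in> lifts \<longleftrightarrow> (\<forall>n. pact (rpoly f) s n \<in> \<int>)"
    and unit: "\<And>z :: complex. poly (map_poly of_int f) z = 0 \<Longrightarrow> cmod z \<noteq> 1"
    using associated_poly by blast
  obtain w where w: "decays w" "\<And>m. pact (rpoly f) w m = (if m = 0 then 1 else 0)"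
    using fundamental_solution_real[OF f(2) unit] by blast
  obtain C \<rho> where rho: "0 < \<rho>" "\<rho> < 1" "\<And>n. norm (w n) \<le> C * \<rho> ^ nat \<bar>n\<bar>" using w(1) by (auto simp: decays_def)
  have pact_eq: "pact (rpoly f) s m = (\<Sum>i\<in>{- int (degree f)..int (degree f)}. of_int (laurent_of_poly f i) * s (m + i))" for s m
    using sum_laurent_of_poly[of f "\<lambda>i. s (m + i)"] by (simp add: pact_rpoly)
  interpret h: hyperbolic_kernel "laurent_of_poly f" "degree f" w C \<rho>
  proof
    show "\<bar>i\<bar> \<le> int (degree f)" if "laurent_of_poly f i \<noteq> 0" for i
      using that le_degree[of f "nat i"] by (auto simp: laurent_of_poly_def split: if_splits)
    show "(\<Sum>i\<in>{- int (degree f)..int (degree f)}. of_int (laurent_of_poly f i) * w (i + m)) = (if m = 0 then 1 else 0)" for m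
      using w(2)[of m] by (simp add: pact_eq add.commute)
  qed (use rho in auto)
  have A_eq: "h.A s n = pact (rpoly f) s n" for s n by (simp add: h.A_def pact_eq)
  have bdd: "bounded (range s) \<longleftrightarrow> bdd_fun s" for s :: "int \<Rightarrow> real"
    by (auto simp: bounded_iff bdd_fun_def)
  have pact_sum: "(\<Sum>i\<le>degree f. of_int (coeff f i) * s (int i + m)) = pact (rpoly f) s m" for s m
    by (simp add: pact_rpoly add.commute)
  have "fund_sol f = w"
    unfolding fund_sol_def pact_sum
  proof (rule the_equality)
    show "bounded (range w) \<and> (\<forall>m. pact (rpoly f) w m = (if m = 0 then 1 else 0))"
      using h.w_bdd w(2) by (simp add: bdd)
    show "s = w" if "bounded (range s) \<and> (\<forall>m. pact (rpoly f) s m = (if m = 0 then 1 else 0))" for s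
      using that h.w_bdd w(2) by (intro h.A_inj) (simp_all add: bdd A_eq)
  qed
  moreover interpret p: kernel_pair "laurent_of_poly f" "degree f" w C \<rho> coords
  proof
    show "\<exists>g. \<forall>n. coords g n = cis (2 * pi * s n)" if "\<And>n. h.A s n \<in> \<int>" for s
      using that lift[of s] by (simp add: A_eq lifts_def)
    show "h.A s n \<in> \<int>" if "\<And>n. coords g n = cis (2 * pi * s n)" for g s n
      using that lift[of s] by (auto simp: A_eq lifts_def)
  qed (use coords_add coords_inj in auto)
  have T_eq: "p.wtop w_both UNIV = T"
    using p.compact_top_eq_wtop[OF compact_T top_UNIV coords_cont] by simp
  have "kernel_dual (laurent_of_poly f) (degree f) w C \<rho> coords"
  proof
    show "compact_space (p.wtop w_both UNIV)" by (simp add: T_eq compact_T)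
    fix ch assume "continuous_map (p.wtop w_both UNIV) euclidean ch" "\<And>g. cmod (ch g) = 1" "\<And>g h. ch (g + h) = ch g * ch h"
    then have "ch \<in> characters (add_tgroup T)" by (simp add: characters_iff T_eq)
    then show "\<exists>c\<in>laurent_polys. \<forall>g. ch g = laurent_mono c (coords g)"
      using generator by (simp add: is_cyclic_generator_def top_UNIV laurent_act_eq)
  qed
  ultimately show thesis using that f(1) by simp
qed

text \<open>A single sequence of coordinates suffices: a box around 0 involves the coordinates of a
  finite window, and for a point far along the orbit these are members of the same sequence,
  displaced by at most \<open>N\<close>. The sign \<open>\<sigma>\<close> treats both time
  directions at once.\<close>

lemma limitin_0_iff:
  assumes \<sigma>: "\<bar>\<sigma>\<bar> = 1"
  shows "limitin T (\<lambda>n. apow \<alpha> (\<sigma> * int n) g) 0 sequentially \<longleftrightarrow> (\<lambda>n. coords g (\<sigma> * int n)) \<longlonglongrightarrow> 1"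
proof
  assume "limitin T (\<lambda>n. apow \<alpha> (\<sigma> * int n) g) 0 sequentially"
  from continuous_map_limit[OF coords_cont this, of 0] show "(\<lambda>n. coords g (\<sigma> * int n)) \<longlonglongrightarrow> 1"
    by (simp add: o_def coords_apow)
next
  assume lim: "(\<lambda>n. coords g (\<sigma> * int n)) \<longlonglongrightarrow> 1"
  have \<sigma>2: "\<sigma> * \<sigma> = 1" using \<sigma> by (auto simp: abs_if split: if_splits)
  have "\<forall>\<^sub>F n in sequentially. apow \<alpha> (\<sigma> * int n) g \<in> U" if U: "openin T U" "0 \<in> U" for U
  proof -
    obtain N where N: "\<And>g. (\<And>n. \<bar>n\<bar> \<le> int N \<Longrightarrow> cmod (coords g n - 1) \<le> 1 / real (Suc N)) \<Longrightarrow> g \<in> U"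
      using nbhd_contains_box[OF U] by blast
    have "1 / real (Suc N) > 0" by simp
    from LIMSEQ_D[OF lim this] obtain n0 where n0: "\<And>n. n \<ge> n0 \<Longrightarrow> cmod (coords g (\<sigma> * int n) - 1) < 1 / real (Suc N)" by blast
    have "apow \<alpha> (\<sigma> * int n) g \<in> U" if n: "n \<ge> n0 + N" for n
    proof (rule N)
      fix m assume m: "\<bar>m\<bar> \<le> int N"
      have "\<bar>\<sigma> * m\<bar> \<le> int N" using m \<sigma> by (simp add: abs_mult)
      then have ge: "int n + \<sigma> * m \<ge> int n0" using n by linarith
      have "\<sigma> * int (nat (int n + \<sigma> * m)) = \<sigma> * int n + (\<sigma> * \<sigma>) * m" using ge by (simp add: distrib_left mult.assoc)
      then have "m + \<sigma> * int n = \<sigma> * int (nat (int n + \<sigma> * m))" by (simp add: \<sigma>2)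
      then show "cmod (coords (apow \<alpha> (\<sigma> * int n) g) m - 1) \<le> 1 / real (Suc N)"
        using less_imp_le[OF n0[of "nat (int n + \<sigma> * m)"]] ge by (simp only: coords_apow le_nat_iff)
    qed
    then show ?thesis by (auto simp: eventually_sequentially)
  qed
  then show "limitin T (\<lambda>n. apow \<alpha> (\<sigma> * int n) g) 0 sequentially" by (simp add: limitin_def top_UNIV)
qed

lemma stable_grp_eq: "stable_grp T \<alpha> = {g. (\<lambda>n. coords g (int n)) \<longlonglongrightarrow> 1}"
proof -
  have "apow \<alpha> (1 * int n) g = (\<alpha> ^^ n) g" for n g by (simp add: apow_def)
  then show ?thesis using limitin_0_iff[of 1] by (simp add: stable_grp_def top_UNIV)
qed

lemma unstable_grp_eq: "unstable_grp T \<alpha> = {g. (\<lambda>n. coords g (- int n)) \<longlonglongrightarrow> 1}"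
proof -
  have "apow \<alpha> (- 1 * int n) g = (inv \<alpha> ^^ n) g" for n g by (cases "n = 0") (simp_all add: apow_def)
  then show ?thesis using limitin_0_iff[of "- 1"] by (simp add: unstable_grp_def top_UNIV)
qed

end

text \<open>The generator is fixed to \<open>cyc_gen\<close>, the one on which \<open>ident\<close>
  and the strong topologies are based.\<close>

locale cyclic_kernel = cyclic_system T \<alpha> "cyc_gen T \<alpha>" +
  k: kernel_dual "laurent_of_poly (assoc_poly T \<alpha> (cyc_gen T \<alpha>))" "degree (assoc_poly T \<alpha> (cyc_gen T \<alpha>))"
    "fund_sol (assoc_poly T \<alpha> (cyc_gen T \<alpha>))" C \<rho> "cyclic_system.coords \<alpha> (cyc_gen T \<alpha>)"
  for T :: "'g::ab_group_add topology" and \<alpha> C \<rho>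
begin

lemma ident_eq: "ident T \<alpha> = k.\<theta>"
  by (rule ext) (simp add: ident_def k.\<theta>_def Let_def top_UNIV coord_def k.cs_def coords_def ri_def)

lemma stable_eq: "stable_grp T \<alpha> = k.stable"
  by (simp add: stable_grp_eq k.stable_def)

lemma unstable_eq: "unstable_grp T \<alpha> = k.unstable"
  by (simp add: unstable_grp_eq k.unstable_def)

lemma homoclinic_eq: "homoclinic_grp T \<alpha> = k.homoclinic"
  by (simp add: homoclinic_grp_def k.homoclinic_def stable_eq unstable_eq Int_commute)

text \<open>The bound \<open>N0\<close> is admissible, so a least admissible one exists; for the
  comparison of topologies its admissibility is enough.\<close>

lemma strong_top_plus_eq: "strong_top_plus T \<alpha> = k.wtop w_up k.stable"
proof -
  have "k.\<theta> ` (\<Union>i. Bplus (Nplus T \<alpha>) i) = k.stable"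
    unfolding Nplus_def ident_eq stable_eq by (rule LeastI) (rule k.image_Bplus_N0)
  from k.strong_top_eq_wtop[OF this] show ?thesis by (simp add: strong_top_plus_def ident_eq stable_eq)
qed

lemma strong_top_minus_eq: "strong_top_minus T \<alpha> = k.wtop w_down k.unstable"
proof -
  have eq: "k.\<theta> ` (\<Union>i. Bminus N i) = k.r.\<theta> ` (\<Union>i. Bplus N i)" for N
    unfolding image_Bminus k.r_theta[abs_def] by simp
  have "k.r.\<theta> ` (\<Union>i. Bplus (Nminus T \<alpha>) i) = k.r.stable"
    unfolding Nminus_def ident_eq unstable_eq eq k.r_stable[symmetric] by (rule LeastI) (rule k.r.image_Bplus_N0)
  from k.r.strong_top_eq_wtop[OF this] show ?thesis
    by (simp add: strong_top_minus_def ident_eq unstable_eq strong_top_reflect k.r_theta[abs_def] k.r_stable k.r_wtop)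
qed

lemma add_tgroup_eq: "add_tgroup T = k.GC"
  using k.compact_top_eq_wtop[OF compact_T top_UNIV coords_cont] by simp

end

theorem mainTheorem6:
  fixes T :: "'g::ab_group_add topology" and \<alpha> :: "'g \<Rightarrow> 'g"
  assumes "topspace T = UNIV"
    and "abelian_tgroup (add_tgroup T)"
    and "Hausdorff_space T" and "compact_space T" and "connected_space T"
    and "tg_iso (add_tgroup T) (add_tgroup T) \<alpha>"
    and "expansive T \<alpha>"
    and "cyclic T \<alpha>"
  shows "LCA (add_tgroup (discrete_topology (homoclinic_grp T \<alpha>)))
       \<and> LCA (pair_tgroup (strong_top_minus T \<alpha>) (strong_top_plus T \<alpha>))
       \<and> LCA (add_tgroup T)
       \<and> short_exact (add_tgroup (discrete_topology (homoclinic_grp T \<alpha>)))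
                     (pair_tgroup (strong_top_minus T \<alpha>) (strong_top_plus T \<alpha>))
                     (add_tgroup T) (\<lambda>\<omega>. (- \<omega>, \<omega>)) (\<lambda>(u, v). u + v)
       \<and> self_dual_seq (add_tgroup (discrete_topology (homoclinic_grp T \<alpha>)))
                     (pair_tgroup (strong_top_minus T \<alpha>) (strong_top_plus T \<alpha>))
                     (add_tgroup T) (\<lambda>\<omega>. (- \<omega>, \<omega>)) (\<lambda>(u, v). u + v)"
proof -
  have add: "continuous_map (prod_topology T T) T (\<lambda>(x, y). x + y)"
    and "\<exists>i. continuous_map T T i \<and> (\<forall>x. x + i x = 0)"
    using assms(1,2) by (simp_all add: abelian_tgroup_def add_tgroup_def tg_top_def tg_op_def tg_unit_def tg_carrier_def Let_def)
  then obtain i where i: "continuous_map T T i" "\<And>x. x + i x = 0" by blast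
  \<comment> \<open>The topological group structure only asserts some continuous inverse; uniqueness
    of inverses identifies it with \<open>uminus\<close>.\<close>
  have "i = uminus" using i(2) by (simp add: fun_eq_iff eq_neg_iff_add_eq_0 add.commute)
  with i(1) have neg: "continuous_map T T uminus" by simp
  have "is_cyclic_generator T \<alpha> (cyc_gen T \<alpha>)"
    using assms(8) unfolding cyclic_def cyc_gen_def by (rule someI_ex)
  then interpret cyclic_system T \<alpha> "cyc_gen T \<alpha>"
    using assms add neg by unfold_locales
  obtain C \<rho> where "kernel_dual (laurent_of_poly (assoc_poly T \<alpha> (cyc_gen T \<alpha>))) (degree (assoc_poly T \<alpha> (cyc_gen T \<alpha>)))
    (fund_sol (assoc_poly T \<alpha> (cyc_gen T \<alpha>))) C \<rho> coords"
    by (rule kernel_system)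
  then interpret cyclic_kernel T \<alpha> C \<rho>
    by (intro cyclic_kernel.intro cyclic_system_axioms)
  show ?thesis
    unfolding homoclinic_eq strong_top_plus_eq strong_top_minus_eq add_tgroup_eq
    using LCA_discrete[OF k.homoclinic_subgroup] k.LCA_GB k.LCA_GC k.exact k.self_dual by (intro conjI)
qed

end
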